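(* Let $\lambda\in\{-1,1\}$, $T>0$ and $u^0\in H^1(\mathbb{T})$, and let $u\in C([0,T];H^1(\mathbb{T}))$ be the solution of the periodic cubic nonlinear Schr\"odinger equation $i\partial_t u+\partial_{xx}u=\lambda|u|^2u$ on $(0,T]\times\mathbb{T}$ with $u(0,\cdot)=u^0$. For positive integers $L$ and $N$ put $\tau=T/L$, $t_n=n\tau$, and let $u^n_{\tau,N}$, $n=0,1,\dots,L$, be the numerical solution defined by $u^0_{\tau,N}=\Pi_N I_{2N}u^0$ and $u^{n+1}_{\tau,N}=\Psi(u^n_{\tau,N})$ for $n=0,1,\dots,L-1$, with the map $\Psi$ given in the context. Then there exist positive constants $\tau_0$, $N_0$ and $C$, depending only on $T$ and $\|u^0\|_{H^1}$, such that for $\tau\le\tau_0$ and $N\ge N_0$ $$\max_{1\le n\le L}\|u(t_n,\cdot)-u^n_{\tau,N}\|_{L^2}\le C\big(\tau\sqrt{\ln(1/\tau)}+N^{-1}\big).$$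
   Context: **Function spaces.** $\mathbb{T}=(-\pi,\pi)$ is the one-dimensional torus (functions are $2\pi$-periodic and complex-valued). Fourier coefficients: $\hat f_k=\mathcal{F}_k[f]=\frac1{2\pi}\int_{\mathbb{T}}e^{-ikx}f(x)\,dx$, $k\in\mathbb{Z}$. Norms: $\|f\|_{L^2}^2=\int_{\mathbb{T}}|f|^2dx$ and $\|f\|_{H^s}^2=2\pi\sum_{k\in\mathbb{Z}}(1+k^2)^s|\hat f_k|^2$. **Solution.** The equation is understood in the Duhamel sense: $u(t)=e^{it\partial_x^2}u^0-i\lambda\int_0^t e^{i(t-s)\partial_x^2}\big(|u(s)|^2u(s)\big)ds$. For $u^0\in H^1(\mathbb{T})$ there is a unique solution $u\in C([0,T];H^1(\mathbb{T}))$, and its norm in this space is bounded by a constant depending on $\|u^0\|_{H^1}$. **Operators.** $\Pi_0f=\frac1{2\pi}\int_{\mathbb{T}}f\,dx=\hat f_0$ (viewed as a number or a constant function) and $\Pi_{\neq0}f=\sum_{k\ne0}\hat f_ke^{ikx}$. $\Pi_Nf=\sum_{|k|\le N}\hat f_ke^{ikx}$, and $S_N=\{f\in L^2(\mathbb{T}):\hat f_k=0\text{ for }|k|>N\}$. $I_{2N}$ is the $(4N+1)$-point trigonometric interpolation operator: $I_{2N}f(x)=\sum_{k=-2N}^{2N}\tilde f_ke^{ikx}$ with $\tilde f_k=\frac1{4N+1}\sum_{n=-2N}^{2N}e^{-ikx_n}f(x_n)$ and $x_n=\frac{2\pi n}{4N+1}$. The operator $\partial_x^{-1}$ is the Fourier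 multiplier with symbol $(ik)^{-1}$ for $k\neq0$ and $0$ for $k=0$, and $\partial_x^{-2}=(\partial_x^{-1})^2$. $e^{\pm i\tau\partial_x^2}$ is the multiplier with symbol $e^{\mp i\tau k^2}$. For numbers $P_N,M_N$, $e^{i\tau(-2\lambda P_N\partial_x^{-1}-2\lambda M_N+\partial_x^2)}$ is the multiplier with symbol $e^{i\tau(-2\lambda P_N(ik)^{-1}-2\lambda M_N-k^2)}$ for $k\ne0$ and $e^{-2i\lambda\tau M_N}$ for $k=0$. **The scheme.** Set $M_N=\Pi_0(|u^0_{\tau,N}|^2)$ and $P_N=\Pi_0\big(u^0_{\tau,N}\,\partial_x\overline{u^0_{\tau,N}}\big)$. For $f\in S_N$, $$\begin{aligned} \Psi(f):={}&e^{i\tau(-2\lambda P_N\partial_x^{-1}-2\lambda M_N+\partial_x^2)}f+(1-e^{-2i\lambda\tau M_N})\Pi_0f-i\lambda\tau\,\Pi_0\big[\Pi_N(|f|^2)f\big]\\ &+\lambda\,\partial_x^{-1}\Pi_N\Big[(e^{i\tau\partial_x^2}f)\cdot\partial_x^{-1}\Pi_N\big(|e^{i\tau\partial_x^2}f|^2\big)\Big]-\lambda\, e^{i\tau\partial_x^2}\partial_x^{-1}\Pi_N\Big[f\cdot\partial_x^{-1}\Pi_N(|f|^2)\Big]\\ &-\frac{\lambda}{2}\Big[\partial_x^{-2}\Pi_N\Big((e^{-i\tau\partial_x^2}\bar f)\,e^{i\tau\partial_x^2}\Pi_N(f^2)\Big)-e^{i\tau\partial_x^2}\partial_x^{-2}\Pi_N\Big(\bar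 f\,\Pi_N(f^2)\Big)\Big]\\ &-\frac{\lambda}{2}\,e^{i\tau\partial_x^2}\partial_x^{-1}\Pi_N\Big[\partial_x\bar f\,\Big(e^{-i\tau\partial_x^2}\Pi_N\big[(e^{i\tau\partial_x^2}\partial_x^{-1}f)^2\big]-\Pi_N\big[(\partial_x^{-1}f)^2\big]\Big)\Big]\\ &-i\lambda\tau\,e^{i\tau\partial_x^2}\partial_x^{-1}\Pi_N\big(\partial_x\bar f\,\Pi_N(f^2)\big)\\ &+2i\lambda\tau\,(\Pi_0f)\,e^{i\tau\partial_x^2}\partial_x^{-1}\Pi_N(\partial_x\bar f\,f)-i\lambda\tau\,(\Pi_0f)^2\,e^{i\tau\partial_x^2}\Pi_{\neq0}\bar f . \end{aligned}$$ *)

theory Defs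
  imports "HOL-Analysis.Analysis"
begin

text \<open>
  Functions on the torus are \<open>2\<pi>\<close>-periodic functions \<open>real \<Rightarrow> complex\<close>. All functions that are
  integrated below are continuous, so the Henstock--Kurzweil integral is the Lebesgue integral.
\<close>

definition fourier :: "(real \<Rightarrow> complex) \<Rightarrow> int \<Rightarrow> complex" where
  "fourier f k = 1 / (2 * of_real pi) * integral {-pi..pi} (\<lambda>x. exp (- \<i> * of_int k * of_real x) * f x)"

definition L2_norm :: "(real \<Rightarrow> complex) \<Rightarrow> real" where
  "L2_norm f = sqrt (integral {-pi..pi} (\<lambda>x. (cmod (f x))\<^sup>2))"

definition Hs_norm :: "real \<Rightarrow> (real \<Rightarrow> complex) \<Rightarrow> real" where
  "Hs_norm s f =
     sqrt (2 * pi * (\<Sum>\<^sub>\<infinity>k::int. (1 + (of_int k)\<^sup>2) powr s * (cmod (fourier f k))\<^sup>2))"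

text \<open>
  In dimension one every class in \<open>H\<^sup>1\<close> has exactly one continuous periodic representative.
  The elements of \<open>H1\<close> are these representatives, so that point values (needed for
  interpolation) make sense.
\<close>

definition H1 :: "(real \<Rightarrow> complex) set" where
  "H1 = {f. continuous_on UNIV f \<and> (\<forall>x. f (x + 2 * pi) = f x) \<and>
            (\<lambda>k::int. (1 + (of_int k)\<^sup>2) powr 1 * (cmod (fourier f k))\<^sup>2) summable_on UNIV}"

text \<open>
  The Fourier multiplier with symbol \<open>m\<close>. It is used only with bounded symbols on functions
  in \<open>H1\<close> and on trigonometric polynomials, where the series converges absolutely.
\<close>

definition multiplier :: "(int \<Rightarrow> complex) \<Rightarrow> (real \<Rightarrow> complex) \<Rightarrow> real \<Rightarrow> complex" where
  "multiplier m f = (\<lambda>x. \<Sum>\<^sub>\<infinity>k::int. m k * fourier f k * exp (\<i> * of_int k * of_real x))"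

text \<open>The free Schroedinger group \<open>e\<close> to the power \<open>i t \<partial>\<^sub>x\<^sup>2\<close>.\<close>

definition schr :: "real \<Rightarrow> (real \<Rightarrow> complex) \<Rightarrow> real \<Rightarrow> complex" where
  "schr t = multiplier (\<lambda>k. exp (- \<i> * of_real t * (of_int k)\<^sup>2))"

definition dx :: "(real \<Rightarrow> complex) \<Rightarrow> real \<Rightarrow> complex" where
  "dx f = (\<lambda>x. vector_derivative f (at x))"

definition dx_inv :: "(real \<Rightarrow> complex) \<Rightarrow> real \<Rightarrow> complex" where
  "dx_inv = multiplier (\<lambda>k. if k = 0 then 0 else inverse (\<i> * of_int k))"

definition Pi0 :: "(real \<Rightarrow> complex) \<Rightarrow> complex" where
  "Pi0 f = 1 / (2 * of_real pi) * integral {-pi..pi} f"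

definition Pi_neq0 :: "(real \<Rightarrow> complex) \<Rightarrow> real \<Rightarrow> complex" where
  "Pi_neq0 = multiplier (\<lambda>k. if k = 0 then 0 else 1)"

definition PiN :: "nat \<Rightarrow> (real \<Rightarrow> complex) \<Rightarrow> real \<Rightarrow> complex" where
  "PiN N f = (\<lambda>x. \<Sum>k\<in>{- int N..int N}. fourier f k * exp (\<i> * of_int k * of_real x))"

text \<open>\<open>trig_interp K\<close> is interpolation at \<open>2 K + 1\<close> equidistant points; \<open>I\<^sub>2\<^sub>N\<close> is \<open>trig_interp (2 * N)\<close>.\<close>

definition trig_node :: "nat \<Rightarrow> int \<Rightarrow> real" where
  "trig_node K n = 2 * pi * of_int n / (2 * of_nat K + 1)"

definition trig_coeff :: "nat \<Rightarrow> (real \<Rightarrow> complex) \<Rightarrow> int \<Rightarrow> complex" where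
  "trig_coeff K f k = 1 / (2 * of_nat K + 1) *
     (\<Sum>n\<in>{- int K..int K}. exp (- \<i> * of_int k * of_real (trig_node K n)) * f (trig_node K n))"

definition trig_interp :: "nat \<Rightarrow> (real \<Rightarrow> complex) \<Rightarrow> real \<Rightarrow> complex" where
  "trig_interp K f = (\<lambda>x. \<Sum>k\<in>{- int K..int K}. trig_coeff K f k * exp (\<i> * of_int k * of_real x))"

text \<open>
  \<open>u\<close> is in \<open>C([0,T]; H\<^sup>1)\<close> and satisfies Duhamel's formula. The latter is an identity in \<open>H\<^sup>1\<close>
  with a continuous \<open>H\<^sup>1\<close>-valued integrand; as \<open>H\<^sup>1\<close> embeds into the continuous functions, it
  can be evaluated at each point \<open>x\<close>.
\<close>

definition cubic :: "(real \<Rightarrow> complex) \<Rightarrow> real \<Rightarrow> complex" where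
  "cubic f = (\<lambda>x. of_real ((cmod (f x))\<^sup>2) * f x)"

definition nls_solution ::
  "real \<Rightarrow> real \<Rightarrow> (real \<Rightarrow> complex) \<Rightarrow> (real \<Rightarrow> real \<Rightarrow> complex) \<Rightarrow> bool" where
  "nls_solution lam T u0 u \<longleftrightarrow>
     (\<forall>t\<in>{0..T}. u t \<in> H1) \<and>
     (\<forall>t\<in>{0..T}. ((\<lambda>s. Hs_norm 1 (\<lambda>x. u s x - u t x)) \<longlongrightarrow> 0) (at t within {0..T})) \<and>
     u 0 = u0 \<and>
     (\<forall>t\<in>{0..T}. \<forall>x. u t x =
        schr t u0 x - \<i> * of_real lam * integral {0..t} (\<lambda>s. schr (t - s) (cubic (u s)) x))"

definition absq :: "(real \<Rightarrow> complex) \<Rightarrow> real \<Rightarrow> complex" where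
  "absq f = (\<lambda>x. of_real ((cmod (f x))\<^sup>2))"

definition sq :: "(real \<Rightarrow> complex) \<Rightarrow> real \<Rightarrow> complex" where
  "sq f = (\<lambda>x. (f x)\<^sup>2)"

definition conj_fun :: "(real \<Rightarrow> complex) \<Rightarrow> real \<Rightarrow> complex" where
  "conj_fun f = (\<lambda>x. cnj (f x))"

definition twisted_schr ::
  "real \<Rightarrow> real \<Rightarrow> complex \<Rightarrow> complex \<Rightarrow> (real \<Rightarrow> complex) \<Rightarrow> real \<Rightarrow> complex" where
  "twisted_schr lam tau P M = multiplier (\<lambda>k.
     if k = 0 then exp (- 2 * \<i> * of_real lam * of_real tau * M)
     else exp (\<i> * of_real tau *
       (- 2 * of_real lam * P * inverse (\<i> * of_int k) - 2 * of_real lam * M - (of_int k)\<^sup>2)))"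

definition Psi ::
  "real \<Rightarrow> real \<Rightarrow> nat \<Rightarrow> complex \<Rightarrow> complex \<Rightarrow> (real \<Rightarrow> complex) \<Rightarrow> real \<Rightarrow> complex" where
  "Psi lam tau N P M f = (\<lambda>x.
     twisted_schr lam tau P M f x
     + (1 - exp (- 2 * \<i> * of_real lam * of_real tau * M)) * Pi0 f
     - \<i> * of_real lam * of_real tau * Pi0 (\<lambda>y. PiN N (absq f) y * f y)
     + of_real lam *
         dx_inv (PiN N (\<lambda>y. schr tau f y * dx_inv (PiN N (absq (schr tau f))) y)) x
     - of_real lam *
         schr tau (dx_inv (PiN N (\<lambda>y. f y * dx_inv (PiN N (absq f)) y))) x
     - of_real lam / 2 *
         (dx_inv (dx_inv (PiN N (\<lambda>y. schr (- tau) (conj_fun f) y * schr tau (PiN N (sq f)) y))) x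
          - schr tau (dx_inv (dx_inv (PiN N (\<lambda>y. conj_fun f y * PiN N (sq f) y)))) x)
     - of_real lam / 2 *
         schr tau (dx_inv (PiN N (\<lambda>y. dx (conj_fun f) y *
           (schr (- tau) (PiN N (sq (schr tau (dx_inv f)))) y - PiN N (sq (dx_inv f)) y)))) x
     - \<i> * of_real lam * of_real tau *
         schr tau (dx_inv (PiN N (\<lambda>y. dx (conj_fun f) y * PiN N (sq f) y))) x
     + 2 * \<i> * of_real lam * of_real tau * Pi0 f *
         schr tau (dx_inv (PiN N (\<lambda>y. dx (conj_fun f) y * f y))) x
     - \<i> * of_real lam * of_real tau * (Pi0 f)\<^sup>2 * schr tau (Pi_neq0 (conj_fun f)) x)"

definition num_init :: "nat \<Rightarrow> (real \<Rightarrow> complex) \<Rightarrow> real \<Rightarrow> complex" where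
  "num_init N u0 = PiN N (trig_interp (2 * N) u0)"

text \<open>The numerical solution after \<open>n\<close> steps; \<open>P\<^sub>N\<close> and \<open>M\<^sub>N\<close> are computed once, from the initial value.\<close>

definition num_sol ::
  "real \<Rightarrow> real \<Rightarrow> nat \<Rightarrow> (real \<Rightarrow> complex) \<Rightarrow> nat \<Rightarrow> real \<Rightarrow> complex" where
  "num_sol lam tau N u0 n =
     (let v = num_init N u0;
          M = Pi0 (absq v);
          P = Pi0 (\<lambda>x. v x * dx (conj_fun v) x)
      in (Psi lam tau N P M ^^ n) v)"

end

theory Submission imports Defs begin

text \<open>
  On the Fourier side the cubic term is a trilinear sum over \<open>k = i + j + l\<close>, where \<open>j\<close> belongs to the
  conjugate factor, and the free flow gives it the phase \<open>\<phi> = 2 (i + j) (l + j)\<close>. Since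
  \<open>1 = (l + j) / k + (i + j) / k - j / k\<close>, and the first two terms times \<open>\<integral> e\<^sup>i\<^sup>s\<^sup>\<phi> ds\<close> factorise, only the
  third has to be approximated. Its phase is \<open>\<phi> = \<alpha> + \<beta>\<close> with \<open>\<alpha> = 2 i l\<close> and \<open>\<beta> = 2 k j\<close>, and \<open>\<Psi>\<close> replaces
  \<open>e\<^sup>i\<^sup>s\<^sup>\<phi>\<close> by \<open>e\<^sup>i\<^sup>s\<^sup>\<alpha> + e\<^sup>i\<^sup>s\<^sup>\<beta> - 1\<close>. The defect \<open>(e\<^sup>i\<^sup>s\<^sup>\<alpha> - 1) (e\<^sup>i\<^sup>s\<^sup>\<beta> - 1)\<close> is dominated by a kernel in \<open>(k, l)\<close> whose
  Hilbert--Schmidt norm is \<open>O(\<tau> \<surd>ln (1 / \<tau>))\<close> for \<open>H\<^sup>1\<close> data; integrating over one step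
  gains another factor \<open>\<tau>\<close>. The resonances \<open>i + j = 0\<close> contribute the mass and the momentum, which the
  exact flow conserves, so that the twisted propagator may use their initial values.

  The scheme is stable in \<open>L\<^sup>2\<close> as long as its \<open>H\<^sup>1\<close> norm is bounded. That norm grows at a rate depending
  only on the \<open>\<ell>\<^sup>1\<close> norm of the coefficients, which is controlled by interpolating the small \<open>L\<^sup>2\<close> error
  against the \<open>H\<^sup>1\<close> bound. This bootstrap closes without any coupling between \<open>\<tau>\<close> and \<open>N\<close>.
\<close>

section \<open>Fourier series on the torus\<close>

text \<open>The constants may depend on the data only through T and the H^1 norm, whereas continuity
  in time bounds a solution by a constant of its own. The uniform bound has to come from energy
  conservation, and at H^1 regularity the energy cannot be differentiated directly: it is computed
  for frequency truncations, whose defect tends to zero without a rate. Mass and momentum do need a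
  rate; there the pairing costs at most one derivative, so the truncation error may be measured in
  L^2, where it is O(1 / N). For H^1 data the numerical error cannot be expected to be small in H^1,
  so the H^1 bound of the scheme is not inherited from the exact solution. What decouples \<tau>
  from N is that the interpolation frequency \<open>q\<close> is fixed by the two H^1 bounds alone.
  The root of the logarithm appears because the kernel is about \<tau> / max(k, l) on the square k,
  l \<le> 1 / \<tau>: its squares sum to \<tau>^2 times a harmonic sum. The estimates are proved on
  finite frequency sets with constants independent of the set, and then passed to the limit.\<close>

definition ek :: "int \<Rightarrow> real \<Rightarrow> complex" where
  "ek k x = exp (\<i> * of_int k * of_real x)"

abbreviation freqs :: "nat \<Rightarrow> int set" where
  "freqs N \<equiv> {- int N..int N}"

lemma ek_0 [simp]: "ek 0 x = 1"
  by (simp add: ek_def)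

lemma ek_add: "ek (j + k) x = ek j x * ek k x"
  by (simp add: ek_def exp_add[symmetric] algebra_simps)

lemma cnj_ek [simp]: "cnj (ek k x) = ek (- k) x"
  by (simp add: ek_def exp_cnj)

lemma norm_ek [simp]: "norm (ek k x) = 1"
  by (simp add: ek_def)

lemma ek_periodic: "ek k (x + 2 * pi) = ek k x"
proof -
  have "ek k (x + 2 * pi) = exp (\<i> * of_int k * of_real x + \<i> * (of_int k * (of_real pi * 2)))"
    by (simp add: ek_def algebra_simps)
  then show ?thesis
    unfolding exp_plus_2pin by (simp add: ek_def)
qed

lemma ek_has_vector_derivative: "(ek k has_vector_derivative \<i> * of_int k * ek k x) (at x within S)"
proof -
  have "((\<lambda>z. exp (\<i> * of_int k * z)) has_field_derivative \<i> * of_int k * exp (\<i> * of_int k * of_real x)) (at (of_real x))"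
    by (auto intro!: derivative_eq_intros)
  from has_vector_derivative_real_field[OF this] show ?thesis
    unfolding ek_def by simp
qed

lemma continuous_on_ek [continuous_intros]: "continuous_on S (ek k)"
  unfolding ek_def by (intro continuous_intros)

lemma ek_has_integral: "(ek k has_integral (if k = 0 then 2 * of_real pi else 0)) {-pi..pi}"
proof (cases "k = 0")
  case True
  have "((\<lambda>x::real. 1::complex) has_integral (pi - (-pi)) *\<^sub>R 1) {-pi..pi}"
    using has_integral_const_real[of "1::complex" "-pi" pi] by simp
  moreover have "ek k = (\<lambda>x. 1)" using True by auto
  moreover have "(pi - (-pi)) *\<^sub>R 1 = (2 * of_real pi :: complex)" by (simp add: scaleR_conv_of_real)
  ultimately show ?thesis using True by simp
next
  case False
  have "((\<lambda>x. ek k x) has_integral (ek k pi / (\<i> * of_int k) - ek k (-pi) / (\<i> * of_int k))) {-pi..pi}"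
  proof (rule fundamental_theorem_of_calculus)
    fix x assume "x \<in> {-pi..pi}"
    show "((\<lambda>x. ek k x / (\<i> * of_int k)) has_vector_derivative ek k x) (at x within {-pi..pi})"
      using has_vector_derivative_divide[OF ek_has_vector_derivative[of k x "{-pi..pi}"], of "\<i> * of_int k"] False
      by simp
  qed simp
  moreover have "ek k pi = ek k (-pi)" using ek_periodic[of k "-pi"] by simp
  ultimately show ?thesis using False by simp
qed

lemma fourier_alt: "fourier f k = 1 / (2 * of_real pi) * integral {-pi..pi} (\<lambda>x. ek (- k) x * f x)"
  unfolding fourier_def ek_def by simp

lemma Pi0_eq_fourier: "Pi0 f = fourier f 0"
  unfolding Pi0_def fourier_alt by simp

lemma fourier_integrable:
  assumes "continuous_on {-pi..pi} f"
  shows "(\<lambda>x. ek (- k) x * f x) integrable_on {-pi..pi}"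
  by (intro integrable_continuous_interval continuous_intros assms)

lemma fourier_add:
  assumes "continuous_on {-pi..pi} f" "continuous_on {-pi..pi} g"
  shows "fourier (\<lambda>x. f x + g x) k = fourier f k + fourier g k"
  unfolding fourier_alt
  by (simp add: ring_distribs integral_add fourier_integrable assms add_divide_distrib)

lemma fourier_diff:
  assumes "continuous_on {-pi..pi} f" "continuous_on {-pi..pi} g"
  shows "fourier (\<lambda>x. f x - g x) k = fourier f k - fourier g k"
  unfolding fourier_alt
  by (simp add: ring_distribs integral_diff fourier_integrable assms diff_divide_distrib)

lemma fourier_cmult: "fourier (\<lambda>x. c * f x) k = c * fourier f k"
proof -
  have "(\<lambda>x. ek (- k) x * (c * f x)) = (\<lambda>x. c * (ek (- k) x * f x))" by (auto simp: mult_ac)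
  then show ?thesis unfolding fourier_alt by simp
qed

lemma fourier_cnj: "fourier (\<lambda>x. cnj (f x)) k = cnj (fourier f (- k))"
proof -
  have "(\<lambda>x. ek (- k) x * cnj (f x)) = (\<lambda>x. cnj (ek k x * f x))" by auto
  then show ?thesis unfolding fourier_alt by (simp add: integral_cnj)
qed

lemma fourier_sum:
  assumes "finite A" "\<And>i. i \<in> A \<Longrightarrow> continuous_on {-pi..pi} (f i)"
  shows "fourier (\<lambda>x. \<Sum>i\<in>A. f i x) k = (\<Sum>i\<in>A. fourier (f i) k)"
  using assms
proof (induction A rule: finite_induct)
  case empty
  then show ?case by (simp add: fourier_alt)
next
  case (insert a A)
  then show ?case by (simp add: fourier_add continuous_on_sum)
qed

lemma fourier_ek: "fourier (ek j) k = (if j = k then 1 else 0)"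
proof -
  have "(\<lambda>x. ek (- k) x * ek j x) = ek (j - k)" by (auto simp flip: ek_add)
  then show ?thesis unfolding fourier_alt
    using integral_unique[OF ek_has_integral[of "j - k"]] by auto
qed

lemma fourier_bound:
  assumes "continuous_on {-pi..pi} f" "\<And>x. x \<in> {-pi..pi} \<Longrightarrow> norm (f x) \<le> B"
  shows "norm (fourier f k) \<le> B"
proof -
  have "norm (integral {-pi..pi} (\<lambda>x. ek (- k) x * f x)) \<le> B * (pi - (-pi))"
    by (rule integral_bound) (auto intro!: continuous_intros assms simp: norm_mult assms(2))
  then show ?thesis
    unfolding fourier_alt by (simp add: norm_mult norm_divide field_simps)
qed

lemma fourier_limit:
  assumes "\<And>n. continuous_on {-pi..pi} (f n)" "continuous_on {-pi..pi} g"
    and "uniform_limit {-pi..pi} f g sequentially"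
  shows "(\<lambda>n. fourier (f n) k) \<longlonglongrightarrow> fourier g k"
proof (rule tendstoI)
  fix e :: real assume e: "e > 0"
  have "\<forall>\<^sub>F n in sequentially. \<forall>x\<in>{-pi..pi}. dist (f n x) (g x) < e/2"
    using uniform_limitD[OF assms(3), of "e/2"] e by auto
  then show "\<forall>\<^sub>F n in sequentially. dist (fourier (f n) k) (fourier g k) < e"
  proof eventually_elim
    case (elim n)
    have "norm (fourier (\<lambda>x. f n x - g x) k) \<le> e/2"
      by (rule fourier_bound) (use elim in \<open>auto intro!: continuous_intros assms simp: dist_norm less_imp_le\<close>)
    then show ?case using e by (simp add: fourier_diff assms dist_norm)
  qed
qed

text \<open>Stone--Weierstrass on the unit circle shows that the trigonometric system is complete.\<close>

lemma real_polynomial_on_circle: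
  fixes p :: "complex \<Rightarrow> real"
  assumes "real_polynomial_function p"
  shows "\<exists>N a. \<forall>x. of_real (p (cis x)) = (\<Sum>k\<in>freqs N. a k * ek k x)"
  using assms
proof (induction p rule: real_polynomial_function.induct)
  case (linear f)
  interpret f: bounded_linear f by (rule linear)
  have 1: "f (cis x) = cos x * f 1 + sin x * f \<i>" for x
  proof -
    have "cis x = cos x *\<^sub>R 1 + sin x *\<^sub>R \<i>" by (simp add: complex_eq_iff)
    then show ?thesis by (simp add: f.add f.scale)
  qed
  have 2: "complex_of_real (cos x) = (ek 1 x + ek (-1) x) / 2" "complex_of_real (sin x) = (ek 1 x - ek (-1) x) / (2*\<i>)" for x
    unfolding ek_def cos_of_real sin_of_real by (simp_all add: cos_exp_eq sin_exp_eq flip: cos_of_real sin_of_real)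
  have "freqs 1 = {-1, 0, 1}" by auto
  then have b: "(\<Sum>k\<in>freqs 1. h k) = h (-1) + h 0 + h 1" for h :: "int \<Rightarrow> complex" by simp
  show ?case
    by (rule exI[of _ 1], rule exI[of _ "\<lambda>k. if k = 1 then of_real (f 1) / 2 + of_real (f \<i>) / (2 * \<i>) else if k = -1 then
       of_real (f 1) / 2 - of_real (f \<i>) / (2 * \<i>) else 0"]) (simp only: b, simp add: 1 2 field_simps)
next
  case (const c)
  show ?case by (rule exI[of _ 0], rule exI[of _ "\<lambda>k. of_real c"]) simp
next
  case (add f g)
  then obtain N a M b where a: "\<And>x. of_real (f (cis x)) = (\<Sum>k\<in>freqs N. a k * ek k x)"
    and b: "\<And>x. of_real (g (cis x)) = (\<Sum>k\<in>freqs M. b k * ek k x)" by blast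
  have ex: "(\<Sum>k\<in>freqs N. a k * ek k x) = (\<Sum>k\<in>freqs (N+M). (if k \<in> freqs N then a k else 0) * ek k x)" for N M a x
    by (rule sum.mono_neutral_cong_left) auto
  define c where "c k = (if k \<in> freqs N then a k else 0) + (if k \<in> freqs M then b k else 0)" for k
  have "of_real (f (cis x) + g (cis x)) = (\<Sum>k\<in>freqs (N+M). c k * ek k x)" for x
    unfolding c_def of_real_add a b ex[of a x N M] ex[of b x M N] by (simp add: add.commute sum.distrib ring_distribs del: atLeastAtMost_iff)
  then show ?case by blast
next
  case (mult f g)
  then obtain N a M b where a: "\<And>x. of_real (f (cis x)) = (\<Sum>k\<in>freqs N. a k * ek k x)"
    and b: "\<And>x. of_real (g (cis x)) = (\<Sum>k\<in>freqs M. b k * ek k x)" by blast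
  define c where "c k = (\<Sum>(i,j)\<in>{p\<in>freqs N \<times> freqs M. fst p + snd p = k}. a i * b j)" for k
  have "of_real (f (cis x) * g (cis x)) = (\<Sum>k\<in>freqs (N+M). c k * ek k x)" for x
  proof -
    have "of_real (f (cis x) * g (cis x)) = (\<Sum>(i,j)\<in>freqs N \<times> freqs M. a i * b j * ek (i + j) x)"
      unfolding of_real_mult a b sum_product sum.cartesian_product by (simp add: ek_add mult_ac)
    also have "\<dots> = (\<Sum>k\<in>freqs (N+M). \<Sum>(i,j)\<in>{p\<in>freqs N \<times> freqs M. fst p + snd p = k}. a i * b j * ek (i + j) x)"
      by (rule sum.group[symmetric]) auto
    also have "\<dots> = (\<Sum>k\<in>freqs (N+M). c k * ek k x)"
      unfolding c_def sum_distrib_right by (intro sum.cong) auto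
    finally show ?thesis .
  qed
  then show ?case by blast
qed

text \<open>The function is transported to the unit circle by an argument function, approximated
  there by a polynomial in the real and imaginary parts, and read back as a trigonometric
  sum.\<close>

lemma periodic_approx:
  assumes f: "continuous_on UNIV f" "\<And>x. f (x + 2 * pi) = f x" and e: "e > 0"
  shows "\<exists>N a. \<forall>x\<in>{-pi..pi}. norm (f x - (\<Sum>k\<in>freqs N. a k * ek k x)) < e"
proof -
  define F where "F z = f (Arg z)" for z
  \<comment> \<open>\<open>Arg\<close> jumps across the negative axis and \<open>Arg2pi\<close>
    across the positive one. By periodicity both branches give the same function, so continuity
    holds on each slit plane, and the two slit planes together cover the circle.\<close>
  have F2: "F z = f (Arg2pi z)" if "z \<noteq> 0" for z
  proof -
    have 1: "exp (\<i> * of_real (Arg z)) = exp (\<i> * of_real (Arg2pi z))"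
      using Arg_eq[OF that] Arg2pi_eq[of z] that
      by (metis mult_cancel_left norm_eq_zero of_real_eq_0_iff)
    then obtain n :: int where n: "\<i> * of_real (Arg z) = \<i> * of_real (Arg2pi z) + of_int (2 * n) * pi * \<i>"
      unfolding exp_eq by auto
    from arg_cong[OF n, of Im] have n': "Arg z = Arg2pi z + of_int n * (2 * pi)" by simp
    have per: "f (x + of_nat m * (2 * pi)) = f x" for x m
    proof (induction m)
      case (Suc m)
      then show ?case using f(2)[of "x + of_nat m * (2 * pi)"] by (simp add: algebra_simps)
    qed simp
    have "f (x + of_int n * (2 * pi)) = f x" for x
    proof (cases "n \<ge> 0")
      case True
      then show ?thesis using per[of x "nat n"] by simp
    next
      case False
      then show ?thesis using per[of "x + of_int n * (2 * pi)" "nat (-n)"] by simp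
    qed
    then show ?thesis unfolding F_def n' by simp
  qed
  have cont: "continuous_on (sphere 0 1) F"
  proof -
    have 1: "continuous_on (- \<real>\<^sub>\<le>\<^sub>0) F"
      unfolding F_def by (rule continuous_on_compose2[OF f(1) continuous_on_Arg]) auto
    have "continuous_on (- \<real>\<^sub>\<ge>\<^sub>0) (\<lambda>z. f (Arg2pi z))"
      by (rule continuous_on_compose2[OF f(1)]) (auto simp: continuous_on_eq_continuous_at open_Compl continuous_at_Arg2pi)
    then have 2: "continuous_on (- \<real>\<^sub>\<ge>\<^sub>0) F"
      by (rule continuous_on_eq) (metis F2 ComplD nonneg_Reals_zero_I)
    have "continuous_on ((- \<real>\<^sub>\<le>\<^sub>0) \<union> (- \<real>\<^sub>\<ge>\<^sub>0)) F"
      by (rule continuous_on_open_Un) (use 1 2 in \<open>auto simp: open_Compl\<close>)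
    then show ?thesis
      by (rule continuous_on_subset) (auto simp: complex_nonpos_Reals_iff complex_nonneg_Reals_iff cmod_def complex_eq_iff)
  qed
  obtain g where g: "polynomial_function g" "\<And>z. z \<in> sphere 0 1 \<Longrightarrow> norm (F z - g z) < e"
    using Stone_Weierstrass_polynomial_function[OF _ cont e] by auto
  have "real_polynomial_function (Re \<circ> g)" "real_polynomial_function (Im \<circ> g)"
    using g(1) bounded_linear_Re bounded_linear_Im unfolding polynomial_function_def by auto
  from this[THEN real_polynomial_on_circle] obtain N a M b where
    a: "\<And>x. of_real (Re (g (cis x))) = (\<Sum>k\<in>freqs N. a k * ek k x)" and
    b: "\<And>x. of_real (Im (g (cis x))) = (\<Sum>k\<in>freqs M. b k * ek k x)" by auto
  have ex: "(\<Sum>k\<in>freqs N. a k * ek k x) = (\<Sum>k\<in>freqs (N+M). (if k \<in> freqs N then a k else 0) * ek k x)" for N M a x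
    by (rule sum.mono_neutral_cong_left) auto
  define c where "c k = (if k \<in> freqs N then a k else 0) + \<i> * (if k \<in> freqs M then b k else 0)" for k
  have gx: "g (cis x) = (\<Sum>k\<in>freqs (N+M). c k * ek k x)" for x
  proof -
    have "g (cis x) = of_real (Re (g (cis x))) + \<i> * of_real (Im (g (cis x)))"
      by (rule complex_eq)
    also have "\<dots> = (\<Sum>k\<in>freqs (N+M). c k * ek k x)"
      unfolding c_def a b ex[of a x N M] ex[of b x M N]
      by (simp only: sum_distrib_left sum.distrib[symmetric] ring_distribs mult.assoc add.commute[of M N])
    finally show ?thesis .
  qed
  have "norm (f x - g (cis x)) < e" if "x \<in> {-pi..pi}" for x
  proof -
    have "F (cis x) = f x"
    \<comment> \<open>\<open>Arg\<close> takes values in the half-open interval from -pi to pi, so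
      the left endpoint is reached only through periodicity.\<close>
    proof (cases "x = - pi")
      case True
      then have "cis x = cis pi" by (simp add: complex_eq_iff)
      moreover have "Arg (cis pi) = pi" using pi_gt_zero by (intro Arg_cis) (simp add: greaterThanAtMost_iff, linarith?)
      ultimately have "Arg (cis x) = pi" by simp
      then show ?thesis unfolding F_def using f(2)[of "-pi"] True by simp
    next
      case False
      then have "Arg (cis x) = x" using that by (intro Arg_cis) auto
      then show ?thesis unfolding F_def by simp
    qed
    then show ?thesis using g(2)[of "cis x"] by simp
  qed
  then have "\<forall>x\<in>{-pi..pi}. norm (f x - (\<Sum>k\<in>freqs (N+M). c k * ek k x)) < e" 
    unfolding gx by blast
  then show ?thesis by blast
qed

text \<open>Such an f is orthogonal to every trigonometric polynomial p, so the integral of |f|^2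
  equals that of \<open>cnj (f x - p x) * f x\<close>, which is arbitrarily small when p
  approximates f uniformly.\<close>

lemma fourier_zero_imp_zero:
  assumes f: "continuous_on UNIV f" "\<And>x. f (x + 2 * pi) = f x" and z: "\<And>k. fourier f k = 0"
  shows "f x = 0"
proof -
  have cf: "continuous_on {-pi..pi} f" using f(1) continuous_on_subset by blast
  define I where "I = integral {-pi..pi} (\<lambda>x. (cmod (f x))\<^sup>2)"
  obtain B where B: "B > 0" "\<And>x. x \<in> {-pi..pi} \<Longrightarrow> norm (f x) \<le> B"
    using compact_continuous_image[OF cf] compact_imp_bounded bounded_pos
    by (metis compact_Icc imageI)
  have int: "(\<lambda>x. (cmod (f x))\<^sup>2) integrable_on {-pi..pi}"
    by (intro integrable_continuous_interval continuous_intros cf)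
  have "I \<le> e" if e: "e > 0" for e
  proof -
    define d where "d = e / (2 * pi * B)"
    have d: "d > 0" using e B by (simp add: d_def)
    obtain N a where a: "\<And>x. x \<in> {-pi..pi} \<Longrightarrow> norm (f x - (\<Sum>k\<in>freqs N. a k * ek k x)) < d"
      using periodic_approx[OF f d] by blast
    define p where "p x = (\<Sum>k\<in>freqs N. a k * ek k x)" for x
    have cp: "continuous_on {-pi..pi} p" unfolding p_def by (intro continuous_intros)
    have "(\<lambda>x. cnj (p x) * f x) = (\<lambda>x. \<Sum>k\<in>freqs N. cnj (a k) * (ek (-k) x * f x))"
      unfolding p_def by (simp add: sum_distrib_right mult.assoc)
    then have "fourier (\<lambda>x. cnj (p x) * f x) 0 = fourier (\<lambda>x. \<Sum>k\<in>freqs N. cnj (a k) * (ek (-k) x * f x)) 0"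
      by simp
    also have "\<dots> = (\<Sum>k\<in>freqs N. cnj (a k) * fourier f k)"
      by (subst fourier_sum) (auto intro!: continuous_intros cf simp: fourier_cmult, simp add: fourier_alt)
    finally have p0: "fourier (\<lambda>x. cnj (p x) * f x) 0 = 0" using z by simp
    have eq: "complex_of_real ((cmod (f x))\<^sup>2) = cnj (p x) * f x + cnj (f x - p x) * f x" for x
      by (simp add: complex_norm_square mult_ac ring_distribs flip: of_real_power)
    have "complex_of_real I = integral {-pi..pi} (\<lambda>x. complex_of_real ((cmod (f x))\<^sup>2))"
      unfolding I_def using int by (metis integral_unique has_integral_of_real integrable_integral)
    also have "\<dots> / (2 * pi) = fourier (\<lambda>x. complex_of_real ((cmod (f x))\<^sup>2)) 0" by (simp add: fourier_alt)
    also have "\<dots> = fourier (\<lambda>x. cnj (f x - p x) * f x) 0"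
      unfolding eq by (subst fourier_add) (auto intro!: continuous_intros cf cp simp: p0)
    finally have "norm (complex_of_real I / (2 * pi)) = norm \<dots>" by simp
    also have "\<dots> \<le> d * B"
      by (rule fourier_bound) (auto intro!: continuous_intros cf cp simp: norm_mult p_def[symmetric] simp del: complex_cnj_diff
          intro!: mult_mono B less_imp_le[OF a[folded p_def]] simp: d less_imp_le)
    finally have "\<bar>I\<bar> \<le> d * B * (2 * pi)" by (simp add: norm_divide field_simps)
    also have "\<dots> = e" using B by (simp add: d_def)
    finally show ?thesis by simp
  qed
  then have "I \<le> 0" by (metis field_le_epsilon add_0)
  moreover have "I \<ge> 0" unfolding I_def by (rule integral_nonneg[OF int]) auto
  ultimately have I: "I = 0" by simp
  have 0: "f y = 0" if "y \<in> {-pi..pi}" for y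
  proof -
    have "(cmod (f y))\<^sup>2 = 0"
    proof -
      have "continuous_on {-pi..pi} (\<lambda>x. (cmod (f x))\<^sup>2)" by (intro continuous_intros cf)
      moreover have "- pi < pi" using pi_gt_zero by linarith
      ultimately have "(integral {-pi..pi} (\<lambda>x. (cmod (f x))\<^sup>2) = 0) = (\<forall>x\<in>{-pi..pi}. (cmod (f x))\<^sup>2 = 0)"
        by (rule integral_eq_0_iff) simp
      then show ?thesis using I that unfolding I_def by blast
    qed
    then show ?thesis by simp
  qed
  define m where "m = \<lfloor>(x + pi) / (2 * pi)\<rfloor>"
  have per: "f (x + of_nat m * (2 * pi)) = f x" for x m
  proof (induction m)
    case (Suc m)
    then show ?case using f(2)[of "x + of_nat m * (2 * pi)"] by (simp add: algebra_simps)
  qed simp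
  have per': "f (x + of_int n * (2 * pi)) = f x" for x n
  proof (cases "n \<ge> 0")
    case True
    then show ?thesis using per[of x "nat n"] by simp
  next
    case False
    then show ?thesis using per[of "x + of_int n * (2 * pi)" "nat (-n)"] by simp
  qed
  have "of_int m \<le> (x + pi) / (2 * pi)" "(x + pi) / (2 * pi) < of_int m + 1" unfolding m_def by linarith+
  then have "x + of_int (- m) * (2 * pi) \<in> {-pi..pi}" by (auto simp: field_simps)
  then show ?thesis using 0 per'[of x "-m"] by metis
qed

text \<open>Every finite set of integers lies in a symmetric interval. Unordered infinite sums
  thereby become limits of symmetric partial sums, the form in which all later limits are
  taken.\<close>

lemma freqs_filterlim: "filterlim freqs (finite_subsets_at_top UNIV) sequentially"
proof (subst filterlim_finite_subsets_at_top, intro allI impI)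
  fix X :: "int set" assume X: "finite X \<and> X \<subseteq> UNIV"
  define M where "M = nat (Max (abs ` (insert 0 X)))"
  have "X \<subseteq> freqs n" if "n \<ge> M" for n
  proof
    fix x assume "x \<in> X"
    then have "\<bar>x\<bar> \<le> Max (abs ` (insert 0 X))" using X by (intro Max_ge) auto
    then show "x \<in> freqs n" using that unfolding M_def by auto
  qed
  then show "\<forall>\<^sub>F y in sequentially. finite (freqs y) \<and> X \<subseteq> freqs y \<and> freqs y \<subseteq> UNIV"
    unfolding eventually_sequentially by blast
qed

lemma infsum_freqs_limit:
  fixes f :: "int \<Rightarrow> 'a :: {t2_space, comm_monoid_add}"
  assumes "f summable_on UNIV"
  shows "(\<lambda>J. \<Sum>k\<in>freqs J. f k) \<longlonglongrightarrow> infsum f UNIV"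
  using filterlim_compose[OF _ freqs_filterlim, of "sum f"] has_sum_infsum[OF assms]
  unfolding has_sum_def by blast

lemma finite_subset_freqs: "finite A \<Longrightarrow> \<exists>N. A \<subseteq> freqs N"
  using freqs_filterlim unfolding filterlim_finite_subsets_at_top eventually_sequentially by (metis order_refl subset_UNIV)

lemma sum_freqs_Suc: "(\<Sum>k\<in>freqs (Suc N). f k) = (\<Sum>k\<in>freqs N. f k) + (f (1 + int N) + f (- 1 - int N))"
proof -
  have "freqs (Suc N) = insert (1 + int N) (insert (- 1 - int N) (freqs N))" by auto
  then show ?thesis by (simp add: add_ac)
qed

section \<open>Weighted norms of coefficient sequences\<close>

text \<open>The Japanese bracket, the weight of the H^1 norm.\<close>

definition jb :: "int \<Rightarrow> real" where "jb k = sqrt (1 + (of_int k)\<^sup>2)"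

lemma jb_sq: "(jb k)\<^sup>2 = 1 + (of_int k)\<^sup>2"
  unfolding jb_def by simp

lemma jb_ge_1: "1 \<le> jb k"
  unfolding jb_def by simp

lemma jb_pos [simp]: "0 < jb k"
  using jb_ge_1[of k] by linarith

lemma jb_nonneg [simp]: "0 \<le> jb k"
  using jb_ge_1[of k] by linarith

lemma jb_uminus [simp]: "jb (- k) = jb k"
  unfolding jb_def by simp

lemma abs_le_jb: "\<bar>of_int k\<bar> \<le> jb k"
  unfolding jb_def by (rule real_le_rsqrt) simp

lemma jb_le: "jb k \<le> 1 + \<bar>of_int k\<bar>"
  unfolding jb_def by (rule real_le_lsqrt) (auto simp: power2_eq_square algebra_simps)

lemma jb_add: "jb (i + j) \<le> jb i + jb j"
proof (rule power2_le_imp_le)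
  have "of_int i * of_int j \<le> jb i * jb j"
    using mult_mono[OF abs_le_jb[of i] abs_le_jb[of j]] abs_ge_self[of "real_of_int i * real_of_int j"]
    by (simp add: abs_mult)
  then show "(jb (i + j))\<^sup>2 \<le> (jb i + jb j)\<^sup>2"
    unfolding power2_sum jb_sq by (simp add: power2_sum)
qed simp

text \<open>The terms are compared with 1 / ((n + 1) (n + 2)), which telescopes. The value 5 is
  rough; it stays below 9, so that the square-summable weight \<open>1 / jb k\<close> has norm at
  most 3.\<close>

lemma inverse_jb_sq_sum:
  assumes "finite A" shows "(\<Sum>k\<in>A. 1 / (jb k)\<^sup>2) \<le> 5"
proof -
  \<comment> \<open>The subtracted remainder pays for the two new frequencies in the induction
    step.\<close>
  have 1: "(\<Sum>k\<in>freqs (Suc N). 1 / (jb k)\<^sup>2) \<le> 5 - 2 / real (Suc N)" for N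
  proof (induction N)
    case 0
    have "freqs (Suc 0) = {-1,0,1}" by auto
    then show ?case by (simp only:) (simp add: jb_sq)
  next
    case (Suc N)
    have j: "(jb (1 + int (Suc N)))\<^sup>2 = 1 + (real N + 2)\<^sup>2" "(jb (- 1 - int (Suc N)))\<^sup>2 = 1 + (real N + 2)\<^sup>2"
      unfolding jb_sq by (simp_all add: power2_eq_square algebra_simps)
    have "1 / (1 + (real N + 2)\<^sup>2) \<le> 1 / ((real N + 1) * (real N + 2))"
      by (rule divide_left_mono) (simp_all add: power2_eq_square algebra_simps add_pos_nonneg)
    also have "\<dots> = 1 / (real N + 1) - 1 / (real N + 2)" by (simp add: field_simps)
    finally have "2 / (1 + (real N + 2)\<^sup>2) \<le> 2 / (real N + 1) - 2 / (real N + 2)" by simp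
    then show ?case using Suc unfolding sum_freqs_Suc[of _ "Suc N"] j by (simp add: add_ac)
  qed
  obtain N where "A \<subseteq> freqs N" using finite_subset_freqs[OF assms] by blast
  then have "A \<subseteq> freqs (Suc N)" by force
  then have "(\<Sum>k\<in>A. 1 / (jb k)\<^sup>2) \<le> (\<Sum>k\<in>freqs (Suc N). 1 / (jb k)\<^sup>2)" by (intro sum_mono2) auto
  also have "\<dots> \<le> 5" using 1[of N] by (rule order_trans) simp
  finally show ?thesis .
qed

text \<open>The norms are taken over a finite frequency set and without the factor 2 pi of
  \<open>Hs_norm\<close>. Existence of sums is then never an issue, and a bound uniform in the set
  stands for membership in the corresponding sequence space.\<close>

definition l1 :: "int set \<Rightarrow> (int \<Rightarrow> 'a::real_normed_vector) \<Rightarrow> real" where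
  "l1 A a = (\<Sum>k\<in>A. norm (a k))"
definition l2 :: "int set \<Rightarrow> (int \<Rightarrow> 'a::real_normed_vector) \<Rightarrow> real" where
  "l2 A a = L2_set (\<lambda>k. norm (a k)) A"
definition h1 :: "int set \<Rightarrow> (int \<Rightarrow> 'a::real_normed_vector) \<Rightarrow> real" where
  "h1 A a = L2_set (\<lambda>k. jb k * norm (a k)) A"

lemma l1_nonneg [simp]: "0 \<le> l1 A a" by (simp add: l1_def sum_nonneg)
lemma l2_nonneg [simp]: "0 \<le> l2 A a" by (simp add: l2_def)
lemma h1_nonneg [simp]: "0 \<le> h1 A a" by (simp add: h1_def)

lemma L2_set_subset_mono:
  assumes "finite B" "A \<subseteq> B" shows "L2_set f A \<le> L2_set f B"
  unfolding L2_set_def using assms by (intro real_sqrt_le_mono sum_mono2) auto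

lemma h1_subset: "finite B \<Longrightarrow> A \<subseteq> B \<Longrightarrow> h1 A a \<le> h1 B a"
  unfolding h1_def by (rule L2_set_subset_mono)

lemma l2_triangle: "l2 A (\<lambda>k. a k + b k) \<le> l2 A a + l2 A b"
  unfolding l2_def by (rule order_trans[OF L2_set_mono L2_set_triangle_ineq]) (auto simp: norm_triangle_ineq)
lemma h1_triangle: "h1 A (\<lambda>k. a k + b k) \<le> h1 A a + h1 A b"
  unfolding h1_def
  by (rule order_trans[OF L2_set_mono L2_set_triangle_ineq]) (auto simp flip: distrib_left intro!: mult_left_mono norm_triangle_ineq)
lemma l1_triangle: "l1 A (\<lambda>k. a k + b k) \<le> l1 A a + l1 A b"
  unfolding l1_def by (auto simp flip: sum.distrib intro!: sum_mono norm_triangle_ineq)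

lemma l2_mono: "(\<And>k. k \<in> A \<Longrightarrow> norm (a k) \<le> norm (b k)) \<Longrightarrow> l2 A a \<le> l2 A b"
  unfolding l2_def by (rule L2_set_mono) auto
lemma h1_mono: "(\<And>k. k \<in> A \<Longrightarrow> norm (a k) \<le> norm (b k)) \<Longrightarrow> h1 A a \<le> h1 A b"
  unfolding h1_def by (rule L2_set_mono) (auto intro!: mult_left_mono)
lemma l1_mono: "(\<And>k. k \<in> A \<Longrightarrow> norm (a k) \<le> norm (b k)) \<Longrightarrow> l1 A a \<le> l1 A b"
  unfolding l1_def by (rule sum_mono)

lemma l2_cong: "(\<And>k. k \<in> A \<Longrightarrow> norm (a k) = norm (b k)) \<Longrightarrow> l2 A a = l2 A b"
  by (intro antisym l2_mono) auto
lemma h1_cong: "(\<And>k. k \<in> A \<Longrightarrow> norm (a k) = norm (b k)) \<Longrightarrow> h1 A a = h1 A b"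
  by (intro antisym h1_mono) auto
lemma l1_cong: "(\<And>k. k \<in> A \<Longrightarrow> norm (a k) = norm (b k)) \<Longrightarrow> l1 A a = l1 A b"
  by (intro antisym l1_mono) auto

lemma h1_diff_triangle: "h1 A (\<lambda>k. a k - b k) \<le> h1 A a + h1 A b"
  using h1_triangle[of A a "\<lambda>k. - b k"] h1_cong[of A "\<lambda>k. - b k" b] by simp

lemma l2_le_h1: "l2 A a \<le> h1 A a"
  unfolding l2_def h1_def
proof (rule L2_set_mono)
  fix k
  show "norm (a k) \<le> jb k * norm (a k)" using mult_right_mono[OF jb_ge_1[of k], of "norm (a k)"] by simp
qed simp

text \<open>Cauchy--Schwarz against \<open>1 / jb k\<close>: the embedding of H^1 into the Wiener
  algebra, with the constant 3 = sqrt 9.\<close>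

lemma l1_le_h1:
  assumes "finite A" shows "l1 A a \<le> 3 * h1 A a"
proof -
  have "l1 A a = (\<Sum>k\<in>A. \<bar>1 / jb k\<bar> * \<bar>jb k * norm (a k)\<bar>)"
    unfolding l1_def by (intro sum.cong) (auto simp: abs_mult less_imp_neq[THEN not_sym])
  also have "\<dots> \<le> L2_set (\<lambda>k. 1 / jb k) A * h1 A a"
    unfolding h1_def by (rule L2_set_mult_ineq)
  also have "L2_set (\<lambda>k. 1 / jb k) A \<le> sqrt 9"
    unfolding L2_set_def using inverse_jb_sq_sum[OF assms] by (intro real_sqrt_le_mono) (simp add: power_divide)
  finally show ?thesis by (simp add: mult_right_mono)
qed

lemma norm_le_h1: "finite A \<Longrightarrow> k \<in> A \<Longrightarrow> norm (a k) \<le> h1 A a"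
  using member_le_L2_set[of A k "\<lambda>k. norm (a k)"] l2_le_h1[of A a] unfolding l2_def by simp

section \<open>Absolutely convergent Fourier series and the space H^1\<close>

definition fourier_series :: "(int \<Rightarrow> complex) \<Rightarrow> real \<Rightarrow> complex" where
  "fourier_series c x = (\<Sum>\<^sub>\<infinity>k. c k * ek k x)"

lemma fourier_series_uniform_limit:
  assumes "(\<lambda>k. norm (c k)) summable_on UNIV"
  shows "uniform_limit S (\<lambda>J x. \<Sum>k\<in>freqs J. c k * ek k x) (fourier_series c) sequentially"
proof -
  have "uniform_limit S (\<lambda>X x. \<Sum>k\<in>X. c k * ek k x) (\<lambda>x. \<Sum>\<^sub>\<infinity>k. c k * ek k x) (finite_subsets_at_top UNIV)"
    by (rule Weierstrass_m_test_general[OF _ assms]) (simp add: norm_mult)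
  from filterlim_compose[OF this freqs_filterlim] show ?thesis
    unfolding fourier_series_def[abs_def] by simp
qed

lemma continuous_on_fourier_series:
  assumes "(\<lambda>k. norm (c k)) summable_on UNIV"
  shows "continuous_on S (fourier_series c)"
  by (rule uniform_limit_theorem[OF _ fourier_series_uniform_limit[OF assms]]) (auto intro!: always_eventually continuous_intros)

lemma fourier_series_periodic: "fourier_series c (x + 2 * pi) = fourier_series c x"
  unfolding fourier_series_def ek_periodic ..

lemma fourier_series_limit:
  assumes "(\<lambda>k. norm (c k)) summable_on UNIV"
  shows "(\<lambda>J. \<Sum>k\<in>freqs J. c k * ek k x) \<longlonglongrightarrow> fourier_series c x"
  by (rule tendsto_uniform_limitI[OF fourier_series_uniform_limit[OF assms, of UNIV]]) simp

lemma fourier_finite_sum: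
  "finite A \<Longrightarrow> fourier (\<lambda>x. \<Sum>k\<in>A. a k * ek k x) j = (if j \<in> A then a j else 0)"
  by (subst fourier_sum) (auto intro!: continuous_intros simp: fourier_cmult fourier_ek if_distrib cong: if_cong)

lemma fourier_fourier_series:
  assumes "(\<lambda>k. norm (c k)) summable_on UNIV"
  shows "fourier (fourier_series c) k = c k"
proof -
  have "(\<lambda>J. fourier (\<lambda>x. \<Sum>k\<in>freqs J. c k * ek k x) k) \<longlonglongrightarrow> fourier (fourier_series c) k"
    by (rule fourier_limit) (auto intro!: continuous_intros continuous_on_fourier_series fourier_series_uniform_limit assms)
  moreover have "(\<lambda>J. fourier (\<lambda>x. \<Sum>k\<in>freqs J. c k * ek k x) k) \<longlonglongrightarrow> c k"
  proof (rule tendsto_eventually, unfold eventually_sequentially, intro exI allI impI)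
    fix n assume "nat \<bar>k\<bar> \<le> n"
    then show "fourier (\<lambda>x. \<Sum>k\<in>freqs n. c k * ek k x) k = c k"
      by (subst fourier_finite_sum) auto
  qed
  ultimately show ?thesis using LIMSEQ_unique by blast
qed

lemma summable_if_h1_bounded:
  assumes "\<And>J. h1 (freqs J) a \<le> B"
  shows "(\<lambda>k. norm (a k)) summable_on UNIV"
proof (rule nonneg_bdd_above_summable_on)
  show "bdd_above (sum (\<lambda>k. norm (a k)) ` {F. F \<subseteq> UNIV \<and> finite F})"
  proof (rule bdd_aboveI2)
    fix F :: "int set" assume "F \<in> {F. F \<subseteq> UNIV \<and> finite F}"
    then obtain N where N: "F \<subseteq> freqs N" using finite_subset_freqs by blast
    have "(\<Sum>k\<in>F. norm (a k)) \<le> l1 (freqs N) a" unfolding l1_def using N by (intro sum_mono2) auto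
    also have "\<dots> \<le> 3 * B" using l1_le_h1[of "freqs N" a] assms[of N] by simp
    finally show "(\<Sum>k\<in>F. norm (a k)) \<le> 3 * B" .
  qed
qed simp

lemma H1_D:
  assumes "f \<in> H1"
  shows "continuous_on S f" "f (x + 2 * pi) = f x" "(\<lambda>k. (jb k * norm (fourier f k))\<^sup>2) summable_on UNIV"
  using assms continuous_on_subset[of UNIV f S] unfolding H1_def by (auto simp: jb_sq power_mult_distrib)

lemma Hs_norm_eq: "Hs_norm 1 f = sqrt (2 * pi * (\<Sum>\<^sub>\<infinity>k. (jb k * norm (fourier f k))\<^sup>2))"
  unfolding Hs_norm_def by (simp add: jb_sq power_mult_distrib)

lemma h1_le_Hs_norm:
  assumes "f \<in> H1" "finite A"
  shows "h1 A (fourier f) \<le> Hs_norm 1 f"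
proof -
  define S where "S = (\<Sum>\<^sub>\<infinity>k. (jb k * norm (fourier f k))\<^sup>2)"
  have "(\<Sum>k\<in>A. (jb k * norm (fourier f k))\<^sup>2) \<le> S"
    unfolding S_def by (rule finite_sum_le_infsum[OF H1_D(3)[OF assms(1)] assms(2)]) auto
  moreover have "S \<ge> 0" unfolding S_def by (rule infsum_nonneg) simp
  then have "S \<le> 2 * pi * S" using pi_ge_two mult_right_mono[of 1 "2 * pi" S] by simp
  ultimately show ?thesis unfolding h1_def L2_set_def Hs_norm_eq S_def[symmetric] by (intro real_sqrt_le_mono) linarith
qed

lemma H1_summable: "f \<in> H1 \<Longrightarrow> (\<lambda>k. norm (fourier f k)) summable_on UNIV"
  using summable_if_h1_bounded h1_le_Hs_norm by (metis finite_atLeastAtMost_int)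

text \<open>Both sides are continuous and periodic with the same coefficients, so completeness makes
  the difference vanish. Point values, which interpolation and the pointwise Duhamel formula use,
  are thus determined by coefficients.\<close>

lemma H1_eq_fourier_series:
  assumes "f \<in> H1" shows "f x = fourier_series (fourier f) x"
proof -
  note s = H1_summable[OF assms]
  have "f x - fourier_series (fourier f) x = 0"
  proof (rule fourier_zero_imp_zero[of "\<lambda>x. f x - fourier_series (fourier f) x"])
    show "continuous_on UNIV (\<lambda>x. f x - fourier_series (fourier f) x)"
      by (intro continuous_intros H1_D[OF assms] continuous_on_fourier_series s)
    show "fourier (\<lambda>x. f x - fourier_series (fourier f) x) k = 0" for k
      by (subst fourier_diff) (auto intro!: H1_D[OF assms] continuous_on_fourier_series s simp: fourier_fourier_series[OF s])
  qed (simp add: H1_D(2)[OF assms] fourier_series_periodic)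
  then show ?thesis by simp
qed

lemma H1_diff:
  assumes "f \<in> H1" "g \<in> H1" shows "(\<lambda>x. f x - g x) \<in> H1"
proof -
  have F: "fourier (\<lambda>x. f x - g x) k = fourier f k - fourier g k" for k
    by (rule fourier_diff) (auto intro: H1_D assms)
  have "(\<lambda>k. (jb k * norm (fourier f k - fourier g k))\<^sup>2) summable_on UNIV"
  proof (rule summable_on_comparison_test)
    show "(\<lambda>k. 2 * (jb k * norm (fourier f k))\<^sup>2 + 2 * (jb k * norm (fourier g k))\<^sup>2) summable_on UNIV"
      by (intro summable_on_add summable_on_cmult_right H1_D assms)
    fix k
    have "(jb k * norm (fourier f k - fourier g k))\<^sup>2 \<le> (jb k * norm (fourier f k) + jb k * norm (fourier g k))\<^sup>2"
      by (intro power_mono) (auto simp flip: distrib_left intro!: mult_left_mono norm_triangle_ineq4)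
    also have "\<dots> \<le> 2 * (jb k * norm (fourier f k))\<^sup>2 + 2 * (jb k * norm (fourier g k))\<^sup>2"
      using sum_squares_bound[of "jb k * norm (fourier f k)" "jb k * norm (fourier g k)"] by (simp add: power2_sum)
    finally show "(jb k * norm (fourier f k - fourier g k))\<^sup>2 \<le> 2 * (jb k * norm (fourier f k))\<^sup>2 + 2 * (jb k * norm (fourier g k))\<^sup>2" .
  qed simp
  then show ?thesis
    using assms unfolding H1_def by (auto intro!: continuous_intros simp: F jb_sq power_mult_distrib)
qed

text \<open>Parseval is computed for the partial sums and carried over by uniform convergence. This
  is the bridge by which coefficient errors return to the L^2 norm of the theorem.\<close>

lemma L2_norm_fourier_series_le:
  assumes s: "(\<lambda>k. norm (c k)) summable_on UNIV" and B: "\<And>J. l2 (freqs J) c \<le> B"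
  shows "L2_norm (fourier_series c) \<le> sqrt (2 * pi) * B"
proof -
  have B0: "B \<ge> 0" using B[of 0] l2_nonneg order_trans by blast
  define p where "p J x = (\<Sum>k\<in>freqs J. c k * ek k x)" for J x
  have cs: "continuous_on {-pi..pi} (fourier_series c)" by (rule continuous_on_fourier_series[OF s])
  have bd: "bounded (fourier_series c ` {-pi..pi})" "bounded ((\<lambda>x. cnj (fourier_series c x)) ` {-pi..pi})"
    by (intro compact_imp_bounded compact_continuous_image continuous_intros cs; simp)+
  have u1: "uniform_limit {-pi..pi} p (fourier_series c) sequentially"
    unfolding p_def by (rule fourier_series_uniform_limit[OF s])
  have u2: "uniform_limit {-pi..pi} (\<lambda>J x. cnj (p J x)) (\<lambda>x. cnj (fourier_series c x)) sequentially"
    by (rule bounded_linear.uniform_limit[OF bounded_linear_cnj u1])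
  have "(\<lambda>J. fourier (\<lambda>x. p J x * cnj (p J x)) 0) \<longlonglongrightarrow> fourier (\<lambda>x. fourier_series c x * cnj (fourier_series c x)) 0"
  proof (rule fourier_limit)
    show "continuous_on {-pi..pi} (\<lambda>x. p J x * cnj (p J x))" for J
      unfolding p_def by (intro continuous_intros)
  qed (intro continuous_intros cs uniform_lim_mult u1 u2 bd)+
  moreover have "fourier (\<lambda>x. p J x * cnj (p J x)) 0 = of_real ((l2 (freqs J) c)\<^sup>2)" for J
  proof -
    have "(\<lambda>x. p J x * cnj (p J x)) = (\<lambda>x. \<Sum>i\<in>freqs J. \<Sum>j\<in>freqs J. c i * cnj (c j) * ek (i - j) x)"
      unfolding p_def cnj_sum sum_product by (intro ext sum.cong refl) (auto simp: ek_add[of i "- j" for i j, simplified])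
    then have "fourier (\<lambda>x. p J x * cnj (p J x)) 0 = (\<Sum>i\<in>freqs J. \<Sum>j\<in>freqs J. c i * cnj (c j) * (if i = j then 1 else 0))"
      by (simp add: fourier_sum continuous_intros fourier_cmult fourier_ek)
    also have "\<dots> = (\<Sum>i\<in>freqs J. c i * cnj (c i))"
      by (intro sum.cong refl) (auto simp: if_distrib cong: if_cong)
    also have "\<dots> = of_real ((l2 (freqs J) c)\<^sup>2)"
      unfolding l2_def L2_set_def by (simp add: sum_nonneg flip: complex_norm_square)
    finally show ?thesis .
  qed
  ultimately have "(\<lambda>J. complex_of_real ((l2 (freqs J) c)\<^sup>2)) \<longlonglongrightarrow> fourier (\<lambda>x. fourier_series c x * cnj (fourier_series c x)) 0" by simp
  then have l: "(\<lambda>J. (l2 (freqs J) c)\<^sup>2) \<longlonglongrightarrow> Re (fourier (\<lambda>x. fourier_series c x * cnj (fourier_series c x)) 0)"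
    using tendsto_Re by fastforce
  have le: "Re (fourier (\<lambda>x. fourier_series c x * cnj (fourier_series c x)) 0) \<le> B\<^sup>2"
    by (rule LIMSEQ_le_const2[OF l]) (auto intro!: power_mono B)
  have "(\<lambda>x. (cmod (fourier_series c x))\<^sup>2) integrable_on {-pi..pi}"
    by (intro integrable_continuous_interval continuous_intros cs)
  then have "integral {-pi..pi} (\<lambda>x. complex_of_real ((cmod (fourier_series c x))\<^sup>2)) = of_real (integral {-pi..pi} (\<lambda>x. (cmod (fourier_series c x))\<^sup>2))"
    by (metis integral_unique has_integral_of_real integrable_integral)
  then have "fourier (\<lambda>x. fourier_series c x * cnj (fourier_series c x)) 0 = of_real (integral {-pi..pi} (\<lambda>x. (cmod (fourier_series c x))\<^sup>2) / (2 * pi))"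
    unfolding fourier_alt by (simp flip: complex_norm_square)
  then have "integral {-pi..pi} (\<lambda>x. (cmod (fourier_series c x))\<^sup>2) / (2 * pi) \<le> B\<^sup>2"
    using le by (simp only: Re_complex_of_real)
  then have "integral {-pi..pi} (\<lambda>x. (cmod (fourier_series c x))\<^sup>2) \<le> 2 * pi * B\<^sup>2"
    by (simp add: field_simps)
  then show ?thesis unfolding L2_norm_def
    using B0 by (metis real_sqrt_le_mono real_sqrt_mult real_sqrt_unique)
qed

section \<open>Trigonometric polynomials\<close>

text \<open>The space S_N, encoded as the functions reproduced by their own coefficients up to N.
  Continuity and the vanishing of all further coefficients follow from this one identity.\<close>

definition trig_poly :: "nat \<Rightarrow> (real \<Rightarrow> complex) \<Rightarrow> bool" where
  "trig_poly N f \<longleftrightarrow> (\<forall>x. f x = (\<Sum>k\<in>freqs N. fourier f k * ek k x))"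

lemma trig_polyI:
  assumes "\<And>x. f x = (\<Sum>k\<in>freqs N. a k * ek k x)"
  shows "trig_poly N f" "fourier f k = (if k \<in> freqs N then a k else 0)"
proof -
  have "f = (\<lambda>x. \<Sum>k\<in>freqs N. a k * ek k x)" using assms by auto
  then show *: "fourier f k = (if k \<in> freqs N then a k else 0)" for k
    using fourier_finite_sum[of "freqs N" a k] by simp
  show "trig_poly N f" unfolding trig_poly_def * using assms by auto
qed

lemma trig_poly_eq: "trig_poly N f \<Longrightarrow> f x = (\<Sum>k\<in>freqs N. fourier f k * ek k x)"
  by (auto simp: trig_poly_def)

lemma trig_poly_fourier_0: "trig_poly N f \<Longrightarrow> k \<notin> freqs N \<Longrightarrow> fourier f k = 0"
  using trig_polyI(2)[OF trig_poly_eq] by (metis (no_types, lifting))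

lemma trig_poly_continuous: "trig_poly N f \<Longrightarrow> continuous_on S f"
proof -
  assume f: "trig_poly N f"
  have "continuous_on S (\<lambda>x. \<Sum>k\<in>freqs N. fourier f k * ek k x)" by (intro continuous_intros)
  then show ?thesis using trig_poly_eq[OF f] by simp
qed

lemma trig_poly_add:
  assumes f: "trig_poly N f" and g: "trig_poly N g"
  shows "trig_poly N (\<lambda>x. f x + g x)"
  by (rule trig_polyI(1)[where a="\<lambda>k. fourier f k + fourier g k"]) (simp add: trig_poly_eq[OF f] trig_poly_eq[OF g] sum.distrib ring_distribs)

lemma trig_poly_diff:
  assumes f: "trig_poly N f" and g: "trig_poly N g"
  shows "trig_poly N (\<lambda>x. f x - g x)"
  by (rule trig_polyI(1)[where a="\<lambda>k. fourier f k - fourier g k"]) (simp add: trig_poly_eq[OF f] trig_poly_eq[OF g] sum_subtractf ring_distribs)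

lemma trig_poly_cmult:
  assumes f: "trig_poly N f"
  shows "trig_poly N (\<lambda>x. c * f x)"
  by (rule trig_polyI(1)[where a="\<lambda>k. c * fourier f k"]) (simp add: trig_poly_eq[OF f] sum_distrib_left mult.assoc)

lemma trig_poly_const: "trig_poly N (\<lambda>x. c)" "fourier (\<lambda>x. c) k = (if k = 0 then c else 0)"
proof -
  have *: "c = (\<Sum>k\<in>freqs N. (if k = 0 then c else 0) * ek k x)" for x N
    by (simp add: if_distrib[of "\<lambda>c. c * _"] cong: if_cong)
  show "trig_poly N (\<lambda>x. c)" by (rule trig_polyI(1)[OF *])
  show "fourier (\<lambda>x. c) k = (if k = 0 then c else 0)"
    using trig_polyI(2)[OF *[of _ 0]] by simp
qed

lemma trig_poly_cnj:
  assumes f: "trig_poly N f" shows "trig_poly N (\<lambda>x. cnj (f x))"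
proof (rule trig_polyI(1)[where a="\<lambda>k. cnj (fourier f (- k))"])
  fix x
  have "cnj (f x) = (\<Sum>k\<in>freqs N. cnj (fourier f k) * ek (- k) x)"
    by (simp add: trig_poly_eq[OF f, of x])
  also have "\<dots> = (\<Sum>k\<in>freqs N. cnj (fourier f (- k)) * ek k x)"
    by (rule sum.reindex_bij_witness[of _ uminus uminus]) auto
  finally show "cnj (f x) = (\<Sum>k\<in>freqs N. cnj (fourier f (- k)) * ek k x)" .
qed

lemma trig_poly_mult:
  assumes f: "trig_poly N f" and g: "trig_poly M g"
  shows "trig_poly (N + M) (\<lambda>x. f x * g x)"
    "fourier (\<lambda>x. f x * g x) k = (\<Sum>i\<in>freqs N. \<Sum>j\<in>freqs M. if i + j = k then fourier f i * fourier g j else 0)"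
proof -
  define c where "c k = (\<Sum>i\<in>freqs N. \<Sum>j\<in>freqs M. if i + j = k then fourier f i * fourier g j else 0)" for k
  have *: "f x * g x = (\<Sum>k\<in>freqs (N+M). c k * ek k x)" for x
  proof -
    have "f x * g x = (\<Sum>i\<in>freqs N. \<Sum>j\<in>freqs M. fourier f i * fourier g j * ek (i + j) x)"
      unfolding trig_poly_eq[OF f, of x] trig_poly_eq[OF g, of x] sum_product by (simp add: ek_add mult_ac)
    also have "\<dots> = (\<Sum>i\<in>freqs N. \<Sum>j\<in>freqs M. \<Sum>k\<in>freqs (N+M). if i + j = k then fourier f i * fourier g j * ek k x else 0)"
      by (intro sum.cong refl) (auto simp: sum.delta)
    also have "\<dots> = (\<Sum>k\<in>freqs (N+M). \<Sum>i\<in>freqs N. \<Sum>j\<in>freqs M. if i + j = k then fourier f i * fourier g j * ek k x else 0)"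
      unfolding sum.swap[of _ "freqs (N+M)" "freqs M"] sum.swap[of _ "freqs (N+M)" "freqs N"] ..
    also have "\<dots> = (\<Sum>k\<in>freqs (N+M). c k * ek k x)"
      unfolding c_def sum_distrib_right by (intro sum.cong refl) auto
    finally show ?thesis .
  qed
  show "trig_poly (N + M) (\<lambda>x. f x * g x)" by (rule trig_polyI(1)[OF *])
  have "c k = 0" if "k \<notin> freqs (N+M)" unfolding c_def by (intro sum.neutral ballI) (use that in auto)
  then show "fourier (\<lambda>x. f x * g x) k = (\<Sum>i\<in>freqs N. \<Sum>j\<in>freqs M. if i + j = k then fourier f i * fourier g j else 0)"
    using trig_polyI(2)[OF *, of k] unfolding c_def[symmetric] by auto
qed

lemma trig_poly_PiN: "trig_poly N (PiN N f)" "fourier (PiN N f) k = (if k \<in> freqs N then fourier f k else 0)"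
proof -
  have *: "PiN N f x = (\<Sum>k\<in>freqs N. fourier f k * ek k x)" for x
    unfolding PiN_def ek_def ..
  show "trig_poly N (PiN N f)" "fourier (PiN N f) k = (if k \<in> freqs N then fourier f k else 0)"
    by (rule trig_polyI(1)[OF *], rule trig_polyI(2)[OF *])
qed

lemma trig_poly_multiplier:
  assumes f: "trig_poly N f"
  shows "trig_poly N (multiplier m f)" "fourier (multiplier m f) k = m k * fourier f k"
proof -
  have *: "multiplier m f x = (\<Sum>k\<in>freqs N. (m k * fourier f k) * ek k x)" for x
  proof -
    have "multiplier m f x = (\<Sum>\<^sub>\<infinity>k\<in>freqs N. m k * fourier f k * ek k x)"
      unfolding multiplier_def ek_def by (rule infsum_cong_neutral) (use trig_poly_fourier_0[OF f] in auto)
    then show ?thesis by simp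
  qed
  show "trig_poly N (multiplier m f)" by (rule trig_polyI(1)[OF *])
  show "fourier (multiplier m f) k = m k * fourier f k"
    using trig_polyI(2)[OF *, of k] trig_poly_fourier_0[OF f, of k] by auto
qed

lemma trig_poly_dx:
  assumes f: "trig_poly N f"
  shows "trig_poly N (dx f)" "fourier (dx f) k = \<i> * of_int k * fourier f k"
proof -
  have *: "dx f x = (\<Sum>k\<in>freqs N. (\<i> * of_int k * fourier f k) * ek k x)" for x
  proof -
    have "((\<lambda>x. \<Sum>k\<in>freqs N. fourier f k * ek k x) has_vector_derivative (\<Sum>k\<in>freqs N. fourier f k * (\<i> * of_int k * ek k x))) (at x)"
      by (intro has_vector_derivative_sum has_vector_derivative_mult_right ek_has_vector_derivative)
    moreover have "f = (\<lambda>x. \<Sum>k\<in>freqs N. fourier f k * ek k x)" using trig_poly_eq[OF f] by auto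
    ultimately have "vector_derivative f (at x) = (\<Sum>k\<in>freqs N. fourier f k * (\<i> * of_int k * ek k x))"
      by (metis (no_types, lifting) vector_derivative_at)
    then show ?thesis unfolding dx_def by (simp add: mult_ac)
  qed
  show "trig_poly N (dx f)" by (rule trig_polyI(1)[OF *])
  show "fourier (dx f) k = \<i> * of_int k * fourier f k"
    using trig_polyI(2)[OF *, of k] trig_poly_fourier_0[OF f, of k] by auto
qed

section \<open>Trilinear sums\<close>

text \<open>The constraint is kept as an indicator instead of eliminating l = k - i - j, so the
  three indices remain symmetric and may be permuted freely.\<close>

definition s3 :: "int set \<Rightarrow> (int \<Rightarrow> int \<Rightarrow> int \<Rightarrow> 'a::comm_monoid_add) \<Rightarrow> int \<Rightarrow> 'a" where
  "s3 A G k = (\<Sum>i\<in>A. \<Sum>j\<in>A. \<Sum>l\<in>A. if i + j + l = k then G i j l else 0)"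

lemma s3_cong:
  "(\<And>i j l. i \<in> A \<Longrightarrow> j \<in> A \<Longrightarrow> l \<in> A \<Longrightarrow> i + j + l = k \<Longrightarrow> G i j l = G' i j l) \<Longrightarrow> s3 A G k = s3 A G' k"
  unfolding s3_def by (intro sum.cong refl) auto

lemma s3_mono:
  fixes G :: "int \<Rightarrow> int \<Rightarrow> int \<Rightarrow> real"
  shows "(\<And>i j l. i \<in> A \<Longrightarrow> j \<in> A \<Longrightarrow> l \<in> A \<Longrightarrow> i + j + l = k \<Longrightarrow> G i j l \<le> G' i j l) \<Longrightarrow> s3 A G k \<le> s3 A G' k"
  unfolding s3_def by (intro sum_mono) auto

lemma s3_nonneg:
  fixes G :: "int \<Rightarrow> int \<Rightarrow> int \<Rightarrow> real"
  shows "(\<And>i j l. 0 \<le> G i j l) \<Longrightarrow> 0 \<le> s3 A G k"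
  unfolding s3_def by (intro sum_nonneg) auto

lemma s3_add: "s3 A (\<lambda>i j l. G i j l + G' i j l) k = s3 A G k + s3 A G' k"
proof -
  have "s3 A (\<lambda>i j l. G i j l + G' i j l) k =
    (\<Sum>i\<in>A. \<Sum>j\<in>A. \<Sum>l\<in>A. (if i + j + l = k then G i j l else 0) + (if i + j + l = k then G' i j l else 0))"
    unfolding s3_def by (intro sum.cong refl) auto
  then show ?thesis unfolding s3_def by (simp add: sum.distrib)
qed

lemma s3_diff:
  fixes G :: "int \<Rightarrow> int \<Rightarrow> int \<Rightarrow> 'a::ab_group_add"
  shows "s3 A (\<lambda>i j l. G i j l - G' i j l) k = s3 A G k - s3 A G' k"
  using s3_add[of A "\<lambda>i j l. G i j l - G' i j l" G' k] by simp

lemma s3_cmult: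
  fixes c :: "'a::semiring_0"
  shows "s3 A (\<lambda>i j l. c * G i j l) k = c * s3 A G k"
  unfolding s3_def sum_distrib_left by (intro sum.cong refl) auto

lemma norm_s3_le: "norm (s3 A G k) \<le> s3 A (\<lambda>i j l. norm (G i j l)) k"
  unfolding s3_def by (intro sum_norm_le) auto

lemma s3_swap12: "s3 A G k = s3 A (\<lambda>i j l. G j i l) k"
  unfolding s3_def by (subst sum.swap) (simp add: add_ac)

lemma s3_swap23: "s3 A G k = s3 A (\<lambda>i j l. G i l j) k"
  unfolding s3_def
proof (rule sum.cong[OF refl])
  fix i
  show "(\<Sum>j\<in>A. \<Sum>l\<in>A. if i + j + l = k then G i j l else 0) = (\<Sum>j\<in>A. \<Sum>l\<in>A. if i + j + l = k then G i l j else 0)"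
    by (subst sum.swap) (simp add: add_ac)
qed

lemma s3_swap13: "s3 A G k = s3 A (\<lambda>i j l. G l j i) k"
  by (simp only: s3_swap12[of A G] s3_swap23[of A "\<lambda>i j l. G j i l"] s3_swap12[of A "\<lambda>i j l. G l i j"])

lemma jb_tri:
  "jb i \<le> jb (i + j + l) + jb j + jb l" "jb j \<le> jb (i + j + l) + jb i + jb l" "jb l \<le> jb (i + j + l) + jb i + jb j"
proof -
  have *: "jb i \<le> jb (i + j + l) + jb j + jb l" for i j l
    using jb_add[of "i + j + l" "- (j + l)"] jb_add[of j l] jb_uminus[of "j + l"] by (simp del: jb_uminus)
  show "jb i \<le> jb (i + j + l) + jb j + jb l" "jb j \<le> jb (i + j + l) + jb i + jb l" "jb l \<le> jb (i + j + l) + jb i + jb j"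
    using *[of i j l] *[of j i l] *[of l i j] by (simp_all add: add_ac)
qed

lemma L2_set_sum_le:
  assumes "finite I"
  shows "L2_set (\<lambda>k. \<Sum>i\<in>I. f i k) K \<le> (\<Sum>i\<in>I. L2_set (f i) K)"
  using assms
proof (induction I rule: finite_induct)
  case empty
  then show ?case by (simp add: L2_set_def)
next
  case (insert i I)
  then show ?case using L2_set_triangle_ineq[of "f i" "\<lambda>k. \<Sum>i\<in>I. f i k" K] by simp
qed

lemma L2_set_inj_le:
  assumes A: "finite A" and K: "finite K" and inj: "inj_on g K"
  shows "L2_set (\<lambda>k. if g k \<in> A then z (g k) else 0) K \<le> L2_set z A"
  unfolding L2_set_def
proof (rule real_sqrt_le_mono)
  have "(\<Sum>k\<in>K. (if g k \<in> A then z (g k) else 0)\<^sup>2) = (\<Sum>k\<in>{k\<in>K. g k \<in> A}. (z (g k))\<^sup>2)"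
    by (rule sum.mono_neutral_cong_right) (auto simp: K)
  also have "\<dots> = (\<Sum>m\<in>g ` {k\<in>K. g k \<in> A}. (z m)\<^sup>2)"
    by (subst sum.reindex) (auto intro: inj_on_subset[OF inj])
  also have "\<dots> \<le> (\<Sum>m\<in>A. (z m)\<^sup>2)"
    by (rule sum_mono2) (auto simp: A)
  finally show "(\<Sum>k\<in>K. (if g k \<in> A then z (g k) else 0)\<^sup>2) \<le> (\<Sum>m\<in>A. (z m)\<^sup>2)" .
qed

lemma conv_L2_L2:
  fixes x y :: "int \<Rightarrow> real"
  assumes A: "finite A" and pos: "\<And>i. 0 \<le> x i" "\<And>i. 0 \<le> y i"
  shows "(\<Sum>i\<in>A. \<Sum>j\<in>A. if i + j = p then x i * y j else 0) \<le> L2_set x A * L2_set y A"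
proof -
  have "(\<Sum>i\<in>A. \<Sum>j\<in>A. if i + j = p then x i * y j else 0) =
      (\<Sum>i\<in>A. \<bar>x i\<bar> * \<bar>if p - i \<in> A then y (p - i) else 0\<bar>)"
  proof (rule sum.cong[OF refl])
    fix i
    have "(\<Sum>j\<in>A. if i + j = p then x i * y j else 0) = (\<Sum>j\<in>A. if j = p - i then x i * y j else 0)"
      by (intro sum.cong refl) auto
    then show "(\<Sum>j\<in>A. if i + j = p then x i * y j else 0) = \<bar>x i\<bar> * \<bar>if p - i \<in> A then y (p - i) else 0\<bar>"
      using A pos by (simp add: sum.delta)
  qed
  also have "\<dots> \<le> L2_set x A * L2_set (\<lambda>i. if p - i \<in> A then y (p - i) else 0) A"
    by (rule L2_set_mult_ineq)
  also have "\<dots> \<le> L2_set x A * L2_set y A"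
    by (intro mult_left_mono L2_set_inj_le A) (auto simp: inj_on_def)
  finally show ?thesis .
qed

text \<open>Young's inequality: the convolution of two square-summable sequences is bounded, and the
  third factor is summable. The bound is pointwise in k; square summability in k must come from a
  separate weight.\<close>

lemma s3_sup_bound:
  fixes x y z :: "int \<Rightarrow> real"
  assumes A: "finite A" and pos: "\<And>i. 0 \<le> x i" "\<And>i. 0 \<le> y i" "\<And>i. 0 \<le> z i"
  shows "s3 A (\<lambda>i j l. x i * y j * z l) k \<le> L2_set x A * L2_set y A * (\<Sum>l\<in>A. z l)"
proof -
  have "s3 A (\<lambda>i j l. x i * y j * z l) k = s3 A (\<lambda>l i j. x i * y j * z l) k"
    by (subst s3_swap13, subst s3_swap23) (rule refl)
  also have "\<dots> = (\<Sum>l\<in>A. z l * (\<Sum>i\<in>A. \<Sum>j\<in>A. if i + j = k - l then x i * y j else 0))"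
    unfolding s3_def sum_distrib_left by (intro sum.cong refl) auto
  also have "\<dots> \<le> (\<Sum>l\<in>A. z l * (L2_set x A * L2_set y A))"
    by (intro sum_mono mult_left_mono conv_L2_L2 assms)
  also have "\<dots> = L2_set x A * L2_set y A * (\<Sum>l\<in>A. z l)" unfolding sum_distrib_right[symmetric] by (rule mult.commute)
  finally show ?thesis .
qed

text \<open>Young's inequality again, now with two summable factors: the sum is a superposition of
  shifted copies of z, and each shift has at most the norm of z.\<close>

lemma s3_L2_bound:
  fixes x y z :: "int \<Rightarrow> real"
  assumes A: "finite A" "finite K" and pos: "\<And>i. 0 \<le> x i" "\<And>i. 0 \<le> y i" "\<And>i. 0 \<le> z i"
  shows "L2_set (s3 A (\<lambda>i j l. x i * y j * z l)) K \<le> (\<Sum>i\<in>A. x i) * (\<Sum>j\<in>A. y j) * L2_set z A"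
proof -
  have eq: "s3 A (\<lambda>i j l. x i * y j * z l) k = (\<Sum>i\<in>A. \<Sum>j\<in>A. x i * y j * (if k - i - j \<in> A then z (k - i - j) else 0))" for k
    unfolding s3_def
  proof (intro sum.cong refl)
    fix i j
    have "(\<Sum>l\<in>A. if i + j + l = k then x i * y j * z l else 0) = (\<Sum>l\<in>A. if l = k - i - j then x i * y j * z l else 0)"
      by (intro sum.cong refl) auto
    then show "(\<Sum>l\<in>A. if i + j + l = k then x i * y j * z l else 0) = x i * y j * (if k - i - j \<in> A then z (k - i - j) else 0)"
      using A by (simp add: sum.delta)
  qed
  have "L2_set (s3 A (\<lambda>i j l. x i * y j * z l)) K \<le>
     (\<Sum>i\<in>A. \<Sum>j\<in>A. L2_set (\<lambda>k. x i * y j * (if k - i - j \<in> A then z (k - i - j) else 0)) K)"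
    unfolding eq by (intro order_trans[OF L2_set_sum_le] sum_mono A L2_set_sum_le)
  also have "\<dots> \<le> (\<Sum>i\<in>A. \<Sum>j\<in>A. x i * y j * L2_set z A)"
  proof (intro sum_mono)
    fix i j
    have "L2_set (\<lambda>k. x i * y j * (if k - i - j \<in> A then z (k - i - j) else 0)) K =
      x i * y j * L2_set (\<lambda>k. if k - i - j \<in> A then z (k - i - j) else 0) K"
      by (rule L2_set_right_distrib[symmetric]) (simp add: pos)
    also have "\<dots> \<le> x i * y j * L2_set z A"
      by (intro mult_left_mono L2_set_inj_le A mult_nonneg_nonneg pos) (auto simp: inj_on_def)
    finally show "L2_set (\<lambda>k. x i * y j * (if k - i - j \<in> A then z (k - i - j) else 0)) K \<le> x i * y j * L2_set z A" .
  qed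
  also have "\<dots> = (\<Sum>i\<in>A. x i) * (\<Sum>j\<in>A. y j) * L2_set z A"
    unfolding sum_product unfolding sum_distrib_right ..
  finally show ?thesis .
qed

lemma L2_set_inverse_jb:
  assumes "finite K" "\<And>k. k \<in> K \<Longrightarrow> 0 \<le> f k" "\<And>k. k \<in> K \<Longrightarrow> f k \<le> B / jb k" "B \<ge> 0"
  shows "L2_set f K \<le> 3 * B"
proof -
  have 0: "L2_set f K \<le> L2_set (\<lambda>k. B * (1 / jb k)) K" by (rule L2_set_mono) (use assms in auto)
  have 1: "L2_set (\<lambda>k. B * (1 / jb k)) K = B * L2_set (\<lambda>k. 1 / jb k) K" by (rule L2_set_right_distrib[symmetric]) fact
  have "L2_set (\<lambda>k. 1 / jb k) K \<le> sqrt 9"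
    unfolding L2_set_def using inverse_jb_sq_sum[OF assms(1)] by (intro real_sqrt_le_mono) (simp add: power_divide)
  then have "B * L2_set (\<lambda>k. 1 / jb k) K \<le> B * 3" using assms(4) by (intro mult_left_mono) auto
  then show ?thesis using 0 1 by simp
qed

section \<open>Trilinear Fourier multipliers with admissible symbols\<close>

definition tri :: "int set \<Rightarrow> (int \<Rightarrow> int \<Rightarrow> int \<Rightarrow> complex) \<Rightarrow> (int \<Rightarrow> complex) \<Rightarrow> (int \<Rightarrow> complex) \<Rightarrow> (int \<Rightarrow> complex) \<Rightarrow> int \<Rightarrow> complex" where
  "tri A m a b d = s3 A (\<lambda>i j l. m i j l * (a i * b j * d l))"

lemma tri_swap12: "tri A m a b d k = tri A (\<lambda>i j l. m j i l) b a d k"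
  unfolding tri_def by (subst s3_swap12) (simp add: mult_ac)
lemma tri_swap13: "tri A m a b d k = tri A (\<lambda>i j l. m l j i) d b a k"
  unfolding tri_def by (subst s3_swap13) (simp add: mult_ac)

lemma tri_m_add: "tri A (\<lambda>i j l. m i j l + m' i j l) a b d k = tri A m a b d k + tri A m' a b d k"
  unfolding tri_def by (simp add: ring_distribs s3_add)
lemma tri_m_diff: "tri A (\<lambda>i j l. m i j l - m' i j l) a b d k = tri A m a b d k - tri A m' a b d k"
  unfolding tri_def by (simp add: ring_distribs s3_diff)
lemma tri_m_cmult: "tri A (\<lambda>i j l. c * m i j l) a b d k = c * tri A m a b d k"
  unfolding tri_def by (simp add: mult.assoc s3_cmult)
lemma tri_m_cong:
  "(\<And>i j l. i \<in> A \<Longrightarrow> j \<in> A \<Longrightarrow> l \<in> A \<Longrightarrow> i + j + l = k \<Longrightarrow> m i j l = m' i j l) \<Longrightarrow> tri A m a b d k = tri A m' a b d k"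
  unfolding tri_def by (rule s3_cong) simp
lemma tri_diff1: "tri A m (\<lambda>k. a k - a' k) b d k = tri A m a b d k - tri A m a' b d k"
  unfolding tri_def by (simp add: ring_distribs s3_diff)
lemma tri_diff2: "tri A m a (\<lambda>k. b k - b' k) d k = tri A m a b d k - tri A m a b' d k"
  unfolding tri_def by (simp add: ring_distribs s3_diff)
lemma tri_diff3: "tri A m a b (\<lambda>k. d k - d' k) k = tri A m a b d k - tri A m a b d' k"
  unfolding tri_def by (simp add: ring_distribs s3_diff)

lemma tri_telescope: "tri A m a b d k - tri A m a' b' d' k =
  tri A m (\<lambda>k. a k - a' k) b d k + tri A m a' (\<lambda>k. b k - b' k) d k + tri A m a' b' (\<lambda>k. d k - d' k) k"
  unfolding tri_diff1 tri_diff2 tri_diff3 by simp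

lemma norm_tri_le:
  assumes "\<And>i j l. i \<in> A \<Longrightarrow> j \<in> A \<Longrightarrow> l \<in> A \<Longrightarrow> i + j + l = k \<Longrightarrow> norm (m i j l) \<le> W i j l"
  shows "norm (tri A m a b d k) \<le> s3 A (\<lambda>i j l. W i j l * (norm (a i) * norm (b j) * norm (d l))) k"
  unfolding tri_def by (rule order_trans[OF norm_s3_le], rule s3_mono) (auto simp: norm_mult intro!: mult_right_mono assms)

text \<open>The weight \<open>jb (i + j + l)\<close> that the \<open>H\<^sup>1\<close> norm puts on the output cancels the denominator, so an admissible symbol
  costs no more than the product in the algebra \<open>H\<^sup>1\<close>.\<close>

definition admissible :: "real \<Rightarrow> (int \<Rightarrow> int \<Rightarrow> int \<Rightarrow> complex) \<Rightarrow> bool" where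
  "admissible C m \<longleftrightarrow> (\<forall>i j l. norm (m i j l) \<le> C * ((jb i + jb j + jb l) / jb (i + j + l)))"

lemma admissible_swap12: "admissible C m \<Longrightarrow> admissible C (\<lambda>i j l. m j i l)"
  unfolding admissible_def by (metis add.commute)
lemma admissible_swap13: "admissible C m \<Longrightarrow> admissible C (\<lambda>i j l. m l j i)"
  unfolding admissible_def by (metis add.commute add.left_commute)

text \<open>A Leibniz rule: after cancelling the denominator, each of the weights jb i, jb j, jb l
  falls on its own factor, and the other two factors are measured in l1. Since the H^1 norm enters
  only linearly, its growth rate under the scheme is governed by l1 norms.\<close>

lemma tri_h1_bound:
  assumes A: "finite A" "finite K" and m: "admissible C m" and C: "C \<ge> 0"
  shows "h1 K (tri A m a b d) \<le> C * (h1 A a * l1 A b * l1 A d + l1 A a * h1 A b * l1 A d + l1 A a * l1 A b * h1 A d)"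
proof -
  define x where "x i = norm (a i)" for i
  define y where "y i = norm (b i)" for i
  define z where "z i = norm (d i)" for i
  define X where "X i = jb i * norm (a i)" for i
  define Y where "Y i = jb i * norm (b i)" for i
  define Z where "Z i = jb i * norm (d i)" for i
  note defs = x_def y_def z_def X_def Y_def Z_def
  have pos: "0 \<le> x i" "0 \<le> y i" "0 \<le> z i" "0 \<le> X i" "0 \<le> Y i" "0 \<le> Z i" for i
    unfolding defs by auto
  define U where "U = s3 A (\<lambda>i j l. y i * z j * X l)"
  define V where "V = s3 A (\<lambda>i j l. x i * z j * Y l)"
  define W where "W = s3 A (\<lambda>i j l. x i * y j * Z l)"
  have "jb k * norm (tri A m a b d k) \<le> C * (U k + V k + W k)" for k
  proof -
    have "norm (tri A m a b d k) \<le> s3 A (\<lambda>i j l. (C * (jb i + jb j + jb l) / jb k) * (norm (a i) * norm (b j) * norm (d l))) k"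
      by (rule norm_tri_le) (use m in \<open>auto simp: admissible_def\<close>)
    also have "\<dots> = s3 A (\<lambda>i j l. (C / jb k) * (X i * y j * z l + x i * Y j * z l + x i * y j * Z l)) k"
      by (rule s3_cong) (simp add: defs field_simps)
    also have "\<dots> = (C / jb k) * (s3 A (\<lambda>i j l. X i * y j * z l) k + s3 A (\<lambda>i j l. x i * Y j * z l) k + W k)"
      unfolding s3_cmult s3_add W_def ..
    also have "s3 A (\<lambda>i j l. X i * y j * z l) k = U k"
      unfolding U_def by (subst s3_swap13, subst s3_swap12, simp add: mult_ac)
    also have "s3 A (\<lambda>i j l. x i * Y j * z l) k = V k"
      unfolding V_def by (subst s3_swap23, simp add: mult_ac)
    finally show ?thesis
      by (simp add: field_simps)
  qed
  then have "h1 K (tri A m a b d) \<le> L2_set (\<lambda>k. C * (U k + V k + W k)) K"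
    unfolding h1_def by (intro L2_set_mono) auto
  also have "\<dots> = C * L2_set (\<lambda>k. U k + V k + W k) K"
    by (rule L2_set_right_distrib[symmetric]) fact
  also have "\<dots> \<le> C * (L2_set U K + L2_set V K + L2_set W K)"
    using L2_set_triangle_ineq[of "\<lambda>k. U k + V k" W K] L2_set_triangle_ineq[of U V K] C
    by (intro mult_left_mono) auto
  also have "\<dots> \<le> C * ((\<Sum>i\<in>A. y i) * (\<Sum>i\<in>A. z i) * L2_set X A + (\<Sum>i\<in>A. x i) * (\<Sum>i\<in>A. z i) * L2_set Y A
      + (\<Sum>i\<in>A. x i) * (\<Sum>i\<in>A. y i) * L2_set Z A)"
    unfolding U_def V_def W_def by (intro mult_left_mono add_mono s3_L2_bound A pos C)
  finally show ?thesis
    unfolding defs h1_def l1_def by (simp add: mult_ac)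
qed

text \<open>The factor measured in L^2 must not receive the derivative. As jb i \<le> jb k + jb j +
  jb l, the weight is at most 1 + 2 (jb j + jb l) / jb k. The 1 is handled by Young's inequality; in
  the rest the derivative sits on b or d, and the spare \<open>1 / jb k\<close> turns a pointwise
  bound into an l2 bound. The constants are 9 + 36 = 45.\<close>

lemma tri_l2_bound1:
  assumes A: "finite A" "finite K" and m: "admissible C m" and C: "C \<ge> 0"
  shows "l2 K (tri A m a b d) \<le> 45 * C * (l2 A a * h1 A b * h1 A d)"
proof -
  define x where "x i = norm (a i)" for i
  define y where "y i = norm (b i)" for i
  define z where "z i = norm (d i)" for i
  define Y where "Y i = jb i * norm (b i)" for i
  define Z where "Z i = jb i * norm (d i)" for i
  note defs = x_def y_def z_def Y_def Z_def
  have pos: "0 \<le> x i" "0 \<le> y i" "0 \<le> z i" "0 \<le> Y i" "0 \<le> Z i" for i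
    unfolding defs by auto
  define U where "U = s3 A (\<lambda>i j l. y i * z j * x l)"
  define V where "V k = 2 * C * (s3 A (\<lambda>i j l. x i * Y j * z l) k + s3 A (\<lambda>i j l. x i * Z j * y l) k) / jb k" for k
  have le: "norm (tri A m a b d k) \<le> C * U k + V k" for k
  proof -
    have "norm (tri A m a b d k) \<le> s3 A (\<lambda>i j l. (C * (1 + 2 * (jb j + jb l) / jb k)) * (norm (a i) * norm (b j) * norm (d l))) k"
    proof (rule norm_tri_le)
      fix i j l assume k: "i + j + l = k"
      have "jb i \<le> jb k + (jb j + jb l)"
        using jb_tri(1)[of i j l] unfolding k[symmetric] by simp
      then have "(jb i + jb j + jb l) / jb k \<le> (jb k + 2 * (jb j + jb l)) / jb k"
        by (intro divide_right_mono) auto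
      also have "\<dots> = 1 + 2 * (jb j + jb l) / jb k" by (simp add: add_divide_distrib less_imp_neq[THEN not_sym])
      finally show "norm (m i j l) \<le> C * (1 + 2 * (jb j + jb l) / jb k)"
        using m C k unfolding admissible_def by (smt (verit) mult_left_mono)
    qed
    also have "\<dots> = s3 A (\<lambda>i j l. C * (x i * y j * z l) + (2 * C / jb k) * (x i * Y j * z l + x i * y j * Z l)) k"
      by (rule s3_cong) (simp add: defs field_simps)
    also have "\<dots> = C * s3 A (\<lambda>i j l. x i * y j * z l) k + (2 * C / jb k) * (s3 A (\<lambda>i j l. x i * Y j * z l) k + s3 A (\<lambda>i j l. x i * y j * Z l) k)"
      unfolding s3_add s3_cmult s3_add ..
    also have "s3 A (\<lambda>i j l. x i * y j * z l) k = U k"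
      unfolding U_def by (subst s3_swap13, subst s3_swap12, simp add: mult_ac)
    also have "s3 A (\<lambda>i j l. x i * y j * Z l) k = s3 A (\<lambda>i j l. x i * Z j * y l) k"
      by (subst s3_swap23, simp add: mult_ac)
    finally show ?thesis unfolding V_def by simp
  qed
  have "l2 K (tri A m a b d) \<le> L2_set (\<lambda>k. C * U k + V k) K"
    unfolding l2_def by (intro L2_set_mono le) simp
  also have "\<dots> \<le> L2_set (\<lambda>k. C * U k) K + L2_set V K" by (rule L2_set_triangle_ineq)
  also have "L2_set (\<lambda>k. C * U k) K = C * L2_set U K"
    by (rule L2_set_right_distrib[symmetric]) fact
  also have "L2_set U K \<le> (\<Sum>i\<in>A. y i) * (\<Sum>i\<in>A. z i) * L2_set x A"
    unfolding U_def by (intro s3_L2_bound A pos)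
  also have "\<dots> = l1 A b * l1 A d * l2 A a" by (simp add: l1_def l2_def defs cong: L2_set_cong)
  also have "\<dots> \<le> (3 * h1 A b) * (3 * h1 A d) * l2 A a"
    by (intro mult_right_mono mult_mono l1_le_h1 A) auto
  also have "L2_set V K \<le> 3 * (2 * C * (l2 A a * h1 A b * (3 * h1 A d) + l2 A a * h1 A d * (3 * h1 A b)))"
  proof (rule L2_set_inverse_jb[OF A(2)])
    fix k
    have 1: "s3 A (\<lambda>i j l. x i * Y j * z l) k \<le> l2 A a * h1 A b * (3 * h1 A d)"
      by (rule order_trans[OF s3_sup_bound[OF A(1)]])
        (use l1_le_h1[OF A(1), of d] in \<open>auto simp: pos defs l2_def[symmetric] h1_def[symmetric] l1_def[symmetric] intro!: mult_left_mono\<close>)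
    have 2: "s3 A (\<lambda>i j l. x i * Z j * y l) k \<le> l2 A a * h1 A d * (3 * h1 A b)"
      by (rule order_trans[OF s3_sup_bound[OF A(1)]])
        (use l1_le_h1[OF A(1), of b] in \<open>auto simp: pos defs l2_def[symmetric] h1_def[symmetric] l1_def[symmetric] intro!: mult_left_mono\<close>)
    show "0 \<le> V k" unfolding V_def
      by (intro divide_nonneg_nonneg mult_nonneg_nonneg add_nonneg_nonneg s3_nonneg) (auto simp: pos C)
    show "V k \<le> 2 * C * (l2 A a * h1 A b * (3 * h1 A d) + l2 A a * h1 A d * (3 * h1 A b)) / jb k"
      unfolding V_def using 1 2 C by (intro divide_right_mono mult_left_mono add_mono) auto
  qed (use C in auto)
  finally have "l2 K (tri A m a b d) \<le> C * ((3 * h1 A b) * (3 * h1 A d) * l2 A a) + 3 * (2 * C * (l2 A a * h1 A b * (3 * h1 A d) + l2 A a * h1 A d * (3 * h1 A b)))"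
    using C by (smt (verit) mult_left_mono)
  then show ?thesis by (simp add: algebra_simps)
qed

lemma tri_l2_bound2:
  assumes A: "finite A" "finite K" and m: "admissible C m" and C: "C \<ge> 0"
  shows "l2 K (tri A m a b d) \<le> 45 * C * (h1 A a * l2 A b * h1 A d)"
  using tri_l2_bound1[OF A admissible_swap12[OF m] C, of b a d] tri_swap12[of A m a b d]
  by (simp add: mult_ac cong: l2_cong)

lemma tri_l2_bound3:
  assumes A: "finite A" "finite K" and m: "admissible C m" and C: "C \<ge> 0"
  shows "l2 K (tri A m a b d) \<le> 45 * C * (h1 A a * h1 A b * l2 A d)"
  using tri_l2_bound1[OF A admissible_swap13[OF m] C, of d b a] tri_swap13[of A m a b d]
  by (simp add: mult_ac cong: l2_cong)

text \<open>To be used with s = jb k. The largest weight u is bounded by s + v + w in one of its two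
  occurrences, so no single factor ever has to carry two derivatives: what remains is one derivative
  times s, or two derivatives on different factors.\<close>

lemma sum_sq_weight:
  fixes u v w s :: real
  assumes "0 \<le> u" "0 \<le> v" "0 \<le> w" "0 \<le> s" "u \<le> s + v + w" "v \<le> s + u + w" "w \<le> s + u + v"
  shows "(u + v + w)\<^sup>2 \<le> 3 * s * (u + v + w) + 6 * (u * v + v * w + u * w)"
proof -
  have main: "(u + v + w)\<^sup>2 \<le> 3 * s * (u + v + w) + 6 * (u * v + v * w + u * w)"
    if p: "0 \<le> u" "0 \<le> v" "0 \<le> w" "0 \<le> s" "u \<le> s + v + w" "v \<le> u" "w \<le> u" for u v w :: real
  proof -
    have "(u + v + w)\<^sup>2 \<le> (3 * u) * (s + 2 * v + 2 * w)"
      unfolding power2_eq_square using p by (intro mult_mono) auto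
    also have "\<dots> = 3 * s * u + 6 * (u * v + u * w)" by (simp add: algebra_simps)
    also have "\<dots> \<le> 3 * s * (u + v + w) + 6 * (u * v + v * w + u * w)"
      using p by (intro add_mono mult_left_mono) auto
    finally show ?thesis .
  qed
  consider "v \<le> u \<and> w \<le> u" | "u \<le> v \<and> w \<le> v" | "u \<le> w \<and> v \<le> w" by linarith
  then show ?thesis
  proof cases
    case 1 then show ?thesis using main[of u v w] assms by auto
  next
    case 2 then show ?thesis using main[of v u w] assms by (auto simp: algebra_simps)
  next
    case 3 then show ?thesis using main[of w u v] assms by (auto simp: algebra_simps)
  qed
qed

text \<open>A symbol one order worse than an admissible one is still bounded from H^1 data to L^2.
  By \<open>sum_sq_weight\<close> it splits into one derivative without denominator and two
  derivatives on distinct factors over jb k, which is where \<open>L2_set_inverse_jb\<close>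
  applies. The constants are 81 + 162 = 243.\<close>

lemma tri_cut_bound:
  assumes A: "finite A" "finite K" and C: "C \<ge> 0"
    and m: "\<And>i j l. i \<in> A \<Longrightarrow> j \<in> A \<Longrightarrow> l \<in> A \<Longrightarrow> i + j + l \<in> K \<Longrightarrow> norm (m i j l) \<le> C * ((jb i + jb j + jb l)\<^sup>2 / jb (i + j + l))"
  shows "l2 K (tri A m a b d) \<le> 243 * C * (h1 A a * h1 A b * h1 A d)"
proof -
  define x where "x i = norm (a i)" for i
  define y where "y i = norm (b i)" for i
  define z where "z i = norm (d i)" for i
  define X where "X i = jb i * norm (a i)" for i
  define Y where "Y i = jb i * norm (b i)" for i
  define Z where "Z i = jb i * norm (d i)" for i
  note defs = x_def y_def z_def X_def Y_def Z_def
  have pos: "0 \<le> x i" "0 \<le> y i" "0 \<le> z i" "0 \<le> X i" "0 \<le> Y i" "0 \<le> Z i" for i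
    unfolding defs by auto
  have sm: "(\<Sum>i\<in>A. x i) \<le> 3 * h1 A a" "(\<Sum>i\<in>A. y i) \<le> 3 * h1 A b" "(\<Sum>i\<in>A. z i) \<le> 3 * h1 A d"
    using l1_le_h1[OF A(1)] unfolding l1_def defs by auto
  have L: "L2_set X A = h1 A a" "L2_set Y A = h1 A b" "L2_set Z A = h1 A d" unfolding defs h1_def by auto
  define P where "P = h1 A a * h1 A b * h1 A d"
  have P: "P \<ge> 0" unfolding P_def by simp
  define U where "U = s3 A (\<lambda>i j l. y i * z j * X l)"
  define V where "V = s3 A (\<lambda>i j l. x i * z j * Y l)"
  define W where "W = s3 A (\<lambda>i j l. x i * y j * Z l)"
  define R where "R k = 6 * C * (s3 A (\<lambda>i j l. X i * Y j * z l) k + s3 A (\<lambda>i j l. Y i * Z j * x l) k + s3 A (\<lambda>i j l. X i * Z j * y l) k) / jb k" for k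
  have le: "norm (tri A m a b d k) \<le> 3 * C * (U k + V k + W k) + R k" if k: "k \<in> K" for k
  proof -
    have "norm (tri A m a b d k) \<le> s3 A (\<lambda>i j l. (C * (3 * (jb i + jb j + jb l) + 6 * (jb i * jb j + jb j * jb l + jb i * jb l) / jb k)) * (norm (a i) * norm (b j) * norm (d l))) k"
    proof (rule norm_tri_le)
      fix i j l assume A': "i \<in> A" "j \<in> A" "l \<in> A" and k': "i + j + l = k"
      have t: "jb i \<le> jb k + jb j + jb l" "jb j \<le> jb k + jb i + jb l" "jb l \<le> jb k + jb i + jb j"
        using jb_tri[of i j l] jb_tri[of j i l] jb_tri[of l i j] unfolding k'[symmetric] by simp_all
      have "norm (m i j l) \<le> C * ((jb i + jb j + jb l)\<^sup>2 / jb k)" using m[OF A'] k unfolding k' by simp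
      also have "\<dots> \<le> C * ((3 * jb k * (jb i + jb j + jb l) + 6 * (jb i * jb j + jb j * jb l + jb i * jb l)) / jb k)"
        by (intro mult_left_mono divide_right_mono sum_sq_weight t C) auto
      also have "\<dots> = C * (3 * (jb i + jb j + jb l) + 6 * (jb i * jb j + jb j * jb l + jb i * jb l) / jb k)"
        using less_imp_neq[OF jb_pos[of k]] by (subst add_divide_distrib) simp
      finally show "norm (m i j l) \<le> C * (3 * (jb i + jb j + jb l) + 6 * (jb i * jb j + jb j * jb l + jb i * jb l) / jb k)" .
    qed
    also have "\<dots> = s3 A (\<lambda>i j l. (3 * C) * (X i * y j * z l + x i * Y j * z l + x i * y j * Z l)
        + (6 * C / jb k) * (X i * Y j * z l + x i * Y j * Z l + X i * y j * Z l)) k"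
      by (rule s3_cong) (use jb_pos[of k] in \<open>simp add: defs field_simps\<close>)
    also have "\<dots> = 3 * C * (s3 A (\<lambda>i j l. X i * y j * z l) k + s3 A (\<lambda>i j l. x i * Y j * z l) k + W k)
        + (6 * C / jb k) * (s3 A (\<lambda>i j l. X i * Y j * z l) k + s3 A (\<lambda>i j l. x i * Y j * Z l) k + s3 A (\<lambda>i j l. X i * y j * Z l) k)"
      unfolding s3_add s3_cmult s3_add W_def ..
    also have "s3 A (\<lambda>i j l. X i * y j * z l) k = U k"
      unfolding U_def by (subst s3_swap13, subst s3_swap12, simp add: mult_ac)
    also have "s3 A (\<lambda>i j l. x i * Y j * z l) k = V k"
      unfolding V_def by (subst s3_swap23, simp add: mult_ac)
    also have "s3 A (\<lambda>i j l. x i * Y j * Z l) k = s3 A (\<lambda>i j l. Y i * Z j * x l) k"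
      by (subst s3_swap12, subst s3_swap23, simp add: mult_ac)
    also have "s3 A (\<lambda>i j l. X i * y j * Z l) k = s3 A (\<lambda>i j l. X i * Z j * y l) k"
      by (subst s3_swap23, simp add: mult_ac)
    finally show ?thesis unfolding R_def by simp
  qed
  have "l2 K (tri A m a b d) \<le> L2_set (\<lambda>k. 3 * C * (U k + V k + W k) + R k) K"
    unfolding l2_def by (intro L2_set_mono le) simp_all
  also have "\<dots> \<le> L2_set (\<lambda>k. 3 * C * (U k + V k + W k)) K + L2_set R K" by (rule L2_set_triangle_ineq)
  also have "L2_set (\<lambda>k. 3 * C * (U k + V k + W k)) K = 3 * C * L2_set (\<lambda>k. U k + V k + W k) K"
    by (rule L2_set_right_distrib[symmetric]) (use C in simp)
  also have "\<dots> \<le> 3 * C * (9 * P + 9 * P + 9 * P)"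
  proof (rule mult_left_mono)
    have "L2_set U K \<le> 9 * P"
    proof -
      have "L2_set U K \<le> (\<Sum>i\<in>A. y i) * (\<Sum>i\<in>A. z i) * L2_set X A" unfolding U_def by (intro s3_L2_bound A pos)
      also have "\<dots> \<le> (3 * h1 A b) * (3 * h1 A d) * h1 A a" unfolding L by (intro mult_right_mono mult_mono sm sum_nonneg pos) auto
      finally show ?thesis unfolding P_def by (simp add: mult_ac)
    qed
    moreover have "L2_set V K \<le> 9 * P"
    proof -
      have "L2_set V K \<le> (\<Sum>i\<in>A. x i) * (\<Sum>i\<in>A. z i) * L2_set Y A" unfolding V_def by (intro s3_L2_bound A pos)
      also have "\<dots> \<le> (3 * h1 A a) * (3 * h1 A d) * h1 A b" unfolding L by (intro mult_right_mono mult_mono sm sum_nonneg pos) auto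
      finally show ?thesis unfolding P_def by (simp add: mult_ac)
    qed
    moreover have "L2_set W K \<le> 9 * P"
    proof -
      have "L2_set W K \<le> (\<Sum>i\<in>A. x i) * (\<Sum>i\<in>A. y i) * L2_set Z A" unfolding W_def by (intro s3_L2_bound A pos)
      also have "\<dots> \<le> (3 * h1 A a) * (3 * h1 A b) * h1 A d" unfolding L by (intro mult_right_mono mult_mono sm sum_nonneg pos) auto
      finally show ?thesis unfolding P_def by (simp add: mult_ac)
    qed
    ultimately show "L2_set (\<lambda>k. U k + V k + W k) K \<le> 9 * P + 9 * P + 9 * P"
      using L2_set_triangle_ineq[of "\<lambda>k. U k + V k" W K] L2_set_triangle_ineq[of U V K] by linarith
  qed (use C in simp)
  also have "L2_set R K \<le> 3 * (6 * C * (3 * P + 3 * P + 3 * P))"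
  proof (rule L2_set_inverse_jb[OF A(2)])
    fix k
    have 1: "s3 A (\<lambda>i j l. X i * Y j * z l) k \<le> 3 * P"
    proof -
      have "s3 A (\<lambda>i j l. X i * Y j * z l) k \<le> h1 A a * h1 A b * (\<Sum>i\<in>A. z i)" unfolding L[symmetric] by (intro s3_sup_bound A pos)
      also have "\<dots> \<le> h1 A a * h1 A b * (3 * h1 A d)" by (intro mult_left_mono sm) auto
      finally show ?thesis unfolding P_def by simp
    qed
    have 2: "s3 A (\<lambda>i j l. Y i * Z j * x l) k \<le> 3 * P"
    proof -
      have "s3 A (\<lambda>i j l. Y i * Z j * x l) k \<le> h1 A b * h1 A d * (\<Sum>i\<in>A. x i)" unfolding L[symmetric] by (intro s3_sup_bound A pos)
      also have "\<dots> \<le> h1 A b * h1 A d * (3 * h1 A a)" by (intro mult_left_mono sm) auto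
      finally show ?thesis unfolding P_def by (simp add: mult_ac)
    qed
    have 3: "s3 A (\<lambda>i j l. X i * Z j * y l) k \<le> 3 * P"
    proof -
      have "s3 A (\<lambda>i j l. X i * Z j * y l) k \<le> h1 A a * h1 A d * (\<Sum>i\<in>A. y i)" unfolding L[symmetric] by (intro s3_sup_bound A pos)
      also have "\<dots> \<le> h1 A a * h1 A d * (3 * h1 A b)" by (intro mult_left_mono sm) auto
      finally show ?thesis unfolding P_def by (simp add: mult_ac)
    qed
    show "0 \<le> R k" unfolding R_def
      by (intro divide_nonneg_nonneg mult_nonneg_nonneg add_nonneg_nonneg s3_nonneg) (auto simp: pos C)
    show "R k \<le> 6 * C * (3 * P + 3 * P + 3 * P) / jb k"
      unfolding R_def using 1 2 3 C by (intro divide_right_mono mult_left_mono add_mono) auto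
  qed (use C P in auto)
  finally show ?thesis unfolding P_def by (simp add: algebra_simps)
qed

text \<open>The coefficients of the conjugate function; with the reflection built in, trilinear sums
  run over \<open>i + j + l = k\<close> without signs.\<close>

definition conj_coeffs :: "(int \<Rightarrow> complex) \<Rightarrow> int \<Rightarrow> complex" where "conj_coeffs a k = cnj (a (- k))"

lemma L2_set_uminus_freqs: "L2_set (\<lambda>k. f (- k)) (freqs N) = L2_set f (freqs N)"
proof -
  have "(\<Sum>k\<in>freqs N. (f (- k))\<^sup>2) = (\<Sum>k\<in>freqs N. (f k)\<^sup>2)"
    by (rule sum.reindex_bij_witness[of _ uminus uminus]) auto
  then show ?thesis unfolding L2_set_def by simp
qed

lemma l2_conj_coeffs [simp]: "l2 (freqs N) (conj_coeffs a) = l2 (freqs N) a"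
  unfolding l2_def conj_coeffs_def using L2_set_uminus_freqs[of "\<lambda>k. norm (a k)" N] by simp
lemma h1_conj_coeffs [simp]: "h1 (freqs N) (conj_coeffs a) = h1 (freqs N) a"
  unfolding h1_def conj_coeffs_def using L2_set_uminus_freqs[of "\<lambda>k. jb k * norm (a k)" N] by simp
lemma l1_conj_coeffs [simp]: "l1 (freqs N) (conj_coeffs a) = l1 (freqs N) a"
  unfolding l1_def conj_coeffs_def by (rule sum.reindex_bij_witness[of _ uminus uminus]) auto
lemma conj_coeffs_diff: "conj_coeffs (\<lambda>k. a k - b k) = (\<lambda>k. conj_coeffs a k - conj_coeffs b k)"
  by (auto simp: conj_coeffs_def)

text \<open>Telescoping places the difference in each slot in turn. All three slots admit an L^2
  argument at the cost 45 C, so no H^1 norm of the difference appears.\<close>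

lemma cubic_l2_diff:
  assumes m: "admissible C m" and C: "C \<ge> 0" and a: "h1 (freqs N) a \<le> B" and b: "h1 (freqs N) b \<le> B" and K: "finite K"
  shows "l2 K (\<lambda>k. tri (freqs N) m a (conj_coeffs a) a k - tri (freqs N) m b (conj_coeffs b) b k) \<le> 135 * C * B\<^sup>2 * l2 (freqs N) (\<lambda>k. a k - b k)"
proof -
  let ?A = "freqs N" and ?e = "\<lambda>k. a k - b k"
  have B: "B \<ge> 0" using a h1_nonneg order_trans by blast
  have BB: "h1 ?A u * h1 ?A v \<le> B\<^sup>2" if "u = a \<or> u = b \<or> u = conj_coeffs a \<or> u = conj_coeffs b" "v = a \<or> v = b \<or> v = conj_coeffs a \<or> v = conj_coeffs b" for u v
    unfolding power2_eq_square using that a b B by (intro mult_mono) auto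
  have 1: "l2 K (tri ?A m ?e (conj_coeffs a) a) \<le> 45 * C * B\<^sup>2 * l2 ?A ?e"
  proof -
    have "l2 K (tri ?A m ?e (conj_coeffs a) a) \<le> 45 * C * (l2 ?A ?e * (h1 ?A (conj_coeffs a) * h1 ?A a))"
      using tri_l2_bound1[OF _ K m C, of ?A ?e "conj_coeffs a" a] by (simp add: mult.assoc)
    also have "\<dots> \<le> 45 * C * (l2 ?A ?e * B\<^sup>2)" using C by (intro mult_left_mono BB) auto
    finally show ?thesis by (simp add: mult_ac)
  qed
  have 2: "l2 K (tri ?A m b (conj_coeffs ?e) a) \<le> 45 * C * B\<^sup>2 * l2 ?A ?e"
  proof -
    have "l2 K (tri ?A m b (conj_coeffs ?e) a) \<le> 45 * C * (l2 ?A ?e * (h1 ?A b * h1 ?A a))"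
      using tri_l2_bound2[OF _ K m C, of ?A b "conj_coeffs ?e" a] by (simp add: mult_ac)
    also have "\<dots> \<le> 45 * C * (l2 ?A ?e * B\<^sup>2)" using C by (intro mult_left_mono BB) auto
    finally show ?thesis by (simp add: mult_ac)
  qed
  have 3: "l2 K (tri ?A m b (conj_coeffs b) ?e) \<le> 45 * C * B\<^sup>2 * l2 ?A ?e"
  proof -
    have "l2 K (tri ?A m b (conj_coeffs b) ?e) \<le> 45 * C * (l2 ?A ?e * (h1 ?A b * h1 ?A (conj_coeffs b)))"
      using tri_l2_bound3[OF _ K m C, of ?A b "conj_coeffs b" ?e] by (simp add: mult_ac)
    also have "\<dots> \<le> 45 * C * (l2 ?A ?e * B\<^sup>2)" using C by (intro mult_left_mono BB) auto
    finally show ?thesis by (simp add: mult_ac)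
  qed
  have "l2 K (\<lambda>k. tri ?A m a (conj_coeffs a) a k - tri ?A m b (conj_coeffs b) b k) \<le>
     l2 K (tri ?A m ?e (conj_coeffs a) a) + l2 K (tri ?A m b (conj_coeffs ?e) a) + l2 K (tri ?A m b (conj_coeffs b) ?e)"
    unfolding tri_telescope[of _ _ a "conj_coeffs a" a _ b "conj_coeffs b" b] conj_coeffs_diff[symmetric]
    using l2_triangle[of K "\<lambda>k. tri ?A m ?e (conj_coeffs a) a k + tri ?A m b (conj_coeffs ?e) a k" "tri ?A m b (conj_coeffs b) ?e"]
      l2_triangle[of K "tri ?A m ?e (conj_coeffs a) a" "tri ?A m b (conj_coeffs ?e) a"] by simp
  then show ?thesis using 1 2 3 by (simp add: mult_ac)
qed

lemma cubic_h1_bound: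
  assumes m: "admissible C m" and C: "C \<ge> 0" and K: "finite K"
  shows "h1 K (tri (freqs N) m a (conj_coeffs a) a) \<le> 3 * C * (l1 (freqs N) a)\<^sup>2 * h1 (freqs N) a"
  using tri_h1_bound[OF _ K m C, of "freqs N" a "conj_coeffs a" a] by (simp add: power2_eq_square algebra_simps)

lemma cubic_h1_diff:
  assumes m: "admissible C m" and C: "C \<ge> 0" and a: "h1 (freqs N) a \<le> B" and b: "h1 (freqs N) b \<le> B" and K: "finite K"
  shows "h1 K (\<lambda>k. tri (freqs N) m a (conj_coeffs a) a k - tri (freqs N) m b (conj_coeffs b) b k) \<le> 81 * C * B\<^sup>2 * h1 (freqs N) (\<lambda>k. a k - b k)"
proof -
  let ?A = "freqs N" and ?e = "\<lambda>k. a k - b k"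
  have g: "h1 K (tri ?A m u v w) \<le> 27 * C * (h1 ?A u * h1 ?A v * h1 ?A w)" for u v w
  proof -
    have "h1 K (tri ?A m u v w) \<le> C * (h1 ?A u * l1 ?A v * l1 ?A w + l1 ?A u * h1 ?A v * l1 ?A w + l1 ?A u * l1 ?A v * h1 ?A w)"
      by (rule tri_h1_bound[OF _ K m C]) simp
    also have "\<dots> \<le> C * (h1 ?A u * (3 * h1 ?A v) * (3 * h1 ?A w) + (3 * h1 ?A u) * h1 ?A v * (3 * h1 ?A w) + (3 * h1 ?A u) * (3 * h1 ?A v) * h1 ?A w)"
      by (intro mult_left_mono C add_mono mult_mono l1_le_h1) auto
    finally show ?thesis by (simp add: algebra_simps)
  qed
  have B: "B \<ge> 0" using a h1_nonneg order_trans by blast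
  have BB: "h1 ?A u * h1 ?A v \<le> B\<^sup>2" if "u = a \<or> u = b \<or> u = conj_coeffs a \<or> u = conj_coeffs b" "v = a \<or> v = b \<or> v = conj_coeffs a \<or> v = conj_coeffs b" for u v
    unfolding power2_eq_square using that a b B by (intro mult_mono) auto
  have le: "27 * C * (h1 ?A ?e * (h1 ?A u * h1 ?A v)) \<le> 27 * C * B\<^sup>2 * h1 ?A ?e"
    if "u = a \<or> u = b \<or> u = conj_coeffs a \<or> u = conj_coeffs b" "v = a \<or> v = b \<or> v = conj_coeffs a \<or> v = conj_coeffs b" for u v
  proof -
    have "27 * C * (h1 ?A ?e * (h1 ?A u * h1 ?A v)) \<le> 27 * C * (h1 ?A ?e * B\<^sup>2)"
      using C by (intro mult_left_mono BB that) auto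
    then show ?thesis by (simp add: mult_ac)
  qed
  have 1: "h1 K (tri ?A m ?e (conj_coeffs a) a) \<le> 27 * C * B\<^sup>2 * h1 ?A ?e"
    using g[of ?e "conj_coeffs a" a] le[of "conj_coeffs a" a] by (simp add: mult_ac)
  have 2: "h1 K (tri ?A m b (conj_coeffs ?e) a) \<le> 27 * C * B\<^sup>2 * h1 ?A ?e"
    using g[of b "conj_coeffs ?e" a] le[of b a] by (simp add: mult_ac)
  have 3: "h1 K (tri ?A m b (conj_coeffs b) ?e) \<le> 27 * C * B\<^sup>2 * h1 ?A ?e"
    using g[of b "conj_coeffs b" ?e] le[of b "conj_coeffs b"] by (simp add: mult_ac)
  have "h1 K (\<lambda>k. tri ?A m a (conj_coeffs a) a k - tri ?A m b (conj_coeffs b) b k) \<le>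
     h1 K (tri ?A m ?e (conj_coeffs a) a) + h1 K (tri ?A m b (conj_coeffs ?e) a) + h1 K (tri ?A m b (conj_coeffs b) ?e)"
    unfolding tri_telescope[of _ _ a "conj_coeffs a" a _ b "conj_coeffs b" b] conj_coeffs_diff[symmetric]
    using h1_triangle[of K "\<lambda>k. tri ?A m ?e (conj_coeffs a) a k + tri ?A m b (conj_coeffs ?e) a k" "tri ?A m b (conj_coeffs b) ?e"]
      h1_triangle[of K "tri ?A m ?e (conj_coeffs a) a" "tri ?A m b (conj_coeffs ?e) a"] by simp
  then show ?thesis using 1 2 3 by (simp add: mult_ac)
qed

section \<open>The logarithmic estimate\<close>

lemma harmonic_le_ln: "J \<ge> 1 \<Longrightarrow> (\<Sum>k\<in>{1..J}. 1 / real k) \<le> 1 + ln (real J)"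
proof (induction J rule: dec_induct)
  case base
  then show ?case by simp
next
  case (step n)
  have "ln (real n / real (Suc n)) \<le> real n / real (Suc n) - 1"
    using step by (intro ln_le_minus_one) auto
  moreover have "ln (real n / real (Suc n)) = ln (real n) - ln (real (Suc n))"
    using step by (simp add: ln_div)
  moreover have "real n / real (Suc n) - 1 = - (1 / real (Suc n))" by (simp add: field_simps)
  ultimately show ?case using step by simp
qed

lemma inverse_square_tail:
  assumes "q \<ge> 1" shows "(\<Sum>k\<in>{1..N}. if q < k then 1 / (real k)\<^sup>2 else 0) \<le> 1 / real q"
proof -
  have "(\<Sum>k\<in>{1..N}. if q < k then 1 / (real k)\<^sup>2 else 0) \<le> (if N \<le> q then 0 else 1 / real q - 1 / real N)"
  proof (induction N)
    case (Suc N)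
    have 1: "1 / (real (Suc N))\<^sup>2 \<le> 1 / real N - 1 / real (Suc N)" if "N \<ge> 1"
    proof -
      have "1 / (real (Suc N))\<^sup>2 \<le> 1 / (real N * real (Suc N))"
        using that by (intro divide_left_mono) (auto simp: power2_eq_square)
      also have "\<dots> = 1 / real N - 1 / real (Suc N)" using that by (simp add: field_simps)
      finally show ?thesis .
    qed
    consider "Suc N \<le> q" | "N = q" | "q < N" by linarith
    then show ?case
    proof cases
      case 1
      then show ?thesis using Suc by auto
    next
      case 2
      then show ?thesis using Suc 1 assms by auto
    next
      case 3
      then show ?thesis using Suc 1 assms by auto
    qed
  qed simp
  also have "\<dots> \<le> 1 / real q" by simp
  finally show ?thesis .
qed

lemma inverse_square_sum: "(\<Sum>k\<in>{1..N}. 1 / (real k)\<^sup>2) \<le> 2"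
proof -
  have "(\<Sum>k\<in>{1..N}. 1 / (real k)\<^sup>2) \<le> (\<Sum>k\<in>{1..N}. (if k = 1 then 1 else 0) + (if 1 < k then 1 / (real k)\<^sup>2 else 0))"
    by (intro sum_mono) auto
  also have "\<dots> \<le> 1 + 1 / real 1"
    unfolding sum.distrib by (intro add_mono inverse_square_tail) auto
  finally show ?thesis by simp
qed

text \<open>In the defect symbol, \<open>l \<le> i\<close> gives \<open>j \<le> k + 2 i\<close>; the part \<open>2 i\<close> leads to \<open>ker1\<close>, the part \<open>k\<close> to \<open>ker2\<close>.
  The logarithm comes from \<open>ker1\<close> alone.\<close>

definition ker1 :: "real \<Rightarrow> real \<Rightarrow> real \<Rightarrow> real" where
  "ker1 \<tau> k l = min (min (1 / l\<^sup>2) \<tau> / k) (2 * \<tau> / l)"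
definition ker2 :: "real \<Rightarrow> real \<Rightarrow> real \<Rightarrow> real" where
  "ker2 \<tau> k l = min (1 / l\<^sup>2) \<tau> * (min 1 (\<tau> * k\<^sup>2) / k)"

lemma min_1_add: "(x::real) \<le> a + b \<Longrightarrow> 0 \<le> a \<Longrightarrow> 0 \<le> b \<Longrightarrow> min 1 x \<le> min 1 a + min 1 b"
  by (auto simp: min_def)

text \<open>The quotient q = min(1, \<tau> i l) / (i l) is at most 1 / (i l) and at most \<tau>,
  hence at most min(1 / l^2, \<tau>) because l \<le> i. The other minimum is subadditive in j \<le>
  k + 2 i. For the part with 2 i there are two competing bounds: dropping it altogether, or keeping
  2 \<tau> k i, whose factors k and i cancel the denominator.\<close>

lemma ker_pointwise:
  assumes "0 < \<tau>" "1 \<le> k" "1 \<le> l" "l \<le> i" "0 \<le> j" "j \<le> k + i + l"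
  shows "min 1 (\<tau> * (i * l)) * min 1 (\<tau> * (k * j)) / (k * (i * l)) \<le> ker1 \<tau> k l + ker2 \<tau> k l"
proof -
  define q where "q = min 1 (\<tau> * (i * l)) / (i * l)"
  have il: "i * l > 0" using assms by simp
  have q0: "q \<ge> 0" unfolding q_def using assms il by simp
  have q1: "q \<le> 1 / (i * l)" unfolding q_def using il by (intro divide_right_mono) auto
  have q2: "q \<le> \<tau>" unfolding q_def using il by (simp add: divide_le_eq)
  have "1 / (i * l) \<le> 1 / l\<^sup>2" using assms by (intro divide_left_mono) (auto simp: power2_eq_square)
  then have q3: "q \<le> min (1 / l\<^sup>2) \<tau>" using q1 q2 by simp
  have "\<tau> * (k * j) \<le> \<tau> * (k * (k + 2 * i))" using assms by (intro mult_left_mono) auto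
  also have "\<dots> = \<tau> * k\<^sup>2 + 2 * \<tau> * k * i" by (simp add: power2_eq_square algebra_simps)
  finally have "min 1 (\<tau> * (k * j)) \<le> min 1 (\<tau> * k\<^sup>2) + min 1 (2 * \<tau> * k * i)"
    using assms by (intro min_1_add) auto
  then have "q * min 1 (\<tau> * (k * j)) / k \<le> q * (min 1 (\<tau> * k\<^sup>2) + min 1 (2 * \<tau> * k * i)) / k"
    using assms q0 by (intro divide_right_mono mult_left_mono) auto
  also have "\<dots> = q * (min 1 (\<tau> * k\<^sup>2) / k) + q * min 1 (2 * \<tau> * k * i) / k" by (simp add: ring_distribs add_divide_distrib)
  also have "q * (min 1 (\<tau> * k\<^sup>2) / k) \<le> ker2 \<tau> k l"
    unfolding ker2_def using assms by (intro mult_right_mono q3) auto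
  also have "q * min 1 (2 * \<tau> * k * i) / k \<le> ker1 \<tau> k l"
    unfolding ker1_def
  proof (rule min.boundedI)
    have "q * min 1 (2 * \<tau> * k * i) \<le> min (1 / l\<^sup>2) \<tau> * 1"
      using assms q0 q3 by (intro mult_mono) auto
    then show "q * min 1 (2 * \<tau> * k * i) / k \<le> min (1 / l\<^sup>2) \<tau> / k"
      using assms by (intro divide_right_mono) auto
    have "q * min 1 (2 * \<tau> * k * i) / k \<le> q * (2 * \<tau> * k * i) / k"
      using assms q0 by (intro divide_right_mono mult_left_mono) auto
    also have "\<dots> = q * (2 * \<tau> * i)" using assms by simp
    also have "\<dots> \<le> 1 / (i * l) * (2 * \<tau> * i)" using assms q1 by (intro mult_right_mono) auto
    also have "\<dots> = 2 * \<tau> / l" using assms by (simp add: field_simps)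
    finally show "q * min 1 (2 * \<tau> * k * i) / k \<le> 2 * \<tau> / l" .
  qed
  finally show ?thesis unfolding q_def by (simp add: mult_ac)
qed

lemma nat_scale:
  assumes "0 < x" "x \<le> 1" shows "\<exists>J::nat. J \<ge> 1 \<and> 1 / x \<le> real J \<and> real J \<le> 2 / x"
proof (intro exI conjI)
  have 1: "1 \<le> 1 / x" using assms by simp
  show "1 / x \<le> real (nat \<lceil>1 / x\<rceil>)" by linarith
  then show "1 \<le> nat \<lceil>1 / x\<rceil>" using 1 by linarith
  have "2 / x = 1 / x + 1 / x" by simp
  then show "real (nat \<lceil>1 / x\<rceil>) \<le> 2 / x" using 1 by linarith
qed

text \<open>The origin of the restriction \<tau> \<le> 1 / 3, as e \<le> 3: terms of pure order
  \<tau> can then be absorbed into those carrying the logarithm.\<close>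

lemma ln_inverse_ge_1: fixes \<tau> :: real assumes "0 < \<tau>" "\<tau> \<le> 1 / 3" shows "1 \<le> ln (1 / \<tau>)"
proof -
  have "exp 1 \<le> (3::real)" by (rule exp_le)
  also have "3 \<le> 1 / \<tau>" using assms by (simp add: field_simps)
  finally show ?thesis using assms by (subst ln_ge_iff) auto
qed

text \<open>The cut is at J of order 1 / \<tau>. Inside the square k, l \<le> J the kernel is at
  most 2 \<tau> / max(k, l), and the squares add up to \<tau>^2 times a harmonic sum; this is the
  logarithm. Outside it, the square is at most \<tau> / (k^2 l^2) with one index beyond J, so a tail
  of order \<tau> is gained and the contribution is 4 \<tau>^2.\<close>

lemma ker1_sum:
  assumes t: "0 < \<tau>" "\<tau> \<le> 1 / 3"
  shows "(\<Sum>k\<in>{1..N}. \<Sum>l\<in>{1..N}. (ker1 \<tau> (real k) (real l))\<^sup>2) \<le> 28 * \<tau>\<^sup>2 * ln (1 / \<tau>)"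
proof -
  obtain J :: nat where J: "J \<ge> 1" "1 / \<tau> \<le> real J" "real J \<le> 2 / \<tau>" using nat_scale[of \<tau>] t by auto
  \<comment> \<open>Here k is the larger index: summing 1 / k^2 over the k admissible values of l
    leaves 1 / k.\<close>
  define f where "f k l = (if l \<le> k \<and> k \<le> J then 1 / (real k)\<^sup>2 else 0)" for k l :: nat
  define g where "g k = (if J < k then 1 / (real k)\<^sup>2 else 0)" for k :: nat
  have pt: "(ker1 \<tau> (real k) (real l))\<^sup>2 \<le> 4 * \<tau>\<^sup>2 * (f k l + f l k) + \<tau> * (g k * (1 / (real l)\<^sup>2) + 1 / (real k)\<^sup>2 * g l)"
    if kl: "k \<in> {1..N}" "l \<in> {1..N}" for k l
  proof -
    have p: "real k \<ge> 1" "real l \<ge> 1" using kl by auto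
    have k0: "0 \<le> ker1 \<tau> (real k) (real l)" unfolding ker1_def using t p by auto
    have f0: "f k l \<ge> 0" "f l k \<ge> 0" "g k \<ge> 0" "g l \<ge> 0" unfolding f_def g_def by auto
    show ?thesis
    proof (cases "k \<le> J \<and> l \<le> J")
      case True
      have "(ker1 \<tau> (real k) (real l))\<^sup>2 \<le> (2 * \<tau> / real (max k l))\<^sup>2"
      proof (rule power_mono[OF _ k0])
        have "ker1 \<tau> (real k) (real l) \<le> 2 * \<tau> / real l" unfolding ker1_def by simp
        moreover have "ker1 \<tau> (real k) (real l) \<le> min (1 / (real l)\<^sup>2) \<tau> / real k" unfolding ker1_def by simp
        moreover have "min (1 / (real l)\<^sup>2) \<tau> / real k \<le> 2 * \<tau> / real k" using t p by (intro divide_right_mono) auto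
        ultimately show "ker1 \<tau> (real k) (real l) \<le> 2 * \<tau> / real (max k l)" by (auto simp: max_def)
      qed
      also have "\<dots> = 4 * \<tau>\<^sup>2 * (1 / (real (max k l))\<^sup>2)" by (simp add: power_divide)
      also have "\<dots> \<le> 4 * \<tau>\<^sup>2 * (f k l + f l k)"
        using True f0 by (intro mult_left_mono) (auto simp: f_def max_def)
      finally show ?thesis using f0 t by (smt (verit) mult_nonneg_nonneg zero_le_divide_1_iff zero_le_power2)
    next
      case False
      have "(ker1 \<tau> (real k) (real l))\<^sup>2 \<le> (min (1 / (real l)\<^sup>2) \<tau> / real k)\<^sup>2"
        using k0 by (intro power_mono) (auto simp: ker1_def)
      also have "\<dots> = min (1 / (real l)\<^sup>2) \<tau> * min (1 / (real l)\<^sup>2) \<tau> / (real k)\<^sup>2" by (simp add: power_divide power2_eq_square)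
      also have "\<dots> \<le> (1 / (real l)\<^sup>2 * \<tau>) / (real k)\<^sup>2"
        using t by (intro divide_right_mono mult_mono) auto
      also have "\<dots> = \<tau> * (1 / (real k)\<^sup>2 * (1 / (real l)\<^sup>2))" by simp
      also have "\<dots> \<le> \<tau> * (g k * (1 / (real l)\<^sup>2) + 1 / (real k)\<^sup>2 * g l)"
      proof (rule mult_left_mono)
        have "0 \<le> 1 / (real k)\<^sup>2 * (1 / (real l)\<^sup>2)" by simp
        then show "1 / (real k)\<^sup>2 * (1 / (real l)\<^sup>2) \<le> g k * (1 / (real l)\<^sup>2) + 1 / (real k)\<^sup>2 * g l"
          using False f0 unfolding g_def by (auto simp del: times_divide_eq_left times_divide_eq_right mult_1_right mult_1_left)
      qed (use t in simp)
      finally show ?thesis using f0 by (smt (verit) mult_nonneg_nonneg zero_le_power2)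
    qed
  qed
  have H: "(\<Sum>k\<in>{1..N}. \<Sum>l\<in>{1..N}. f k l) \<le> 3 * ln (1 / \<tau>)"
  proof -
    have "(\<Sum>l\<in>{1..N}. f k l) \<le> (if k \<le> J then 1 / real k else 0)" if "k \<in> {1..N}" for k
    proof -
      have "(\<Sum>l\<in>{1..N}. f k l) = (\<Sum>l\<in>{1..k}. f k l)"
        using that by (intro sum.mono_neutral_right) (auto simp: f_def)
      also have "\<dots> = (\<Sum>l\<in>{1..k}. if k \<le> J then 1 / (real k)\<^sup>2 else 0)"
        by (intro sum.cong) (auto simp: f_def)
      also have "\<dots> = (if k \<le> J then 1 / real k else 0)"
        by (simp add: power2_eq_square)
      finally show ?thesis by simp
    qed
    then have "(\<Sum>k\<in>{1..N}. \<Sum>l\<in>{1..N}. f k l) \<le> (\<Sum>k\<in>{1..N}. if k \<le> J then 1 / real k else 0)"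
      by (rule sum_mono)
    also have "\<dots> = (\<Sum>k\<in>{k\<in>{1..N}. k \<le> J}. 1 / real k)"
      by (rule sum.mono_neutral_cong_right) auto
    also have "\<dots> \<le> (\<Sum>k\<in>{1..J}. 1 / real k)"
      by (rule sum_mono2) auto
    also have "\<dots> \<le> 1 + ln (real J)" by (rule harmonic_le_ln[OF J(1)])
    also have "ln (real J) \<le> ln (2 * (1 / \<tau>))" using J t by (subst ln_le_cancel_iff) auto
    also have "\<dots> = ln 2 + ln (1 / \<tau>)" using t by (subst ln_mult) auto
    also have "ln 2 \<le> (1::real)" using ln_le_minus_one[of "2::real"] by simp
    finally show ?thesis using ln_inverse_ge_1[OF t] by simp
  qed
  have G: "(\<Sum>k\<in>{1..N}. g k) \<le> \<tau>"
  proof -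
    have "(\<Sum>k\<in>{1..N}. g k) \<le> 1 / real J" unfolding g_def by (rule inverse_square_tail[OF J(1)])
    also have "\<dots> \<le> \<tau>" using J t by (simp add: field_simps)
    finally show ?thesis .
  qed
  have G0: "(\<Sum>k\<in>{1..N}. g k) \<ge> 0" unfolding g_def by (intro sum_nonneg) auto
  have "(\<Sum>k\<in>{1..N}. \<Sum>l\<in>{1..N}. (ker1 \<tau> (real k) (real l))\<^sup>2) \<le>
     (\<Sum>k\<in>{1..N}. \<Sum>l\<in>{1..N}. 4 * \<tau>\<^sup>2 * (f k l + f l k) + \<tau> * (g k * (1 / (real l)\<^sup>2) + 1 / (real k)\<^sup>2 * g l))"
    by (intro sum_mono pt)
  also have "\<dots> = 4 * \<tau>\<^sup>2 * ((\<Sum>k\<in>{1..N}. \<Sum>l\<in>{1..N}. f k l) + (\<Sum>k\<in>{1..N}. \<Sum>l\<in>{1..N}. f l k))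
    + \<tau> * ((\<Sum>k\<in>{1..N}. g k) * (\<Sum>l\<in>{1..N}. 1 / (real l)\<^sup>2) + (\<Sum>k\<in>{1..N}. 1 / (real k)\<^sup>2) * (\<Sum>l\<in>{1..N}. g l))"
    unfolding sum.distrib sum_distrib_left[symmetric] sum_distrib_right[symmetric] sum_product[symmetric] ..
  also have "(\<Sum>k\<in>{1..N}. \<Sum>l\<in>{1..N}. f l k) = (\<Sum>k\<in>{1..N}. \<Sum>l\<in>{1..N}. f k l)" by (rule sum.swap)
  also have "4 * \<tau>\<^sup>2 * ((\<Sum>k\<in>{1..N}. \<Sum>l\<in>{1..N}. f k l) + (\<Sum>k\<in>{1..N}. \<Sum>l\<in>{1..N}. f k l)) \<le> 4 * \<tau>\<^sup>2 * (3 * ln (1 / \<tau>) + 3 * ln (1 / \<tau>))"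
    using H by (intro mult_left_mono) auto
  also have "\<tau> * ((\<Sum>k\<in>{1..N}. g k) * (\<Sum>l\<in>{1..N}. 1 / (real l)\<^sup>2) + (\<Sum>k\<in>{1..N}. 1 / (real k)\<^sup>2) * (\<Sum>l\<in>{1..N}. g l)) \<le> \<tau> * (\<tau> * 2 + 2 * \<tau>)"
    using t G G0 inverse_square_sum[of N] by (intro mult_left_mono add_mono mult_mono) (auto intro: sum_nonneg)
  also have "\<tau> * (\<tau> * 2 + 2 * \<tau>) = 4 * \<tau>\<^sup>2 * 1" by (simp add: power2_eq_square)
  also have "\<dots> \<le> 4 * \<tau>\<^sup>2 * ln (1 / \<tau>)" using ln_inverse_ge_1[OF t] by (intro mult_left_mono) auto
  finally show ?thesis by (simp add: algebra_simps)
qed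

text \<open>This kernel is a product, so its square sum factorises. Cutting both sums at
  \<tau>^(-1/2) gives 3 \<tau>^(3/2) for l and 9 \<tau>^(1/2) for k, and the product carries no
  logarithm.\<close>

lemma ker2_sum:
  assumes t: "0 < \<tau>" "\<tau> \<le> 1 / 3"
  shows "(\<Sum>k\<in>{1..N}. \<Sum>l\<in>{1..N}. (ker2 \<tau> (real k) (real l))\<^sup>2) \<le> 27 * \<tau>\<^sup>2"
proof -
  define s where "s = sqrt \<tau>"
  have s: "0 < s" "s \<le> 1" "\<tau> = s\<^sup>2" unfolding s_def using t by auto
  obtain q :: nat where q: "q \<ge> 1" "1 / s \<le> real q" "real q \<le> 2 / s" using nat_scale[OF s(1,2)] by auto
  have q': "1 / real q \<le> s" using q s by (simp add: field_simps)
  have cnt: "(\<Sum>k\<in>{1..N}. if k \<le> q then c else 0) \<le> real q * c" if "c \<ge> 0" for c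
  proof -
    have "(\<Sum>k\<in>{1..N}. if k \<le> q then c else 0) = (\<Sum>k\<in>{k\<in>{1..N}. k \<le> q}. c)"
      by (rule sum.mono_neutral_cong_right) auto
    also have "\<dots> \<le> (\<Sum>k\<in>{1..q}. c)" using that by (intro sum_mono2) auto
    finally show ?thesis by simp
  qed
  have "(\<Sum>l\<in>{1..N}. (min (1 / (real l)\<^sup>2) \<tau>)\<^sup>2) \<le>
     (\<Sum>l\<in>{1..N}. (if l \<le> q then \<tau>\<^sup>2 else 0) + s\<^sup>2 * (if q < l then 1 / (real l)\<^sup>2 else 0))"
  proof (rule sum_mono)
    fix l assume l: "l \<in> {1..N}"
    show "(min (1 / (real l)\<^sup>2) \<tau>)\<^sup>2 \<le> (if l \<le> q then \<tau>\<^sup>2 else 0) + s\<^sup>2 * (if q < l then 1 / (real l)\<^sup>2 else 0)"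
    proof (cases "l \<le> q")
      case True
      then show ?thesis using t by (auto intro!: power_mono)
    next
      case False
      have "(min (1 / (real l)\<^sup>2) \<tau>)\<^sup>2 \<le> (1 / real l)\<^sup>2 * (1 / (real l)\<^sup>2)"
        unfolding power2_eq_square[of "min _ _"] using t by (intro mult_mono) (auto simp: power_divide)
      also have "\<dots> \<le> s\<^sup>2 * (1 / (real l)\<^sup>2)"
      proof (intro mult_right_mono power_mono)
        have "1 / real l \<le> 1 / real q" using False q by (intro divide_left_mono) auto
        then show "1 / real l \<le> s" using q' by simp
      qed auto
      finally show ?thesis using False by simp
    qed
  qed
  also have "\<dots> = (\<Sum>l\<in>{1..N}. if l \<le> q then \<tau>\<^sup>2 else 0) + s\<^sup>2 * (\<Sum>l\<in>{1..N}. if q < l then 1 / (real l)\<^sup>2 else 0)"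
    unfolding sum.distrib sum_distrib_left[symmetric] ..
  also have "\<dots> \<le> real q * \<tau>\<^sup>2 + s\<^sup>2 * (1 / real q)"
    by (intro add_mono mult_left_mono cnt inverse_square_tail q) auto
  also have "\<dots> \<le> (2 / s) * \<tau>\<^sup>2 + s\<^sup>2 * s"
    using q q' by (intro add_mono mult_right_mono mult_left_mono) auto
  also have "\<dots> = 3 * s^3" unfolding s(3) using s(1) by (simp add: power2_eq_square power3_eq_cube)
  finally have 1: "(\<Sum>l\<in>{1..N}. (min (1 / (real l)\<^sup>2) \<tau>)\<^sup>2) \<le> 3 * s^3" .
  have "(\<Sum>k\<in>{1..N}. (min 1 (\<tau> * (real k)\<^sup>2) / real k)\<^sup>2) \<le>
     (\<Sum>k\<in>{1..N}. (if k \<le> q then (\<tau> * real q)\<^sup>2 else 0) + (if q < k then 1 / (real k)\<^sup>2 else 0))"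
  proof (rule sum_mono)
    fix k assume k: "k \<in> {1..N}"
    show "(min 1 (\<tau> * (real k)\<^sup>2) / real k)\<^sup>2 \<le> (if k \<le> q then (\<tau> * real q)\<^sup>2 else 0) + (if q < k then 1 / (real k)\<^sup>2 else 0)"
    proof (cases "k \<le> q")
      case True
      have "min 1 (\<tau> * (real k)\<^sup>2) / real k \<le> (\<tau> * (real k)\<^sup>2) / real k" by (intro divide_right_mono) auto
      also have "\<dots> = \<tau> * real k" using k by (simp add: power2_eq_square)
      also have "\<dots> \<le> \<tau> * real q" using True t by (intro mult_left_mono) auto
      finally show ?thesis using True t by (auto intro!: power_mono)
    next
      case False
      have "(min 1 (\<tau> * (real k)\<^sup>2) / real k)\<^sup>2 \<le> (1 / real k)\<^sup>2" using t by (intro power_mono divide_right_mono) auto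
      then show ?thesis using False by (simp add: power_divide)
    qed
  qed
  also have "\<dots> = (\<Sum>k\<in>{1..N}. if k \<le> q then (\<tau> * real q)\<^sup>2 else 0) + (\<Sum>k\<in>{1..N}. if q < k then 1 / (real k)\<^sup>2 else 0)"
    unfolding sum.distrib ..
  also have "\<dots> \<le> real q * (\<tau> * real q)\<^sup>2 + 1 / real q"
    by (intro add_mono cnt inverse_square_tail q) auto
  also have "\<dots> \<le> (2 / s) * (\<tau> * (2 / s))\<^sup>2 + s"
    using q q' t s by (intro add_mono mult_mono power_mono mult_left_mono) auto
  also have "\<dots> = 9 * s" unfolding s(3) using s(1) by (simp add: power2_eq_square)
  finally have 2: "(\<Sum>k\<in>{1..N}. (min 1 (\<tau> * (real k)\<^sup>2) / real k)\<^sup>2) \<le> 9 * s" .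
  have "(\<Sum>k\<in>{1..N}. \<Sum>l\<in>{1..N}. (ker2 \<tau> (real k) (real l))\<^sup>2) =
    (\<Sum>k\<in>{1..N}. (min 1 (\<tau> * (real k)\<^sup>2) / real k)\<^sup>2) * (\<Sum>l\<in>{1..N}. (min (1 / (real l)\<^sup>2) \<tau>)\<^sup>2)"
    unfolding ker2_def power_mult_distrib sum_product by (simp add: mult.commute)
  also have "\<dots> \<le> (9 * s) * (3 * s^3)"
    using s by (intro mult_mono 1 2 sum_nonneg) auto
  also have "\<dots> = 27 * \<tau>\<^sup>2" unfolding s(3) by (simp add: power2_eq_square power3_eq_cube)
  finally show ?thesis .
qed

lemma sum_freqs_nonzero:
  fixes f :: "int \<Rightarrow> real"
  assumes "\<And>k. f (- k) = f k"
  shows "(\<Sum>k\<in>freqs N - {0}. f k) = 2 * (\<Sum>n\<in>{1..N}. f (int n))"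
proof -
  have "(\<Sum>k\<in>freqs N. f k) = f 0 + 2 * (\<Sum>n\<in>{1..N}. f (int n))"
  proof (induction N)
    case (Suc N)
    have "f (- 1 - int N) = f (1 + int N)" using assms[of "1 + int N"] by simp
    then show ?case unfolding sum_freqs_Suc using Suc by simp
  qed simp
  then show ?thesis by (simp add: sum_diff1)
qed

text \<open>The value 0 at l = 0 matches the defect, which contains the factor min(1, \<tau> |i l|)
  and vanishes there.\<close>

definition log_kernel :: "real \<Rightarrow> int \<Rightarrow> int \<Rightarrow> real" where
  "log_kernel \<tau> k l = (if l = 0 then 0 else ker1 \<tau> \<bar>of_int k\<bar> \<bar>of_int l\<bar> + ker2 \<tau> \<bar>of_int k\<bar> \<bar>of_int l\<bar>)"

lemma log_kernel_nonneg: "0 \<le> \<tau> \<Longrightarrow> 0 \<le> log_kernel \<tau> k l"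
  unfolding log_kernel_def ker1_def ker2_def by (auto intro!: add_nonneg_nonneg mult_nonneg_nonneg divide_nonneg_nonneg)

lemma log_kernel_sum:
  assumes t: "0 < \<tau>" "\<tau> \<le> 1 / 3"
  shows "(\<Sum>k\<in>freqs N - {0}. \<Sum>l\<in>freqs N. (log_kernel \<tau> k l)\<^sup>2) \<le> 440 * \<tau>\<^sup>2 * ln (1 / \<tau>)"
proof -
  have "(\<Sum>k\<in>freqs N - {0}. \<Sum>l\<in>freqs N. (log_kernel \<tau> k l)\<^sup>2) = (\<Sum>k\<in>freqs N - {0}. \<Sum>l\<in>freqs N - {0}. (log_kernel \<tau> k l)\<^sup>2)"
    by (intro sum.cong refl sum.mono_neutral_right) (auto simp: log_kernel_def)
  also have "\<dots> = 4 * (\<Sum>k\<in>{1..N}. \<Sum>l\<in>{1..N}. (log_kernel \<tau> (int k) (int l))\<^sup>2)"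
  proof -
    have "(\<Sum>l\<in>freqs N - {0}. (log_kernel \<tau> k l)\<^sup>2) = 2 * (\<Sum>l\<in>{1..N}. (log_kernel \<tau> k (int l))\<^sup>2)" for k
      by (rule sum_freqs_nonzero) (simp add: log_kernel_def)
    moreover have "(\<Sum>k\<in>freqs N - {0}. 2 * (\<Sum>l\<in>{1..N}. (log_kernel \<tau> k (int l))\<^sup>2)) = 2 * (\<Sum>k\<in>{1..N}. 2 * (\<Sum>l\<in>{1..N}. (log_kernel \<tau> (int k) (int l))\<^sup>2))"
      by (rule sum_freqs_nonzero) (simp add: log_kernel_def)
    ultimately show ?thesis by (simp add: sum_distrib_left)
  qed
  also have "(\<Sum>k\<in>{1..N}. \<Sum>l\<in>{1..N}. (log_kernel \<tau> (int k) (int l))\<^sup>2) \<le>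
     (\<Sum>k\<in>{1..N}. \<Sum>l\<in>{1..N}. 2 * (ker1 \<tau> (real k) (real l))\<^sup>2 + 2 * (ker2 \<tau> (real k) (real l))\<^sup>2)"
  proof (intro sum_mono)
    fix k l assume "k \<in> {1..N}" "l \<in> {1..N}"
    then show "(log_kernel \<tau> (int k) (int l))\<^sup>2 \<le> 2 * (ker1 \<tau> (real k) (real l))\<^sup>2 + 2 * (ker2 \<tau> (real k) (real l))\<^sup>2"
      using sum_squares_bound[of "ker1 \<tau> (real k) (real l)" "ker2 \<tau> (real k) (real l)"]
      by (simp add: log_kernel_def power2_sum)
  qed
  also have "\<dots> = 2 * (\<Sum>k\<in>{1..N}. \<Sum>l\<in>{1..N}. (ker1 \<tau> (real k) (real l))\<^sup>2) + 2 * (\<Sum>k\<in>{1..N}. \<Sum>l\<in>{1..N}. (ker2 \<tau> (real k) (real l))\<^sup>2)"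
    unfolding sum.distrib sum_distrib_left ..
  also have "\<dots> \<le> 2 * (28 * \<tau>\<^sup>2 * ln (1 / \<tau>)) + 2 * (27 * \<tau>\<^sup>2)"
    using ker1_sum[OF t, of N] ker2_sum[OF t, of N] by simp
  also have "27 * \<tau>\<^sup>2 \<le> 27 * \<tau>\<^sup>2 * ln (1 / \<tau>)"
    using ln_inverse_ge_1[OF t] mult_left_mono[of 1 "ln (1 / \<tau>)" "27 * \<tau>\<^sup>2"] by simp
  finally show ?thesis by (simp add: mult_ac)
qed

text \<open>Each of i, j, l hands one derivative to its own factor, and the kernel is attached to
  whichever of i and l is smaller. Cauchy--Schwarz in that index leaves one row of the kernel, and
  the l2 norm of the rows over k is its Hilbert--Schmidt norm. The output k = 0 has no denominator
  and is estimated directly.\<close>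

lemma tri_log_bound:
  assumes t: "0 < \<tau>" "\<tau> \<le> 1 / 3"
    and m: "\<And>i j l. i \<in> freqs N \<Longrightarrow> j \<in> freqs N \<Longrightarrow> l \<in> freqs N \<Longrightarrow> i + j + l \<noteq> 0 \<Longrightarrow> norm (m i j l) \<le>
       \<bar>of_int j\<bar> / \<bar>of_int (i + j + l)\<bar> * (min 1 (\<tau> * \<bar>of_int (i * l)\<bar>) * min 1 (\<tau> * \<bar>of_int ((i + j + l) * j)\<bar>))"
    and m0: "\<And>i j l. i \<in> freqs N \<Longrightarrow> j \<in> freqs N \<Longrightarrow> l \<in> freqs N \<Longrightarrow> i + j + l = 0 \<Longrightarrow> norm (m i j l) \<le> \<tau> * \<bar>of_int (i * l)\<bar>"
  shows "l2 (freqs N) (tri (freqs N) m a b d) \<le> 45 * (\<tau> * sqrt (ln (1 / \<tau>))) * (h1 (freqs N) a * h1 (freqs N) b * h1 (freqs N) d)"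
proof -
  let ?A = "freqs N"
  define y where "y i = norm (b i)" for i
  define X where "X i = jb i * norm (a i)" for i
  define Y where "Y i = jb i * norm (b i)" for i
  define Z where "Z i = jb i * norm (d i)" for i
  note defs = y_def X_def Y_def Z_def
  have pos: "0 \<le> y i" "0 \<le> X i" "0 \<le> Y i" "0 \<le> Z i" for i unfolding defs by auto
  have L: "L2_set X ?A = h1 ?A a" "L2_set Y ?A = h1 ?A b" "L2_set Z ?A = h1 ?A d"
    unfolding h1_def by (auto simp: defs cong: L2_set_cong)
  define P where "P = h1 ?A a * h1 ?A b * h1 ?A d"
  have P: "P \<ge> 0" unfolding P_def by simp
  define Lg where "Lg = ln (1 / \<tau>)"
  have Lg: "Lg \<ge> 1" unfolding Lg_def by (rule ln_inverse_ge_1[OF t])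
  have zero: "norm (tri ?A m a b d 0) \<le> 3 * \<tau> * P"
  proof -
    have "norm (tri ?A m a b d 0) \<le> s3 ?A (\<lambda>i j l. (\<tau> * \<bar>of_int (i * l)\<bar>) * (norm (a i) * norm (b j) * norm (d l))) 0"
      by (rule norm_tri_le) (rule m0)
    also have "\<dots> \<le> s3 ?A (\<lambda>i j l. \<tau> * (X i * Z l * y j)) 0"
    proof (rule s3_mono)
      fix i j l
      have "\<bar>of_int (i * l)\<bar> \<le> jb i * jb l"
        unfolding of_int_mult abs_mult by (intro mult_mono abs_le_jb) auto
      then have "\<tau> * (\<bar>of_int (i * l)\<bar> * (norm (a i) * norm (b j) * norm (d l))) \<le> \<tau> * ((jb i * jb l) * (norm (a i) * norm (b j) * norm (d l)))"
        using t by (intro mult_left_mono mult_right_mono) auto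
      then show "\<tau> * \<bar>of_int (i * l)\<bar> * (norm (a i) * norm (b j) * norm (d l)) \<le> \<tau> * (X i * Z l * y j)"
        by (simp add: defs mult_ac)
    qed
    also have "\<dots> = \<tau> * s3 ?A (\<lambda>i l j. X i * Z l * y j) 0"
      unfolding s3_cmult by (subst s3_swap23) (rule refl)
    also have "\<dots> \<le> \<tau> * (h1 ?A a * h1 ?A d * (\<Sum>l\<in>?A. y l))"
      unfolding L[symmetric] using t by (intro mult_left_mono s3_sup_bound pos) auto
    also have "\<dots> \<le> \<tau> * (h1 ?A a * h1 ?A d * (3 * h1 ?A b))"
      using t l1_le_h1[of ?A b] unfolding l1_def y_def by (intro mult_left_mono) auto
    finally show ?thesis unfolding P_def by (simp add: mult_ac)
  qed
  have nz: "norm (tri ?A m a b d k) \<le> 2 * P * L2_set (log_kernel \<tau> k) ?A" if k: "k \<in> ?A - {0}" for k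
  proof -
    have G0: "0 \<le> log_kernel \<tau> k l" for l using log_kernel_nonneg t by auto
    have "norm (tri ?A m a b d k) \<le> s3 ?A (\<lambda>i j l. (\<bar>of_int j\<bar> / \<bar>of_int k\<bar> * (min 1 (\<tau> * \<bar>of_int (i * l)\<bar>) * min 1 (\<tau> * \<bar>of_int (k * j)\<bar>)))
        * (norm (a i) * norm (b j) * norm (d l))) k"
      by (rule norm_tri_le) (use m k in auto)
    also have "\<dots> \<le> s3 ?A (\<lambda>i j l. X i * Y j * (Z l * log_kernel \<tau> k l) + Z l * Y j * (X i * log_kernel \<tau> k i)) k"
    proof (rule s3_mono)
      fix i j l assume ijl: "i + j + l = k"
      define W where "W = \<bar>of_int j\<bar> / \<bar>of_int k\<bar> * (min 1 (\<tau> * \<bar>of_int (i * l)\<bar>) * min 1 (\<tau> * \<bar>real_of_int (k * j)\<bar>))"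
      show "W * (norm (a i) * norm (b j) * norm (d l)) \<le> X i * Y j * (Z l * log_kernel \<tau> k l) + Z l * Y j * (X i * log_kernel \<tau> k i)"
      proof (cases "i = 0 \<or> l = 0")
        case True
        then have "W = 0" unfolding W_def by auto
        then show ?thesis using pos G0 by simp
      next
        case False
        define ri rj rl rk where "ri = \<bar>real_of_int i\<bar>" and "rj = \<bar>real_of_int j\<bar>" and "rl = \<bar>real_of_int l\<bar>" and "rk = \<bar>real_of_int k\<bar>"
        have one: "1 \<le> ri" "1 \<le> rl" "1 \<le> rk" using False k unfolding ri_def rl_def rk_def by (simp_all, linarith+)
        have rj: "0 \<le> rj" "rj \<le> rk + ri + rl" unfolding ri_def rj_def rl_def rk_def ijl[symmetric] by auto
        \<comment> \<open>Multiplying and dividing by i l exposes the three derivatives in front of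
          the normalised kernel.\<close>
        have Weq: "W = rj * (ri * rl) * (min 1 (\<tau> * (ri * rl)) * min 1 (\<tau> * (rk * rj)) / (rk * (ri * rl)))"
          unfolding W_def using one by (simp add: ri_def rj_def rl_def rk_def abs_mult)
        have "min 1 (\<tau> * (ri * rl)) * min 1 (\<tau> * (rk * rj)) / (rk * (ri * rl)) \<le> log_kernel \<tau> k l + log_kernel \<tau> k i"
        proof (cases "rl \<le> ri")
          case True
          have "min 1 (\<tau> * (ri * rl)) * min 1 (\<tau> * (rk * rj)) / (rk * (ri * rl)) \<le> ker1 \<tau> rk rl + ker2 \<tau> rk rl"
            by (rule ker_pointwise) (use t one rj True in auto)
          also have "\<dots> = log_kernel \<tau> k l" unfolding log_kernel_def rk_def rl_def using False by simp
          finally show ?thesis using G0[of i] by simp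
        next
          case f: False
          have "min 1 (\<tau> * (rl * ri)) * min 1 (\<tau> * (rk * rj)) / (rk * (rl * ri)) \<le> ker1 \<tau> rk ri + ker2 \<tau> rk ri"
            by (rule ker_pointwise) (use t one rj f in auto)
          also have "\<dots> = log_kernel \<tau> k i" unfolding log_kernel_def rk_def ri_def using False by simp
          finally show ?thesis using G0[of l] by (simp add: mult.commute[of rl ri])
        qed
        then have "W \<le> rj * (ri * rl) * (log_kernel \<tau> k l + log_kernel \<tau> k i)"
          unfolding Weq using rj one by (intro mult_left_mono) auto
        also have "\<dots> \<le> jb j * (jb i * jb l) * (log_kernel \<tau> k l + log_kernel \<tau> k i)"
          using one G0 by (intro mult_right_mono mult_mono add_nonneg_nonneg) (auto simp: ri_def rj_def rl_def abs_le_jb)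
        finally have "W * (norm (a i) * norm (b j) * norm (d l)) \<le>
           jb j * (jb i * jb l) * (log_kernel \<tau> k l + log_kernel \<tau> k i) * (norm (a i) * norm (b j) * norm (d l))"
          by (intro mult_right_mono) auto
        then show ?thesis by (simp add: defs algebra_simps)
      qed
    qed
    also have "\<dots> = s3 ?A (\<lambda>i j l. X i * Y j * (Z l * log_kernel \<tau> k l)) k + s3 ?A (\<lambda>l j i. Z l * Y j * (X i * log_kernel \<tau> k i)) k"
      unfolding s3_add by (subst (2) s3_swap13) (rule refl)
    also have "\<dots> \<le> L2_set X ?A * L2_set Y ?A * (\<Sum>l\<in>?A. Z l * log_kernel \<tau> k l) + L2_set Z ?A * L2_set Y ?A * (\<Sum>l\<in>?A. X l * log_kernel \<tau> k l)"
      by (intro add_mono s3_sup_bound pos mult_nonneg_nonneg G0) auto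
    also have "\<dots> \<le> L2_set X ?A * L2_set Y ?A * (L2_set Z ?A * L2_set (log_kernel \<tau> k) ?A) + L2_set Z ?A * L2_set Y ?A * (L2_set X ?A * L2_set (log_kernel \<tau> k) ?A)"
      using L2_set_mult_ineq[of Z "log_kernel \<tau> k" ?A] L2_set_mult_ineq[of X "log_kernel \<tau> k" ?A] pos G0
      by (intro add_mono mult_left_mono) auto
    finally show ?thesis unfolding L P_def by (simp add: algebra_simps)
  qed
  have "l2 ?A (tri ?A m a b d) \<le> L2_set (\<lambda>k. (if k = 0 then 3 * \<tau> * P else 0) + (if k = 0 then 0 else 2 * P * L2_set (log_kernel \<tau> k) ?A)) ?A"
    unfolding l2_def by (rule L2_set_mono) (use zero nz in auto)
  also have "\<dots> \<le> L2_set (\<lambda>k. if k = 0 then 3 * \<tau> * P else 0) ?A + L2_set (\<lambda>k. if k = 0 then 0 else 2 * P * L2_set (log_kernel \<tau> k) ?A) ?A"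
    by (rule L2_set_triangle_ineq)
  also have "L2_set (\<lambda>k. if k = 0 then 3 * \<tau> * P else 0) ?A \<le> 3 * \<tau> * P"
    by (rule order_trans[OF L2_set_le_sum_abs]) (use t P in \<open>simp add: if_distrib cong: if_cong\<close>)
  also have "L2_set (\<lambda>k. if k = 0 then 0 else 2 * P * L2_set (log_kernel \<tau> k) ?A) ?A = sqrt ((2 * P)\<^sup>2 * (\<Sum>k\<in>?A - {0}. \<Sum>l\<in>?A. (log_kernel \<tau> k l)\<^sup>2))"
  proof -
    have "(\<Sum>k\<in>?A. (if k = 0 then 0 else 2 * P * L2_set (log_kernel \<tau> k) ?A)\<^sup>2) = (\<Sum>k\<in>?A - {0}. (2 * P)\<^sup>2 * (\<Sum>l\<in>?A. (log_kernel \<tau> k l)\<^sup>2))"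
      by (rule sum.mono_neutral_cong_right) (auto simp: power_mult_distrib L2_set_def sum_nonneg)
    then show ?thesis by (simp add: L2_set_def[of "\<lambda>k. if k = 0 then 0 else 2 * P * L2_set (log_kernel \<tau> k) ?A"] sum_distrib_left)
  qed
  \<comment> \<open>The constant 440 is rounded up to 441 = 21^2 to take the root; then 3 + 2 * 21
    gives the 45 of the claim.\<close>
  also have "\<dots> \<le> sqrt ((2 * P)\<^sup>2 * (21\<^sup>2 * \<tau>\<^sup>2 * Lg))"
    using log_kernel_sum[OF t, of N] Lg unfolding Lg_def by (intro real_sqrt_le_mono mult_left_mono) (auto intro: order_trans)
  also have "\<dots> = 2 * P * (21 * \<tau> * sqrt Lg)"
    using P t by (simp add: real_sqrt_mult)
  also have "3 * \<tau> * P \<le> 3 * \<tau> * P * sqrt Lg"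
    using mult_left_mono[of 1 "sqrt Lg" "3 * \<tau> * P"] t P Lg by simp
  finally show ?thesis unfolding P_def Lg_def by (simp add: algebra_simps)
qed

section \<open>The scheme in Fourier coefficients\<close>

definition schr_symbol :: "real \<Rightarrow> int \<Rightarrow> complex" where
  "schr_symbol t k = exp (- \<i> * of_real t * (of_int k)\<^sup>2)"

definition dx_inv_symbol :: "int \<Rightarrow> complex" where
  "dx_inv_symbol k = (if k = 0 then 0 else inverse (\<i> * of_int k))"

definition phase :: "real \<Rightarrow> int \<Rightarrow> complex" where
  "phase t x = exp (\<i> * of_real (t * of_int x))"

text \<open>The closed form of the integral of \<open>phase s x\<close> over s from 0 to t; the case
  x = 0 is the resonant one.\<close>

definition phase_int :: "real \<Rightarrow> int \<Rightarrow> complex" where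
  "phase_int t x = (if x = 0 then of_real t else (phase t x - 1) / (\<i> * of_int x))"

lemma norm_schr_symbol [simp]: "norm (schr_symbol t k) = 1"
  by (simp add: schr_symbol_def)

lemma schr_symbol_uminus [simp]: "schr_symbol t (- k) = schr_symbol t k"
  by (simp add: schr_symbol_def)

lemma cnj_schr_symbol [simp]: "cnj (schr_symbol t k) = schr_symbol (- t) k"
  by (simp add: schr_symbol_def exp_cnj)

lemma schr_symbol_inverse: "schr_symbol t k * schr_symbol (- t) k = 1"
  by (simp add: schr_symbol_def flip: exp_add)

lemma schr_symbol_add: "schr_symbol (s + t) k = schr_symbol s k * schr_symbol t k"
  by (simp add: schr_symbol_def algebra_simps flip: exp_add)

text \<open>The identity k^2 - i^2 + j^2 - l^2 = 2 (i + j) (l + j) for k = i + j + l. The next two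
  lemmas split off the parts 2 k j and 2 i l of this phase in the same way.\<close>

lemma schr_symbol_resonance: "k = i + j + l \<Longrightarrow> schr_symbol t i * schr_symbol (- t) j * schr_symbol t l = schr_symbol t k * phase t (2 * (i + j) * (l + j))"
  unfolding schr_symbol_def phase_def by (simp flip: exp_add) (simp add: power2_eq_square algebra_simps)

lemma schr_symbol_resonance2: "k = i + j + l \<Longrightarrow> schr_symbol (- t) j * schr_symbol t (i + l) = schr_symbol t k * phase t (2 * k * j)"
  unfolding schr_symbol_def phase_def by (simp flip: exp_add) (simp add: power2_eq_square algebra_simps)

lemma schr_symbol_resonance3: "schr_symbol (- t) (i + l) * (schr_symbol t i * schr_symbol t l) = phase t (2 * i * l)"
  unfolding schr_symbol_def phase_def by (simp flip: exp_add) (simp add: power2_eq_square algebra_simps)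

text \<open>A certificate that f lies in S_N, together with its coefficient sequence. Every
  operation in \<Psi> has one rule for it, so the coefficients of the whole expression are obtained
  by composing rules.\<close>

definition has_coeffs :: "nat \<Rightarrow> (real \<Rightarrow> complex) \<Rightarrow> (int \<Rightarrow> complex) \<Rightarrow> bool" where
  "has_coeffs N f c \<longleftrightarrow> trig_poly N f \<and> (\<forall>k. fourier f k = c k)"

lemma has_coeffs_add: "has_coeffs N f a \<Longrightarrow> has_coeffs N g b \<Longrightarrow> has_coeffs N (\<lambda>x. f x + g x) (\<lambda>k. a k + b k)"
  unfolding has_coeffs_def by (auto simp: trig_poly_add fourier_add trig_poly_continuous)
lemma has_coeffs_diff: "has_coeffs N f a \<Longrightarrow> has_coeffs N g b \<Longrightarrow> has_coeffs N (\<lambda>x. f x - g x) (\<lambda>k. a k - b k)"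
  unfolding has_coeffs_def by (auto simp: trig_poly_diff fourier_diff trig_poly_continuous)
lemma has_coeffs_cmult: "has_coeffs N f a \<Longrightarrow> has_coeffs N (\<lambda>x. c * f x) (\<lambda>k. c * a k)"
  unfolding has_coeffs_def by (auto simp: trig_poly_cmult fourier_cmult)
lemma has_coeffs_const: "has_coeffs N (\<lambda>x. c) (\<lambda>k. if k = 0 then c else 0)"
  unfolding has_coeffs_def by (auto simp: trig_poly_const)
lemma has_coeffs_multiplier: "has_coeffs N f a \<Longrightarrow> has_coeffs N (multiplier m f) (\<lambda>k. m k * a k)"
  unfolding has_coeffs_def by (auto simp: trig_poly_multiplier)
lemma has_coeffs_schr: "has_coeffs N f a \<Longrightarrow> has_coeffs N (schr t f) (\<lambda>k. schr_symbol t k * a k)"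
  unfolding schr_def schr_symbol_def by (rule has_coeffs_multiplier)
lemma has_coeffs_dx_inv: "has_coeffs N f a \<Longrightarrow> has_coeffs N (dx_inv f) (\<lambda>k. dx_inv_symbol k * a k)"
  unfolding dx_inv_def dx_inv_symbol_def by (rule has_coeffs_multiplier)
lemma has_coeffs_cnj: "has_coeffs N f a \<Longrightarrow> has_coeffs N (conj_fun f) (conj_coeffs a)"
  unfolding has_coeffs_def conj_fun_def by (auto simp: trig_poly_cnj fourier_cnj conj_coeffs_def)
lemma has_coeffs_dx: "has_coeffs N f a \<Longrightarrow> has_coeffs N (dx f) (\<lambda>k. \<i> * of_int k * a k)"
  unfolding has_coeffs_def by (auto simp: trig_poly_dx)

definition convol :: "nat \<Rightarrow> (int \<Rightarrow> complex) \<Rightarrow> (int \<Rightarrow> complex) \<Rightarrow> int \<Rightarrow> complex" where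
  "convol N a b k = (\<Sum>i\<in>freqs N. \<Sum>j\<in>freqs N. if i + j = k then a i * b j else 0)"

lemma has_coeffs_fourier_mult: "has_coeffs N f a \<Longrightarrow> has_coeffs N g b \<Longrightarrow> fourier (\<lambda>x. f x * g x) k = convol N a b k"
  unfolding has_coeffs_def convol_def using trig_poly_mult(2)[of N f N g k] by (auto cong: if_cong)

lemma has_coeffs_conv: "has_coeffs N f a \<Longrightarrow> has_coeffs N g b \<Longrightarrow> has_coeffs N (PiN N (\<lambda>y. f y * g y)) (\<lambda>k. if k \<in> freqs N then convol N a b k else 0)"
  using has_coeffs_fourier_mult[of N f a g b] by (simp add: has_coeffs_def trig_poly_PiN)

text \<open>The inner projection survives as the indicator that i + j is at most N in modulus, and
  any multiplier between the two products becomes a function of i + j.\<close>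

lemma convol_nest:
  "convol N g (\<lambda>p. \<gamma> p * (if p \<in> freqs N then convol N \<alpha> \<beta> p else 0)) k =
   s3 (freqs N) (\<lambda>i j l. (if i + j \<in> freqs N then \<gamma> (i + j) else 0) * (\<alpha> i * \<beta> j * g l)) k"
proof -
  let ?A = "freqs N"
  have "convol N g (\<lambda>p. \<gamma> p * (if p \<in> ?A then convol N \<alpha> \<beta> p else 0)) k =
    (\<Sum>l\<in>?A. \<Sum>p\<in>?A. \<Sum>i\<in>?A. \<Sum>j\<in>?A. if p = i + j \<and> l + p = k then g l * (\<gamma> p * (\<alpha> i * \<beta> j)) else 0)"
    unfolding convol_def
  proof (intro sum.cong refl)
    fix l p assume "p \<in> ?A"
    then show "(if l + p = k then g l * (\<gamma> p * (if p \<in> ?A then \<Sum>i\<in>?A. \<Sum>j\<in>?A. if i + j = p then \<alpha> i * \<beta> j else 0 else 0)) else 0) =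
      (\<Sum>i\<in>?A. \<Sum>j\<in>?A. if p = i + j \<and> l + p = k then g l * (\<gamma> p * (\<alpha> i * \<beta> j)) else 0)"
      by (auto simp: sum_distrib_left intro!: sum.cong)
  qed
  also have "\<dots> = (\<Sum>l\<in>?A. \<Sum>i\<in>?A. \<Sum>j\<in>?A. \<Sum>p\<in>?A. if p = i + j \<and> l + p = k then g l * (\<gamma> p * (\<alpha> i * \<beta> j)) else 0)"
  proof (rule sum.cong[OF refl])
    fix l
    show "(\<Sum>p\<in>?A. \<Sum>i\<in>?A. \<Sum>j\<in>?A. if p = i + j \<and> l + p = k then g l * (\<gamma> p * (\<alpha> i * \<beta> j)) else 0) =
      (\<Sum>i\<in>?A. \<Sum>j\<in>?A. \<Sum>p\<in>?A. if p = i + j \<and> l + p = k then g l * (\<gamma> p * (\<alpha> i * \<beta> j)) else 0)"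
      by (subst sum.swap, rule sum.cong[OF refl], rule sum.swap)
  qed
  also have "\<dots> = (\<Sum>l\<in>?A. \<Sum>i\<in>?A. \<Sum>j\<in>?A. if i + j + l = k then (if i + j \<in> ?A then \<gamma> (i + j) else 0) * (\<alpha> i * \<beta> j * g l) else 0)"
  proof (intro sum.cong refl)
    fix l i j
    have "(\<Sum>p\<in>?A. if p = i + j \<and> l + p = k then g l * (\<gamma> p * (\<alpha> i * \<beta> j)) else 0) =
       (\<Sum>p\<in>?A. if p = i + j then (if i + j + l = k then g l * (\<gamma> p * (\<alpha> i * \<beta> j)) else 0) else 0)"
      by (intro sum.cong refl) auto
    also have "\<dots> = (if i + j \<in> ?A then (if i + j + l = k then g l * (\<gamma> (i + j) * (\<alpha> i * \<beta> j)) else 0) else 0)"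
      by (rule sum.delta) simp
    also have "\<dots> = (if i + j + l = k then (if i + j \<in> ?A then \<gamma> (i + j) else 0) * (\<alpha> i * \<beta> j * g l) else 0)"
      by (simp add: mult_ac)
    finally show "(\<Sum>p\<in>?A. if p = i + j \<and> l + p = k then g l * (\<gamma> p * (\<alpha> i * \<beta> j)) else 0) =
      (if i + j + l = k then (if i + j \<in> ?A then \<gamma> (i + j) else 0) * (\<alpha> i * \<beta> j * g l) else 0)" .
  qed
  also have "\<dots> = s3 ?A (\<lambda>i j l. (if i + j \<in> ?A then \<gamma> (i + j) else 0) * (\<alpha> i * \<beta> j * g l)) k"
    unfolding s3_def by (subst sum.swap, rule sum.cong[OF refl], rule sum.swap)
  finally show ?thesis .
qed

text \<open>At k = 0 the value is 1: the propagator in \<Psi> and the correction with (1 - e)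
  \<Pi>_0 f add up to the identity on the mean value.\<close>

definition twist_symbol :: "real \<Rightarrow> real \<Rightarrow> complex \<Rightarrow> complex \<Rightarrow> int \<Rightarrow> complex" where
  "twist_symbol lam tau P M k = (if k = 0 then 1
     else exp (\<i> * of_real tau * (- 2 * of_real lam * P * inverse (\<i> * of_int k) - 2 * of_real lam * M - (of_int k)\<^sup>2)))"

text \<open>The symbol of the nonlinear part of \<open>\<Psi>\<close>, with the common factor \<open>- i \<lambda> schr_symbol \<tau> k\<close> taken out. The first
  line after \<open>k = 0\<close> is twice the term \<open>(l + j) / k\<close> of the splitting, because the term with
  \<open>i + j\<close> is its mirror image under \<open>i \<leftrightarrow> l\<close>.\<close>

definition sym_num :: "real \<Rightarrow> nat \<Rightarrow> int \<Rightarrow> int \<Rightarrow> int \<Rightarrow> complex" where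
  "sym_num t N i j l = (let k = i + j + l in
     if k = 0 then (if i + j \<in> freqs N then of_real t else 0)
     else (if i + j \<noteq> 0 \<and> i + j \<in> freqs N then 2 * (of_int (l + j) / of_int k) * phase_int t (2 * (i + j) * (l + j)) else 0)
       + (if i + l \<in> freqs N then of_int j / of_int k * (of_real t - phase_int t (2 * k * j) - (if i \<noteq> 0 \<and> l \<noteq> 0 then phase_int t (2 * i * l) else 0)) else 0)
       - (if i = 0 then 2 * of_real t * (of_int j / of_int k) else 0)
       + (if i = 0 \<and> l = 0 then of_real t else 0))"

definition Psi_hat :: "real \<Rightarrow> real \<Rightarrow> nat \<Rightarrow> complex \<Rightarrow> complex \<Rightarrow> (int \<Rightarrow> complex) \<Rightarrow> int \<Rightarrow> complex" where
  "Psi_hat lam tau N P M a k = (if k \<in> freqs N then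
     twist_symbol lam tau P M k * a k + (- \<i> * of_real lam * schr_symbol tau k) * tri (freqs N) (sym_num tau N) a (conj_coeffs a) a k else 0)"

text \<open>The two terms of \<Psi> that integrate |f|^2 are the endpoint values of the phase 2 (i +
  j) (l + j). Their antiderivatives supply the denominators k and i + j; completing i + j to the
  full phase leaves (l + j) / k times the oscillatory integral.\<close>

lemma sym_num_T1:
  assumes "k = i + j + l" "k \<noteq> 0" "i + j \<noteq> 0"
  shows "dx_inv_symbol k * (dx_inv_symbol (i + j) * (schr_symbol t i * schr_symbol (- t) j * schr_symbol t l) - schr_symbol t k * dx_inv_symbol (i + j)) =
    - \<i> * schr_symbol t k * (2 * (of_int (l + j) / of_int k) * phase_int t (2 * (i + j) * (l + j)))"
proof (cases "l + j = 0")
  case True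
  then show ?thesis using schr_symbol_resonance[OF assms(1), of t] by (simp add: phase_def)
next
  case False
  define p q :: complex where "p = of_int (i + j)" and "q = of_int (l + j)"
  define K :: complex where "K = of_int k"
  have nz: "p \<noteq> 0" "q \<noteq> 0" "K \<noteq> 0" unfolding p_def q_def K_def using False assms by (simp_all flip: of_int_add)
  have x: "complex_of_int (2 * (i + j) * (l + j)) = 2 * p * q" unfolding p_def q_def by simp
  have phase_int: "phase_int t (2 * (i + j) * (l + j)) = (phase t (2 * (i + j) * (l + j)) - 1) / (\<i> * (2 * p * q))"
    unfolding phase_int_def x using False assms by simp
  have d: "dx_inv_symbol k = 1 / (\<i> * K)" "dx_inv_symbol (i + j) = 1 / (\<i> * p)" unfolding dx_inv_symbol_def K_def p_def using assms by (simp_all add: inverse_eq_divide)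
  show ?thesis
    unfolding schr_symbol_resonance[OF assms(1), of t] phase_int d q_def[symmetric] K_def[symmetric]
    using nz by (simp add: field_simps)
qed

text \<open>The double antiderivative supplies k^2; against the phase 2 k j this leaves j / k times
  its oscillatory integral.\<close>

lemma sym_num_T2:
  assumes "k = i + j + l" "k \<noteq> 0"
  shows "dx_inv_symbol k * (dx_inv_symbol k * (schr_symbol (- t) j * schr_symbol t (i + l) - schr_symbol t k)) = 2 * \<i> * schr_symbol t k * (of_int j / of_int k * (- phase_int t (2 * k * j)))"
proof (cases "j = 0")
  case True
  then show ?thesis using schr_symbol_resonance2[OF assms(1), of t] by (simp add: phase_def)
next
  case False
  define K J :: complex where "K = of_int k" and "J = of_int j"
  have nz: "K \<noteq> 0" "J \<noteq> 0" unfolding K_def J_def of_int_eq_0_iff using False assms by auto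
  have x: "complex_of_int (2 * k * j) = 2 * K * J" unfolding K_def J_def by simp
  have phase_int: "phase_int t (2 * k * j) = (phase t (2 * k * j) - 1) / (\<i> * (2 * K * J))"
    unfolding phase_int_def x using False assms by simp
  have d: "dx_inv_symbol k = 1 / (\<i> * K)" unfolding dx_inv_symbol_def K_def using assms by (simp_all add: inverse_eq_divide)
  show ?thesis
    unfolding schr_symbol_resonance2[OF assms(1), of t] phase_int d J_def[symmetric] K_def[symmetric]
    using nz by (simp add: field_simps)
qed

text \<open>The antiderivatives of the two outer factors supply i l, as the phase 2 i l requires,
  and the derivative on the conjugate factor with the last antiderivative gives j / k.\<close>

lemma sym_num_T3:
  assumes "k \<noteq> 0" "i \<noteq> 0" "l \<noteq> 0"
  shows "dx_inv_symbol k * (\<i> * of_int j) * ((schr_symbol (- t) (i + l) * (schr_symbol t i * schr_symbol t l) - 1) * (dx_inv_symbol i * dx_inv_symbol l)) = 2 * \<i> * (of_int j / of_int k * (- phase_int t (2 * i * l)))"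
proof -
  define K J I L :: complex where "K = of_int k" and "J = of_int j" and "I = of_int i" and "L = of_int l"
  have nz: "K \<noteq> 0" "I \<noteq> 0" "L \<noteq> 0" unfolding K_def I_def L_def using assms by simp_all
  have x: "complex_of_int (2 * i * l) = 2 * I * L" unfolding I_def L_def by simp
  have phase_int: "phase_int t (2 * i * l) = (phase t (2 * i * l) - 1) / (\<i> * (2 * I * L))"
    unfolding phase_int_def x using assms by simp
  have d: "dx_inv_symbol k = 1 / (\<i> * K)" "dx_inv_symbol i = 1 / (\<i> * I)" "dx_inv_symbol l = 1 / (\<i> * L)" unfolding dx_inv_symbol_def K_def I_def L_def using assms by (simp_all add: inverse_eq_divide)
  show ?thesis
    unfolding schr_symbol_resonance3 phase_int d J_def[symmetric] K_def[symmetric]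
    using nz by (simp add: field_simps)
qed

lemma convol_diff2: "convol N g (\<lambda>p. u p - v p) k = convol N g u k - convol N g v k"
proof -
  have "convol N g (\<lambda>p. u p - v p) k = (\<Sum>i\<in>freqs N. \<Sum>j\<in>freqs N. (if i + j = k then g i * u j else 0) - (if i + j = k then g i * v j else 0))"
    unfolding convol_def by (intro sum.cong refl) (auto simp: ring_distribs)
  then show ?thesis unfolding convol_def by (simp add: sum_subtractf)
qed

text \<open>A factor \<Pi>_0 f is rewritten as a trilinear sum with its first index pinned to 0. All
  cubic terms of \<Psi> then have the same three arguments, and only their symbols have to be
  added.\<close>

lemma convol_first_zero:
  "d 0 * convol N (\<lambda>j. g j * b j) d k = tri (freqs N) (\<lambda>i j l. if i = 0 then g j else 0) d b d k"
proof -
  let ?A = "freqs N"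
  have "tri ?A (\<lambda>i j l. if i = 0 then g j else 0) d b d k =
    (\<Sum>i\<in>?A. if i = 0 then (\<Sum>j\<in>?A. \<Sum>l\<in>?A. if j + l = k then g j * (d 0 * b j * d l) else 0) else 0)"
    unfolding tri_def s3_def by (intro sum.cong refl) (auto intro!: sum.cong sum.neutral)
  also have "\<dots> = (\<Sum>j\<in>?A. \<Sum>l\<in>?A. if j + l = k then g j * (d 0 * b j * d l) else 0)"
    by (simp add: sum.delta)
  also have "\<dots> = d 0 * convol N (\<lambda>j. g j * b j) d k"
    unfolding convol_def sum_distrib_left by (intro sum.cong refl) auto
  finally show ?thesis ..
qed

lemma tri_zero_zero:
  assumes "k \<in> freqs N"
  shows "(d 0)\<^sup>2 * b k = tri (freqs N) (\<lambda>i j l. if i = 0 \<and> l = 0 then 1 else 0) d b d k"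
proof -
  let ?A = "freqs N"
  have "tri ?A (\<lambda>i j l. if i = 0 \<and> l = 0 then 1 else 0) d b d k =
    (\<Sum>i\<in>?A. if i = 0 then (\<Sum>j\<in>?A. if j = k then (\<Sum>l\<in>?A. if l = 0 then d 0 * b k * d 0 else 0) else 0) else 0)"
    unfolding tri_def s3_def
  proof (rule sum.cong[OF refl])
    fix i
    have "(\<Sum>l\<in>?A. if 0 + j + l = k then (if l = 0 then 1 else 0) * (d 0 * b j * d l) else 0) =
      (if j = k then \<Sum>l\<in>?A. if l = 0 then d 0 * b k * d 0 else 0 else 0)" for j
      by (cases "j = k") (auto intro!: sum.cong sum.neutral)
    then show "(\<Sum>j\<in>?A. \<Sum>l\<in>?A. if i + j + l = k then (if i = 0 \<and> l = 0 then 1 else 0) * (d i * b j * d l) else 0) =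
      (if i = 0 then \<Sum>j\<in>?A. if j = k then \<Sum>l\<in>?A. if l = 0 then d 0 * b k * d 0 else 0 else 0 else 0)"
      by (cases "i = 0") (simp_all cong: if_cong)
  qed
  also have "\<dots> = d 0 * b k * d 0"
    using assms by (simp add: sum.delta)
  finally show ?thesis by (simp add: power2_eq_square)
qed

lemma convol_nest_tri1:
  "convol N (\<lambda>k. u k * a k) (\<lambda>p. \<gamma> p * (if p \<in> freqs N then convol N (\<lambda>k. u k * a k) (\<lambda>k. v k * b k) p else 0)) k =
   tri (freqs N) (\<lambda>i j l. if i + j \<in> freqs N then \<gamma> (i + j) * (u i * v j * u l) else 0) a b a k"
  unfolding convol_nest tri_def by (intro s3_cong) auto

lemma convol_nest_tri2:
  "convol N (\<lambda>k. v k * b k) (\<lambda>p. \<gamma> p * (if p \<in> freqs N then convol N (\<lambda>k. u k * a k) (\<lambda>k. u k * a k) p else 0)) k =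
   tri (freqs N) (\<lambda>i j l. if i + l \<in> freqs N then \<gamma> (i + l) * (u i * u l * v j) else 0) a b a k"
  unfolding convol_nest tri_def by (subst s3_swap23, rule s3_cong) auto

lemma has_coeffs_absq: "has_coeffs N f a \<Longrightarrow> has_coeffs N (PiN N (absq f)) (\<lambda>k. if k \<in> freqs N then convol N a (conj_coeffs a) k else 0)"
proof -
  assume f: "has_coeffs N f a"
  have "absq f = (\<lambda>y. f y * conj_fun f y)" by (auto simp: absq_def conj_fun_def simp flip: complex_norm_square)
  then show ?thesis using has_coeffs_conv[OF f has_coeffs_cnj[OF f]] by simp
qed

lemma has_coeffs_sq: "has_coeffs N f a \<Longrightarrow> has_coeffs N (PiN N (sq f)) (\<lambda>k. if k \<in> freqs N then convol N a a k else 0)"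
  using has_coeffs_conv[of N f a f a] by (simp add: sq_def power2_eq_square)

lemma conj_coeffs_schr_symbol: "conj_coeffs (\<lambda>k. schr_symbol t k * a k) = (\<lambda>k. schr_symbol (- t) k * conj_coeffs a k)"
  by (auto simp: conj_coeffs_def)

text \<open>The rules for \<open>has_coeffs\<close> produce the coefficient sequence of \<Psi> term
  by term. All cubic terms are then brought to trilinear form over the same arguments, which reduces
  the claim to an identity between symbols for fixed i, j, l.\<close>

lemma has_coeffs_Psi:
  assumes f: "has_coeffs N f a"
  shows "has_coeffs N (Psi lam tau N P M f) (Psi_hat lam tau N P M a)"
proof -
  let ?A = "freqs N"
  define b where "b = conj_coeffs a"
  define e where "e = exp (- 2 * \<i> * of_real lam * of_real tau * M)"
  define s where "s k = schr_symbol tau k * a k" for k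
  define s' where "s' k = schr_symbol (- tau) k * b k" for k
  define ct where "ct c = (\<lambda>k. if k \<in> ?A then c k else (0::complex))" for c :: "int \<Rightarrow> complex"
  have S: "has_coeffs N (schr tau f) s" unfolding s_def by (rule has_coeffs_schr[OF f])
  have rs: "conj_coeffs s = s'" unfolding s_def s'_def b_def by (rule conj_coeffs_schr_symbol)
  have F: "has_coeffs N (conj_fun f) b" unfolding b_def by (rule has_coeffs_cnj[OF f])
  have t1: "has_coeffs N (twisted_schr lam tau P M f) (\<lambda>k. (if k = 0 then e else exp (\<i> * of_real tau *
       (- 2 * of_real lam * P * inverse (\<i> * of_int k) - 2 * of_real lam * M - (of_int k)\<^sup>2))) * a k)"
    unfolding twisted_schr_def e_def by (rule has_coeffs_multiplier[OF f])
  have Pi0f: "Pi0 f = a 0" using f unfolding Pi0_eq_fourier has_coeffs_def by simp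
  have t3: "Pi0 (\<lambda>y. PiN N (absq f) y * f y) = convol N a (ct (convol N a b)) 0"
  proof -
    have "Pi0 (\<lambda>y. PiN N (absq f) y * f y) = fourier (\<lambda>y. f y * PiN N (absq f) y) 0"
      unfolding Pi0_eq_fourier by (simp add: mult.commute)
    then show ?thesis unfolding has_coeffs_fourier_mult[OF f has_coeffs_absq[OF f]] b_def ct_def .
  qed
  have t4: "has_coeffs N (dx_inv (PiN N (\<lambda>y. schr tau f y * dx_inv (PiN N (absq (schr tau f))) y)))
     (\<lambda>k. dx_inv_symbol k * ct (convol N s (\<lambda>p. dx_inv_symbol p * ct (convol N s s') p)) k)"
    using has_coeffs_dx_inv[OF has_coeffs_conv[OF S has_coeffs_dx_inv[OF has_coeffs_absq[OF S]]]] unfolding rs ct_def .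
  have t5: "has_coeffs N (schr tau (dx_inv (PiN N (\<lambda>y. f y * dx_inv (PiN N (absq f)) y))))
     (\<lambda>k. schr_symbol tau k * (dx_inv_symbol k * ct (convol N a (\<lambda>p. dx_inv_symbol p * ct (convol N a b) p)) k))"
    using has_coeffs_schr[OF has_coeffs_dx_inv[OF has_coeffs_conv[OF f has_coeffs_dx_inv[OF has_coeffs_absq[OF f]]]]] unfolding b_def ct_def .
  have t6: "has_coeffs N (dx_inv (dx_inv (PiN N (\<lambda>y. schr (- tau) (conj_fun f) y * schr tau (PiN N (sq f)) y))))
     (\<lambda>k. dx_inv_symbol k * (dx_inv_symbol k * ct (convol N s' (\<lambda>p. schr_symbol tau p * ct (convol N a a) p)) k))"
    using has_coeffs_dx_inv[OF has_coeffs_dx_inv[OF has_coeffs_conv[OF has_coeffs_schr[OF F, of "-tau"] has_coeffs_schr[OF has_coeffs_sq[OF f]]]]] unfolding s'_def ct_def .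
  have t6': "has_coeffs N (schr tau (dx_inv (dx_inv (PiN N (\<lambda>y. conj_fun f y * PiN N (sq f) y)))))
     (\<lambda>k. schr_symbol tau k * (dx_inv_symbol k * (dx_inv_symbol k * ct (convol N b (ct (convol N a a))) k)))"
    using has_coeffs_schr[OF has_coeffs_dx_inv[OF has_coeffs_dx_inv[OF has_coeffs_conv[OF F has_coeffs_sq[OF f]]]]] unfolding ct_def .
  define db where "db k = \<i> * of_int k * b k" for k
  define g where "g k = dx_inv_symbol k * a k" for k
  define sg' where "sg' k = schr_symbol tau k * (dx_inv_symbol k * a k)" for k
  have D: "has_coeffs N (dx (conj_fun f)) db" unfolding db_def by (rule has_coeffs_dx[OF F])
  have t7: "has_coeffs N (schr tau (dx_inv (PiN N (\<lambda>y. dx (conj_fun f) y *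
           (schr (- tau) (PiN N (sq (schr tau (dx_inv f)))) y - PiN N (sq (dx_inv f)) y)))))
     (\<lambda>k. schr_symbol tau k * (dx_inv_symbol k * ct (convol N db (\<lambda>p. schr_symbol (- tau) p * ct (convol N sg' sg') p - ct (convol N g g) p)) k))"
    using has_coeffs_schr[OF has_coeffs_dx_inv[OF has_coeffs_conv[OF D has_coeffs_diff[OF has_coeffs_schr[OF has_coeffs_sq[OF has_coeffs_schr[OF has_coeffs_dx_inv[OF f], of tau]], of "-tau"] has_coeffs_sq[OF has_coeffs_dx_inv[OF f]]]]]]
    unfolding sg'_def g_def ct_def .
  have t8: "has_coeffs N (schr tau (dx_inv (PiN N (\<lambda>y. dx (conj_fun f) y * PiN N (sq f) y))))
     (\<lambda>k. schr_symbol tau k * (dx_inv_symbol k * ct (convol N db (ct (convol N a a))) k))"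
    using has_coeffs_schr[OF has_coeffs_dx_inv[OF has_coeffs_conv[OF D has_coeffs_sq[OF f]]]] unfolding ct_def .
  have t9: "has_coeffs N (schr tau (dx_inv (PiN N (\<lambda>y. dx (conj_fun f) y * f y))))
     (\<lambda>k. schr_symbol tau k * (dx_inv_symbol k * ct (convol N db a) k))"
    using has_coeffs_schr[OF has_coeffs_dx_inv[OF has_coeffs_conv[OF D f]]] unfolding ct_def .
  have t10: "has_coeffs N (schr tau (Pi_neq0 (conj_fun f))) (\<lambda>k. schr_symbol tau k * ((if k = 0 then 0 else 1) * b k))"
    unfolding Pi_neq0_def by (rule has_coeffs_schr[OF has_coeffs_multiplier[OF F]])
  note T = has_coeffs_diff[OF has_coeffs_add[OF has_coeffs_diff[OF has_coeffs_diff[OF has_coeffs_diff[OF has_coeffs_diff[OF has_coeffs_add[OF has_coeffs_diff[OF has_coeffs_add[OF t1 has_coeffs_const[of N "(1 - e) * a 0"]]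
     has_coeffs_const[of N "\<i> * of_real lam * of_real tau * convol N a (ct (convol N a b)) 0"]] has_coeffs_cmult[OF t4, of "of_real lam"]] has_coeffs_cmult[OF t5, of "of_real lam"]]
     has_coeffs_cmult[OF has_coeffs_diff[OF t6 t6'], of "of_real lam / 2"]] has_coeffs_cmult[OF t7, of "of_real lam / 2"]] has_coeffs_cmult[OF t8, of "\<i> * of_real lam * of_real tau"]]
     has_coeffs_cmult[OF t9, of "2 * \<i> * of_real lam * of_real tau * a 0"]] has_coeffs_cmult[OF t10, of "\<i> * of_real lam * of_real tau * (a 0)\<^sup>2"]]
  obtain c where c: "has_coeffs N (Psi lam tau N P M f) c" and ceq: "c = (\<lambda>k. (if k = 0 then e else exp (\<i> * of_real tau *
       (- 2 * of_real lam * P * inverse (\<i> * of_int k) - 2 * of_real lam * M - (of_int k)\<^sup>2))) * a k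
     + (if k = 0 then (1 - e) * a 0 else 0)
     - (if k = 0 then \<i> * of_real lam * of_real tau * convol N a (ct (convol N a b)) 0 else 0)
     + of_real lam * (dx_inv_symbol k * ct (convol N s (\<lambda>p. dx_inv_symbol p * ct (convol N s s') p)) k)
     - of_real lam * (schr_symbol tau k * (dx_inv_symbol k * ct (convol N a (\<lambda>p. dx_inv_symbol p * ct (convol N a b) p)) k))
     - of_real lam / 2 * (dx_inv_symbol k * (dx_inv_symbol k * ct (convol N s' (\<lambda>p. schr_symbol tau p * ct (convol N a a) p)) k) - schr_symbol tau k * (dx_inv_symbol k * (dx_inv_symbol k * ct (convol N b (ct (convol N a a))) k)))
     - of_real lam / 2 * (schr_symbol tau k * (dx_inv_symbol k * ct (convol N db (\<lambda>p. schr_symbol (- tau) p * ct (convol N sg' sg') p - ct (convol N g g) p)) k))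
     - \<i> * of_real lam * of_real tau * (schr_symbol tau k * (dx_inv_symbol k * ct (convol N db (ct (convol N a a))) k))
     + 2 * \<i> * of_real lam * of_real tau * a 0 * (schr_symbol tau k * (dx_inv_symbol k * ct (convol N db a) k))
     - \<i> * of_real lam * of_real tau * (a 0)\<^sup>2 * (schr_symbol tau k * ((if k = 0 then 0 else 1) * b k)))"
    using T unfolding Psi_def Pi0f t3 e_def by blast
  have "c k = Psi_hat lam tau N P M a k" for k
  proof (cases "k \<in> ?A")
    case False
    then have "c k = 0" using c trig_poly_fourier_0 unfolding has_coeffs_def by metis
    then show ?thesis using False unfolding Psi_hat_def by auto
  next
    case kA: True
    then have ck: "ct h k = h k" for h unfolding ct_def by simp
    have cta: "ct h = (\<lambda>p. (\<lambda>_. 1) p * (if p \<in> ?A then h p else 0))" for h unfolding ct_def by auto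
    have cta': "ct h p = (if p \<in> ?A then h p else 0)" for h p unfolding ct_def by auto
    have n0: "convol N a (ct (convol N a b)) k = tri ?A (\<lambda>i j l. if i + j \<in> ?A then 1 else 0) a b a k" for k
      using convol_nest_tri1[of N "\<lambda>_. 1" a "\<lambda>_. 1" "\<lambda>_. 1" b k] unfolding cta by (simp cong: if_cong)
    show ?thesis
    proof (cases "k = 0")
      case True
      \<comment> \<open>On the mean value every term behind an antiderivative disappears, and the
        two twisted contributions add up to \<open>a 0\<close>.\<close>
      have "c k = a 0 - \<i> * of_real lam * of_real tau * convol N a (ct (convol N a b)) 0"
        unfolding ceq True dx_inv_symbol_def by (simp add: algebra_simps)
      also have "\<dots> = a 0 + (- \<i> * of_real lam * schr_symbol tau 0) * tri ?A (\<lambda>i j l. of_real tau * (if i + j \<in> ?A then 1 else 0)) a b a 0"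
        unfolding tri_m_cmult n0 by (simp add: schr_symbol_def)
      also have "tri ?A (\<lambda>i j l. of_real tau * (if i + j \<in> ?A then 1 else 0)) a b a 0 = tri ?A (sym_num tau N) a b a 0"
        by (rule tri_m_cong) (auto simp: sym_num_def)
      finally show ?thesis using kA True unfolding Psi_hat_def b_def twist_symbol_def by simp
    next
      case False
      \<comment> \<open>\<open>m1\<close>, \<open>m2\<close> and \<open>m3\<close> are the
        difference pairs with the phases 2 (i + j) (l + j), 2 k j and 2 i l. \<open>m4\<close> to
        \<open>m6\<close> are the terms proportional to \<tau>, the last two containing the mean
        value.\<close>
      define m1 where "m1 i j l = of_real lam * (dx_inv_symbol k * (if i + j \<in> ?A then dx_inv_symbol (i + j) * (schr_symbol tau i * schr_symbol (- tau) j * schr_symbol tau l) else 0)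
          - schr_symbol tau k * dx_inv_symbol k * (if i + j \<in> ?A then dx_inv_symbol (i + j) else 0))" for i j l
      define m2 where "m2 i j l = of_real lam / 2 * (dx_inv_symbol k * dx_inv_symbol k * (if i + l \<in> ?A then schr_symbol tau (i + l) * schr_symbol (- tau) j else 0)
          - schr_symbol tau k * (dx_inv_symbol k * dx_inv_symbol k) * (if i + l \<in> ?A then 1 else 0))" for i j l
      define m3 where "m3 i j l = of_real lam / 2 * (schr_symbol tau k * dx_inv_symbol k) * ((if i + l \<in> ?A then schr_symbol (- tau) (i + l) * ((schr_symbol tau i * dx_inv_symbol i) * (schr_symbol tau l * dx_inv_symbol l) * (\<i> * of_int j)) else 0)
          - (if i + l \<in> ?A then dx_inv_symbol i * dx_inv_symbol l * (\<i> * of_int j) else 0))" for i j l :: int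
      define m4 where "m4 i j l = \<i> * of_real lam * of_real tau * (schr_symbol tau k * dx_inv_symbol k) * (if i + l \<in> ?A then \<i> * of_int j else 0)" for i j l :: int
      define m5 where "m5 i j l = 2 * \<i> * of_real lam * of_real tau * (schr_symbol tau k * dx_inv_symbol k) * (if i = 0 then \<i> * of_int j else 0)" for i j l :: int
      define m6 where "m6 i j l = \<i> * of_real lam * of_real tau * schr_symbol tau k * (if i = 0 \<and> l = 0 then 1 else 0)" for i j l :: int
      have n1: "convol N s (\<lambda>p. dx_inv_symbol p * ct (convol N s s') p) k = tri ?A (\<lambda>i j l. if i + j \<in> ?A then dx_inv_symbol (i + j) * (schr_symbol tau i * schr_symbol (- tau) j * schr_symbol tau l) else 0) a b a k"
        unfolding s_def s'_def cta' by (rule convol_nest_tri1)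
      have n2: "convol N a (\<lambda>p. dx_inv_symbol p * ct (convol N a b) p) k = tri ?A (\<lambda>i j l. if i + j \<in> ?A then dx_inv_symbol (i + j) else 0) a b a k"
        using convol_nest_tri1[of N "\<lambda>_. 1" a dx_inv_symbol "\<lambda>_. 1" b k] unfolding cta' by (simp cong: if_cong)
      have n3: "convol N s' (\<lambda>p. schr_symbol tau p * ct (convol N a a) p) k = tri ?A (\<lambda>i j l. if i + l \<in> ?A then schr_symbol tau (i + l) * schr_symbol (- tau) j else 0) a b a k"
        using convol_nest_tri2[of N "schr_symbol (- tau)" b "schr_symbol tau" "\<lambda>_. 1" a k] unfolding cta' s'_def by (simp cong: if_cong)
      have n4: "convol N b (ct (convol N a a)) k = tri ?A (\<lambda>i j l. if i + l \<in> ?A then 1 else 0) a b a k"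
        using convol_nest_tri2[of N "\<lambda>_. 1" b "\<lambda>_. 1" "\<lambda>_. 1" a k] unfolding cta by (simp cong: if_cong)
      have n5: "convol N db (\<lambda>p. schr_symbol (- tau) p * ct (convol N sg' sg') p) k = tri ?A (\<lambda>i j l. if i + l \<in> ?A then schr_symbol (- tau) (i + l) * ((schr_symbol tau i * dx_inv_symbol i) * (schr_symbol tau l * dx_inv_symbol l) * (\<i> * of_int j)) else 0) a b a k"
        using convol_nest_tri2[of N "\<lambda>j. \<i> * of_int j" b "schr_symbol (- tau)" "\<lambda>i. schr_symbol tau i * dx_inv_symbol i" a k] unfolding cta' db_def sg'_def by (simp only: mult.assoc)
      have n6: "convol N db (ct (convol N g g)) k = tri ?A (\<lambda>i j l. if i + l \<in> ?A then dx_inv_symbol i * dx_inv_symbol l * (\<i> * of_int j) else 0) a b a k"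
        using convol_nest_tri2[of N "\<lambda>j. \<i> * of_int j" b "\<lambda>_. 1" dx_inv_symbol a k] unfolding cta db_def g_def by (simp cong: if_cong)
      have n7: "convol N db (ct (convol N a a)) k = tri ?A (\<lambda>i j l. if i + l \<in> ?A then \<i> * of_int j else 0) a b a k"
        using convol_nest_tri2[of N "\<lambda>j. \<i> * of_int j" b "\<lambda>_. 1" "\<lambda>_. 1" a k] unfolding cta db_def by (simp cong: if_cong)
      have n8: "a 0 * convol N db a k = tri ?A (\<lambda>i j l. if i = 0 then \<i> * of_int j else 0) a b a k"
        unfolding db_def by (rule convol_first_zero)
      have n9: "(a 0)\<^sup>2 * b k = tri ?A (\<lambda>i j l. if i = 0 \<and> l = 0 then 1 else 0) a b a k"
        by (rule tri_zero_zero[OF kA])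
      have q1: "of_real lam * (dx_inv_symbol k * convol N s (\<lambda>p. dx_inv_symbol p * ct (convol N s s') p) k) - of_real lam * (schr_symbol tau k * (dx_inv_symbol k * convol N a (\<lambda>p. dx_inv_symbol p * ct (convol N a b) p) k)) = tri ?A m1 a b a k"
        unfolding n1 n2 m1_def tri_m_diff tri_m_cmult by (simp add: algebra_simps)
      have q2: "of_real lam / 2 * (dx_inv_symbol k * (dx_inv_symbol k * convol N s' (\<lambda>p. schr_symbol tau p * ct (convol N a a) p) k) - schr_symbol tau k * (dx_inv_symbol k * (dx_inv_symbol k * convol N b (ct (convol N a a)) k))) = tri ?A m2 a b a k"
        unfolding n3 n4 m2_def tri_m_diff tri_m_cmult by (simp add: algebra_simps)
      have q3: "of_real lam / 2 * (schr_symbol tau k * (dx_inv_symbol k * convol N db (\<lambda>p. schr_symbol (- tau) p * ct (convol N sg' sg') p - ct (convol N g g) p) k)) = tri ?A m3 a b a k"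
        unfolding convol_diff2 n5 n6 m3_def tri_m_diff tri_m_cmult by (simp add: algebra_simps)
      have quartic: "\<i> * of_real lam * of_real tau * (schr_symbol tau k * (dx_inv_symbol k * convol N db (ct (convol N a a)) k)) = tri ?A m4 a b a k"
        unfolding n7 m4_def tri_m_cmult by (simp add: algebra_simps)
      have q5: "2 * \<i> * of_real lam * of_real tau * a 0 * (schr_symbol tau k * (dx_inv_symbol k * convol N db a k)) = tri ?A m5 a b a k"
        unfolding m5_def tri_m_cmult n8[symmetric] by (simp add: algebra_simps)
      have q6: "\<i> * of_real lam * of_real tau * (a 0)\<^sup>2 * (schr_symbol tau k * ((if k = 0 then 0 else 1) * b k)) = tri ?A m6 a b a k"
        unfolding m6_def tri_m_cmult n9[symmetric] using False by (simp add: algebra_simps)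
      have "c k = twist_symbol lam tau P M k * a k + (tri ?A m1 a b a k - tri ?A m2 a b a k - tri ?A m3 a b a k - tri ?A m4 a b a k + tri ?A m5 a b a k - tri ?A m6 a b a k)"
        unfolding ceq ck q1[symmetric] q2[symmetric] q3[symmetric] quartic[symmetric] q5[symmetric] q6[symmetric] twist_symbol_def using False
        by (simp only: if_False) (simp only: algebra_simps)
      also have "tri ?A m1 a b a k - tri ?A m2 a b a k - tri ?A m3 a b a k - tri ?A m4 a b a k + tri ?A m5 a b a k - tri ?A m6 a b a k
        = tri ?A (\<lambda>i j l. m1 i j l - m2 i j l - m3 i j l - m4 i j l + m5 i j l - m6 i j l) a b a k"
        unfolding tri_m_diff tri_m_add ..
      also have "\<dots> = tri ?A (\<lambda>i j l. (- \<i> * of_real lam * schr_symbol tau k) * sym_num tau N i j l) a b a k"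
      proof (rule tri_m_cong)
        fix i j l assume ijl: "i + j + l = k"
        define X1 where "X1 = (if i + j \<noteq> 0 \<and> i + j \<in> ?A then 2 * (of_int (l + j) / of_int k) * phase_int tau (2 * (i + j) * (l + j)) else 0)"
        define X2 where "X2 = (if i + l \<in> ?A then of_int j / of_int k * (- phase_int tau (2 * k * j)) else 0)"
        define X3 where "X3 = (if i + l \<in> ?A \<and> i \<noteq> 0 \<and> l \<noteq> 0 then of_int j / of_int k * (- phase_int tau (2 * i * l)) else 0)"
        define X4 where "X4 = (if i + l \<in> ?A then of_real tau * (of_int j / of_int k) else 0 :: complex)"
        define X5 where "X5 = (if i = 0 then 2 * of_real tau * (of_int j / of_int k) else 0 :: complex)"
        define X6 where "X6 = (if i = 0 \<and> l = 0 then of_real tau else 0 :: complex)"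
        have dij: "dx_inv_symbol k * (\<i> * of_int j) = of_int j / of_int k" using False by (simp add: dx_inv_symbol_def field_simps)
        have e1: "m1 i j l = (- \<i> * of_real lam * schr_symbol tau k) * X1"
        proof (cases "i + j \<noteq> 0 \<and> i + j \<in> ?A")
          case True
          then show ?thesis unfolding m1_def X1_def using sym_num_T1[OF ijl[symmetric] False, of tau] by (simp add: algebra_simps)
        next
          case f: False
          \<comment> \<open>The antiderivative annihilates the mean of |f|^2, which is how the
            scheme itself leaves out the resonance i + j = 0.\<close>
          then have "(if i + j \<in> ?A then dx_inv_symbol (i + j) else 0) = 0" by (auto simp: dx_inv_symbol_def)
          moreover from f have "(if i + j \<in> ?A then dx_inv_symbol (i + j) * (schr_symbol tau i * schr_symbol (- tau) j * schr_symbol tau l) else 0) = 0" by (auto simp: dx_inv_symbol_def)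
          ultimately show ?thesis unfolding m1_def X1_def using f by (simp only:) simp
        qed
        have e2: "- m2 i j l = (- \<i> * of_real lam * schr_symbol tau k) * X2"
        proof -
          have "- m2 i j l = - (of_real lam / 2 * (if i + l \<in> ?A then dx_inv_symbol k * (dx_inv_symbol k * (schr_symbol (- tau) j * schr_symbol tau (i + l) - schr_symbol tau k)) else 0))"
            unfolding m2_def by (simp add: algebra_simps)
          also have "\<dots> = (- \<i> * of_real lam * schr_symbol tau k) * X2"
            unfolding X2_def using sym_num_T2[OF ijl[symmetric] False, of tau] by simp
          finally show ?thesis .
        qed
        have e3: "- m3 i j l = (- \<i> * of_real lam * schr_symbol tau k) * X3"
        proof (cases "i \<noteq> 0 \<and> l \<noteq> 0")
          case True
          have "- m3 i j l = - (of_real lam / 2 * schr_symbol tau k * (if i + l \<in> ?A then dx_inv_symbol k * (\<i> * of_int j) * ((schr_symbol (- tau) (i + l) * (schr_symbol tau i * schr_symbol tau l) - 1) * (dx_inv_symbol i * dx_inv_symbol l)) else 0))"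
            unfolding m3_def by (simp add: algebra_simps)
          also have "\<dots> = (- \<i> * of_real lam * schr_symbol tau k) * X3"
            unfolding X3_def using sym_num_T3[OF False, of i l j tau] True by simp
          finally show ?thesis .
        next
          case f: False
          then have "dx_inv_symbol i * dx_inv_symbol l = 0" by (auto simp: dx_inv_symbol_def)
          then show ?thesis unfolding m3_def X3_def using f by auto
        qed
        have e4: "- m4 i j l = (- \<i> * of_real lam * schr_symbol tau k) * X4"
          unfolding m4_def X4_def dij[symmetric] by simp
        have e5: "m5 i j l = - ((- \<i> * of_real lam * schr_symbol tau k) * X5)"
          unfolding m5_def X5_def dij[symmetric] by simp
        have e6: "- m6 i j l = (- \<i> * of_real lam * schr_symbol tau k) * X6"
          unfolding m6_def X6_def by simp
        have x: "sym_num tau N i j l = X1 + X2 + X3 + X4 - X5 + X6"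
          unfolding sym_num_def Let_def ijl using False
          unfolding X1_def X2_def X3_def X4_def X5_def X6_def by (simp add: algebra_simps)
        have "m1 i j l - m2 i j l - m3 i j l - m4 i j l + m5 i j l - m6 i j l = m1 i j l + (- m2 i j l) + (- m3 i j l) + (- m4 i j l) + m5 i j l + (- m6 i j l)" by simp
        also have "\<dots> = (- \<i> * of_real lam * schr_symbol tau k) * sym_num tau N i j l"
        proof -
          have "c * X1 + c * X2 + c * X3 + c * X4 + - (c * X5) + c * X6 = c * (X1 + X2 + X3 + X4 - X5 + X6)" for c
            by (simp add: algebra_simps)
          then show ?thesis unfolding e1 e2 e3 e4 e5 e6 x .
        qed
        finally show "m1 i j l - m2 i j l - m3 i j l - m4 i j l + m5 i j l - m6 i j l = (- \<i> * of_real lam * schr_symbol tau k) * sym_num tau N i j l" .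
      qed
      finally show ?thesis unfolding Psi_hat_def tri_m_cmult b_def using kA by simp
    qed
  qed
  then show ?thesis using c unfolding has_coeffs_def by simp
qed

section \<open>Size of the oscillatory integrals and of the numerical symbol\<close>

lemma norm_phase_minus_1: "norm (phase t x - 1) \<le> \<bar>t * of_int x\<bar>" "norm (phase t x - 1) \<le> 2"
proof -
  have "norm (phase t x - 1) = 2 * \<bar>sin (t * of_int x / 2)\<bar>"
    unfolding phase_def by (rule dist_exp_i_1)
  also have "\<dots> \<le> 2 * \<bar>t * of_int x / 2\<bar>" by (intro mult_left_mono abs_sin_x_le_abs_x) auto
  finally show "norm (phase t x - 1) \<le> \<bar>t * of_int x\<bar>" by simp
  show "norm (phase t x - 1) \<le> 2"
    using norm_triangle_ineq4[of "phase t x" 1] by (simp add: phase_def)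
qed

lemma norm_phase [simp]: "norm (phase t x) = 1" by (simp add: phase_def)

lemma phase_int_norm: "0 \<le> t \<Longrightarrow> norm (phase_int t x) \<le> t"
  using norm_phase_minus_1(1)[of t x] by (auto simp: phase_int_def norm_divide norm_mult divide_le_eq abs_mult)

lemma continuous_on_phase [continuous_intros]: "continuous_on S (\<lambda>s. phase s x)"
  unfolding phase_def by (intro continuous_intros)

lemma phase_int_has_integral:
  assumes "0 \<le> t" shows "((\<lambda>s. phase s x) has_integral phase_int t x) {0..t}"
proof (cases "x = 0")
  case True
  then show ?thesis using has_integral_const_real[of "1::complex" 0 t] assms by (simp add: phase_def phase_int_def scaleR_conv_of_real)
next
  case False
  have "((\<lambda>s. phase s x) has_integral (phase t x / (\<i> * of_int x) - phase 0 x / (\<i> * of_int x))) {0..t}"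
  proof (rule fundamental_theorem_of_calculus[OF assms])
    fix s assume "s \<in> {0..t}"
    have "((\<lambda>z. exp (\<i> * (z * of_int x))) has_field_derivative \<i> * of_int x * exp (\<i> * (of_real s * of_int x))) (at (of_real s))"
      by (auto intro!: derivative_eq_intros)
    from has_vector_derivative_real_field[OF this, of "{0..t}"]
    have "((\<lambda>s. phase s x) has_vector_derivative \<i> * of_int x * phase s x) (at s within {0..t})"
      unfolding phase_def by simp
    from has_vector_derivative_divide[OF this, of "\<i> * of_int x"]
    show "((\<lambda>s. phase s x / (\<i> * of_int x)) has_vector_derivative phase s x) (at s within {0..t})"
      using False by simp
  qed
  moreover have "phase t x / (\<i> * of_int x) - phase 0 x / (\<i> * of_int x) = phase_int t x"
    using False by (simp add: phase_int_def phase_def diff_divide_distrib)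
  ultimately show ?thesis by simp
qed

lemma phase_add: "phase t (x + y) = phase t x * phase t y"
  by (simp add: phase_def algebra_simps flip: exp_add)

lemma phase_int_minus_t:
  assumes "0 \<le> t" shows "norm (phase_int t x - of_real t) \<le> t * (t * \<bar>of_int x\<bar>)"
proof -
  have h: "((\<lambda>s. phase s x - phase s 0) has_integral (phase_int t x - phase_int t 0)) {0..t}"
    by (intro has_integral_diff phase_int_has_integral assms)
  have "norm (phase_int t x - phase_int t 0) \<le> (t * \<bar>of_int x\<bar>) * measure lborel (cbox 0 t)"
  proof (rule has_integral_bound)
    show "((\<lambda>s. phase s x - phase s 0) has_integral (phase_int t x - phase_int t 0)) (cbox 0 t)" using h by simp
    fix s assume "s \<in> cbox 0 t"
    then have "\<bar>s * of_int x\<bar> \<le> t * \<bar>of_int x\<bar>" by (auto simp: abs_mult intro!: mult_right_mono)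
    then show "norm (phase s x - phase s 0) \<le> t * \<bar>of_int x\<bar>"
      using norm_phase_minus_1(1)[of s x] by (simp add: phase_def)
  qed (use assms in auto)
  then show ?thesis using assms by (simp add: phase_int_def mult_ac)
qed

text \<open>The left-hand side is the integral of \<open>(phase s x - 1) * (phase s y - 1)\<close>,
  so each factor may be bounded by 2 or by its argument independently of the other.\<close>

lemma phase_int_product:
  assumes "0 \<le> t"
  shows "norm (phase_int t (x + y) - phase_int t x - phase_int t y + of_real t) \<le> t * (min 2 (t * \<bar>of_int x\<bar>) * min 2 (t * \<bar>of_int y\<bar>))"
proof -
  have h: "((\<lambda>s. phase s (x + y) - phase s x - phase s y + phase s 0) has_integral (phase_int t (x + y) - phase_int t x - phase_int t y + phase_int t 0)) {0..t}"
    by (intro has_integral_diff has_integral_add phase_int_has_integral assms)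
  have b: "norm (phase s x - 1) \<le> min 2 (t * \<bar>of_int x\<bar>)" if "s \<in> cbox 0 t" for s x
  proof -
    have "\<bar>s * of_int x\<bar> \<le> t * \<bar>of_int x\<bar>" using that by (auto simp: abs_mult intro!: mult_right_mono)
    then show ?thesis using norm_phase_minus_1[of s x] by simp
  qed
  have "norm (phase_int t (x + y) - phase_int t x - phase_int t y + phase_int t 0) \<le> (min 2 (t * \<bar>of_int x\<bar>) * min 2 (t * \<bar>of_int y\<bar>)) * measure lborel (cbox 0 t)"
  proof (rule has_integral_bound)
    show "((\<lambda>s. phase s (x + y) - phase s x - phase s y + phase s 0) has_integral (phase_int t (x + y) - phase_int t x - phase_int t y + phase_int t 0)) (cbox 0 t)" using h by simp
    fix s assume s: "s \<in> cbox 0 t"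
    have "phase s (x + y) - phase s x - phase s y + phase s 0 = (phase s x - 1) * (phase s y - 1)"
      unfolding phase_add by (simp add: phase_def algebra_simps)
    then have "norm (phase s (x + y) - phase s x - phase s y + phase s 0) = norm (phase s x - 1) * norm (phase s y - 1)" by (simp add: norm_mult)
    also have "\<dots> \<le> min 2 (t * \<bar>of_int x\<bar>) * min 2 (t * \<bar>of_int y\<bar>)"
      using assms by (intro mult_mono b s) auto
    finally show "norm (phase s (x + y) - phase s x - phase s y + phase s 0) \<le> min 2 (t * \<bar>of_int x\<bar>) * min 2 (t * \<bar>of_int y\<bar>)" .
  qed (use assms in auto)
  then show ?thesis using assms by (simp add: phase_int_def mult_ac)
qed

text \<open>The ratio of jb k to |k| is largest at |k| = 1, where it is sqrt 2 < 3 / 2.\<close>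

lemma inverse_abs_le_jb:
  assumes "k \<noteq> 0" shows "1 / \<bar>of_int k\<bar> \<le> (3 / 2) / jb k"
proof -
  have "1 \<le> \<bar>real_of_int k\<bar>" using assms by linarith
  then have "1 \<le> (real_of_int k)\<^sup>2" using power_mono[of 1 "\<bar>real_of_int k\<bar>" 2] by simp
  then have "jb k \<le> (3 / 2) * \<bar>of_int k\<bar>"
    unfolding jb_def by (intro real_le_lsqrt) (auto simp: power_mult_distrib power2_eq_square)
  then show ?thesis using assms by (simp add: field_simps)
qed

lemma quotient_le_jb:
  assumes "k \<noteq> 0" "\<bar>x\<bar> \<le> S" shows "norm (complex_of_real x / of_int k) \<le> (3 / 2) * (S / jb k)"
proof -
  have "norm (complex_of_real x / of_int k) = \<bar>x\<bar> * (1 / \<bar>of_int k\<bar>)" by (simp add: norm_divide)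
  also have "\<dots> \<le> S * ((3 / 2) / jb k)" using assms by (intro mult_mono inverse_abs_le_jb) auto
  finally show ?thesis by simp
qed

lemma jb_sum_ge: "jb (i + j + l) \<le> jb i + jb j + jb l"
  using jb_add[of "i + j" l] jb_add[of i j] by linarith

lemma jb_sum_quot_ge_1: "1 \<le> (jb i + jb j + jb l) / jb (i + j + l)"
  using jb_sum_ge[of i j l] by (simp add: le_divide_eq)

lemma abs_of_int_le_jb_sum:
  "\<bar>real_of_int j\<bar> \<le> jb i + jb j + jb l" "\<bar>real_of_int (i + j)\<bar> \<le> jb i + jb j + jb l" "\<bar>real_of_int (l + j)\<bar> \<le> jb i + jb j + jb l"
  using abs_le_jb[of i] abs_le_jb[of j] abs_le_jb[of l] jb_nonneg[of i] jb_nonneg[of j] jb_nonneg[of l]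
  unfolding of_int_add by linarith+

text \<open>The quotients j / k and (l + j) / k cost 3 / 2 times the admissible weight and every
  oscillatory integral costs t. The four parts contribute 3, 9/2, 3 and 1, rounded up to 12.\<close>

lemma admissible_sym_num:
  assumes t: "0 \<le> t" shows "admissible (12 * t) (sym_num t N)"
  unfolding admissible_def
proof (intro allI)
  fix i j l :: int
  define k where "k = i + j + l"
  define R where "R = (jb i + jb j + jb l) / jb k"
  have R1: "1 \<le> R" unfolding R_def k_def by (rule jb_sum_quot_ge_1)
  show "norm (sym_num t N i j l) \<le> 12 * t * ((jb i + jb j + jb l) / jb (i + j + l))"
    unfolding k_def[symmetric] R_def[symmetric]
  proof (cases "k = 0")
    case True
    have "t * 1 \<le> t * (12 * R)" using R1 t by (intro mult_left_mono) auto
    then show "norm (sym_num t N i j l) \<le> 12 * t * R"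
      using True t unfolding sym_num_def Let_def k_def by (auto simp: mult_ac)
  next
    case False
    define q1 q2 where "q1 = complex_of_int (l + j) / of_int k" and "q2 = complex_of_int j / of_int k"
    have q1: "norm q1 \<le> (3 / 2) * R" and q2: "norm q2 \<le> (3 / 2) * R"
      unfolding q1_def q2_def R_def using quotient_le_jb[OF False abs_of_int_le_jb_sum(3)] quotient_le_jb[OF False abs_of_int_le_jb_sum(1)]
      by (simp_all only: of_real_of_int_eq)
    define X1 where "X1 = (if i + j \<noteq> 0 \<and> i + j \<in> freqs N then 2 * q1 * phase_int t (2 * (i + j) * (l + j)) else 0)"
    define X2 where "X2 = (if i + l \<in> freqs N then q2 * (of_real t - phase_int t (2 * k * j) - (if i \<noteq> 0 \<and> l \<noteq> 0 then phase_int t (2 * i * l) else 0)) else 0)"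
    define X3 where "X3 = (if i = 0 then 2 * of_real t * q2 else 0)"
    define X4 where "X4 = (if i = 0 \<and> l = 0 then of_real t else 0 :: complex)"
    have x: "sym_num t N i j l = X1 + X2 - X3 + X4"
      using False unfolding sym_num_def Let_def k_def[symmetric] X1_def X2_def X3_def X4_def q1_def q2_def by simp
    have RR: "0 \<le> (3/2) * R" using R1 by simp
    have "norm (2 * q1 * phase_int t (2 * (i + j) * (l + j))) \<le> 2 * ((3 / 2) * R) * t"
      unfolding norm_mult using q1 phase_int_norm[OF t] RR by (intro mult_mono) auto
    then have 1: "norm X1 \<le> 3 * (R * t)" unfolding X1_def using R1 t by auto
    have "norm (of_real t - phase_int t (2 * k * j) - (if i \<noteq> 0 \<and> l \<noteq> 0 then phase_int t (2 * i * l) else 0)) \<le> 3 * t"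
    proof -
      have "norm (if i \<noteq> 0 \<and> l \<noteq> 0 then phase_int t (2 * i * l) else 0) \<le> t" using phase_int_norm[OF t] t by auto
      then show ?thesis using norm_triangle_ineq4[of "of_real t - phase_int t (2 * k * j)" "if i \<noteq> 0 \<and> l \<noteq> 0 then phase_int t (2 * i * l) else 0"]
        norm_triangle_ineq4[of "of_real t" "phase_int t (2 * k * j)"] phase_int_norm[OF t, of "2 * k * j"] t by simp
    qed
    then have "norm (q2 * (of_real t - phase_int t (2 * k * j) - (if i \<noteq> 0 \<and> l \<noteq> 0 then phase_int t (2 * i * l) else 0))) \<le> ((3 / 2) * R) * (3 * t)"
      unfolding norm_mult using q2 RR by (intro mult_mono) auto
    then have 2: "norm X2 \<le> (9 / 2) * (R * t)" unfolding X2_def using R1 t by (auto simp: mult_ac)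
    have "norm (2 * of_real t * q2) \<le> 2 * t * ((3 / 2) * R)"
      unfolding norm_mult using q2 t by (intro mult_mono) auto
    then have 3: "norm X3 \<le> 3 * (R * t)" unfolding X3_def using R1 t by (auto simp: mult_ac)
    have "t * 1 \<le> t * R" using R1 t by (intro mult_left_mono) auto
    then have 4: "norm X4 \<le> R * t" unfolding X4_def using t R1 by (auto simp: mult_ac)
    have "norm (X1 + X2 - X3 + X4) \<le> norm X1 + norm X2 + norm X3 + norm X4"
      using norm_triangle_ineq[of "X1 + X2 - X3" X4] norm_triangle_ineq4[of "X1 + X2" X3] norm_triangle_ineq[of X1 X2] by linarith
    also have "\<dots> \<le> 12 * (R * t)" using 1 2 3 4 R1 t mult_nonneg_nonneg[of R t] by linarith
    also have "\<dots> = 12 * t * R" by simp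
    finally show "norm (sym_num t N i j l) \<le> 12 * t * R" unfolding x .
  qed
qed

section \<open>Exact, numerical and defect symbols\<close>

text \<open>\<open>sym_res\<close> collects the resonances \<open>i + j = 0\<close> and \<open>l + j = 0\<close> that the twisted propagator takes over,
  \<open>sym_log\<close> is the defect of the product splitting, and \<open>sym_cut\<close> stems from the inner projections \<open>\<Pi>\<^sub>N\<close>.\<close>

definition sym_exact :: "real \<Rightarrow> int \<Rightarrow> int \<Rightarrow> int \<Rightarrow> complex" where
  "sym_exact t i j l = phase_int t (2 * (i + j) * (l + j))"

definition sym_res :: "real \<Rightarrow> int \<Rightarrow> int \<Rightarrow> int \<Rightarrow> complex" where
  "sym_res t i j l = (if i + j + l \<noteq> 0 \<and> i + j = 0 then 2 * of_real t * (of_int (l + j) / of_int (i + j + l)) else 0)"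

definition sym_log :: "real \<Rightarrow> int \<Rightarrow> int \<Rightarrow> int \<Rightarrow> complex" where
  "sym_log t i j l = (let k = i + j + l in
     if k = 0 then phase_int t (2 * (i + j) * (l + j)) - of_real t
     else - (of_int j / of_int k * (phase_int t (2 * (i + j) * (l + j)) - phase_int t (2 * i * l) - phase_int t (2 * k * j) + of_real t)))"

definition sym_cut :: "real \<Rightarrow> nat \<Rightarrow> int \<Rightarrow> int \<Rightarrow> int \<Rightarrow> complex" where
  "sym_cut t N i j l = (let k = i + j + l in
     if k = 0 then (if i + j \<in> freqs N then 0 else of_real t)
     else (if i + j \<in> freqs N then 0 else of_int (l + j) / of_int k * phase_int t (2 * (i + j) * (l + j)))
       + (if l + j \<in> freqs N then 0 else of_int (i + j) / of_int k * phase_int t (2 * (i + j) * (l + j)))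
       + (if i + l \<in> freqs N then 0 else of_int j / of_int k * (of_real t - phase_int t (2 * k * j) - (if i \<noteq> 0 \<and> l \<noteq> 0 then phase_int t (2 * i * l) else 0))))"

text \<open>The two sides agree only after symmetrisation in \<open>i \<leftrightarrow> l\<close>, which the equality of the two outer
  arguments permits.\<close>

lemma tri_sym_exact_decompose:
  "tri A (sym_exact t) a b a k - (tri A (sym_num t N) a b a k + tri A (sym_res t) a b a k) = tri A (sym_log t) a b a k + tri A (sym_cut t N) a b a k"
proof -
  \<comment> \<open>\<open>sym_num\<close> and \<open>sym_res\<close> contain certain terms twice in
    place of a term and its mirror image. \<open>U\<close> is one copy of these and \<open>V\<close>
    the remainder, so one copy can be traded for its reflection at no cost.\<close>
  define U where "U i j l = (if i + j + l = 0 then 0 else (if i + j \<in> freqs N then of_int (l + j) / of_int (i + j + l) * phase_int t (2 * (i + j) * (l + j)) else 0)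
     - (if i = 0 then of_real t * (of_int j / of_int (i + j + l)) else 0))" for i j l
  define V where "V i j l = sym_num t N i j l + sym_res t i j l - U i j l - U i j l" for i j l
  have sw: "tri A (\<lambda>i j l. U l j i) a b a k = tri A U a b a k"
    using tri_swap13[of A U a b a k] by simp
  have "tri A (sym_num t N) a b a k + tri A (sym_res t) a b a k = tri A U a b a k + tri A (\<lambda>i j l. U l j i) a b a k + tri A V a b a k"
    unfolding sw V_def tri_m_diff tri_m_add by simp
  then have "tri A (sym_exact t) a b a k - (tri A (sym_num t N) a b a k + tri A (sym_res t) a b a k) =
     tri A (\<lambda>i j l. sym_exact t i j l - (U i j l + U l j i + V i j l)) a b a k"
    unfolding tri_m_diff tri_m_add by simp
  also have "\<dots> = tri A (\<lambda>i j l. sym_log t i j l + sym_cut t N i j l) a b a k"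
  proof (rule tri_m_cong)
    fix i j l :: int
    define k where "k = i + j + l"
    have k': "l + j + i = k" "i + j + l = k" unfolding k_def by (simp_all add: add_ac)
    show "sym_exact t i j l - (U i j l + U l j i + V i j l) = sym_log t i j l + sym_cut t N i j l"
    proof (cases "k = 0")
      case True
      then show ?thesis unfolding V_def sym_num_def sym_res_def U_def sym_log_def sym_cut_def sym_exact_def Let_def k' by simp
    next
      case False
      define p1 p2 p3 where "p1 = phase_int t (2 * (i + j) * (l + j))" and "p2 = phase_int t (2 * i * l)" and "p3 = phase_int t (2 * k * j)"
      have p1': "phase_int t (2 * (l + j) * (i + j)) = p1"
      proof -
        have "2 * (l + j) * (i + j) = 2 * (i + j) * (l + j)" by (simp add: algebra_simps)
        then show ?thesis unfolding p1_def by (simp only:)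
      qed
      define q1 q2 q3 where "q1 = complex_of_int (l + j) / of_int k" and "q2 = complex_of_int (i + j) / of_int k" and "q3 = complex_of_int j / of_int k"
      have q: "q1 + q2 - q3 = 1"
      proof -
        have "q1 + q2 - q3 = complex_of_int ((l + j) + (i + j) - j) / of_int k"
          unfolding q1_def q2_def q3_def of_int_add of_int_diff add_divide_distrib diff_divide_distrib ..
        also have "(l + j) + (i + j) - j = k" unfolding k_def by simp
        finally show ?thesis using False by simp
      qed
      have res: "i + j = 0 \<Longrightarrow> p1 = of_real t" unfolding p1_def by (simp add: phase_int_def)
      \<comment> \<open>When i or l vanishes the phase 2 i l is trivial, but the antiderivatives in
        the scheme delete this contribution. The terms with \<Pi>_0 f restore it: once for i = 0,
        once for l = 0, and the last term corrects the double count at i = l = 0, where j / k =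
        1.\<close>
      have z: "i = 0 \<or> l = 0 \<Longrightarrow> p2 = of_real t" unfolding p2_def by (auto simp: phase_int_def)
      have zz: "i = 0 \<Longrightarrow> l = 0 \<Longrightarrow> q3 = 1" unfolding q3_def using False by (auto simp: k_def)
      define Uc where "Uc = (if i + j \<in> freqs N then q1 * p1 else 0)"
      define Vc where "Vc = (if l + j \<in> freqs N then q2 * p1 else 0)"
      define Wc where "Wc = (if i + l \<in> freqs N then q3 * (of_real t - p3 - (if i \<noteq> 0 \<and> l \<noteq> 0 then p2 else 0)) else 0)"
      have U1: "U i j l = Uc - (if i = 0 then of_real t * q3 else 0)"
        unfolding U_def k' p1_def[symmetric] q1_def[symmetric] q3_def[symmetric] Uc_def using False by simp
      have U2: "U l j i = Vc - (if l = 0 then of_real t * q3 else 0)"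
        unfolding U_def k' p1' q2_def[symmetric] q3_def[symmetric] Vc_def using False by simp
      have X: "sym_num t N i j l + sym_res t i j l = 2 * Uc + Wc - (if i = 0 then 2 * of_real t * q3 else 0) + (if i = 0 \<and> l = 0 then of_real t else 0)"
        unfolding sym_num_def sym_res_def Let_def k' p1_def[symmetric] p2_def[symmetric] p3_def[symmetric] q1_def[symmetric] q3_def[symmetric] Uc_def Wc_def
        using False res by simp
      have xl: "sym_log t i j l = - (q3 * (p1 - p2 - p3 + of_real t))"
        unfolding sym_log_def Let_def k' p1_def[symmetric] p2_def[symmetric] p3_def[symmetric] q3_def[symmetric] using False by simp
      have xc: "sym_cut t N i j l = (q1 * p1 - Uc) + (q2 * p1 - Vc) + (q3 * (of_real t - p3 - (if i \<noteq> 0 \<and> l \<noteq> 0 then p2 else 0)) - Wc)"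
        unfolding sym_cut_def Let_def k' p1_def[symmetric] p2_def[symmetric] p3_def[symmetric] q1_def[symmetric] q2_def[symmetric] q3_def[symmetric] Uc_def Vc_def Wc_def
        using False by simp
      have p: "sym_exact t i j l = (q1 + q2 - q3) * p1" unfolding q sym_exact_def p1_def by simp
      show ?thesis
        unfolding V_def U2 p xl xc X unfolding U1
        using z zz by (cases "i = 0"; cases "l = 0") (simp_all add: algebra_simps)
    qed
  qed
  finally show ?thesis by (simp add: tri_m_add)
qed

text \<open>The condition i + j = 0 forces l = k and pairs a i with its own conjugate. The
  resonances therefore act on a k as a real scalar built from mass and momentum, with (l + j) / k =
  1 - i / k.\<close>

lemma tri_sym_res:
  assumes k: "k \<in> freqs N"
  shows "tri (freqs N) (sym_res t) a (conj_coeffs a) a k =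
    (if k = 0 then 0 else of_real (2 * t * ((\<Sum>i\<in>freqs N. (norm (a i))\<^sup>2) - (\<Sum>i\<in>freqs N. of_int i * (norm (a i))\<^sup>2) / of_int k)) * a k)"
proof -
  let ?A = "freqs N"
  have "tri ?A (sym_res t) a (conj_coeffs a) a k = (\<Sum>i\<in>?A. if k = 0 then 0 else of_real (2 * t * ((norm (a i))\<^sup>2 - of_int i * (norm (a i))\<^sup>2 / of_int k)) * a k)"
    unfolding tri_def s3_def
  proof (rule sum.cong[OF refl])
    fix i assume i: "i \<in> ?A"
    have "(\<Sum>j\<in>?A. \<Sum>l\<in>?A. if i + j + l = k then sym_res t i j l * (a i * conj_coeffs a j * a l) else 0) =
      (\<Sum>j\<in>?A. if j = - i then \<Sum>l\<in>?A. if l = k then (if k = 0 then 0 else 2 * of_real t * (of_int (k - i) / of_int k)) * (a i * cnj (a i) * a k) else 0 else 0)"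
    proof (rule sum.cong[OF refl])
      fix j
      show "(\<Sum>l\<in>?A. if i + j + l = k then sym_res t i j l * (a i * conj_coeffs a j * a l) else 0) =
        (if j = - i then \<Sum>l\<in>?A. if l = k then (if k = 0 then 0 else 2 * of_real t * (of_int (k - i) / of_int k)) * (a i * cnj (a i) * a k) else 0 else 0)"
        by (cases "j = - i") (auto simp: sym_res_def conj_coeffs_def intro!: sum.cong sum.neutral)
    qed
    also have "\<dots> = (if k = 0 then 0 else 2 * of_real t * (of_int (k - i) / of_int k)) * (a i * cnj (a i) * a k)"
      using i k by (simp add: sum.delta)
    also have "\<dots> = (if k = 0 then 0 else of_real (2 * t * ((norm (a i))\<^sup>2 - of_int i * (norm (a i))\<^sup>2 / of_int k)) * a k)"
      unfolding complex_norm_square[symmetric] by (simp add: field_simps)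
    finally show "(\<Sum>j\<in>?A. \<Sum>l\<in>?A. if i + j + l = k then sym_res t i j l * (a i * conj_coeffs a j * a l) else 0) =
      (if k = 0 then 0 else of_real (2 * t * ((norm (a i))\<^sup>2 - of_int i * (norm (a i))\<^sup>2 / of_int k)) * a k)" .
  qed
  also have "\<dots> = (if k = 0 then 0 else of_real (2 * t * ((\<Sum>i\<in>?A. (norm (a i))\<^sup>2) - (\<Sum>i\<in>?A. of_int i * (norm (a i))\<^sup>2) / of_int k)) * a k)"
  proof -
    have "(\<Sum>i\<in>?A. 2 * t * ((norm (a i))\<^sup>2 - of_int i * (norm (a i))\<^sup>2 / of_int k)) =
      2 * t * ((\<Sum>i\<in>?A. (norm (a i))\<^sup>2) - (\<Sum>i\<in>?A. of_int i * (norm (a i))\<^sup>2) / of_int k)"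
      by (simp only: sum_distrib_left[symmetric] sum_subtractf sum_divide_distrib)
    then show ?thesis
      by (cases "k = 0", simp, simp only: if_False sum_distrib_right[symmetric] of_real_sum[symmetric])
  qed
  finally show ?thesis .
qed

lemma tri_sym_log_bound:
  assumes t: "0 < t" "t \<le> 1 / 3"
  shows "l2 (freqs N) (tri (freqs N) (sym_log t) a b d) \<le> 180 * (t\<^sup>2 * sqrt (ln (1 / t))) * (h1 (freqs N) a * h1 (freqs N) b * h1 (freqs N) d)"
proof -
  let ?A = "freqs N"
  \<comment> \<open>The length t of the time interval and the factor 2 in each of the phases 2 i l
    and 2 k j are scaled out: min(2, 2 x) = 2 min(1, x) occurs twice.\<close>
  define m where "m i j l = sym_log t i j l / of_real (4 * t)" for i j l
  have m2: "min 2 (2 * x) = 2 * min 1 x" for x :: real by (auto simp: min_def)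
  have "l2 ?A (tri ?A m a b d) \<le> 45 * (t * sqrt (ln (1 / t))) * (h1 ?A a * h1 ?A b * h1 ?A d)"
  proof (rule tri_log_bound[OF t])
    fix i j l :: int
    define k where "k = i + j + l"
    assume "i + j + l \<noteq> 0"
    then have k0: "k \<noteq> 0" unfolding k_def by simp
    have arg: "2 * (i + j) * (l + j) = 2 * i * l + 2 * k * j" unfolding k_def by (simp add: algebra_simps)
    have "norm (sym_log t i j l) \<le> \<bar>of_int j\<bar> / \<bar>of_int k\<bar> * (t * (min 2 (t * \<bar>of_int (2 * i * l)\<bar>) * min 2 (t * \<bar>of_int (2 * k * j)\<bar>)))"
      unfolding sym_log_def Let_def k_def[symmetric] arg using k0 t
      by (simp only: if_False norm_minus_cancel norm_mult norm_divide norm_of_int) (intro mult_left_mono phase_int_product, auto)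
    also have "\<dots> = 4 * t * (\<bar>of_int j\<bar> / \<bar>of_int k\<bar> * (min 1 (t * \<bar>of_int (i * l)\<bar>) * min 1 (t * \<bar>of_int (k * j)\<bar>)))"
      using m2[of "t * \<bar>of_int (i * l)\<bar>"] m2[of "t * \<bar>of_int (k * j)\<bar>"] by (simp add: abs_mult mult_ac)
    finally show "norm (m i j l) \<le> \<bar>of_int j\<bar> / \<bar>of_int (i + j + l)\<bar> * (min 1 (t * \<bar>of_int (i * l)\<bar>) * min 1 (t * \<bar>of_int ((i + j + l) * j)\<bar>))"
      unfolding m_def k_def[symmetric] norm_divide using t by (simp add: divide_le_eq mult_ac)
  next
    fix i j l :: int
    assume k: "i + j + l = 0"
    have e: "i + j = - l" "l + j = - i" using k by linarith+
    have arg: "2 * (i + j) * (l + j) = 2 * i * l" unfolding e by simp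
    have "norm (sym_log t i j l) \<le> t * (t * \<bar>of_int (2 * i * l)\<bar>)"
      unfolding sym_log_def Let_def k arg using phase_int_minus_t[of t "2 * i * l"] t by simp
    also have "\<dots> \<le> 4 * t * (t * \<bar>of_int (i * l)\<bar>)" using t by (simp add: abs_mult)
    finally show "norm (m i j l) \<le> t * \<bar>of_int (i * l)\<bar>"
      unfolding m_def norm_divide using t by (simp add: divide_le_eq mult_ac)
  qed
  moreover have "l2 ?A (tri ?A (sym_log t) a b d) = 4 * t * l2 ?A (tri ?A m a b d)"
  proof -
    have "tri ?A (sym_log t) a b d k = of_real (4 * t) * tri ?A m a b d k" for k
      unfolding tri_m_cmult[symmetric] m_def using t by simp
    then have "l2 ?A (tri ?A (sym_log t) a b d) = L2_set (\<lambda>k. (4 * t) * norm (tri ?A m a b d k)) ?A"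
      unfolding l2_def using t by (simp add: norm_mult)
    then show ?thesis unfolding l2_def using t by (simp add: L2_set_right_distrib)
  qed
  ultimately have "l2 ?A (tri ?A (sym_log t) a b d) \<le> 4 * t * (45 * (t * sqrt (ln (1 / t))) * (h1 ?A a * h1 ?A b * h1 ?A d))"
    using t by simp
  then show ?thesis by (simp add: power2_eq_square mult_ac)
qed

text \<open>The symbol is nonzero only if some pair of input frequencies leaves the range of
  \<Pi>_N, and then jb i + jb j + jb l is at least N. Inserting this sum divided by N buys the rate
  for one more power of the weight, which \<open>tri_cut_bound\<close> affords. The parts of the
  symbol contribute 3/2 + 3/2 + 9/2, rounded up to 8.\<close>

lemma tri_sym_cut_bound:
  assumes t: "0 \<le> t" and N: "N \<ge> 1"
  shows "l2 (freqs N) (tri (freqs N) (sym_cut t N) a b d) \<le> 1944 * (t / real N) * (h1 (freqs N) a * h1 (freqs N) b * h1 (freqs N) d)"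
proof -
  let ?A = "freqs N"
  have "l2 ?A (tri ?A (sym_cut t N) a b d) \<le> 243 * (8 * t / real N) * (h1 ?A a * h1 ?A b * h1 ?A d)"
  proof (rule tri_cut_bound)
    fix i j l assume il: "i \<in> ?A" "l \<in> ?A"
    define k where "k = i + j + l"
    define S where "S = jb i + jb j + jb l"
    define R where "R = S / jb k"
    have R1: "1 \<le> R" unfolding R_def S_def k_def by (rule jb_sum_quot_ge_1)
    show "norm (sym_cut t N i j l) \<le> 8 * t / real N * ((jb i + jb j + jb l)\<^sup>2 / jb (i + j + l))"
    proof (cases "i + j \<in> ?A \<and> l + j \<in> ?A \<and> i + l \<in> ?A")
      case True
      then have "sym_cut t N i j l = 0" unfolding sym_cut_def Let_def by simp
      then show ?thesis using t by simp
    next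
      case False
      have big: "real N \<le> S"
      proof -
        have "real N \<le> \<bar>real_of_int i\<bar> + \<bar>real_of_int j\<bar> + \<bar>real_of_int l\<bar>" using False by auto
        also have "\<dots> \<le> S" unfolding S_def by (intro add_mono abs_le_jb)
        finally show ?thesis .
      qed
      have "norm (sym_cut t N i j l) \<le> 8 * t * R"
      proof (cases "k = 0")
        case True
        have "t * 1 \<le> t * (8 * R)" using R1 t by (intro mult_left_mono) auto
        then show ?thesis using True t unfolding sym_cut_def Let_def k_def by (auto simp: mult_ac)
      next
        case k0: False
        define q1 q2 q3 where "q1 = complex_of_int (l + j) / of_int k" and "q2 = complex_of_int (i + j) / of_int k" and "q3 = complex_of_int j / of_int k"
        have q: "norm q1 \<le> (3 / 2) * R" "norm q2 \<le> (3 / 2) * R" "norm q3 \<le> (3 / 2) * R"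
          unfolding q1_def q2_def q3_def R_def S_def using quotient_le_jb[OF k0 abs_of_int_le_jb_sum(3)] quotient_le_jb[OF k0 abs_of_int_le_jb_sum(2)] quotient_le_jb[OF k0 abs_of_int_le_jb_sum(1)]
          by (simp_all only: of_real_of_int_eq)
        define X1 where "X1 = (if i + j \<in> ?A then 0 else q1 * phase_int t (2 * (i + j) * (l + j)))"
        define X2 where "X2 = (if l + j \<in> ?A then 0 else q2 * phase_int t (2 * (i + j) * (l + j)))"
        define X3 where "X3 = (if i + l \<in> ?A then 0 else q3 * (of_real t - phase_int t (2 * k * j) - (if i \<noteq> 0 \<and> l \<noteq> 0 then phase_int t (2 * i * l) else 0)))"
        have x: "sym_cut t N i j l = X1 + X2 + X3"
          using k0 unfolding sym_cut_def Let_def k_def[symmetric] X1_def X2_def X3_def q1_def q2_def q3_def by simp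
        have RR: "0 \<le> (3/2) * R" using R1 by simp
        have "norm (q1 * phase_int t (2 * (i + j) * (l + j))) \<le> ((3 / 2) * R) * t" "norm (q2 * phase_int t (2 * (i + j) * (l + j))) \<le> ((3 / 2) * R) * t"
          unfolding norm_mult by (intro mult_mono q phase_int_norm[OF t] RR norm_ge_zero)+
        then have 1: "norm X1 \<le> (3/2) * (R * t)" "norm X2 \<le> (3/2) * (R * t)" unfolding X1_def X2_def using R1 t by auto
        have "norm (of_real t - phase_int t (2 * k * j) - (if i \<noteq> 0 \<and> l \<noteq> 0 then phase_int t (2 * i * l) else 0)) \<le> 3 * t"
        proof -
          have "norm (if i \<noteq> 0 \<and> l \<noteq> 0 then phase_int t (2 * i * l) else 0) \<le> t" using phase_int_norm[OF t] t by auto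
          then show ?thesis using norm_triangle_ineq4[of "of_real t - phase_int t (2 * k * j)" "if i \<noteq> 0 \<and> l \<noteq> 0 then phase_int t (2 * i * l) else 0"]
            norm_triangle_ineq4[of "of_real t" "phase_int t (2 * k * j)"] phase_int_norm[OF t, of "2 * k * j"] t by simp
        qed
        then have "norm (q3 * (of_real t - phase_int t (2 * k * j) - (if i \<noteq> 0 \<and> l \<noteq> 0 then phase_int t (2 * i * l) else 0))) \<le> ((3 / 2) * R) * (3 * t)"
          unfolding norm_mult using q RR by (intro mult_mono) auto
        then have 2: "norm X3 \<le> (9 / 2) * (R * t)" unfolding X3_def using R1 t by (auto simp: mult_ac)
        have "norm (X1 + X2 + X3) \<le> norm X1 + norm X2 + norm X3"
          using norm_triangle_ineq[of "X1 + X2" X3] norm_triangle_ineq[of X1 X2] by linarith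
        also have "\<dots> \<le> 8 * (R * t)" using 1 2 mult_nonneg_nonneg[of R t] R1 t by linarith
        finally show ?thesis unfolding x by (simp add: mult_ac)
      qed
      also have "\<dots> \<le> 8 * t * R * (S / real N)"
        using big N t R1 mult_left_mono[of 1 "S / real N" "8 * t * R"] by (simp add: le_divide_eq)
      also have "\<dots> = 8 * t / real N * (S\<^sup>2 / jb k)" unfolding R_def by (simp add: power2_eq_square mult_ac)
      finally show ?thesis unfolding S_def k_def .
    qed
  qed (use t in auto)
  then show ?thesis by simp
qed

text \<open>The momentum parameter has the form -i Q with Q real, so the exponent is imaginary and
  the twisted propagator is unitary. To first order in t its twist is -i \<lambda> times the scalar
  in \<open>tri_sym_res\<close>.\<close>

lemma twist_symbol_eq:
  "twist_symbol lam t (- \<i> * of_real Q) (of_real M) k =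
     (if k = 0 then 1 else schr_symbol t k * exp (\<i> * of_real (- 2 * lam * t * (M - Q / of_int k))))"
proof (cases "k = 0")
  case False
  have "\<i> * of_real t * (- 2 * of_real lam * (- \<i> * of_real Q) * inverse (\<i> * of_int k) - 2 * of_real lam * of_real M - (of_int k)\<^sup>2) =
    - \<i> * of_real t * (of_int k)\<^sup>2 + \<i> * of_real (- 2 * lam * t * (M - Q / of_int k))"
    using False by (simp add: field_simps)
  then show ?thesis using False unfolding twist_symbol_def schr_symbol_def by (simp only: if_False exp_add)
qed (simp add: twist_symbol_def)

lemma norm_twist_symbol: "norm (twist_symbol lam t (- \<i> * of_real Q) (of_real M) k) = 1"
  unfolding twist_symbol_eq by (simp add: norm_mult)

lemma norm_exp_i_taylor: "norm (exp (\<i> * of_real x) - 1 - \<i> * of_real x) \<le> x\<^sup>2"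
  using Taylor_exp[of "\<i> * of_real x" 1] by (simp add: norm_mult diff_diff_eq power2_eq_square)

section \<open>Stability and consistency of one step\<close>

text \<open>The linear part is an isometry. The constant 36 is 3 times the 12 of
  \<open>admissible_sym_num\<close>, and it is multiplied by an l1 norm only.\<close>

lemma Psi_hat_h1_bound:
  assumes lam: "\<bar>lam\<bar> = 1" and t: "0 \<le> t"
  shows "h1 (freqs N) (Psi_hat lam t N (- \<i> * of_real Q) (of_real M) a) \<le> (1 + 36 * t * (l1 (freqs N) a)\<^sup>2) * h1 (freqs N) a"
proof -
  let ?A = "freqs N"
  let ?u = "\<lambda>k. twist_symbol lam t (- \<i> * of_real Q) (of_real M) k * a k"
  let ?v = "\<lambda>k. (- \<i> * of_real lam * schr_symbol t k) * tri ?A (sym_num t N) a (conj_coeffs a) a k"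
  have "h1 ?A (Psi_hat lam t N (- \<i> * of_real Q) (of_real M) a) = h1 ?A (\<lambda>k. ?u k + ?v k)"
    by (rule h1_cong) (simp add: Psi_hat_def)
  also have "\<dots> \<le> h1 ?A ?u + h1 ?A ?v" by (rule h1_triangle)
  also have "h1 ?A ?u = h1 ?A a" by (rule h1_cong) (simp only: norm_mult norm_twist_symbol mult_1_left)
  also have "h1 ?A ?v = h1 ?A (tri ?A (sym_num t N) a (conj_coeffs a) a)" by (rule h1_cong) (simp add: norm_mult lam)
  also have "\<dots> \<le> 3 * (12 * t) * (l1 ?A a)\<^sup>2 * h1 ?A a"
    by (rule cubic_h1_bound[OF admissible_sym_num[OF t]]) (use t in auto)
  finally show ?thesis by (simp add: algebra_simps)
qed

lemma Psi_hat_l2_diff: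
  assumes lam: "\<bar>lam\<bar> = 1" and t: "0 \<le> t" and B: "h1 (freqs N) a \<le> B" "h1 (freqs N) b \<le> B"
  shows "l2 (freqs N) (\<lambda>k. Psi_hat lam t N (- \<i> * of_real Q) (of_real M) a k - Psi_hat lam t N (- \<i> * of_real Q) (of_real M) b k)
    \<le> (1 + 1620 * t * B\<^sup>2) * l2 (freqs N) (\<lambda>k. a k - b k)"
proof -
  let ?A = "freqs N"
  let ?u = "\<lambda>k. twist_symbol lam t (- \<i> * of_real Q) (of_real M) k * (a k - b k)"
  let ?w = "\<lambda>k. tri ?A (sym_num t N) a (conj_coeffs a) a k - tri ?A (sym_num t N) b (conj_coeffs b) b k"
  let ?v = "\<lambda>k. (- \<i> * of_real lam * schr_symbol t k) * ?w k"
  have "l2 ?A (\<lambda>k. Psi_hat lam t N (- \<i> * of_real Q) (of_real M) a k - Psi_hat lam t N (- \<i> * of_real Q) (of_real M) b k) = l2 ?A (\<lambda>k. ?u k + ?v k)"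
    by (rule l2_cong) (simp add: Psi_hat_def algebra_simps)
  also have "\<dots> \<le> l2 ?A ?u + l2 ?A ?v" by (rule l2_triangle)
  also have "l2 ?A ?u = l2 ?A (\<lambda>k. a k - b k)" by (rule l2_cong) (simp only: norm_mult norm_twist_symbol mult_1_left)
  also have "l2 ?A ?v = l2 ?A ?w" by (rule l2_cong) (simp add: norm_mult lam)
  also have "\<dots> \<le> 135 * (12 * t) * B\<^sup>2 * l2 ?A (\<lambda>k. a k - b k)"
    by (rule cubic_l2_diff[OF admissible_sym_num[OF t] _ B]) (use t in auto)
  finally show ?thesis by (simp add: algebra_simps)
qed

lemma l2_const_mult_le:
  assumes "\<And>k. k \<in> A \<Longrightarrow> norm (a k) \<le> c * norm (b k)" "0 \<le> c"
  shows "l2 A a \<le> c * l2 A b"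
proof -
  have "l2 A a \<le> L2_set (\<lambda>k. c * norm (b k)) A" unfolding l2_def by (rule L2_set_mono) (use assms in auto)
  then show ?thesis unfolding l2_def using assms(2) by (simp add: L2_set_right_distrib)
qed

text \<open>After the symbol decomposition, the resonant part is compared with the twist: 1 + i y,
  linear and with the current mass and momentum, against exp(i x) with the prescribed values M and
  Q. The Taylor remainder costs t^2 D^2 and the mismatch of the invariants costs t \<delta>.\<close>

lemma Psi_hat_consistency:
  assumes lam: "\<bar>lam\<bar> = 1" and t: "0 < t" "t \<le> 1 / 3" and N: "N \<ge> 1" and B: "h1 (freqs N) a \<le> B"
    and M: "\<bar>M - (\<Sum>i\<in>freqs N. (norm (a i))\<^sup>2)\<bar> \<le> \<delta>" "\<bar>M\<bar> \<le> D"
    and Q: "\<bar>Q - (\<Sum>i\<in>freqs N. of_int i * (norm (a i))\<^sup>2)\<bar> \<le> \<delta>" "\<bar>Q\<bar> \<le> D"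
  shows "l2 (freqs N) (\<lambda>k. schr_symbol t k * (a k - \<i> * of_real lam * tri (freqs N) (sym_exact t) a (conj_coeffs a) a k)
       - Psi_hat lam t N (- \<i> * of_real Q) (of_real M) a k)
    \<le> 180 * (t\<^sup>2 * sqrt (ln (1 / t))) * B^3 + 1944 * (t / real N) * B^3 + (16 * t\<^sup>2 * D\<^sup>2 + 4 * t * \<delta>) * B"
proof -
  let ?A = "freqs N"
  have B0: "B \<ge> 0" using B h1_nonneg order_trans by blast
  define M0 where "M0 = (\<Sum>i\<in>?A. (norm (a i))\<^sup>2)"
  define Q0 where "Q0 = (\<Sum>i\<in>?A. of_int i * (norm (a i))\<^sup>2)"
  define x where "x k = - 2 * lam * t * (M - Q / of_int k)" for k
  define y where "y k = - 2 * lam * t * (M0 - Q0 / of_int k)" for k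
  let ?L = "tri ?A (sym_log t) a (conj_coeffs a) a"
  let ?C = "tri ?A (sym_cut t N) a (conj_coeffs a) a"
  define E where "E k = (if k = 0 then 0 else (1 + \<i> * of_real (y k) - exp (\<i> * of_real (x k))) * a k)" for k
  have d0: "0 \<le> \<delta>" "0 \<le> D" using M by linarith+
  have eq: "schr_symbol t k * (a k - \<i> * of_real lam * tri ?A (sym_exact t) a (conj_coeffs a) a k) - Psi_hat lam t N (- \<i> * of_real Q) (of_real M) a k
    = (- \<i> * of_real lam * schr_symbol t k) * (?L k + ?C k) + schr_symbol t k * E k" if k: "k \<in> ?A" for k
  proof -
    have p: "Psi_hat lam t N (- \<i> * of_real Q) (of_real M) a k = twist_symbol lam t (- \<i> * of_real Q) (of_real M) k * a k
        + (- \<i> * of_real lam * schr_symbol t k) * tri ?A (sym_num t N) a (conj_coeffs a) a k" using k by (simp add: Psi_hat_def)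
    have xx: "tri ?A (sym_exact t) a (conj_coeffs a) a k = tri ?A (sym_num t N) a (conj_coeffs a) a k + tri ?A (sym_res t) a (conj_coeffs a) a k + (?L k + ?C k)"
      using tri_sym_exact_decompose[of ?A t a "conj_coeffs a" k N] by (simp add: algebra_simps)
    have r: "tri ?A (sym_res t) a (conj_coeffs a) a k = (if k = 0 then 0 else of_real (2 * t * (M0 - Q0 / of_int k)) * a k)"
      unfolding M0_def Q0_def by (rule tri_sym_res[OF k])
    show ?thesis
    proof (cases "k = 0")
      case True
      then show ?thesis unfolding p xx r twist_symbol_eq E_def by (simp add: schr_symbol_def algebra_simps)
    next
      case False
      have y: "of_real lam * of_real (2 * t * (M0 - Q0 / of_int k)) = - complex_of_real (y k)" unfolding y_def by simp
      \<comment> \<open>The numerical part X occurs on both sides and cancels. What remains is the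
        defect W and the comparison of the resonant scalar r with the twist factor z.\<close>
      have ring: "s * (x - \<i> * l * (X + r * x + W)) - (s * z * x + (- \<i> * l * s) * X) = (- \<i> * l * s) * W + s * (x - \<i> * (l * r) * x - z * x)"
        for s x l X r W z :: complex by (simp add: algebra_simps)
      have "schr_symbol t k * (a k - \<i> * of_real lam * tri ?A (sym_exact t) a (conj_coeffs a) a k) - Psi_hat lam t N (- \<i> * of_real Q) (of_real M) a k
        = (- \<i> * of_real lam * schr_symbol t k) * (?L k + ?C k) + schr_symbol t k * (a k - \<i> * (of_real lam * of_real (2 * t * (M0 - Q0 / of_int k))) * a k - exp (\<i> * of_real (x k)) * a k)"
        unfolding p xx r twist_symbol_eq x_def if_not_P[OF False] by (rule ring)
      then show ?thesis unfolding y E_def using False by (simp add: algebra_simps)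
    qed
  qed
  have nE: "norm (E k) \<le> (16 * t\<^sup>2 * D\<^sup>2 + 4 * t * \<delta>) * norm (a k)" for k
  proof (cases "k = 0")
    case False
    then have k1: "1 \<le> \<bar>real_of_int k\<bar>" by linarith
    have dv: "\<bar>z / of_int k\<bar> \<le> \<bar>z\<bar>" for z :: real
      using k1 by (simp add: divide_le_eq mult_left_mono[of 1 "\<bar>of_int k\<bar>" "\<bar>z\<bar>", simplified])
    have "\<bar>M - Q / of_int k\<bar> \<le> D + D" using M(2) Q(2) dv[of Q] by linarith
    then have "2 * t * \<bar>M - Q / of_int k\<bar> \<le> 2 * t * (D + D)" using t by (intro mult_left_mono) auto
    then have "\<bar>x k\<bar> \<le> 4 * t * D" unfolding x_def using lam t by (simp add: abs_mult)
    then have "\<bar>x k\<bar>\<^sup>2 \<le> (4 * t * D)\<^sup>2" by (intro power_mono) auto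
    then have x2: "(x k)\<^sup>2 \<le> 16 * t\<^sup>2 * D\<^sup>2" by (simp add: power_mult_distrib)
    have "\<bar>(M0 - Q0 / of_int k) - (M - Q / of_int k)\<bar> \<le> \<delta> + \<delta>"
      using M(1) Q(1) dv[of "Q0 - Q"] unfolding M0_def[symmetric] Q0_def[symmetric] by (simp add: diff_divide_distrib)
    then have "2 * t * \<bar>(M0 - Q0 / of_int k) - (M - Q / of_int k)\<bar> \<le> 2 * t * (\<delta> + \<delta>)" using t by (intro mult_left_mono) auto
    moreover have "y k - x k = - 2 * lam * t * ((M0 - Q0 / of_int k) - (M - Q / of_int k))" unfolding x_def y_def by (simp add: algebra_simps)
    ultimately have yx: "\<bar>y k - x k\<bar> \<le> 4 * t * \<delta>" using lam t by (simp add: abs_mult)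
    have "1 + \<i> * of_real (y k) - exp (\<i> * of_real (x k)) = - (exp (\<i> * of_real (x k)) - 1 - \<i> * of_real (x k)) + \<i> * of_real (y k - x k)"
      by (simp add: algebra_simps)
    then have "norm (1 + \<i> * of_real (y k) - exp (\<i> * of_real (x k))) \<le> norm (exp (\<i> * of_real (x k)) - 1 - \<i> * of_real (x k)) + norm (\<i> * of_real (y k - x k))"
      by (metis norm_minus_cancel norm_triangle_ineq)
    also have "\<dots> \<le> 16 * t\<^sup>2 * D\<^sup>2 + 4 * t * \<delta>"
      using norm_exp_i_taylor[of "x k"] x2 yx by (intro add_mono) (auto simp: norm_mult simp del: of_real_diff)
    finally show ?thesis using False unfolding E_def by (simp add: norm_mult mult_right_mono)
  qed (use t d0 in \<open>simp add: E_def\<close>)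
  have BBB: "h1 ?A a * h1 ?A (conj_coeffs a) * h1 ?A a \<le> B^3"
    unfolding h1_conj_coeffs power3_eq_cube using B B0 by (intro mult_mono) auto
  have Lg: "0 \<le> ln (1 / t)" using ln_inverse_ge_1[OF t] by simp
  have "l2 ?A (\<lambda>k. schr_symbol t k * (a k - \<i> * of_real lam * tri ?A (sym_exact t) a (conj_coeffs a) a k) - Psi_hat lam t N (- \<i> * of_real Q) (of_real M) a k)
    = l2 ?A (\<lambda>k. (- \<i> * of_real lam * schr_symbol t k) * (?L k + ?C k) + schr_symbol t k * E k)"
    by (rule l2_cong) (simp only: eq)
  also have "\<dots> \<le> l2 ?A (\<lambda>k. (- \<i> * of_real lam * schr_symbol t k) * (?L k + ?C k)) + l2 ?A (\<lambda>k. schr_symbol t k * E k)" by (rule l2_triangle)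
  also have "l2 ?A (\<lambda>k. (- \<i> * of_real lam * schr_symbol t k) * (?L k + ?C k)) = l2 ?A (\<lambda>k. ?L k + ?C k)" by (rule l2_cong) (simp add: norm_mult lam)
  also have "\<dots> \<le> l2 ?A ?L + l2 ?A ?C" by (rule l2_triangle)
  also have "l2 ?A ?L \<le> 180 * (t\<^sup>2 * sqrt (ln (1 / t))) * B^3"
    by (rule order_trans[OF tri_sym_log_bound[OF t]]) (use t Lg in \<open>intro mult_left_mono BBB; simp\<close>)
  also have "l2 ?A ?C \<le> 1944 * (t / real N) * B^3"
  proof -
    have "l2 ?A ?C \<le> 1944 * (t / real N) * (h1 ?A a * h1 ?A (conj_coeffs a) * h1 ?A a)"
      by (rule tri_sym_cut_bound) (use t N in auto)
    also have "\<dots> \<le> 1944 * (t / real N) * B^3" by (intro mult_left_mono BBB) (use t in simp)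
    finally show ?thesis .
  qed
  also have "l2 ?A (\<lambda>k. schr_symbol t k * E k) = l2 ?A E" by (rule l2_cong) (simp add: norm_mult)
  also have "\<dots> \<le> (16 * t\<^sup>2 * D\<^sup>2 + 4 * t * \<delta>) * l2 ?A a"
    by (rule l2_const_mult_le[OF nE]) (use t d0 in auto)
  also have "\<dots> \<le> (16 * t\<^sup>2 * D\<^sup>2 + 4 * t * \<delta>) * B"
    using l2_le_h1[of ?A a] B t d0 by (intro mult_left_mono) auto
  finally show ?thesis by simp
qed

section \<open>The exact solution\<close>

lemma tail_inverse_jb:
  assumes q: "q \<ge> 1" shows "(\<Sum>k\<in>freqs J - freqs q. 1 / (jb k)\<^sup>2) \<le> 2 / real q"
proof -
  define f where "f k = (if k \<in> freqs q then 0 else 1 / (real_of_int k)\<^sup>2)" for k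
  have "(\<Sum>k\<in>freqs J - freqs q. 1 / (jb k)\<^sup>2) \<le> (\<Sum>k\<in>freqs J - freqs q. f k)"
  proof (rule sum_mono)
    fix k assume k: "k \<in> freqs J - freqs q"
    then have "k \<noteq> 0" by auto
    then have "1 / (1 + (real_of_int k)\<^sup>2) \<le> 1 / (real_of_int k)\<^sup>2"
      by (intro divide_left_mono) (auto intro!: mult_pos_pos add_pos_nonneg)
    then show "1 / (jb k)\<^sup>2 \<le> f k" using k unfolding f_def jb_sq by auto
  qed
  also have "\<dots> = (\<Sum>k\<in>freqs J - {0}. f k)"
    by (rule sum.mono_neutral_left) (auto simp: f_def)
  also have "\<dots> = 2 * (\<Sum>n\<in>{1..J}. f (int n))" by (rule sum_freqs_nonzero) (auto simp: f_def)
  also have "(\<Sum>n\<in>{1..J}. f (int n)) = (\<Sum>n\<in>{1..J}. if q < n then 1 / (real n)\<^sup>2 else 0)"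
    by (intro sum.cong refl) (auto simp: f_def)
  also have "\<dots> \<le> 1 / real q" by (rule inverse_square_tail[OF q])
  finally show ?thesis by simp
qed

lemma l1_tail:
  assumes q: "q \<ge> 1" shows "l1 (freqs J - freqs q) a \<le> sqrt (2 / real q) * h1 (freqs J) a"
proof -
  let ?D = "freqs J - freqs q"
  have "l1 ?D a = (\<Sum>k\<in>?D. \<bar>1 / jb k\<bar> * \<bar>jb k * norm (a k)\<bar>)"
    unfolding l1_def by (intro sum.cong) (auto simp: abs_mult less_imp_neq[THEN not_sym])
  also have "\<dots> \<le> L2_set (\<lambda>k. 1 / jb k) ?D * h1 ?D a"
    unfolding h1_def by (rule L2_set_mult_ineq)
  also have "L2_set (\<lambda>k. 1 / jb k) ?D \<le> sqrt (2 / real q)"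
    unfolding L2_set_def using tail_inverse_jb[OF q, of J] by (intro real_sqrt_le_mono) (simp add: power_divide)
  also have "h1 ?D a \<le> h1 (freqs J) a" by (rule h1_subset) auto
  finally show ?thesis by (simp add: mult_right_mono mult_left_mono)
qed

text \<open>Cauchy--Schwarz over the 2 q + 1 low frequencies and the tail of the inverse weights
  above q. With q large the H^1 part has a small coefficient, and the L^2 part pays for it.\<close>

lemma l1_interp:
  assumes q: "q \<ge> 1" shows "l1 (freqs J) a \<le> sqrt (2 * real q + 1) * l2 (freqs J) a + sqrt (2 / real q) * h1 (freqs J) a"
proof -
  have "l1 (freqs J) a = l1 (freqs J \<inter> freqs q) a + l1 (freqs J - freqs q) a"
    unfolding l1_def by (rule sum.Int_Diff) simp
  also have "l1 (freqs J - freqs q) a \<le> sqrt (2 / real q) * h1 (freqs J) a" by (rule l1_tail[OF q])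
  also have "l1 (freqs J \<inter> freqs q) a \<le> sqrt (2 * real q + 1) * l2 (freqs J) a"
  proof -
    let ?D = "freqs J \<inter> freqs q"
    have "l1 ?D a = (\<Sum>k\<in>?D. \<bar>1\<bar> * \<bar>norm (a k)\<bar>)" unfolding l1_def by simp
    also have "\<dots> \<le> L2_set (\<lambda>k. 1) ?D * L2_set (\<lambda>k. norm (a k)) ?D" by (rule L2_set_mult_ineq)
    also have "\<dots> \<le> L2_set (\<lambda>k. 1) (freqs q) * l2 (freqs J) a"
      unfolding l2_def by (intro mult_mono L2_set_subset_mono) auto
    also have "L2_set (\<lambda>k. 1) (freqs q) = sqrt (2 * real q + 1)"
      unfolding L2_set_constant by simp
    finally show ?thesis .
  qed
  finally show ?thesis by simp
qed

text \<open>The rate depends on the sequence only through its H^1 bound. It is therefore uniform in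
  time along the solution, as the interchange of integrals in Duhamel's formula requires.\<close>

lemma fourier_series_tail_bound:
  assumes B: "\<And>J. h1 (freqs J) a \<le> B" and q: "q \<ge> 1"
  shows "norm (fourier_series a x - (\<Sum>k\<in>freqs q. a k * ek k x)) \<le> sqrt (2 / real q) * B"
proof -
  have l: "(\<lambda>J. norm ((\<Sum>k\<in>freqs J. a k * ek k x) - (\<Sum>k\<in>freqs q. a k * ek k x))) \<longlonglongrightarrow> norm (fourier_series a x - (\<Sum>k\<in>freqs q. a k * ek k x))"
    by (intro tendsto_intros fourier_series_limit summable_if_h1_bounded[OF B])
  show ?thesis
  proof (rule LIMSEQ_le_const2[OF l], intro exI allI impI)
    fix J assume "q \<le> J"
    then have "freqs q \<subseteq> freqs J" by auto
    then have "(\<Sum>k\<in>freqs J. a k * ek k x) - (\<Sum>k\<in>freqs q. a k * ek k x) = (\<Sum>k\<in>freqs J - freqs q. a k * ek k x)"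
      by (simp add: sum_diff)
    then have "norm ((\<Sum>k\<in>freqs J. a k * ek k x) - (\<Sum>k\<in>freqs q. a k * ek k x)) \<le> (\<Sum>k\<in>freqs J - freqs q. norm (a k))"
      by (simp add: sum_norm_le norm_mult)
    also have "\<dots> \<le> sqrt (2 / real q) * h1 (freqs J) a" using l1_tail[OF q, of J a] unfolding l1_def .
    also have "\<dots> \<le> sqrt (2 / real q) * B" by (intro mult_left_mono B) auto
    finally show "norm ((\<Sum>k\<in>freqs J. a k * ek k x) - (\<Sum>k\<in>freqs q. a k * ek k x)) \<le> sqrt (2 / real q) * B" .
  qed
qed

lemma schr_eq_fourier_series: "schr t f = fourier_series (\<lambda>k. schr_symbol t k * fourier f k)"
  unfolding schr_def multiplier_def fourier_series_def[abs_def] schr_symbol_def ek_def ..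

section \<open>The cubic nonlinearity and its truncations\<close>

abbreviation sym_one :: "int \<Rightarrow> int \<Rightarrow> int \<Rightarrow> complex" where "sym_one \<equiv> \<lambda>i j l. 1"

lemma admissible_sym_one: "admissible 1 sym_one"
  unfolding admissible_def using jb_sum_quot_ge_1 by simp

definition cube :: "nat \<Rightarrow> (int \<Rightarrow> complex) \<Rightarrow> int \<Rightarrow> complex" where
  "cube J a = tri (freqs J) sym_one a (conj_coeffs a) a"

lemma cube_h1: assumes "h1 (freqs J) a \<le> B" "finite K" shows "h1 K (cube J a) \<le> 27 * B^3"
proof -
  have B: "B \<ge> 0" using assms h1_nonneg order_trans by blast
  have "h1 K (cube J a) \<le> 3 * 1 * (l1 (freqs J) a)\<^sup>2 * h1 (freqs J) a"
    unfolding cube_def by (rule cubic_h1_bound[OF admissible_sym_one]) (use assms in auto)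
  also have "\<dots> \<le> 3 * 1 * (3 * B)\<^sup>2 * B"
    using l1_le_h1[of "freqs J" a] assms B by (intro mult_mono power_mono) auto
  finally show ?thesis by (simp add: power2_eq_square power3_eq_cube)
qed

lemma cube_l2: "l2 (freqs J) (cube J a) \<le> (l1 (freqs J) a)\<^sup>2 * l2 (freqs J) a"
proof -
  let ?A = "freqs J"
  have "norm (cube J a k) \<le> s3 ?A (\<lambda>i j l. norm (a i) * norm (conj_coeffs a j) * norm (a l)) k" for k
    unfolding cube_def using norm_tri_le[of ?A k sym_one "\<lambda>_ _ _. 1" a "conj_coeffs a" a] by simp
  then have "l2 ?A (cube J a) \<le> L2_set (s3 ?A (\<lambda>i j l. norm (a i) * norm (conj_coeffs a j) * norm (a l))) ?A"
    unfolding l2_def by (intro L2_set_mono) auto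
  also have "\<dots> \<le> l1 ?A a * l1 ?A (conj_coeffs a) * l2 ?A a"
    unfolding l1_def l2_def by (rule s3_L2_bound) auto
  finally show ?thesis by (simp add: power2_eq_square)
qed

definition trunc :: "nat \<Rightarrow> (int \<Rightarrow> complex) \<Rightarrow> int \<Rightarrow> complex" where
  "trunc N a k = (if k \<in> freqs N then a k else 0)"

lemma s3_restrict:
  assumes "finite B" "A \<subseteq> B" "\<And>i j l. \<not> (i \<in> A \<and> j \<in> A \<and> l \<in> A) \<Longrightarrow> G i j l = 0"
  shows "s3 B G k = s3 A G k"
proof -
  have "s3 B G k = (\<Sum>i\<in>A. \<Sum>j\<in>B. \<Sum>l\<in>B. if i + j + l = k then G i j l else 0)"
    unfolding s3_def by (rule sum.mono_neutral_right) (use assms in \<open>auto intro!: sum.neutral\<close>)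
  also have "\<dots> = (\<Sum>i\<in>A. \<Sum>j\<in>A. \<Sum>l\<in>B. if i + j + l = k then G i j l else 0)"
    by (intro sum.cong refl sum.mono_neutral_right) (use assms in \<open>auto intro!: sum.neutral\<close>)
  also have "\<dots> = s3 A G k"
    unfolding s3_def by (intro sum.cong refl sum.mono_neutral_right) (use assms in auto)
  finally show ?thesis .
qed

text \<open>Two cutoffs of one input become two inputs at one cutoff. The Lipschitz bounds for
  \<open>cube J\<close> thereby control truncation errors.\<close>

lemma cube_trunc: assumes "N \<le> J" shows "cube J (trunc N a) = cube N a"
proof
  fix k
  have neg: "- j \<in> freqs N \<longleftrightarrow> j \<in> freqs N" for j by auto
  have "cube J (trunc N a) k = s3 (freqs N) (\<lambda>i j l. 1 * (trunc N a i * conj_coeffs (trunc N a) j * trunc N a l)) k"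
    unfolding cube_def tri_def by (rule s3_restrict) (use assms neg in \<open>auto simp: trunc_def conj_coeffs_def\<close>)
  also have "\<dots> = cube N a k"
    unfolding cube_def tri_def by (rule s3_cong) (use neg in \<open>auto simp: trunc_def conj_coeffs_def\<close>)
  finally show "cube J (trunc N a) k = cube N a k" .
qed

lemma h1_trunc_le: "h1 A (trunc N a) \<le> h1 A a"
  by (rule h1_mono) (auto simp: trunc_def)

lemma l2_trunc_diff:
  assumes "N \<ge> 1" shows "l2 A (\<lambda>k. a k - trunc N a k) \<le> h1 A a / real N"
proof -
  have "l2 A (\<lambda>k. a k - trunc N a k) \<le> L2_set (\<lambda>k. (1 / real N) * (jb k * norm (a k))) A"
    unfolding l2_def
  proof (rule L2_set_mono)
    fix k
    show "norm (a k - trunc N a k) \<le> 1 / real N * (jb k * norm (a k))"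
    proof (cases "k \<in> freqs N")
      case False
      then have "real N \<le> \<bar>real_of_int k\<bar>" by auto
      then have "real N \<le> jb k" using abs_le_jb[of k] by linarith
      then have "1 \<le> jb k / real N" using assms by (simp add: le_divide_eq)
      then show ?thesis using False mult_right_mono[of 1 "jb k / real N" "norm (a k)"] by (simp add: trunc_def)
    qed (simp add: trunc_def)
  qed simp
  also have "\<dots> = 1 / real N * h1 A a" unfolding h1_def by (rule L2_set_right_distrib[symmetric]) simp
  finally show ?thesis by simp
qed

lemma cube_l2_diff:
  assumes "h1 (freqs J) a \<le> B" "h1 (freqs J) b \<le> B" "finite K"
  shows "l2 K (\<lambda>k. cube J a k - cube J b k) \<le> 135 * B\<^sup>2 * l2 (freqs J) (\<lambda>k. a k - b k)"
  using cubic_l2_diff[OF admissible_sym_one _ assms] unfolding cube_def by simp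

lemma cube_h1_diff:
  assumes "h1 (freqs J) a \<le> B" "h1 (freqs J) b \<le> B" "finite K"
  shows "h1 K (\<lambda>k. cube J a k - cube J b k) \<le> 81 * B\<^sup>2 * h1 (freqs J) (\<lambda>k. a k - b k)"
  using cubic_h1_diff[OF admissible_sym_one _ assms] unfolding cube_def by simp

lemma fourier_cubic_trig_poly:
  assumes f: "has_coeffs J f a" shows "fourier (cubic f) k = cube J a k"
proof -
  let ?A = "freqs J" and ?B = "freqs (J + J)"
  let ?b = "conj_coeffs a"
  have F: "trig_poly J f" "\<And>k. fourier f k = a k" using f unfolding has_coeffs_def by auto
  have G: "trig_poly J (conj_fun f)" "\<And>k. fourier (conj_fun f) k = ?b k" using has_coeffs_cnj[OF f] unfolding has_coeffs_def by auto
  have eq: "cubic f = (\<lambda>x. (f x * conj_fun f x) * f x)"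
    by (auto simp: cubic_def conj_fun_def simp flip: complex_norm_square)
  have "fourier (cubic f) k = (\<Sum>q\<in>?B. \<Sum>l\<in>?A. if q + l = k then (\<Sum>i\<in>?A. \<Sum>j\<in>?A. if i + j = q then a i * ?b j else 0) * a l else 0)"
    unfolding eq trig_poly_mult(2)[OF trig_poly_mult(1)[OF F(1) G(1)] F(1)] trig_poly_mult(2)[OF F(1) G(1)] F(2) G(2) ..
  also have "\<dots> = (\<Sum>q\<in>?B. \<Sum>l\<in>?A. \<Sum>i\<in>?A. \<Sum>j\<in>?A. if q = i + j then (if i + j + l = k then a i * ?b j * a l else 0) else 0)"
    by (intro sum.cong refl) (auto simp: sum_distrib_right intro!: sum.cong sum.neutral[symmetric] sum.neutral)
  also have "\<dots> = (\<Sum>l\<in>?A. \<Sum>i\<in>?A. \<Sum>j\<in>?A. \<Sum>q\<in>?B. if q = i + j then (if i + j + l = k then a i * ?b j * a l else 0) else 0)"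
    by (subst sum.swap, rule sum.cong[OF refl], subst sum.swap, rule sum.cong[OF refl], rule sum.swap)
  also have "\<dots> = (\<Sum>l\<in>?A. \<Sum>i\<in>?A. \<Sum>j\<in>?A. if i + j + l = k then a i * ?b j * a l else 0)"
    by (intro sum.cong refl, subst sum.delta) auto
  also have "\<dots> = (\<Sum>i\<in>?A. \<Sum>j\<in>?A. \<Sum>l\<in>?A. if i + j + l = k then a i * ?b j * a l else 0)"
    by (subst sum.swap, rule sum.cong[OF refl], rule sum.swap)
  finally show ?thesis unfolding cube_def tri_def s3_def mult_1_left .
qed

text \<open>Partial sums converge uniformly, hence so do their cubes and the coefficients of these.
  Every estimate for the true nonlinearity is obtained from \<open>cube\<close> through this
  limit.\<close>

lemma fourier_cubic_limit:
  assumes s: "(\<lambda>k. norm (a k)) summable_on UNIV"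
  shows "(\<lambda>J. cube J a k) \<longlonglongrightarrow> fourier (cubic (fourier_series a)) k"
proof -
  define p where "p J x = (\<Sum>k\<in>freqs J. a k * ek k x)" for J x
  have cs: "continuous_on {-pi..pi} (fourier_series a)" by (rule continuous_on_fourier_series[OF s])
  have cube_eq: "cubic f = (\<lambda>x. (f x * cnj (f x)) * f x)" for f
    by (auto simp: cubic_def simp flip: complex_norm_square)
  have bd: "bounded (fourier_series a ` {-pi..pi})" "bounded ((\<lambda>x. cnj (fourier_series a x)) ` {-pi..pi})" "bounded ((\<lambda>x. fourier_series a x * cnj (fourier_series a x)) ` {-pi..pi})"
    by (intro compact_imp_bounded compact_continuous_image continuous_intros cs; simp)+
  have u1: "uniform_limit {-pi..pi} p (fourier_series a) sequentially"
    unfolding p_def by (rule fourier_series_uniform_limit[OF s])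
  have u2: "uniform_limit {-pi..pi} (\<lambda>J x. cnj (p J x)) (\<lambda>x. cnj (fourier_series a x)) sequentially"
    by (rule bounded_linear.uniform_limit[OF bounded_linear_cnj u1])
  have "(\<lambda>J. fourier (cubic (p J)) k) \<longlonglongrightarrow> fourier (cubic (fourier_series a)) k"
    unfolding cube_eq
  proof (rule fourier_limit)
    show "continuous_on {-pi..pi} (\<lambda>x. p J x * cnj (p J x) * p J x)" for J
      unfolding p_def by (intro continuous_intros)
  qed (intro continuous_intros cs uniform_lim_mult u1 u2 bd)+
  moreover have "fourier (cubic (p J)) k = cube J a k" for J
  proof -
    have "has_coeffs J (p J) (\<lambda>k. if k \<in> freqs J then a k else 0)"
      using trig_polyI[where f="p J" and N=J and a=a] unfolding has_coeffs_def p_def by blast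
    from fourier_cubic_trig_poly[OF this] have "fourier (cubic (p J)) k = cube J (trunc J a) k"
      unfolding trunc_def[abs_def] by simp
    then show ?thesis using cube_trunc[of J J a] by simp
  qed
  ultimately show ?thesis by simp
qed

lemma h1_limit_le:
  assumes "finite K" "\<And>k. k \<in> K \<Longrightarrow> (\<lambda>J. f J k) \<longlonglongrightarrow> g k" "\<And>J. J \<ge> J0 \<Longrightarrow> h1 K (f J) \<le> B"
  shows "h1 K g \<le> B"
proof -
  have "(\<lambda>J. h1 K (f J)) \<longlonglongrightarrow> h1 K g"
    unfolding h1_def L2_set_def by (intro tendsto_intros assms)
  then show ?thesis using assms(3) by (intro LIMSEQ_le_const2) auto
qed

lemma l2_limit_le:
  assumes "finite K" "\<And>k. k \<in> K \<Longrightarrow> (\<lambda>J. f J k) \<longlonglongrightarrow> g k" "\<And>J. J \<ge> J0 \<Longrightarrow> l2 K (f J) \<le> B"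
  shows "l2 K g \<le> B"
proof -
  have "(\<lambda>J. l2 K (f J)) \<longlonglongrightarrow> l2 K g"
    unfolding l2_def L2_set_def by (intro tendsto_intros assms)
  then show ?thesis using assms(3) by (intro LIMSEQ_le_const2) auto
qed

section \<open>The solution in Fourier coefficients and its Duhamel formula\<close>

locale nls_sol =
  fixes lam T :: real and u0 :: "real \<Rightarrow> complex" and u :: "real \<Rightarrow> real \<Rightarrow> complex"
  assumes lam: "\<bar>lam\<bar> = 1" and T: "0 < T" and u0: "u0 \<in> H1" and sol: "nls_solution lam T u0 u"
begin

definition c :: "real \<Rightarrow> int \<Rightarrow> complex" where "c t k = fourier (u t) k"
definition F :: "real \<Rightarrow> int \<Rightarrow> complex" where "F t k = fourier (cubic (u t)) k"

lemma u_H1: "t \<in> {0..T} \<Longrightarrow> u t \<in> H1"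
  and u_cont: "t \<in> {0..T} \<Longrightarrow> ((\<lambda>s. Hs_norm 1 (\<lambda>x. u s x - u t x)) \<longlongrightarrow> 0) (at t within {0..T})"
  and u_0: "u 0 = u0"
  and duhamel: "t \<in> {0..T} \<Longrightarrow> u t x = schr t u0 x - \<i> * of_real lam * integral {0..t} (\<lambda>s. schr (t - s) (cubic (u s)) x)"
  using sol unfolding nls_solution_def by blast+

lemma c_fun: "c t = fourier (u t)" by (auto simp: c_def)

lemma c_h1_diff: "s \<in> {0..T} \<Longrightarrow> t \<in> {0..T} \<Longrightarrow> finite A \<Longrightarrow> h1 A (\<lambda>k. c s k - c t k) \<le> Hs_norm 1 (\<lambda>x. u s x - u t x)"
proof -
  assume st: "s \<in> {0..T}" "t \<in> {0..T}" and A: "finite A"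
  have "fourier (\<lambda>x. u s x - u t x) = (\<lambda>k. c s k - c t k)"
    unfolding c_def by (intro ext fourier_diff) (auto intro: H1_D u_H1 st)
  then show ?thesis using h1_le_Hs_norm[OF H1_diff[OF u_H1[OF st(1)] u_H1[OF st(2)]] A] by simp
qed

text \<open>Compactness of the time interval with continuity in H^1. This bound depends on the
  solution itself; it justifies the limits below until \<open>c_h1_bound\<close> supplies a bound in
  terms of the initial norm.\<close>

lemma c_bounded: "\<exists>B. \<forall>t\<in>{0..T}. \<forall>J. h1 (freqs J) (c t) \<le> B"
proof (rule ccontr)
  assume "\<not> ?thesis"
  then have "\<forall>n::nat. \<exists>t\<in>{0..T}. \<exists>J. real n < h1 (freqs J) (c t)" by (meson not_le)
  then obtain t J where tJ: "\<And>n::nat. t n \<in> {0..T}" "\<And>n. real n < h1 (freqs (J n)) (c (t n))" by metis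
  obtain l r where l: "l \<in> {0..T}" and r: "strict_mono r" and lim: "(t \<circ> r) \<longlonglongrightarrow> l"
    using compact_Icc[of 0 T] tJ(1) unfolding compact_def by blast
  have "\<forall>\<^sub>F s in at l within {0..T}. Hs_norm 1 (\<lambda>x. u s x - u l x) < 1"
    using order_tendstoD(2)[OF u_cont[OF l], of 1] by simp
  then obtain d where d: "d > 0" "\<And>s. s \<in> {0..T} \<Longrightarrow> s \<noteq> l \<Longrightarrow> dist s l < d \<Longrightarrow> Hs_norm 1 (\<lambda>x. u s x - u l x) < 1"
    unfolding eventually_at by blast
  have near: "h1 (freqs J) (c s) \<le> Hs_norm 1 (u l) + 1" if s: "s \<in> {0..T}" "dist s l < d" for s J
  proof -
    have "h1 (freqs J) (c l) \<le> Hs_norm 1 (u l)" unfolding c_fun by (rule h1_le_Hs_norm[OF u_H1[OF l]]) simp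
    moreover have "h1 (freqs J) (\<lambda>k. c s k - c l k) \<le> 1"
    proof (cases "s = l")
      case True
      then show ?thesis by (simp add: h1_def L2_set_def)
    next
      case False
      then show ?thesis using c_h1_diff[OF s(1) l, of "freqs J"] d(2)[OF s(1) False s(2)] by simp
    qed
    moreover have "h1 (freqs J) (c s) \<le> h1 (freqs J) (\<lambda>k. c s k - c l k) + h1 (freqs J) (c l)"
      using h1_triangle[of "freqs J" "\<lambda>k. c s k - c l k" "c l"] by simp
    ultimately show ?thesis by linarith
  qed
  obtain n0 where n0: "\<And>n. n \<ge> n0 \<Longrightarrow> dist (t (r n)) l < d"
    using metric_LIMSEQ_D[OF lim d(1)] by auto
  obtain n1 :: nat where n1: "Hs_norm 1 (u l) + 1 \<le> real n1" using real_arch_simple by blast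
  define n where "n = max n0 n1"
  have "real n \<le> real (r n)" using seq_suble[OF r, of n] by simp
  also have "\<dots> < h1 (freqs (J (r n))) (c (t (r n)))" by (rule tJ(2))
  also have "\<dots> \<le> Hs_norm 1 (u l) + 1" by (rule near[OF tJ(1) n0]) (simp add: n_def)
  also have "\<dots> \<le> real n" using n1 unfolding n_def by simp
  finally show False by simp
qed

lemma c_summable: "t \<in> {0..T} \<Longrightarrow> (\<lambda>k. norm (c t k)) summable_on UNIV"
  unfolding c_fun by (rule H1_summable[OF u_H1])

lemma u_fourier_series: "t \<in> {0..T} \<Longrightarrow> u t = fourier_series (c t)"
  unfolding c_fun using H1_eq_fourier_series[OF u_H1] by blast

lemma F_limit: "t \<in> {0..T} \<Longrightarrow> (\<lambda>J. cube J (c t) k) \<longlonglongrightarrow> F t k"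
  unfolding F_def using fourier_cubic_limit[OF c_summable, of t k] u_fourier_series by simp

lemma F_h1_bound:
  assumes t: "t \<in> {0..T}" and B: "\<And>J. h1 (freqs J) (c t) \<le> B" and K: "finite K"
  shows "h1 K (F t) \<le> 27 * B^3"
  by (rule h1_limit_le[OF K F_limit[OF t] cube_h1[OF B K]])

lemma F_h1_diff:
  assumes t: "t \<in> {0..T}" "s \<in> {0..T}" and B: "\<And>J. h1 (freqs J) (c t) \<le> B" "\<And>J. h1 (freqs J) (c s) \<le> B" and K: "finite K"
  shows "h1 K (\<lambda>k. F t k - F s k) \<le> 81 * B\<^sup>2 * Hs_norm 1 (\<lambda>x. u t x - u s x)"
proof (rule h1_limit_le[OF K])
  show "(\<lambda>J. cube J (c t) k - cube J (c s) k) \<longlonglongrightarrow> F t k - F s k" for k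
    by (intro tendsto_intros F_limit t)
  fix J :: nat
  show "h1 K (\<lambda>k. cube J (c t) k - cube J (c s) k) \<le> 81 * B\<^sup>2 * Hs_norm 1 (\<lambda>x. u t x - u s x)"
    by (rule order_trans[OF cube_h1_diff[OF B K]]) (intro mult_left_mono c_h1_diff t, auto)
qed

text \<open>In L^2 a truncation of H^1 data gains 1 / N, so the truncation error of the nonlinearity
  has a rate.\<close>

lemma F_cube_l2:
  assumes t: "t \<in> {0..T}" and B: "\<And>J. h1 (freqs J) (c t) \<le> B" and K: "finite K" and N: "N \<ge> 1"
  shows "l2 K (\<lambda>k. F t k - cube N (c t) k) \<le> 135 * B^3 / real N"
proof (rule l2_limit_le[OF K])
  show "(\<lambda>J. cube J (c t) k - cube N (c t) k) \<longlonglongrightarrow> F t k - cube N (c t) k" for k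
    by (intro tendsto_intros F_limit t)
  fix J assume J: "J \<ge> N"
  have "l2 K (\<lambda>k. cube J (c t) k - cube J (trunc N (c t)) k) \<le> 135 * B\<^sup>2 * l2 (freqs J) (\<lambda>k. c t k - trunc N (c t) k)"
    by (rule cube_l2_diff[OF B order_trans[OF h1_trunc_le B] K])
  also have "\<dots> \<le> 135 * B\<^sup>2 * (h1 (freqs J) (c t) / real N)"
    by (intro mult_left_mono l2_trunc_diff N) auto
  also have "\<dots> \<le> 135 * B\<^sup>2 * (B / real N)"
    by (intro mult_left_mono divide_right_mono B) auto
  finally show "l2 K (\<lambda>k. cube J (c t) k - cube N (c t) k) \<le> 135 * B^3 / real N"
    unfolding cube_trunc[OF J] by (simp add: power2_eq_square power3_eq_cube)
qed

text \<open>In H^1 the error is only as small as the tail of the solution, so the tail bound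
  \<open>e\<close> is carried along instead of a rate.\<close>

lemma F_cube_h1:
  assumes t: "t \<in> {0..T}" and B: "\<And>J. h1 (freqs J) (c t) \<le> B" and K: "finite K"
    and e: "\<And>J. h1 (freqs J) (\<lambda>k. c t k - trunc N (c t) k) \<le> e"
  shows "h1 K (\<lambda>k. F t k - cube N (c t) k) \<le> 81 * B\<^sup>2 * e"
proof (rule h1_limit_le[OF K])
  show "(\<lambda>J. cube J (c t) k - cube N (c t) k) \<longlonglongrightarrow> F t k - cube N (c t) k" for k
    by (intro tendsto_intros F_limit t)
  fix J assume J: "J \<ge> N"
  have "h1 K (\<lambda>k. cube J (c t) k - cube J (trunc N (c t)) k) \<le> 81 * B\<^sup>2 * h1 (freqs J) (\<lambda>k. c t k - trunc N (c t) k)"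
    by (rule cube_h1_diff[OF B order_trans[OF h1_trunc_le B] K])
  also have "\<dots> \<le> 81 * B\<^sup>2 * e" by (intro mult_left_mono e) auto
  finally show "h1 K (\<lambda>k. cube J (c t) k - cube N (c t) k) \<le> 81 * B\<^sup>2 * e"
    unfolding cube_trunc[OF J] .
qed

lemma continuous_on_F: "continuous_on {0..T} (\<lambda>t. F t k)"
  unfolding continuous_on_def
proof
  fix t assume t: "t \<in> {0..T}"
  obtain B where B: "\<And>t J. t \<in> {0..T} \<Longrightarrow> h1 (freqs J) (c t) \<le> B" using c_bounded by blast
  have z: "((\<lambda>s. 81 * B\<^sup>2 * Hs_norm 1 (\<lambda>x. u s x - u t x)) \<longlongrightarrow> 0) (at t within {0..T})"
    using tendsto_mult_right_zero[OF u_cont[OF t]] .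
  have "((\<lambda>s. norm (F s k - F t k)) \<longlongrightarrow> 0) (at t within {0..T})"
  proof (rule tendsto_sandwich[OF _ _ tendsto_const z])
    show "\<forall>\<^sub>F s in at t within {0..T}. norm (F s k - F t k) \<le> 81 * B\<^sup>2 * Hs_norm 1 (\<lambda>x. u s x - u t x)"
      unfolding eventually_at_filter
    proof (rule always_eventually, intro allI impI)
      fix s assume s: "s \<in> {0..T}"
      show "norm (F s k - F t k) \<le> 81 * B\<^sup>2 * Hs_norm 1 (\<lambda>x. u s x - u t x)"
        using norm_le_h1[of "{k}" k "\<lambda>k. F s k - F t k"] F_h1_diff[OF s t B[OF s] B[OF t], of "{k}"] by simp
    qed
  qed simp
  then show "((\<lambda>t. F t k) \<longlongrightarrow> F t k) (at t within {0..T})"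
    using Lim_null tendsto_norm_zero_iff by blast
qed

lemma continuous_on_schr_symbol [continuous_intros]: "continuous_on S f \<Longrightarrow> continuous_on S (\<lambda>s. schr_symbol (f s) k)"
  unfolding schr_symbol_def by (intro continuous_intros)

text \<open>Duhamel's formula holds pointwise in x. Its coefficients are taken by exchanging the
  integrals over x and s, which needs joint continuity of the integrand; this follows from the
  uniform convergence of its partial sums, given the H^1 bound on the nonlinearity.\<close>

lemma duhamel_fourier:
  assumes t: "t \<in> {0..T}"
  shows "c t k = schr_symbol t k * c 0 k - \<i> * of_real lam * integral {0..t} (\<lambda>s. schr_symbol (t - s) k * F s k)"
proof -
  have sub: "{0..t} \<subseteq> {0..T}" using t by auto
  obtain B where B: "\<And>t J. t \<in> {0..T} \<Longrightarrow> h1 (freqs J) (c t) \<le> B" using c_bounded by blast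
  define d where "d s k = schr_symbol (t - s) k * F s k" for s k
  define G where "G x s = fourier_series (d s) x" for x s
  have dB: "h1 (freqs J) (d s) \<le> 27 * B^3" if "s \<in> {0..t}" for s J
  proof -
    have s: "s \<in> {0..T}" using that sub by auto
    have "h1 (freqs J) (d s) = h1 (freqs J) (F s)" by (rule h1_cong) (simp add: d_def norm_mult)
    then show ?thesis using F_h1_bound[OF s B[OF s], of "freqs J"] by simp
  qed
  have schrG: "schr (t - s) (cubic (u s)) x = G x s" for s x
    unfolding schr_eq_fourier_series G_def d_def F_def ..
  have contG: "continuous_on (cbox (- pi, 0) (pi, t)) (\<lambda>(x, s). G x s)"
  proof (rule uniform_limit_theorem[where F=sequentially and f="\<lambda>q (x, s). \<Sum>k\<in>freqs q. d s k * ek k x"])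
    have cd: "continuous_on (cbox (- pi, 0) (pi, t)) (\<lambda>p. d (snd p) k * ek k (fst p))" for k
    proof -
      have 1: "continuous_on (cbox (- pi, 0) (pi, t)) (\<lambda>p. F (snd p) k)"
        by (rule continuous_on_compose2[OF continuous_on_F]) (use t in \<open>auto intro!: continuous_intros simp: cbox_Pair_eq\<close>)
      have 2: "continuous_on (cbox (- pi, 0) (pi, t)) (\<lambda>p. ek k (fst p))"
        by (rule continuous_on_compose2[OF continuous_on_ek[of UNIV]]) (auto intro!: continuous_intros)
      show ?thesis unfolding d_def by (intro continuous_intros 1 2)
    qed
    then show "\<forall>\<^sub>F q in sequentially. continuous_on (cbox (- pi, 0) (pi, t)) (\<lambda>(x, s). \<Sum>k\<in>freqs q. d s k * ek k x)"
      unfolding case_prod_beta by (intro always_eventually allI continuous_on_sum)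
    show "uniform_limit (cbox (- pi, 0) (pi, t)) (\<lambda>q (x, s). \<Sum>k\<in>freqs q. d s k * ek k x) (\<lambda>(x, s). G x s) sequentially"
    proof (rule uniform_limitI)
      fix e :: real assume e: "e > 0"
      have "(\<lambda>q. sqrt (2 / real q) * (27 * B^3)) \<longlonglongrightarrow> sqrt 0 * (27 * B^3)"
        by (intro tendsto_intros lim_const_over_n)
      then have "\<forall>\<^sub>F q in sequentially. sqrt (2 / real q) * (27 * B^3) < e"
        using e order_tendstoD(2)[of _ "sqrt 0 * (27 * B^3)"] by simp
      then show "\<forall>\<^sub>F q in sequentially. \<forall>p\<in>cbox (- pi, 0) (pi, t). dist (case p of (x, s) \<Rightarrow> \<Sum>k\<in>freqs q. d s k * ek k x) (case p of (x, s) \<Rightarrow> G x s) < e"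
        using eventually_ge_at_top[of 1]
      proof eventually_elim
        case (elim q)
        show ?case
        proof
          fix p assume p: "p \<in> cbox (- pi, 0) (pi, t)"
          obtain x s where ps: "p = (x, s)" by (cases p)
          then have "s \<in> {0..t}" using p by (auto simp: cbox_Pair_eq)
          from fourier_series_tail_bound[OF dB[OF this] elim(2), of x]
          show "dist (case p of (x, s) \<Rightarrow> \<Sum>k\<in>freqs q. d s k * ek k x) (case p of (x, s) \<Rightarrow> G x s) < e"
            unfolding ps G_def using elim(1) by (simp add: dist_norm norm_minus_commute)
        qed
      qed
    qed
  qed simp
  define I where "I x = integral {0..t} (G x)" for x
  have s0: "(\<lambda>k. norm (schr_symbol t k * c 0 k)) summable_on UNIV" using c_summable[of 0] T by (simp add: norm_mult)
  have su0: "schr t u0 = fourier_series (\<lambda>k. schr_symbol t k * c 0 k)" unfolding schr_eq_fourier_series c_def u_0 ..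
  have ut: "u t = (\<lambda>x. fourier_series (\<lambda>k. schr_symbol t k * c 0 k) x - \<i> * of_real lam * I x)"
    using duhamel[OF t] unfolding schrG su0 I_def by auto
  have cu: "continuous_on {-pi..pi} (u t)" using H1_D(1)[OF u_H1[OF t]] .
  have cs: "continuous_on {-pi..pi} (fourier_series (\<lambda>k. schr_symbol t k * c 0 k))" by (rule continuous_on_fourier_series[OF s0])
  \<comment> \<open>Continuity of the time integral in x is read off the equation itself, whose
    other terms are known to be continuous.\<close>
  have "continuous_on {-pi..pi} (\<lambda>x. fourier_series (\<lambda>k. schr_symbol t k * c 0 k) x - u t x)" by (intro continuous_intros cu cs)
  then have cI: "continuous_on {-pi..pi} (\<lambda>x. \<i> * of_real lam * I x)" unfolding ut by simp
  have "c t k = schr_symbol t k * c 0 k - \<i> * of_real lam * fourier I k"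
    unfolding c_def[of t] by (subst ut, subst fourier_diff[OF cs cI]) (simp add: fourier_fourier_series[OF s0] fourier_cmult)
  also have "fourier I k = 1 / (2 * of_real pi) * integral {-pi..pi} (\<lambda>x. integral {0..t} (\<lambda>s. ek (- k) x * G x s))"
    unfolding fourier_alt I_def by simp
  also have "integral {-pi..pi} (\<lambda>x. integral {0..t} (\<lambda>s. ek (- k) x * G x s)) = integral {0..t} (\<lambda>s. integral {-pi..pi} (\<lambda>x. ek (- k) x * G x s))"
  proof -
    have "continuous_on (cbox (- pi, 0) (pi, t)) (\<lambda>p. ek (- k) (fst p) * (case p of (x, s) \<Rightarrow> G x s))"
      by (intro continuous_intros contG continuous_on_compose2[OF continuous_on_ek[of UNIV]]) auto
    then have "continuous_on (cbox (- pi, 0) (pi, t)) (\<lambda>(x, s). ek (- k) x * G x s)"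
      by (simp add: case_prod_beta)
    from integral_swap_continuous[OF this] show ?thesis by simp
  qed
  also have "1 / (2 * of_real pi) * integral {0..t} (\<lambda>s. integral {-pi..pi} (\<lambda>x. ek (- k) x * G x s)) = integral {0..t} (\<lambda>s. fourier (fourier_series (d s)) k)"
    unfolding fourier_alt G_def by simp
  also have "\<dots> = integral {0..t} (\<lambda>s. schr_symbol (t - s) k * F s k)"
    by (rule integral_cong) (simp add: fourier_fourier_series[OF summable_if_h1_bounded[OF dB]] d_def)
  finally show ?thesis .
qed

text \<open>The interaction picture. The coefficients c rotate with speed k^2, but the profile v
  moves only by the nonlinearity and is Lipschitz in time in L^2 without loss of
  derivatives.\<close>

definition v :: "real \<Rightarrow> int \<Rightarrow> complex" where "v t k = schr_symbol (- t) k * c t k"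

lemma c_v: "c t k = schr_symbol t k * v t k"
  unfolding v_def using schr_symbol_inverse[of t k] by (simp flip: mult.assoc)

lemma v_integral:
  assumes t: "t \<in> {0..T}"
  shows "v t k = v 0 k - \<i> * of_real lam * integral {0..t} (\<lambda>s. schr_symbol (- s) k * F s k)"
proof -
  have "(\<lambda>s. schr_symbol (t - s) k * F s k) = (\<lambda>s. schr_symbol t k * (schr_symbol (- s) k * F s k))"
    using schr_symbol_add[of t "- s" k for s] by (auto simp: mult.assoc)
  then have "c t k = schr_symbol t k * (c 0 k - \<i> * of_real lam * integral {0..t} (\<lambda>s. schr_symbol (- s) k * F s k))"
    using duhamel_fourier[OF t, of k] by (simp add: algebra_simps)
  then have "v t k = (schr_symbol t k * schr_symbol (- t) k) * (c 0 k - \<i> * of_real lam * integral {0..t} (\<lambda>s. schr_symbol (- s) k * F s k))"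
    unfolding v_def by simp
  then show ?thesis unfolding schr_symbol_inverse by (simp add: v_def schr_symbol_def)
qed

lemma v_has_vector_derivative:
  assumes t: "t \<in> {0..T}"
  shows "((\<lambda>t. v t k) has_vector_derivative - \<i> * of_real lam * (schr_symbol (- t) k * F t k)) (at t within {0..T})"
proof -
  have "((\<lambda>t. integral {0..t} (\<lambda>s. schr_symbol (- s) k * F s k)) has_vector_derivative schr_symbol (- t) k * F t k) (at t within {0..T})"
    by (rule integral_has_vector_derivative[OF _ t]) (intro continuous_intros continuous_on_F)
  then have "((\<lambda>t. v 0 k - \<i> * of_real lam * integral {0..t} (\<lambda>s. schr_symbol (- s) k * F s k)) has_vector_derivative 0 - \<i> * of_real lam * (schr_symbol (- t) k * F t k)) (at t within {0..T})"
    by (intro has_vector_derivative_diff has_vector_derivative_const has_vector_derivative_mult_right)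
  then have "((\<lambda>t. v t k) has_vector_derivative 0 - \<i> * of_real lam * (schr_symbol (- t) k * F t k)) (at t within {0..T})"
    by (rule has_vector_derivative_transform[OF t, rotated]) (erule v_integral)
  then show ?thesis by simp
qed

lemma v_diff_integral:
  assumes "t \<in> {0..T}" "s \<in> {0..T}" "s \<le> t"
  shows "v t k - v s k = - \<i> * of_real lam * integral {s..t} (\<lambda>r. schr_symbol (- r) k * F r k)"
proof -
  have "(\<lambda>r. schr_symbol (- r) k * F r k) integrable_on {0..t}"
    by (intro integrable_continuous_interval continuous_intros continuous_on_subset[OF continuous_on_F]) (use assms in auto)
  then have "integral {0..s} (\<lambda>r. schr_symbol (- r) k * F r k) + integral {s..t} (\<lambda>r. schr_symbol (- r) k * F r k) = integral {0..t} (\<lambda>r. schr_symbol (- r) k * F r k)"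
    using assms by (intro Henstock_Kurzweil_Integration.integral_combine) auto
  then show ?thesis unfolding v_integral[OF assms(1)] v_integral[OF assms(2)] by (simp add: algebra_simps flip: distrib_left)
qed

end

section \<open>Conservation laws\<close>

definition quartic_freqs :: "int set \<Rightarrow> (int \<times> int \<times> int \<times> int) set" where
  "quartic_freqs A = {(i, j, l, m). i \<in> A \<and> j \<in> A \<and> l \<in> A \<and> m \<in> A \<and> i + l = j + m}"

text \<open>The mean of a conj(b) d conj(e) for truncated series, seen on the frequency side.
  Summing over a set of quadruples makes its symmetries bijections of the index set.\<close>

definition quartic :: "int set \<Rightarrow> (int \<Rightarrow> complex) \<Rightarrow> (int \<Rightarrow> complex) \<Rightarrow> (int \<Rightarrow> complex) \<Rightarrow> (int \<Rightarrow> complex) \<Rightarrow> complex" where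
  "quartic A a b d e = (\<Sum>(i, j, l, m)\<in>quartic_freqs A. a i * cnj (b j) * d l * cnj (e m))"

lemma quartic_swap13: "quartic A a b d e = quartic A d b a e"
  unfolding quartic_def
  by (rule sum.reindex_bij_witness[of _ "\<lambda>(i, j, l, m). (l, j, i, m)" "\<lambda>(i, j, l, m). (l, j, i, m)"]) (auto simp: quartic_freqs_def)

lemma quartic_swap24: "quartic A a b d e = quartic A a e d b"
  unfolding quartic_def
  by (rule sum.reindex_bij_witness[of _ "\<lambda>(i, j, l, m). (i, m, l, j)" "\<lambda>(i, j, l, m). (i, m, l, j)"]) (auto simp: quartic_freqs_def)

lemma quartic_cnj: "cnj (quartic A a b d e) = quartic A b a e d"
  unfolding quartic_def cnj_sum
  by (rule sum.reindex_bij_witness[of _ "\<lambda>(i, j, l, m). (j, i, m, l)" "\<lambda>(i, j, l, m). (j, i, m, l)"]) (auto simp: quartic_freqs_def)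

text \<open>The last frequency is the output of the projected cubic. Together with the derivative
  formula below, this exhibits \<open>cube J\<close> as the gradient of the truncated quartic
  energy, up to a factor.\<close>

lemma quartic_cube: "quartic (freqs J) a a a e = (\<Sum>m\<in>freqs J. cnj (e m) * cube J a m)"
proof -
  let ?A = "freqs J"
  have "(\<Sum>m\<in>?A. cnj (e m) * cube J a m) =
     (\<Sum>m\<in>?A. \<Sum>i\<in>?A. \<Sum>j\<in>?A. \<Sum>l\<in>?A. if i + j + l = m then cnj (e m) * (a i * conj_coeffs a j * a l) else 0)"
    unfolding cube_def tri_def s3_def sum_distrib_left by (intro sum.cong refl) auto
  also have "\<dots> = (\<Sum>(m, i, j, l)\<in>?A \<times> ?A \<times> ?A \<times> ?A. if i + j + l = m then cnj (e m) * (a i * conj_coeffs a j * a l) else 0)"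
    by (simp add: sum.cartesian_product)
  also have "\<dots> = (\<Sum>(m, i, j, l)\<in>{(m, i, j, l). m \<in> ?A \<and> i \<in> ?A \<and> j \<in> ?A \<and> l \<in> ?A \<and> i + j + l = m}. cnj (e m) * (a i * conj_coeffs a j * a l))"
    by (rule sum.mono_neutral_cong_right) (auto split: if_splits)
  also have "\<dots> = quartic ?A a a a e"
    unfolding quartic_def
    by (rule sum.reindex_bij_witness[of _ "\<lambda>(i, j, l, m). (m, i, - j, l)" "\<lambda>(m, i, j, l). (i, - j, l, m)"]) (auto simp: quartic_freqs_def conj_coeffs_def)
  finally show ?thesis ..
qed

lemma Im_quartic: "Im (quartic A a a a a) = 0"
  using quartic_cnj[of A a a a a] by (metis Im_complex_of_real Reals_cnj_iff complex_is_Real_iff)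

text \<open>Since j + m = i + l, the weights on the conjugated slots and on the others give equal
  totals. By the swap symmetries the two slots of either kind agree, so the weight may move from m
  to l, and this form is the complex conjugate of the original.\<close>

lemma Im_quartic_weight: "Im (quartic A a a a (\<lambda>m. of_int m * a m)) = 0"
proof -
  let ?w = "\<lambda>m. of_int m * a m"
  have "quartic A a a a ?w + quartic A a ?w a a = quartic A ?w a a a + quartic A a a ?w a"
    unfolding quartic_def sum.distrib[symmetric]
  proof (rule sum.cong[OF refl])
    fix p assume "p \<in> quartic_freqs A"
    then obtain i j l m where p: "p = (i, j, l, m)" "i + l = j + m" unfolding quartic_freqs_def by auto
    have e: "complex_of_int j + of_int m = of_int i + of_int l" using p(2) by (metis of_int_add)
    have "(case p of (i, j, l, m) \<Rightarrow> a i * cnj (a j) * a l * cnj (of_int m * a m)) + (case p of (i, j, l, m) \<Rightarrow> a i * cnj (of_int j * a j) * a l * cnj (a m))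
      = (of_int j + of_int m) * (a i * cnj (a j) * a l * cnj (a m))" unfolding p by (simp add: algebra_simps)
    also have "\<dots> = (case p of (i, j, l, m) \<Rightarrow> of_int i * a i * cnj (a j) * a l * cnj (a m)) + (case p of (i, j, l, m) \<Rightarrow> a i * cnj (a j) * (of_int l * a l) * cnj (a m))"
      unfolding e p by (simp add: algebra_simps)
    finally show "(case p of (i, j, l, m) \<Rightarrow> a i * cnj (a j) * a l * cnj (of_int m * a m)) + (case p of (i, j, l, m) \<Rightarrow> a i * cnj (of_int j * a j) * a l * cnj (a m)) =
      (case p of (i, j, l, m) \<Rightarrow> of_int i * a i * cnj (a j) * a l * cnj (a m)) + (case p of (i, j, l, m) \<Rightarrow> a i * cnj (a j) * (of_int l * a l) * cnj (a m))" .
  qed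
  then have "2 * quartic A a a a ?w = 2 * quartic A a a ?w a"
    using quartic_swap24[of A a ?w a a] quartic_swap13[of A ?w a a a] by simp
  then have "quartic A a a a ?w = cnj (quartic A a a a ?w)" unfolding quartic_cnj by simp
  then show ?thesis by (metis complex_is_Real_iff Reals_cnj_iff)
qed

text \<open>Under the swaps and conjugation all four slots contribute the same real part, hence the
  factor 4.\<close>

lemma quartic_has_vector_derivative:
  assumes A: "finite A" and f: "\<And>k. ((\<lambda>t. f t k) has_vector_derivative f' k) (at t within S)"
  shows "((\<lambda>t. Re (quartic A (f t) (f t) (f t) (f t))) has_vector_derivative 4 * Re (quartic A (f t) (f t) (f t) f')) (at t within S)"
proof -
  have fc: "((\<lambda>t. cnj (f t k)) has_vector_derivative cnj (f' k)) (at t within S)" for k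
    by (rule bounded_linear.has_vector_derivative[OF bounded_linear_cnj f])
  let ?f = "f t"
  have "((\<lambda>t. quartic A (f t) (f t) (f t) (f t)) has_vector_derivative
     (\<Sum>p\<in>quartic_freqs A. case p of (i, j, l, m) \<Rightarrow> (?f i * cnj (?f j) * ?f l) * cnj (f' m) + ((?f i * cnj (?f j)) * f' l + (?f i * cnj (f' j) + f' i * cnj (?f j)) * ?f l) * cnj (?f m))) (at t within S)"
    unfolding quartic_def
  proof (rule has_vector_derivative_sum)
    fix p assume "p \<in> quartic_freqs A"
    obtain i j l m where p: "p = (i, j, l, m)" by (cases p) auto
    show "((\<lambda>t. case p of (i, j, l, m) \<Rightarrow> f t i * cnj (f t j) * f t l * cnj (f t m)) has_vector_derivative
      (case p of (i, j, l, m) \<Rightarrow> (?f i * cnj (?f j) * ?f l) * cnj (f' m) + ((?f i * cnj (?f j)) * f' l + (?f i * cnj (f' j) + f' i * cnj (?f j)) * ?f l) * cnj (?f m))) (at t within S)"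
      unfolding p prod.case by (intro has_vector_derivative_mult f fc)
  qed
  also have "(\<Sum>p\<in>quartic_freqs A. case p of (i, j, l, m) \<Rightarrow> (?f i * cnj (?f j) * ?f l) * cnj (f' m) + ((?f i * cnj (?f j)) * f' l + (?f i * cnj (f' j) + f' i * cnj (?f j)) * ?f l) * cnj (?f m))
    = quartic A ?f ?f ?f f' + quartic A ?f ?f f' ?f + quartic A ?f f' ?f ?f + quartic A f' ?f ?f ?f"
    unfolding quartic_def sum.distrib[symmetric] by (intro sum.cong refl) (auto simp: algebra_simps)
  finally have d: "((\<lambda>t. quartic A (f t) (f t) (f t) (f t)) has_vector_derivative (quartic A ?f ?f ?f f' + quartic A ?f ?f f' ?f + quartic A ?f f' ?f ?f + quartic A f' ?f ?f ?f)) (at t within S)" .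
  have "Re (quartic A ?f ?f f' ?f) = Re (quartic A ?f ?f ?f f')" using quartic_cnj[of A ?f ?f ?f f'] by (metis complex_cnj(1) complex.sel(1) cnj.sel(1))
  moreover have "quartic A ?f f' ?f ?f = quartic A ?f ?f ?f f'" by (rule quartic_swap24)
  moreover have "quartic A f' ?f ?f ?f = quartic A ?f ?f f' ?f" by (rule quartic_swap13)
  ultimately have e: "Re (quartic A ?f ?f ?f f' + quartic A ?f ?f f' ?f + quartic A ?f f' ?f ?f + quartic A f' ?f ?f ?f) = 4 * Re (quartic A ?f ?f ?f f')" by simp
  show ?thesis using bounded_linear.has_vector_derivative[OF bounded_linear_Re d] unfolding e .
qed

lemma sum_mult_le_l2: "(\<Sum>k\<in>A. norm (a k) * norm (b k)) \<le> l2 A a * l2 A b"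
  using L2_set_mult_ineq[of "\<lambda>k. norm (a k)" "\<lambda>k. norm (b k)" A] unfolding l2_def by simp

lemma sum_mult_le_h1: "(\<Sum>k\<in>A. (jb k * norm (a k)) * (jb k * norm (b k))) \<le> h1 A a * h1 A b"
  using L2_set_mult_ineq[of "\<lambda>k. jb k * norm (a k)" "\<lambda>k. jb k * norm (b k)" A] unfolding h1_def by (simp add: abs_mult)

lemma norm_quartic_le: "norm (quartic (freqs J) a a a a) \<le> (l1 (freqs J) a)\<^sup>2 * (l2 (freqs J) a)\<^sup>2"
proof -
  have "norm (quartic (freqs J) a a a a) \<le> (\<Sum>m\<in>freqs J. norm (a m) * norm (cube J a m))"
    unfolding quartic_cube by (rule sum_norm_le) (simp add: norm_mult)
  also have "\<dots> \<le> l2 (freqs J) a * l2 (freqs J) (cube J a)" by (rule sum_mult_le_l2)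
  also have "\<dots> \<le> l2 (freqs J) a * ((l1 (freqs J) a)\<^sup>2 * l2 (freqs J) a)" by (intro mult_left_mono cube_l2) auto
  finally show ?thesis by (simp add: power2_eq_square mult_ac)
qed

lemma l2_sq: "(l2 A a)\<^sup>2 = (\<Sum>k\<in>A. (norm (a k))\<^sup>2)"
  unfolding l2_def L2_set_def by (simp add: sum_nonneg)

lemma h1_sq: "(h1 A a)\<^sup>2 = (\<Sum>k\<in>A. (norm (a k))\<^sup>2) + (\<Sum>k\<in>A. (of_int k)\<^sup>2 * (norm (a k))\<^sup>2)"
proof -
  have "(h1 A a)\<^sup>2 = (\<Sum>k\<in>A. (jb k * norm (a k))\<^sup>2)" unfolding h1_def L2_set_def by (simp add: sum_nonneg)
  then show ?thesis by (simp add: power_mult_distrib jb_sq ring_distribs sum.distrib)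
qed

text \<open>The frequency \<open>q\<close> is chosen so large that the interpolation inequality \<open>l1_interp\<close> absorbs the potential energy
  into half of the kinetic energy, whatever the sign of \<open>\<lambda>\<close>.\<close>

definition h1_bound_const :: "real \<Rightarrow> real" where
  "h1_bound_const R = (let m = R\<^sup>2 + 1; q = real (nat \<lceil>4 * m\<rceil>) in sqrt (m + 2 * (R\<^sup>2 + 9 / 2 * R^4 + 1 + m\<^sup>2 * (2 * q + 1) + m / 2)))"

section \<open>Nearly conserved mass and momentum of the truncated solution\<close>

context nls_sol begin

lemma c_has_vector_derivative:
  assumes t: "t \<in> {0..T}"
  shows "((\<lambda>t. c t k) has_vector_derivative - \<i> * (of_int k)\<^sup>2 * c t k - \<i> * of_real lam * F t k) (at t within {0..T})"
proof -
  have "((\<lambda>z. exp (- \<i> * z * (of_int k)\<^sup>2)) has_field_derivative - \<i> * (of_int k)\<^sup>2 * exp (- \<i> * of_real t * (of_int k)\<^sup>2)) (at (of_real t))"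
    by (auto intro!: derivative_eq_intros)
  from has_vector_derivative_real_field[OF this, of "{0..T}"]
  have "((\<lambda>t. schr_symbol t k) has_vector_derivative - \<i> * (of_int k)\<^sup>2 * schr_symbol t k) (at t within {0..T})"
    unfolding schr_symbol_def by simp
  from has_vector_derivative_mult[OF this v_has_vector_derivative[OF t]]
  have "((\<lambda>t. c t k) has_vector_derivative schr_symbol t k * (- \<i> * of_real lam * (schr_symbol (- t) k * F t k)) + - \<i> * (of_int k)\<^sup>2 * schr_symbol t k * v t k) (at t within {0..T})"
    unfolding c_v by simp
  moreover have "schr_symbol t k * (- \<i> * of_real lam * (schr_symbol (- t) k * F t k)) + - \<i> * (of_int k)\<^sup>2 * schr_symbol t k * v t k =
    - \<i> * (of_int k)\<^sup>2 * c t k - \<i> * of_real lam * (schr_symbol t k * schr_symbol (- t) k) * F t k"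
    unfolding c_v by (simp add: algebra_simps)
  ultimately show ?thesis unfolding schr_symbol_inverse mult_1_right by simp
qed

lemma normsq_has_vector_derivative:
  assumes t: "t \<in> {0..T}"
  shows "((\<lambda>t. (norm (c t k))\<^sup>2) has_vector_derivative 2 * lam * Im (cnj (c t k) * F t k)) (at t within {0..T})"
proof -
  have "((\<lambda>t. Re (c t k * cnj (c t k))) has_vector_derivative
     Re (c t k * cnj (- \<i> * (of_int k)\<^sup>2 * c t k - \<i> * of_real lam * F t k) + (- \<i> * (of_int k)\<^sup>2 * c t k - \<i> * of_real lam * F t k) * cnj (c t k))) (at t within {0..T})"
    by (intro bounded_linear.has_vector_derivative[OF bounded_linear_Re] has_vector_derivative_mult
        bounded_linear.has_vector_derivative[OF bounded_linear_cnj] c_has_vector_derivative t)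
  moreover have "Re (z * cnj z) = (norm z)\<^sup>2" for z unfolding cmod_power2 by (simp add: power2_eq_square)
  moreover have "Re (z * cnj (- \<i> * (of_int k)\<^sup>2 * z - \<i> * of_real lam * w) + (- \<i> * (of_int k)\<^sup>2 * z - \<i> * of_real lam * w) * cnj z) = 2 * lam * Im (cnj z * w)" for z w
  proof -
    have "(of_int k :: complex)\<^sup>2 = of_real ((of_int k)\<^sup>2)" by simp
    then show ?thesis by (simp only:) (simp add: algebra_simps)
  qed
  ultimately show ?thesis by simp
qed

text \<open>The weights \<open>1\<close> and \<open>k\<close> give mass and momentum. For the truncated nonlinearity these are conserved exactly, and
  replacing \<open>F\<close> by it costs \<open>O(1 / N)\<close>.\<close>

lemma weighted_mass:
  assumes B: "\<And>t J. t \<in> {0..T} \<Longrightarrow> h1 (freqs J) (c t) \<le> B" and t: "t \<in> {0..T}" and N: "N \<ge> 1"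
    and w: "\<And>k. \<bar>w k\<bar> \<le> jb k" and z: "\<And>a. (\<Sum>k\<in>freqs N. w k * Im (cnj (a k) * cube N a k)) = 0"
  shows "\<bar>(\<Sum>k\<in>freqs N. w k * (norm (c t k))\<^sup>2) - (\<Sum>k\<in>freqs N. w k * (norm (c 0 k))\<^sup>2)\<bar> \<le> 270 * B^4 * T / real N"
proof -
  let ?A = "freqs N"
  have B0: "0 \<le> B" using order_trans[OF h1_nonneg B[of 0 0]] T by simp
  define D where "D s = (\<Sum>k\<in>?A. w k * (2 * lam * Im (cnj (c s k) * F s k)))" for s
  have "((\<lambda>s. \<Sum>k\<in>?A. w k * (norm (c s k))\<^sup>2) has_vector_derivative D s) (at s within {0..t})" if s: "s \<in> {0..t}" for s
    unfolding D_def
    by (intro has_vector_derivative_sum has_vector_derivative_mult_right has_vector_derivative_within_subset[OF normsq_has_vector_derivative]) (use s t in auto)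
  then have "(D has_integral (\<Sum>k\<in>?A. w k * (norm (c t k))\<^sup>2) - (\<Sum>k\<in>?A. w k * (norm (c 0 k))\<^sup>2)) {0..t}"
    using t by (intro fundamental_theorem_of_calculus) auto
  then have int: "(D has_integral (\<Sum>k\<in>?A. w k * (norm (c t k))\<^sup>2) - (\<Sum>k\<in>?A. w k * (norm (c 0 k))\<^sup>2)) (cbox 0 t)" by simp
  have bd: "norm (D s) \<le> 270 * B^4 / real N" if s: "s \<in> cbox 0 t" for s
  proof -
    have sT: "s \<in> {0..T}" using s t by auto
    let ?d = "\<lambda>k. F s k - cube N (c s) k"
    have "D s = 2 * lam * (\<Sum>k\<in>?A. w k * Im (cnj (c s k) * F s k))" unfolding D_def sum_distrib_left by (simp add: mult_ac)
    \<comment> \<open>Only the truncation error of the nonlinearity survives. The weight is charged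
      to the solution in H^1, so the error is needed in L^2 only, where it is 135 B^3 / N.\<close>
    also have "(\<Sum>k\<in>?A. w k * Im (cnj (c s k) * F s k)) = (\<Sum>k\<in>?A. w k * Im (cnj (c s k) * ?d k)) + (\<Sum>k\<in>?A. w k * Im (cnj (c s k) * cube N (c s) k))"
      unfolding sum.distrib[symmetric] by (intro sum.cong refl) (simp add: algebra_simps)
    also have "(\<Sum>k\<in>?A. w k * Im (cnj (c s k) * cube N (c s) k)) = 0" by (rule z)
    finally have Ds: "\<bar>D s\<bar> = 2 * \<bar>\<Sum>k\<in>?A. w k * Im (cnj (c s k) * ?d k)\<bar>" using lam by (simp add: abs_mult)
    have "\<bar>\<Sum>k\<in>?A. w k * Im (cnj (c s k) * ?d k)\<bar> \<le> (\<Sum>k\<in>?A. \<bar>jb k * norm (c s k)\<bar> * \<bar>norm (?d k)\<bar>)"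
    proof (rule order_trans[OF sum_abs sum_mono])
      fix k
      have "\<bar>Im (cnj (c s k) * ?d k)\<bar> \<le> norm (c s k) * norm (?d k)" using abs_Im_le_cmod[of "cnj (c s k) * ?d k"] by (simp add: norm_mult)
      then have "\<bar>w k\<bar> * \<bar>Im (cnj (c s k) * ?d k)\<bar> \<le> jb k * (norm (c s k) * norm (?d k))" by (intro mult_mono w) auto
      then show "\<bar>w k * Im (cnj (c s k) * ?d k)\<bar> \<le> \<bar>jb k * norm (c s k)\<bar> * \<bar>norm (?d k)\<bar>" by (simp add: abs_mult mult.assoc)
    qed
    also have "\<dots> \<le> h1 ?A (c s) * l2 ?A ?d" unfolding h1_def l2_def by (rule L2_set_mult_ineq)
    also have "\<dots> \<le> B * (135 * B^3 / real N)"
      by (rule mult_mono[OF B[OF sT] F_cube_l2[OF sT B[OF sT] _ N] B0]) auto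
    finally have "\<bar>D s\<bar> \<le> 2 * (B * (135 * B^3 / real N))" unfolding Ds by simp
    then show ?thesis by (simp add: eval_nat_numeral)
  qed
  have "norm ((\<Sum>k\<in>?A. w k * (norm (c t k))\<^sup>2) - (\<Sum>k\<in>?A. w k * (norm (c 0 k))\<^sup>2)) \<le> 270 * B^4 / real N * measure lborel (cbox 0 t)"
    by (rule has_integral_bound[OF _ int]) (use bd B0 in auto)
  also have "\<dots> \<le> 270 * B^4 / real N * T" using t B0 by (intro mult_left_mono) auto
  finally show ?thesis by simp
qed

lemma mass_diff:
  assumes B: "\<And>t J. t \<in> {0..T} \<Longrightarrow> h1 (freqs J) (c t) \<le> B" and t: "t \<in> {0..T}" and N: "N \<ge> 1"
  shows "\<bar>(\<Sum>k\<in>freqs N. (norm (c t k))\<^sup>2) - (\<Sum>k\<in>freqs N. (norm (c 0 k))\<^sup>2)\<bar> \<le> 270 * B^4 * T / real N"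
proof -
  have "(\<Sum>k\<in>freqs N. 1 * Im (cnj (a k) * cube N a k)) = 0" for a
    using Im_quartic[of "freqs N" a] unfolding quartic_cube by simp
  then show ?thesis using weighted_mass[OF B t N, of "\<lambda>_. 1"] jb_ge_1 by simp
qed

lemma momentum_diff:
  assumes B: "\<And>t J. t \<in> {0..T} \<Longrightarrow> h1 (freqs J) (c t) \<le> B" and t: "t \<in> {0..T}" and N: "N \<ge> 1"
  shows "\<bar>(\<Sum>k\<in>freqs N. of_int k * (norm (c t k))\<^sup>2) - (\<Sum>k\<in>freqs N. of_int k * (norm (c 0 k))\<^sup>2)\<bar> \<le> 270 * B^4 * T / real N"
proof -
  have "(\<Sum>k\<in>freqs N. of_int k * Im (cnj (a k) * cube N a k)) = 0" for a
  proof -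
    have "Im (\<Sum>m\<in>freqs N. cnj (of_int m * a m) * cube N a m) = (\<Sum>k\<in>freqs N. of_int k * Im (cnj (a k) * cube N a k))"
      unfolding Im_sum
    proof (rule sum.cong[OF refl])
      fix k
      have "complex_of_int k = of_real (of_int k)" by simp
      then show "Im (cnj (of_int k * a k) * cube N a k) = of_int k * Im (cnj (a k) * cube N a k)"
        by (simp only: complex_cnj_mult complex_cnj_complex_of_real mult.assoc) (simp del: of_real_of_int_eq)
    qed
    then show ?thesis using Im_quartic_weight[of "freqs N" a] unfolding quartic_cube by simp
  qed
  then show ?thesis using weighted_mass[OF B t N, of of_int] abs_le_jb by simp
qed

section \<open>Energy conservation in the limit and the a priori bound in H^1\<close>

definition energy :: "nat \<Rightarrow> real \<Rightarrow> real" where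
  "energy J t = (\<Sum>k\<in>freqs J. (of_int k)\<^sup>2 * (norm (c t k))\<^sup>2) + lam / 2 * Re (quartic (freqs J) (c t) (c t) (c t) (c t))"

text \<open>Convergence of the H^1 series at one fixed time. No rate in J and no uniformity in time
  is claimed, which is why dominated convergence is used in \<open>energy_limit\<close>.\<close>

lemma trunc_tail:
  assumes t: "t \<in> {0..T}"
  shows "\<exists>e. (\<forall>J J'. h1 (freqs J') (\<lambda>k. c t k - trunc J (c t) k) \<le> e J) \<and> e \<longlonglongrightarrow> 0"
proof -
  define f where "f k = (jb k * norm (c t k))\<^sup>2" for k
  have sf: "f summable_on UNIV" unfolding f_def c_fun by (rule H1_D(3)[OF u_H1[OF t]])
  define e where "e J = sqrt (infsum f UNIV - sum f (freqs J))" for J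
  have "h1 (freqs J') (\<lambda>k. c t k - trunc J (c t) k) \<le> e J" for J J'
  proof -
    have "(\<Sum>k\<in>freqs J'. (jb k * norm (c t k - trunc J (c t) k))\<^sup>2) = sum f (freqs J' - freqs J)"
      by (rule sum.mono_neutral_cong_right) (auto simp: trunc_def f_def)
    also have "\<dots> = sum f ((freqs J' - freqs J) \<union> freqs J) - sum f (freqs J)"
      by (subst sum.union_disjoint) auto
    also have "\<dots> \<le> infsum f UNIV - sum f (freqs J)"
      using finite_sum_le_infsum[OF sf, of "(freqs J' - freqs J) \<union> freqs J"] by (simp add: f_def)
    finally show ?thesis unfolding h1_def L2_set_def e_def by (rule real_sqrt_le_mono)
  qed
  moreover have "e \<longlonglongrightarrow> sqrt (infsum f UNIV - infsum f UNIV)"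
    unfolding e_def by (intro tendsto_intros infsum_freqs_limit[OF sf])
  ultimately show ?thesis by auto
qed

text \<open>The time derivative of the truncated energy after all cancellations: every summand
  contains the difference between the true and the truncated nonlinearity.\<close>

definition energy_deriv :: "nat \<Rightarrow> real \<Rightarrow> real" where
  "energy_deriv J t = 2 * lam * (\<Sum>k\<in>freqs J. (of_int k)\<^sup>2 * Im (cnj (c t k) * (F t k - cube J (c t) k)) - lam * Im (cnj (F t k - cube J (c t) k) * cube J (c t) k))"

lemma energy_has_vector_derivative:
  assumes t: "t \<in> {0..T}"
  shows "(energy J has_vector_derivative energy_deriv J t) (at t within {0..T})"
proof -
  let ?A = "freqs J" and ?T = "cube J (c t)"
  let ?c' = "\<lambda>k. - \<i> * (of_int k)\<^sup>2 * c t k - \<i> * of_real lam * F t k"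
  have "((\<lambda>t. (\<Sum>k\<in>?A. (of_int k)\<^sup>2 * (norm (c t k))\<^sup>2) + lam / 2 * Re (quartic ?A (c t) (c t) (c t) (c t))) has_vector_derivative
    (\<Sum>k\<in>?A. (of_int k)\<^sup>2 * (2 * lam * Im (cnj (c t k) * F t k))) + lam / 2 * (4 * Re (quartic ?A (c t) (c t) (c t) ?c'))) (at t within {0..T})"
    by (intro has_vector_derivative_add has_vector_derivative_sum has_vector_derivative_mult_right normsq_has_vector_derivative
        quartic_has_vector_derivative c_has_vector_derivative t) auto
  moreover have "(\<Sum>k\<in>?A. (of_int k)\<^sup>2 * (2 * lam * Im (cnj (c t k) * F t k))) + lam / 2 * (4 * Re (quartic ?A (c t) (c t) (c t) ?c')) = energy_deriv J t"
  proof -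
    \<comment> \<open>The kinetic part and the linear flow inside the potential part combine to k^2
      times the truncation error. In the remaining term |cube|^2 is real and may be subtracted
      inside the imaginary part.\<close>
    have "(of_int k)\<^sup>2 * (2 * lam * Im (cnj (c t k) * F t k)) + 2 * lam * Re (cnj (?c' k) * ?T k) =
      2 * lam * ((of_int k)\<^sup>2 * Im (cnj (c t k) * (F t k - ?T k)) - lam * Im (cnj (F t k - ?T k) * ?T k))" for k
    proof -
      have k2: "(of_int k :: complex)\<^sup>2 = of_real ((of_int k)\<^sup>2)" by simp
      show ?thesis unfolding k2 by (simp add: algebra_simps)
    qed
    note per = this
    have "(\<Sum>k\<in>?A. (of_int k)\<^sup>2 * (2 * lam * Im (cnj (c t k) * F t k))) + lam / 2 * (4 * Re (quartic ?A (c t) (c t) (c t) ?c')) =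
      (\<Sum>k\<in>?A. (of_int k)\<^sup>2 * (2 * lam * Im (cnj (c t k) * F t k))) + 2 * lam * (\<Sum>k\<in>?A. Re (cnj (?c' k) * ?T k))"
      unfolding quartic_cube Re_sum by simp
    also have "\<dots> = (\<Sum>k\<in>?A. (of_int k)\<^sup>2 * (2 * lam * Im (cnj (c t k) * F t k)) + 2 * lam * Re (cnj (?c' k) * ?T k))"
      by (simp only: sum.distrib sum_distrib_left)
    also have "\<dots> = energy_deriv J t" unfolding per energy_deriv_def sum_distrib_left ..
    finally show ?thesis .
  qed
  ultimately show ?thesis unfolding energy_def[abs_def] by simp
qed

text \<open>The weight k^2 is shared equally between the solution and the truncation error, so the
  error must be measured in H^1 and the bound is proportional to the tail.\<close>

lemma energy_deriv_bound:
  assumes t: "t \<in> {0..T}" and B: "\<And>J. h1 (freqs J) (c t) \<le> B"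
    and e: "\<And>J'. h1 (freqs J') (\<lambda>k. c t k - trunc J (c t) k) \<le> e"
  shows "\<bar>energy_deriv J t\<bar> \<le> 2 * (B + 27 * B^3) * (81 * B\<^sup>2 * e)"
proof -
  let ?A = "freqs J" and ?T = "cube J (c t)"
  let ?d = "\<lambda>k. F t k - ?T k"
  have B0: "0 \<le> B" using B[of 0] h1_nonneg order_trans by blast
  have hd: "h1 ?A ?d \<le> 81 * B\<^sup>2 * e" by (rule F_cube_h1[OF t B _ e]) simp
  have Dt: "\<bar>energy_deriv J t\<bar> = 2 * \<bar>\<Sum>k\<in>?A. (of_int k)\<^sup>2 * Im (cnj (c t k) * ?d k) - lam * Im (cnj (?d k) * ?T k)\<bar>"
    unfolding energy_deriv_def using lam by (simp add: abs_mult)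
  have "\<bar>\<Sum>k\<in>?A. (of_int k)\<^sup>2 * Im (cnj (c t k) * ?d k) - lam * Im (cnj (?d k) * ?T k)\<bar>
    \<le> (\<Sum>k\<in>?A. (jb k * norm (c t k)) * (jb k * norm (?d k)) + norm (?d k) * norm (?T k))"
  proof (rule order_trans[OF sum_abs sum_mono])
    fix k
    have "\<bar>Im (cnj (c t k) * ?d k)\<bar> \<le> norm (c t k) * norm (?d k)" using abs_Im_le_cmod[of "cnj (c t k) * ?d k"] by (simp add: norm_mult)
    then have "(of_int k)\<^sup>2 * \<bar>Im (cnj (c t k) * ?d k)\<bar> \<le> (jb k)\<^sup>2 * (norm (c t k) * norm (?d k))"
      by (intro mult_mono) (auto simp: jb_sq)
    moreover have "\<bar>Im (cnj (?d k) * ?T k)\<bar> \<le> norm (?d k) * norm (?T k)" using abs_Im_le_cmod[of "cnj (?d k) * ?T k"] by (metis complex_mod_cnj norm_mult)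
    moreover have "\<bar>(of_int k)\<^sup>2 * Im (cnj (c t k) * ?d k) - lam * Im (cnj (?d k) * ?T k)\<bar> \<le> (of_int k)\<^sup>2 * \<bar>Im (cnj (c t k) * ?d k)\<bar> + \<bar>Im (cnj (?d k) * ?T k)\<bar>"
      using abs_triangle_ineq4[of "(of_int k)\<^sup>2 * Im (cnj (c t k) * ?d k)" "lam * Im (cnj (?d k) * ?T k)"] lam by (simp add: abs_mult)
    ultimately show "\<bar>(of_int k)\<^sup>2 * Im (cnj (c t k) * ?d k) - lam * Im (cnj (?d k) * ?T k)\<bar> \<le> (jb k * norm (c t k)) * (jb k * norm (?d k)) + norm (?d k) * norm (?T k)"
      by (simp add: power2_eq_square mult_ac)
  qed
  also have "\<dots> \<le> h1 ?A (c t) * h1 ?A ?d + l2 ?A ?d * l2 ?A ?T"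
    unfolding sum.distrib by (intro add_mono sum_mult_le_h1 sum_mult_le_l2)
  also have "\<dots> \<le> B * (81 * B\<^sup>2 * e) + (81 * B\<^sup>2 * e) * (27 * B^3)"
  proof -
    have e0: "0 \<le> 81 * B\<^sup>2 * e" using order_trans[OF h1_nonneg hd] .
    have "l2 ?A ?d \<le> 81 * B\<^sup>2 * e" using l2_le_h1[of ?A ?d] hd by linarith
    moreover have "l2 ?A ?T \<le> 27 * B^3" using l2_le_h1[of ?A ?T] cube_h1[OF B[of J], of ?A] by simp
    ultimately have "l2 ?A ?d * l2 ?A ?T \<le> (81 * B\<^sup>2 * e) * (27 * B^3)" using e0 by (intro mult_mono) auto
    moreover have "h1 ?A (c t) * h1 ?A ?d \<le> B * (81 * B\<^sup>2 * e)" by (rule mult_mono[OF B hd B0]) simp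
    ultimately show ?thesis by linarith
  qed
  finally have "\<bar>energy_deriv J t\<bar> \<le> 2 * (B * (81 * B\<^sup>2 * e) + (81 * B\<^sup>2 * e) * (27 * B^3))" unfolding Dt by simp
  then show ?thesis by (simp add: algebra_simps)
qed

text \<open>The derivative of the truncated energy tends to zero at each time and is dominated by
  the bound obtained from the trivial tail estimate \<open>B\<close>.\<close>

lemma energy_limit:
  assumes t: "t \<in> {0..T}"
  shows "(\<lambda>J. energy J t - energy J 0) \<longlonglongrightarrow> 0"
proof -
  obtain B where B: "\<And>t J. t \<in> {0..T} \<Longrightarrow> h1 (freqs J) (c t) \<le> B" using c_bounded by blast
  have int: "(energy_deriv J has_integral (energy J t - energy J 0)) {0..t}" for J
    by (rule fundamental_theorem_of_calculus) (use t in \<open>auto intro!: has_vector_derivative_within_subset[OF energy_has_vector_derivative]\<close>)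
  have "(\<lambda>J. integral {0..t} (energy_deriv J)) \<longlonglongrightarrow> integral {0..t} (\<lambda>_. 0)"
  proof (rule dominated_convergence(2)[where h="\<lambda>_. 2 * (B + 27 * B^3) * (81 * B\<^sup>2 * B)"])
    show "energy_deriv J integrable_on {0..t}" for J using int by blast
    show "(\<lambda>_. 2 * (B + 27 * B^3) * (81 * B\<^sup>2 * B)) integrable_on {0..t}" by (rule integrable_const_ivl)
    fix s assume s: "s \<in> {0..t}"
    then have sT: "s \<in> {0..T}" using t by auto
    have "h1 (freqs J') (\<lambda>k. c s k - trunc J (c s) k) \<le> B" for J J'
      by (rule order_trans[OF h1_mono B[OF sT]]) (auto simp: trunc_def)
    then show "norm (energy_deriv J s) \<le> 2 * (B + 27 * B^3) * (81 * B\<^sup>2 * B)" for J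
      using energy_deriv_bound[OF sT B[OF sT], of J B] by simp
    obtain e where e: "\<And>J J'. h1 (freqs J') (\<lambda>k. c s k - trunc J (c s) k) \<le> e J" "e \<longlonglongrightarrow> 0"
      using trunc_tail[OF sT] by blast
    show "(\<lambda>J. energy_deriv J s) \<longlonglongrightarrow> 0"
    proof (rule Lim_null_comparison)
      show "\<forall>\<^sub>F J in sequentially. norm (energy_deriv J s) \<le> 2 * (B + 27 * B^3) * (81 * B\<^sup>2 * e J)"
        using energy_deriv_bound[OF sT B[OF sT] e(1)] by (intro always_eventually) simp
      have "(\<lambda>J. 2 * (B + 27 * B^3) * (81 * B\<^sup>2 * e J)) \<longlonglongrightarrow> 2 * (B + 27 * B^3) * (81 * B\<^sup>2 * 0)"
        by (intro tendsto_intros e(2))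
      then show "(\<lambda>J. 2 * (B + 27 * B^3) * (81 * B\<^sup>2 * e J)) \<longlonglongrightarrow> 0" by simp
    qed
  qed
  then show ?thesis using integral_unique[OF int] by simp
qed

lemma c_h1_bound:
  assumes R: "Hs_norm 1 u0 \<le> R" and t: "t \<in> {0..T}"
  shows "h1 (freqs J0) (c t) \<le> h1_bound_const R"
proof -
  have h0: "h1 (freqs J) (c 0) \<le> R" for J
    unfolding c_fun u_0 using h1_le_Hs_norm[OF u0, of "freqs J"] R by simp
  obtain B where B: "\<And>t J. t \<in> {0..T} \<Longrightarrow> h1 (freqs J) (c t) \<le> B" using c_bounded by blast
  define m where "m = R\<^sup>2 + 1"
  \<comment> \<open>With this choice the coefficient 4 m / q of m plus the kinetic energy, in the
    bound on the quartic term, is at most 1; the factor \<lambda> / 2 then leaves half of the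
    kinetic energy.\<close>
  define q where "q = nat \<lceil>4 * m\<rceil>"
  have m1: "1 \<le> m" unfolding m_def by simp
  have q4m: "4 * m \<le> real q" unfolding q_def by linarith
  have q1: "1 \<le> q" using q4m m1 by linarith
  define G where "G = m\<^sup>2 * (2 * real q + 1)"
  define K where "K = R\<^sup>2 + 9 / 2 * R^4 + 1 + G + m / 2"
  have "(\<lambda>N. 270 * B^4 * T / real N) \<longlonglongrightarrow> 0" by (rule lim_const_over_n)
  then have "\<forall>\<^sub>F N in sequentially. 270 * B^4 * T / real N < 1" by (rule order_tendstoD) simp
  moreover have "\<forall>\<^sub>F J in sequentially. \<bar>energy J t - energy J 0\<bar> < 1"
    using tendstoD[OF energy_limit[OF t], of 1] by simp
  ultimately have "\<forall>\<^sub>F J in sequentially. 270 * B^4 * T / real J < 1 \<and> \<bar>energy J t - energy J 0\<bar> < 1 \<and> J \<ge> max 1 J0"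
    using eventually_ge_at_top[of "max 1 J0"] by (intro eventually_conj)
  \<comment> \<open>\<open>J\<close> depends on the solution through the crude bound
    \<open>B\<close>, but it only serves to push the conservation defects below 1. The resulting
    estimate contains R alone.\<close>
  then obtain J where J: "270 * B^4 * T / real J < 1" "\<bar>energy J t - energy J 0\<bar> < 1" "J \<ge> 1" "J \<ge> J0"
    unfolding eventually_sequentially by fastforce
  let ?A = "freqs J"
  define ms where "ms s = (\<Sum>k\<in>?A. (norm (c s k))\<^sup>2)" for s
  define Kin where "Kin s = (\<Sum>k\<in>?A. (of_int k)\<^sup>2 * (norm (c s k))\<^sup>2)" for s
  have hs: "(h1 ?A (c s))\<^sup>2 = ms s + Kin s" for s unfolding ms_def Kin_def by (rule h1_sq)
  have pos: "0 \<le> ms s" "0 \<le> Kin s" for s unfolding ms_def Kin_def by (auto intro!: sum_nonneg)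
  have sum0: "ms 0 + Kin 0 \<le> R\<^sup>2" unfolding hs[symmetric] using h0[of J] by (intro power_mono) auto
  have mst: "ms t \<le> m" using mass_diff[OF B t J(3)] J(1) sum0 pos(2)[of 0] unfolding ms_def[symmetric] m_def by linarith
  have V: "\<bar>Re (quartic ?A (c s) (c s) (c s) (c s))\<bar> \<le> (l1 ?A (c s))\<^sup>2 * ms s" for s
    using abs_Re_le_cmod[of "quartic ?A (c s) (c s) (c s) (c s)"] norm_quartic_le[of J "c s"] unfolding l2_sq ms_def by linarith
  have "(l1 ?A (c 0))\<^sup>2 \<le> (3 * R)\<^sup>2" using l1_le_h1[of ?A "c 0"] h0[of J] by (intro power_mono) auto
  then have "(l1 ?A (c 0))\<^sup>2 * ms 0 \<le> (3 * R)\<^sup>2 * R\<^sup>2" using sum0 pos[of 0] by (intro mult_mono) auto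
  then have V0: "\<bar>Re (quartic ?A (c 0) (c 0) (c 0) (c 0))\<bar> \<le> 9 * R^4" using V[of 0] by (simp add: power_mult_distrib eval_nat_numeral)
  have Vlam: "\<bar>lam / 2 * z\<bar> = \<bar>z\<bar> / 2" for z using lam by (simp add: abs_mult)
  have E: "energy J s = Kin s + lam / 2 * Re (quartic ?A (c s) (c s) (c s) (c s))" for s unfolding energy_def Kin_def ..
  have E0: "energy J 0 \<le> R\<^sup>2 + 9 / 2 * R^4" using E[of 0] V0 Vlam[of "Re (quartic ?A (c 0) (c 0) (c 0) (c 0))"] sum0 pos(1)[of 0] by linarith
  have l1b: "(l1 ?A (c t))\<^sup>2 \<le> 2 * (2 * real q + 1) * ms t + 4 / real q * (ms t + Kin t)"
  proof -
    have "(l1 ?A (c t))\<^sup>2 \<le> (sqrt (2 * real q + 1) * l2 ?A (c t) + sqrt (2 / real q) * h1 ?A (c t))\<^sup>2"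
      by (intro power_mono l1_interp q1) auto
    also have "\<dots> \<le> 2 * (sqrt (2 * real q + 1) * l2 ?A (c t))\<^sup>2 + 2 * (sqrt (2 / real q) * h1 ?A (c t))\<^sup>2"
      using sum_squares_bound[of "sqrt (2 * real q + 1) * l2 ?A (c t)" "sqrt (2 / real q) * h1 ?A (c t)"] by (simp add: power2_sum)
    also have "\<dots> = 2 * (2 * real q + 1) * ms t + 4 / real q * (ms t + Kin t)"
      unfolding power_mult_distrib hs l2_sq ms_def[symmetric] by simp
    finally show ?thesis .
  qed
  have "(l1 ?A (c t))\<^sup>2 * ms t \<le> (2 * (2 * real q + 1) * m + 4 / real q * (m + Kin t)) * m"
  proof (intro mult_mono mst pos)
    show "(l1 ?A (c t))\<^sup>2 \<le> 2 * (2 * real q + 1) * m + 4 / real q * (m + Kin t)"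
      by (rule order_trans[OF l1b]) (intro add_mono mult_left_mono mst, auto)
    show "0 \<le> 2 * (2 * real q + 1) * m + 4 / real q * (m + Kin t)" using m1 pos[of t] by (intro add_nonneg_nonneg mult_nonneg_nonneg) auto
  qed
  also have "\<dots> = 2 * G + (4 * m / real q) * (m + Kin t)" unfolding G_def by (simp add: power2_eq_square algebra_simps)
  also have "\<dots> \<le> 2 * G + 1 * (m + Kin t)"
    using q4m q1 m1 pos(2)[of t] by (intro add_left_mono mult_right_mono) auto
  finally have Vt: "\<bar>Re (quartic ?A (c t) (c t) (c t) (c t))\<bar> \<le> 2 * G + (m + Kin t)"
    unfolding mult_1_left by (rule order_trans[OF V])
  have "Kin t \<le> energy J t + (G + (m + Kin t) / 2)"
  proof -
    define X where "X = lam / 2 * Re (quartic ?A (c t) (c t) (c t) (c t))"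
    have "\<bar>X\<bar> \<le> G + (m + Kin t) / 2" unfolding X_def Vlam using Vt by (simp add: field_simps)
    moreover have "energy J t = Kin t + X" using E[of t] unfolding X_def .
    ultimately show ?thesis by linarith
  qed
  also have "energy J t \<le> R\<^sup>2 + 9 / 2 * R^4 + 1" using J(2) E0 by linarith
  finally have "Kin t \<le> 2 * K" unfolding K_def by (simp add: field_simps)
  then have "(h1 ?A (c t))\<^sup>2 \<le> m + 2 * K" unfolding hs using mst by linarith
  then have "h1 ?A (c t) \<le> sqrt (m + 2 * K)" by (rule real_le_rsqrt)
  also have "\<dots> = h1_bound_const R" unfolding h1_bound_const_def Let_def K_def G_def q_def m_def ..
  finally have "h1 ?A (c t) \<le> h1_bound_const R" .
  moreover have "h1 (freqs J0) (c t) \<le> h1 ?A (c t)" using J(4) by (intro h1_subset) auto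
  ultimately show ?thesis by simp
qed

end

section \<open>Local error\<close>

text \<open>Minkowski's integral inequality by duality: the vector of integrals is paired with
  itself, Cauchy--Schwarz is applied under the integral, and one factor of the norm is
  cancelled.\<close>

lemma l2_integral_le:
  fixes g :: "int \<Rightarrow> real \<Rightarrow> complex"
  assumes K: "finite K" and ab: "a \<le> b" and I: "\<And>k. k \<in> K \<Longrightarrow> (g k has_integral I k) {a..b}"
    and G: "\<And>s. s \<in> {a..b} \<Longrightarrow> l2 K (\<lambda>k. g k s) \<le> G" "0 \<le> G"
  shows "l2 K I \<le> (b - a) * G"
proof (cases "l2 K I = 0")
  case True
  then show ?thesis using ab G by simp
next
  case False
  then have pos: "0 < l2 K I" by (metis l2_nonneg order_le_less)
  have "((\<lambda>s. \<Sum>k\<in>K. cnj (I k) * g k s) has_integral (\<Sum>k\<in>K. cnj (I k) * I k)) {a..b}"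
    by (intro has_integral_sum K has_integral_mult_right I)
  then have h: "((\<lambda>s. \<Sum>k\<in>K. cnj (I k) * g k s) has_integral (\<Sum>k\<in>K. cnj (I k) * I k)) (cbox a b)" by simp
  have "norm (\<Sum>k\<in>K. cnj (I k) * I k) \<le> (l2 K I * G) * measure lborel (cbox a b)"
  proof (rule has_integral_bound[OF _ h])
    fix s assume s: "s \<in> cbox a b"
    have "norm (\<Sum>k\<in>K. cnj (I k) * g k s) \<le> (\<Sum>k\<in>K. norm (I k) * norm (g k s))"
      by (rule sum_norm_le) (simp add: norm_mult)
    also have "\<dots> \<le> l2 K I * l2 K (\<lambda>k. g k s)" by (rule sum_mult_le_l2)
    also have "\<dots> \<le> l2 K I * G" using G s by (intro mult_left_mono) auto
    finally show "norm (\<Sum>k\<in>K. cnj (I k) * g k s) \<le> l2 K I * G" .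
  qed (use pos G in auto)
  moreover have "(\<Sum>k\<in>K. cnj (I k) * I k) = of_real ((l2 K I)\<^sup>2)"
    unfolding l2_sq of_real_sum by (intro sum.cong refl) (simp only: complex_norm_square mult.commute)
  ultimately have "(l2 K I)\<^sup>2 \<le> (l2 K I * G) * (b - a)" using ab by (simp only: norm_of_real) simp
  then have "l2 K I * l2 K I \<le> l2 K I * ((b - a) * G)" by (simp add: power2_eq_square mult_ac)
  then show ?thesis using pos by (simp only: mult_le_cancel_left_pos)
qed

lemma cube_schr_symbol:
  "schr_symbol (- s) k * cube N (\<lambda>k. schr_symbol s k * a k) k = tri (freqs N) (\<lambda>i j l. phase s (2 * (i + j) * (l + j))) a (conj_coeffs a) a k"
proof -
  have "schr_symbol (- s) k * cube N (\<lambda>k. schr_symbol s k * a k) k = tri (freqs N) (\<lambda>i j l. schr_symbol (- s) k * (schr_symbol s i * schr_symbol (- s) j * schr_symbol s l)) a (conj_coeffs a) a k"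
    unfolding cube_def conj_coeffs_schr_symbol tri_def s3_cmult[symmetric] by (rule s3_cong) (simp add: mult_ac)
  also have "\<dots> = tri (freqs N) (\<lambda>i j l. phase s (2 * (i + j) * (l + j))) a (conj_coeffs a) a k"
  proof (rule tri_m_cong)
    fix i j l assume "i + j + l = k"
    then have "schr_symbol (- s) k * (schr_symbol s i * schr_symbol (- s) j * schr_symbol s l) = (schr_symbol s k * schr_symbol (- s) k) * phase s (2 * (i + j) * (l + j))"
      using schr_symbol_resonance[of k i j l s] by simp
    then show "schr_symbol (- s) k * (schr_symbol s i * schr_symbol (- s) j * schr_symbol s l) = phase s (2 * (i + j) * (l + j))" unfolding schr_symbol_inverse by simp
  qed
  finally show ?thesis .
qed

lemma tri_phase_has_integral:
  assumes "0 \<le> t"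
  shows "((\<lambda>s. tri A (\<lambda>i j l. phase s (2 * (i + j) * (l + j))) a b d k) has_integral tri A (sym_exact t) a b d k) {0..t}"
proof (cases "finite A")
  case True
  show ?thesis
    unfolding tri_def s3_def sym_exact_def
  proof (intro has_integral_sum True)
    fix i j l
    show "((\<lambda>s. if i + j + l = k then phase s (2 * (i + j) * (l + j)) * (a i * b j * d l) else 0) has_integral
      (if i + j + l = k then phase_int t (2 * (i + j) * (l + j)) * (a i * b j * d l) else 0)) {0..t}"
      by (cases "i + j + l = k") (auto intro!: has_integral_mult_left phase_int_has_integral assms)
  qed
next
  case False
  then show ?thesis unfolding tri_def s3_def by simp
qed

context nls_sol begin

lemma v_l2_lipschitz:
  assumes B: "\<And>t J. t \<in> {0..T} \<Longrightarrow> h1 (freqs J) (c t) \<le> B" and t: "t \<in> {0..T}" "s \<in> {0..T}" "s \<le> t" and K: "finite K"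
  shows "l2 K (\<lambda>k. v t k - v s k) \<le> (t - s) * (27 * B^3)"
proof -
  have B0: "0 \<le> B" using order_trans[OF h1_nonneg B[of 0 0]] T by simp
  have "l2 K (\<lambda>k. v t k - v s k) = l2 K (\<lambda>k. integral {s..t} (\<lambda>r. schr_symbol (- r) k * F r k))"
    by (rule l2_cong) (simp only: v_diff_integral[OF t] norm_mult, simp add: lam)
  also have "\<dots> \<le> (t - s) * (27 * B^3)"
  proof (rule l2_integral_le[OF K t(3)])
    show "((\<lambda>r. schr_symbol (- r) k * F r k) has_integral integral {s..t} (\<lambda>r. schr_symbol (- r) k * F r k)) {s..t}" for k
      by (intro integrable_integral integrable_continuous_interval continuous_intros continuous_on_subset[OF continuous_on_F]) (use t in auto)
    fix r assume "r \<in> {s..t}"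
    then have r: "r \<in> {0..T}" using t by auto
    have "l2 K (\<lambda>k. schr_symbol (- r) k * F r k) = l2 K (F r)" by (rule l2_cong) (simp add: norm_mult)
    also have "\<dots> \<le> h1 K (F r)" by (rule l2_le_h1)
    also have "\<dots> \<le> 27 * B^3" by (rule F_h1_bound[OF r B[OF r] K])
    finally show "l2 K (\<lambda>k. schr_symbol (- r) k * F r k) \<le> 27 * B^3" .
  qed (use B0 in simp)
  finally show ?thesis .
qed

lemma exact_step:
  assumes B: "\<And>t J. t \<in> {0..T} \<Longrightarrow> h1 (freqs J) (c t) \<le> B" and t: "t \<in> {0..T}" "t + \<tau> \<in> {0..T}" "0 \<le> \<tau>" and N: "N \<ge> 1"
  shows "l2 (freqs N) (\<lambda>k. c (t + \<tau>) k - schr_symbol \<tau> k * (c t k - \<i> * of_real lam * tri (freqs N) (sym_exact \<tau>) (c t) (conj_coeffs (c t)) (c t) k))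
    \<le> \<tau> * (135 * B^3 / real N + 135 * B\<^sup>2 * (\<tau> * (27 * B^3)))"
proof -
  let ?A = "freqs N" and ?X = "tri (freqs N) (sym_exact \<tau>) (c t) (conj_coeffs (c t)) (c t)"
  have B0: "0 \<le> B" using order_trans[OF h1_nonneg B[of 0 0]] T by simp
  define g where "g k s = schr_symbol (- s) k * (F (t + s) k - cube N (\<lambda>k. schr_symbol s k * c t k) k)" for k s
  define I where "I k = integral {t..t+\<tau>} (\<lambda>r. schr_symbol (- (r - t)) k * F r k) - ?X k" for k
  have s1: "((\<lambda>s. schr_symbol (- s) k * F (t + s) k) has_integral integral {t..t+\<tau>} (\<lambda>r. schr_symbol (- (r - t)) k * F r k)) {0..\<tau>}" for k
  proof -
    have "((\<lambda>r. schr_symbol (- (r - t)) k * F r k) has_integral integral {t..t+\<tau>} (\<lambda>r. schr_symbol (- (r - t)) k * F r k)) {t..t+\<tau>}"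
      by (intro integrable_integral integrable_continuous_interval continuous_intros continuous_on_subset[OF continuous_on_F]) (use t in auto)
    then have "((\<lambda>r. schr_symbol (- (r - t)) k * F r k) has_integral integral {t..t+\<tau>} (\<lambda>r. schr_symbol (- (r - t)) k * F r k)) (cbox t (t+\<tau>))" by simp
    from has_integral_affinity[OF this, of 1 t] show ?thesis by (simp add: add.commute)
  qed
  have gI: "(g k has_integral I k) {0..\<tau>}" for k
    unfolding g_def[abs_def] I_def right_diff_distrib cube_schr_symbol by (intro has_integral_diff s1 tri_phase_has_integral t)
  have eq: "c (t + \<tau>) k - schr_symbol \<tau> k * (c t k - \<i> * of_real lam * ?X k) = (- \<i> * of_real lam * schr_symbol \<tau> k) * I k" for k
  proof -
    have v: "v (t + \<tau>) k = v t k - \<i> * of_real lam * integral {t..t+\<tau>} (\<lambda>r. schr_symbol (- r) k * F r k)"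
      using v_diff_integral[OF t(2,1)] t(3) by (simp add: algebra_simps)
    have "(\<lambda>r. schr_symbol (- (r - t)) k * F r k) = (\<lambda>r. schr_symbol t k * (schr_symbol (- r) k * F r k))"
      using schr_symbol_add[of t "- r" k for r] by (auto simp: mult.assoc)
    then have i: "integral {t..t+\<tau>} (\<lambda>r. schr_symbol (- (r - t)) k * F r k) = schr_symbol t k * integral {t..t+\<tau>} (\<lambda>r. schr_symbol (- r) k * F r k)" by simp
    show ?thesis unfolding I_def i c_v[of "t + \<tau>"] c_v[of t k] v schr_symbol_add by (simp add: algebra_simps)
  qed
  have "l2 ?A (\<lambda>k. c (t + \<tau>) k - schr_symbol \<tau> k * (c t k - \<i> * of_real lam * ?X k)) = l2 ?A I"
    unfolding eq by (rule l2_cong) (simp add: norm_mult lam)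
  also have "\<dots> \<le> (\<tau> - 0) * (135 * B^3 / real N + 135 * B\<^sup>2 * (\<tau> * (27 * B^3)))"
  proof (rule l2_integral_le[OF _ t(3) gI])
    fix s assume s: "s \<in> {0..\<tau>}"
    then have ts: "t + s \<in> {0..T}" using t by auto
    let ?b = "\<lambda>k. schr_symbol s k * c t k"
    have hb: "h1 ?A ?b \<le> B"
      using B[OF t(1), of N] h1_cong[of ?A ?b "c t"] by (simp add: norm_mult)
    have "l2 ?A (\<lambda>k. g k s) = l2 ?A (\<lambda>k. (F (t + s) k - cube N (c (t + s)) k) + (cube N (c (t + s)) k - cube N ?b k))"
      by (rule l2_cong) (simp add: g_def norm_mult)
    also have "\<dots> \<le> l2 ?A (\<lambda>k. F (t + s) k - cube N (c (t + s)) k) + l2 ?A (\<lambda>k. cube N (c (t + s)) k - cube N ?b k)"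
      by (rule l2_triangle)
    also have "\<dots> \<le> 135 * B^3 / real N + 135 * B\<^sup>2 * (\<tau> * (27 * B^3))"
    proof (rule add_mono)
      show "l2 ?A (\<lambda>k. F (t + s) k - cube N (c (t + s)) k) \<le> 135 * B^3 / real N"
        by (rule F_cube_l2[OF ts B[OF ts] _ N]) simp
      have "l2 ?A (\<lambda>k. cube N (c (t + s)) k - cube N ?b k) \<le> 135 * B\<^sup>2 * l2 ?A (\<lambda>k. c (t + s) k - ?b k)"
        by (rule cube_l2_diff[OF B[OF ts] hb]) simp
      also have "l2 ?A (\<lambda>k. c (t + s) k - ?b k) = l2 ?A (\<lambda>k. v (t + s) k - v t k)"
      proof (rule l2_cong)
        fix k
        have "c (t + s) k - ?b k = schr_symbol s k * schr_symbol t k * (v (t + s) k - v t k)"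
          unfolding c_v[of "t + s" k] c_v[of t k] schr_symbol_add by (simp add: algebra_simps)
        then show "norm (c (t + s) k - ?b k) = norm (v (t + s) k - v t k)" by (simp add: norm_mult)
      qed
      also have "135 * B\<^sup>2 * l2 ?A (\<lambda>k. v (t + s) k - v t k) \<le> 135 * B\<^sup>2 * (\<tau> * (27 * B^3))"
      proof (rule mult_left_mono)
        have "l2 ?A (\<lambda>k. v (t + s) k - v t k) \<le> (t + s - t) * (27 * B^3)"
          by (rule v_l2_lipschitz[OF B ts t(1)]) (use s in auto)
        also have "\<dots> \<le> \<tau> * (27 * B^3)" using s B0 by (intro mult_right_mono) auto
        finally show "l2 ?A (\<lambda>k. v (t + s) k - v t k) \<le> \<tau> * (27 * B^3)" .
      qed simp
      finally show "l2 ?A (\<lambda>k. cube N (c (t + s)) k - cube N ?b k) \<le> 135 * B\<^sup>2 * (\<tau> * (27 * B^3))" .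
    qed
    finally show "l2 ?A (\<lambda>k. g k s) \<le> 135 * B^3 / real N + 135 * B\<^sup>2 * (\<tau> * (27 * B^3))" .
  qed (use B0 t in auto)
  finally show ?thesis by simp
qed

end

section \<open>Initial data\<close>

text \<open>A sum of roots of unity over a full period is invariant under a shift of the index, and
  the shift multiplies it by \<open>e 1\<close>. Unless \<open>e 1 = 1\<close>, that is unless the
  number of nodes divides p, the sum must vanish.\<close>

lemma discrete_orthogonality:
  "(\<Sum>n\<in>freqs K. ek p (trig_node K n)) = (if (2 * int K + 1) dvd p then 2 * of_nat K + 1 else 0)"
proof -
  define D :: int where "D = 2 * int K + 1"
  define e where "e n = exp (\<i> * of_real (2 * pi * of_int p * of_int n / of_int D))" for n :: int
  have ek: "ek p (trig_node K n) = e n" for n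
    unfolding ek_def trig_node_def e_def D_def by (simp add: mult_ac)
  have D0: "D > 0" unfolding D_def by simp
  have shift: "e (n + 1) = e 1 * e n" for n
    unfolding e_def by (simp flip: exp_add) (simp add: ring_distribs add_divide_distrib add.commute)
  have per: "e (n + D) = e n" for n
  proof -
    have "e (n + D) = exp (\<i> * of_real (2 * pi * of_int p * of_int n / of_int D) + \<i> * (of_int p * (of_real pi * 2)))"
      unfolding e_def using D0 by (simp add: field_simps)
    then show ?thesis unfolding exp_plus_2pin e_def .
  qed
  show ?thesis
  proof (cases "D dvd p")
    case True
    then obtain r where r: "p = D * r" by blast
    have "e n = 1" for n
    proof -
      have "e n = exp (0 + \<i> * (of_int (r * n) * (of_real pi * 2)))" unfolding e_def r using D0 by (simp add: mult_ac)
      then show ?thesis unfolding exp_plus_2pin by simp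
    qed
    then show ?thesis using True unfolding ek D_def[symmetric] by simp
  next
    case False
    have ne: "e 1 \<noteq> 1"
    proof
      assume "e 1 = 1"
      then obtain n :: int where "2 * pi * of_int p / of_int D = of_int (2 * n) * pi"
        unfolding e_def exp_eq_1 by auto
      then have "real_of_int p = of_int (D * n)" using D0 by (simp add: field_simps)
      then have "p = D * n" by linarith
      then show False using False by simp
    qed
    have "e 1 * (\<Sum>n\<in>freqs K. e n) = (\<Sum>n\<in>freqs K. e (n + 1))" unfolding sum_distrib_left shift ..
    also have "\<dots> = (\<Sum>n\<in>{- int K + 1..int K + 1}. e n)"
      by (rule sum.reindex_bij_witness[of _ "\<lambda>n. n - 1" "\<lambda>n. n + 1"]) auto
    also have "\<dots> = (\<Sum>n\<in>freqs K. e n) - e (- int K) + e (int K + 1)"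
    proof -
      have "insert (- int K) {- int K + 1..int K + 1} = insert (int K + 1) (freqs K)" by auto
      then have "(\<Sum>n\<in>insert (- int K) {- int K + 1..int K + 1}. e n) = (\<Sum>n\<in>insert (int K + 1) (freqs K). e n)" by simp
      then show ?thesis by (simp add: algebra_simps)
    qed
    also have "e (int K + 1) = e (- int K)" using per[of "- int K"] unfolding D_def by (simp add: add.commute)
    finally have "(e 1 - 1) * (\<Sum>n\<in>freqs K. e n) = 0" by (simp add: algebra_simps)
    then show ?thesis using ne False unfolding ek D_def[symmetric] by simp
  qed
qed

text \<open>Aliasing: on the nodes, frequencies congruent modulo the number of nodes coincide, so
  the interpolation coefficient collects the whole congruence class of k.\<close>

lemma trig_coeff_alias:
  assumes s: "(\<lambda>k. norm (a k)) summable_on UNIV"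
  shows "(\<lambda>J. \<Sum>m\<in>freqs J. if (2 * int K + 1) dvd (m - k) then a m else 0) \<longlonglongrightarrow> trig_coeff K (fourier_series a) k"
proof -
  define D :: complex where "D = 2 * of_nat K + 1"
  have D: "D \<noteq> 0" unfolding D_def by (metis of_nat_1 of_nat_add of_nat_eq_0_iff of_nat_mult of_nat_numeral add_is_0 one_neq_zero)
  have tc: "trig_coeff K f k = 1 / D * (\<Sum>n\<in>freqs K. ek (- k) (trig_node K n) * f (trig_node K n))" for f
    unfolding trig_coeff_def ek_def D_def by simp
  have "(\<lambda>J. 1 / D * (\<Sum>n\<in>freqs K. ek (- k) (trig_node K n) * (\<Sum>m\<in>freqs J. a m * ek m (trig_node K n)))) \<longlonglongrightarrow> trig_coeff K (fourier_series a) k"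
    unfolding tc by (intro tendsto_intros fourier_series_limit s)
  moreover have "1 / D * (\<Sum>n\<in>freqs K. ek (- k) (trig_node K n) * (\<Sum>m\<in>freqs J. a m * ek m (trig_node K n))) =
    (\<Sum>m\<in>freqs J. if (2 * int K + 1) dvd (m - k) then a m else 0)" for J
  proof -
    have "(\<Sum>n\<in>freqs K. ek (- k) (trig_node K n) * (\<Sum>m\<in>freqs J. a m * ek m (trig_node K n))) =
      (\<Sum>n\<in>freqs K. \<Sum>m\<in>freqs J. a m * ek (m - k) (trig_node K n))"
      unfolding sum_distrib_left using ek_add[of "- k" m for m] by (intro sum.cong refl) (simp add: mult_ac)
    also have "\<dots> = (\<Sum>m\<in>freqs J. a m * (\<Sum>n\<in>freqs K. ek (m - k) (trig_node K n)))"
      by (subst sum.swap) (simp add: sum_distrib_left)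
    also have "\<dots> = (\<Sum>m\<in>freqs J. D * (if (2 * int K + 1) dvd (m - k) then a m else 0))"
      unfolding discrete_orthogonality D_def by (intro sum.cong refl) auto
    finally show ?thesis using D by (simp add: sum_distrib_left[symmetric])
  qed
  ultimately show ?thesis by simp
qed

text \<open>An alias has the form m = k + (4 N + 1) p with p nonzero, hence |m| \<ge> 3 N |p|. The
  sum is at most 1 / (9 N^2) times the two-sided sum of 1 / p^2, which is at most 4.\<close>

lemma alias_sum_bound:
  assumes N: "N \<ge> 1" and k: "k \<in> freqs N"
  shows "(\<Sum>m\<in>{m\<in>freqs J. m \<noteq> k \<and> (4 * int N + 1) dvd (m - k)}. 1 / (jb m)\<^sup>2) \<le> 1 / (real N)\<^sup>2"
proof -
  define D :: int where "D = 4 * int N + 1"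
  let ?Z = "{m\<in>freqs J. m \<noteq> k \<and> D dvd (m - k)}"
  define P where "P = J + N"
  have D1: "D \<ge> 1" unfolding D_def by simp
  have "(\<Sum>m\<in>?Z. 1 / (jb m)\<^sup>2) \<le> (\<Sum>m\<in>?Z. 1 / (9 * (real N)\<^sup>2) * (1 / (of_int ((m - k) div D))\<^sup>2))"
  proof (rule sum_mono)
    fix m assume m: "m \<in> ?Z"
    define p where "p = (m - k) div D"
    have mp: "m = k + D * p" using m unfolding p_def by auto
    have p0: "p \<noteq> 0" using m mp by auto
    have p1: "1 \<le> \<bar>p\<bar>" using p0 by linarith
    have "\<bar>D * p\<bar> = D * \<bar>p\<bar>" using D1 by (simp add: abs_mult)
    then have "D * \<bar>p\<bar> - int N \<le> \<bar>m\<bar>" using mp k by auto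
    moreover have "3 * int N * \<bar>p\<bar> \<le> D * \<bar>p\<bar> - int N"
    proof -
      have "int N * 1 \<le> int N * \<bar>p\<bar>" using p1 by (intro mult_left_mono) auto
      then show ?thesis using p1 unfolding D_def by (simp add: algebra_simps)
    qed
    ultimately have "3 * int N * \<bar>p\<bar> \<le> \<bar>m\<bar>" by linarith
    then have "real_of_int (3 * int N * \<bar>p\<bar>) \<le> real_of_int \<bar>m\<bar>" by (simp only: of_int_le_iff)
    then have "3 * real N * \<bar>of_int p\<bar> \<le> jb m" using abs_le_jb[of m] by simp
    then have "(3 * real N * \<bar>of_int p\<bar>)\<^sup>2 \<le> (jb m)\<^sup>2" by (intro power_mono) auto
    then have "1 / (jb m)\<^sup>2 \<le> 1 / (3 * real N * \<bar>of_int p\<bar>)\<^sup>2" using p0 N jb_pos[of m] by (intro divide_left_mono mult_pos_pos zero_less_power) (auto simp del: jb_pos)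
    then show "1 / (jb m)\<^sup>2 \<le> 1 / (9 * (real N)\<^sup>2) * (1 / (of_int ((m - k) div D))\<^sup>2)"
      unfolding p_def[symmetric] by (simp add: power_mult_distrib)
  qed
  also have "\<dots> = 1 / (9 * (real N)\<^sup>2) * (\<Sum>m\<in>?Z. 1 / (of_int ((m - k) div D))\<^sup>2)" by (simp only: sum_distrib_left)
  finally have 1: "(\<Sum>m\<in>?Z. 1 / (jb m)\<^sup>2) \<le> 1 / (9 * (real N)\<^sup>2) * (\<Sum>m\<in>?Z. 1 / (of_int ((m - k) div D))\<^sup>2)" .
  have "(\<Sum>m\<in>?Z. 1 / (real_of_int ((m - k) div D))\<^sup>2) = (\<Sum>p\<in>(\<lambda>m. (m - k) div D) ` ?Z. 1 / (real_of_int p)\<^sup>2)"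
  proof (subst sum.reindex)
    show "inj_on (\<lambda>m. (m - k) div D) ?Z"
    proof (rule inj_onI)
      fix m n assume mn: "m \<in> ?Z" "n \<in> ?Z" "(m - k) div D = (n - k) div D"
      have "m - k = D * ((m - k) div D)" using mn(1) by auto
      also have "\<dots> = D * ((n - k) div D)" unfolding mn(3) ..
      also have "\<dots> = n - k" using mn(2) by auto
      finally show "m = n" by simp
    qed
  qed simp
  also have "\<dots> \<le> (\<Sum>p\<in>freqs P - {0}. 1 / (real_of_int p)\<^sup>2)"
  proof (rule sum_mono2)
    show "(\<lambda>m. (m - k) div D) ` ?Z \<subseteq> freqs P - {0}"
    proof
      fix p assume "p \<in> (\<lambda>m. (m - k) div D) ` ?Z"
      then obtain m where m: "m \<in> ?Z" "p = (m - k) div D" by blast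
      then have mp: "m - k = D * p" by simp
      have "p \<noteq> 0"
      proof
        assume "p = 0"
        then have "m = k" using mp by simp
        then show False using m(1) by simp
      qed
      moreover have "\<bar>p\<bar> * 1 \<le> \<bar>p\<bar> * D" using D1 by (intro mult_left_mono) auto
      then have "\<bar>p\<bar> \<le> \<bar>m - k\<bar>" unfolding mp using D1 by (simp add: abs_mult mult.commute)
      ultimately show "p \<in> freqs P - {0}" using m(1) k unfolding P_def by auto
    qed
  qed auto
  also have "\<dots> = 2 * (\<Sum>n\<in>{1..P}. 1 / (real_of_int (int n))\<^sup>2)" by (rule sum_freqs_nonzero) simp
  also have "\<dots> \<le> 4" using inverse_square_sum[of P] by simp
  finally have "1 / (9 * (real N)\<^sup>2) * (\<Sum>m\<in>?Z. 1 / (of_int ((m - k) div D))\<^sup>2) \<le> 1 / (9 * (real N)\<^sup>2) * 4"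
    by (intro mult_left_mono) auto
  also have "\<dots> \<le> 1 / (real N)\<^sup>2" using N by (simp add: field_simps)
  finally show ?thesis using 1 unfolding D_def by linarith
qed

text \<open>Cauchy--Schwarz on each alias class gives 1 / N^2 times its share of the H^1 norm. Two
  frequencies up to N differ by at most 2 N, less than the number of nodes, so the classes are
  disjoint and the shares add up to at most the full norm.\<close>

lemma interpolation_error:
  assumes f: "f \<in> H1" and R: "Hs_norm 1 f \<le> R" and N: "N \<ge> 1"
  shows "l2 (freqs N) (\<lambda>k. trig_coeff (2 * N) f k - fourier f k) \<le> R / real N"
proof -
  define D :: int where "D = 4 * int N + 1"
  define a where "a = fourier f"
  have fa: "f = fourier_series a" unfolding a_def using H1_eq_fourier_series[OF f] by blast
  have s: "(\<lambda>k. norm (a k)) summable_on UNIV" unfolding a_def by (rule H1_summable[OF f])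
  have h: "h1 (freqs J) a \<le> R" for J unfolding a_def using h1_le_Hs_norm[OF f, of "freqs J"] R by simp
  have R0: "0 \<le> R" using order_trans[OF h1_nonneg h[of 0]] .
  define A where "A J k = (\<Sum>m\<in>freqs J. if D dvd (m - k) then a m else 0) - a k" for J k
  define Z where "Z J k = {m\<in>freqs J. m \<noteq> k \<and> D dvd (m - k)}" for J k
  show ?thesis
  proof (rule l2_limit_le)
    show "(\<lambda>J. A J k) \<longlonglongrightarrow> trig_coeff (2 * N) f k - fourier f k" for k
      using tendsto_diff[OF trig_coeff_alias[OF s, of "2 * N" k] tendsto_const[of "a k"]]
      unfolding A_def fa[symmetric] D_def by (simp add: a_def)
    fix J assume J: "J \<ge> N"
    have Ak: "A J k = (\<Sum>m\<in>Z J k. a m)" if k: "k \<in> freqs N" for k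
    proof -
      have "(\<Sum>m\<in>freqs J. if D dvd (m - k) then a m else 0) = (\<Sum>m\<in>insert k (Z J k). a m)"
        by (rule sum.mono_neutral_cong_right) (use k J in \<open>auto simp: Z_def\<close>)
      moreover have "finite (Z J k)" "k \<notin> Z J k" unfolding Z_def by (auto intro: finite_subset[of _ "freqs J"])
      ultimately show ?thesis unfolding A_def by simp
    qed
    have sq: "(norm (A J k))\<^sup>2 \<le> (1 / (real N)\<^sup>2) * (\<Sum>m\<in>Z J k. (jb m * norm (a m))\<^sup>2)" if k: "k \<in> freqs N" for k
    proof -
      have "norm (A J k) \<le> (\<Sum>m\<in>Z J k. norm (a m))" unfolding Ak[OF k] by (rule norm_sum)
      also have "\<dots> = (\<Sum>m\<in>Z J k. \<bar>1 / jb m\<bar> * \<bar>jb m * norm (a m)\<bar>)"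
        by (intro sum.cong) (auto simp: abs_mult less_imp_neq[THEN not_sym])
      also have "\<dots> \<le> L2_set (\<lambda>m. 1 / jb m) (Z J k) * L2_set (\<lambda>m. jb m * norm (a m)) (Z J k)" by (rule L2_set_mult_ineq)
      finally have "(norm (A J k))\<^sup>2 \<le> (L2_set (\<lambda>m. 1 / jb m) (Z J k) * L2_set (\<lambda>m. jb m * norm (a m)) (Z J k))\<^sup>2"
        by (intro power_mono) auto
      also have "\<dots> = (\<Sum>m\<in>Z J k. 1 / (jb m)\<^sup>2) * (\<Sum>m\<in>Z J k. (jb m * norm (a m))\<^sup>2)"
        unfolding power_mult_distrib L2_set_def by (simp add: sum_nonneg power_divide power_mult_distrib)
      also have "\<dots> \<le> (1 / (real N)\<^sup>2) * (\<Sum>m\<in>Z J k. (jb m * norm (a m))\<^sup>2)"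
        using alias_sum_bound[OF N k, of J] unfolding Z_def D_def by (intro mult_right_mono sum_nonneg) auto
      finally show ?thesis .
    qed
    have "(l2 (freqs N) (A J))\<^sup>2 \<le> (\<Sum>k\<in>freqs N. (1 / (real N)\<^sup>2) * (\<Sum>m\<in>Z J k. (jb m * norm (a m))\<^sup>2))"
      unfolding l2_sq by (intro sum_mono sq)
    also have "\<dots> = (1 / (real N)\<^sup>2) * (\<Sum>k\<in>freqs N. \<Sum>m\<in>Z J k. (jb m * norm (a m))\<^sup>2)" by (simp only: sum_distrib_left)
    also have "(\<Sum>k\<in>freqs N. \<Sum>m\<in>Z J k. (jb m * norm (a m))\<^sup>2) = (\<Sum>m\<in>(\<Union>k\<in>freqs N. Z J k). (jb m * norm (a m))\<^sup>2)"
    proof (rule sum.UNION_disjoint[symmetric])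
      show "\<forall>i\<in>freqs N. \<forall>j\<in>freqs N. i \<noteq> j \<longrightarrow> Z J i \<inter> Z J j = {}"
      proof (intro ballI impI)
        fix i j assume ij: "i \<in> freqs N" "j \<in> freqs N" "i \<noteq> j"
        have "\<not> D dvd (i - j)"
        proof
          assume "D dvd (i - j)"
          then have "D \<le> \<bar>i - j\<bar>" using ij by (metis abs_dvd_iff dvd_abs_iff right_minus_eq zdvd_imp_le zero_less_abs_iff)
          then show False using ij unfolding D_def by auto
        qed
        moreover have "D dvd (i - j)" if "m \<in> Z J i" "m \<in> Z J j" for m
          using dvd_diff[of D "m - j" "m - i"] that unfolding Z_def by simp
        ultimately show "Z J i \<inter> Z J j = {}" by blast
      qed
    qed (auto simp: Z_def intro: finite_subset[of _ "freqs J"])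
    also have "\<dots> \<le> (\<Sum>m\<in>freqs J. (jb m * norm (a m))\<^sup>2)" by (rule sum_mono2) (auto simp: Z_def)
    also have "\<dots> = (h1 (freqs J) a)\<^sup>2" unfolding h1_def L2_set_def by (simp add: sum_nonneg)
    also have "\<dots> \<le> R\<^sup>2" by (intro power_mono h) simp
    finally have "(l2 (freqs N) (A J))\<^sup>2 \<le> (1 / (real N)\<^sup>2) * R\<^sup>2" by (simp add: mult_left_mono divide_right_mono)
    then have "(l2 (freqs N) (A J))\<^sup>2 \<le> (R / real N)\<^sup>2" by (simp add: power_divide)
    then show "l2 (freqs N) (A J) \<le> R / real N" by (rule power2_le_imp_le) (use R0 in simp)
  qed simp
qed

lemma h1_inverse_inequality:
  assumes "N \<ge> 1" shows "h1 (freqs N) a \<le> 2 * real N * l2 (freqs N) a"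
proof -
  have "h1 (freqs N) a \<le> L2_set (\<lambda>k. (2 * real N) * norm (a k)) (freqs N)"
    unfolding h1_def
  proof (rule L2_set_mono)
    fix k assume "k \<in> freqs N"
    then have "\<bar>real_of_int k\<bar> \<le> real N" by auto
    then have "jb k \<le> 2 * real N" using jb_le[of k] assms by linarith
    then show "jb k * norm (a k) \<le> 2 * real N * norm (a k)" by (intro mult_right_mono) auto
  qed simp
  then show ?thesis unfolding l2_def by (simp add: L2_set_right_distrib)
qed

definition init_hat :: "nat \<Rightarrow> (real \<Rightarrow> complex) \<Rightarrow> int \<Rightarrow> complex" where
  "init_hat N u0 k = (if k \<in> freqs N then trig_coeff (2 * N) u0 k else 0)"

lemma has_coeffs_num_init: "has_coeffs N (num_init N u0) (init_hat N u0)"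
proof -
  have "trig_interp (2 * N) u0 x = (\<Sum>k\<in>freqs (2 * N). trig_coeff (2 * N) u0 k * ek k x)" for x
    unfolding trig_interp_def ek_def ..
  from trig_polyI(2)[OF this] have "fourier (trig_interp (2 * N) u0) k = (if k \<in> freqs (2 * N) then trig_coeff (2 * N) u0 k else 0)" for k .
  then show ?thesis unfolding num_init_def has_coeffs_def init_hat_def by (auto simp: trig_poly_PiN)
qed

lemma mass_has_coeffs:
  assumes f: "has_coeffs N f a" shows "Pi0 (absq f) = of_real (\<Sum>k\<in>freqs N. (norm (a k))\<^sup>2)"
proof -
  have "absq f = (\<lambda>y. f y * conj_fun f y)" by (auto simp: absq_def conj_fun_def simp flip: complex_norm_square)
  then have "Pi0 (absq f) = convol N a (conj_coeffs a) 0" unfolding Pi0_eq_fourier using has_coeffs_fourier_mult[OF f has_coeffs_cnj[OF f]] by simp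
  also have "\<dots> = (\<Sum>i\<in>freqs N. a i * cnj (a i))"
    unfolding convol_def
  proof (rule sum.cong[OF refl])
    fix i assume "i \<in> freqs N"
    moreover have "(\<Sum>j\<in>freqs N. if i + j = 0 then a i * conj_coeffs a j else 0) = (\<Sum>j\<in>freqs N. if j = - i then a i * conj_coeffs a j else 0)"
      by (intro sum.cong refl) auto
    ultimately show "(\<Sum>j\<in>freqs N. if i + j = 0 then a i * conj_coeffs a j else 0) = a i * cnj (a i)" by (simp add: sum.delta conj_coeffs_def)
  qed
  finally show ?thesis unfolding of_real_sum by (simp only: complex_norm_square)
qed

text \<open>The value is imaginary, as the unitarity of the twisted propagator requires.\<close>

lemma momentum_has_coeffs:
  assumes f: "has_coeffs N f a" shows "Pi0 (\<lambda>x. f x * dx (conj_fun f) x) = - \<i> * of_real (\<Sum>k\<in>freqs N. of_int k * (norm (a k))\<^sup>2)"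
proof -
  have "Pi0 (\<lambda>x. f x * dx (conj_fun f) x) = convol N a (\<lambda>k. \<i> * of_int k * conj_coeffs a k) 0"
    unfolding Pi0_eq_fourier using has_coeffs_fourier_mult[OF f has_coeffs_dx[OF has_coeffs_cnj[OF f]]] by simp
  also have "\<dots> = (\<Sum>i\<in>freqs N. - \<i> * of_real (of_int i * (norm (a i))\<^sup>2))"
    unfolding convol_def
  proof (rule sum.cong[OF refl])
    fix i assume "i \<in> freqs N"
    moreover have "(\<Sum>j\<in>freqs N. if i + j = 0 then a i * (\<i> * of_int j * conj_coeffs a j) else 0) = (\<Sum>j\<in>freqs N. if j = - i then a i * (\<i> * of_int j * conj_coeffs a j) else 0)"
      by (intro sum.cong refl) auto
    ultimately have "(\<Sum>j\<in>freqs N. if i + j = 0 then a i * (\<i> * of_int j * conj_coeffs a j) else 0) = - \<i> * (of_int i * (a i * cnj (a i)))" by (simp add: sum.delta conj_coeffs_def)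
    then show "(\<Sum>j\<in>freqs N. if i + j = 0 then a i * (\<i> * of_int j * conj_coeffs a j) else 0) = - \<i> * of_real (of_int i * (norm (a i))\<^sup>2)"
      by (simp only: complex_norm_square[symmetric] of_real_mult of_real_of_int_eq)
  qed
  finally show ?thesis by (simp add: sum_distrib_left)
qed

text \<open>The inverse inequality turns the L^2 error R / N into an H^1 error of at most 2 R, hence
  the bound 3 R. For mass and momentum the difference of squares is factored: the error is taken in
  L^2 and the weight goes to the sum of the two sequences, of norm at most 4 R.\<close>

lemma init_hat_error:
  assumes f: "f \<in> H1" and R: "Hs_norm 1 f \<le> R" and N: "N \<ge> 1"
  shows "l2 (freqs N) (\<lambda>k. fourier f k - init_hat N f k) \<le> R / real N"
    and "h1 (freqs N) (init_hat N f) \<le> 3 * R"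
    and "\<bar>(\<Sum>k\<in>freqs N. (norm (init_hat N f k))\<^sup>2) - (\<Sum>k\<in>freqs N. (norm (fourier f k))\<^sup>2)\<bar> \<le> 4 * R\<^sup>2 / real N"
    and "\<bar>(\<Sum>k\<in>freqs N. of_int k * (norm (init_hat N f k))\<^sup>2) - (\<Sum>k\<in>freqs N. of_int k * (norm (fourier f k))\<^sup>2)\<bar> \<le> 4 * R\<^sup>2 / real N"
proof -
  let ?A = "freqs N" and ?a = "init_hat N f" and ?c = "fourier f"
  let ?e = "\<lambda>k. fourier f k - init_hat N f k"
  have hc: "h1 ?A ?c \<le> R" using h1_le_Hs_norm[OF f, of ?A] R by simp
  have R0: "0 \<le> R" using order_trans[OF h1_nonneg hc] .
  show e: "l2 ?A ?e \<le> R / real N"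
    using interpolation_error[OF f R N] l2_cong[of ?A ?e "\<lambda>k. trig_coeff (2 * N) f k - fourier f k"]
    by (simp add: init_hat_def norm_minus_commute)
  have "h1 ?A ?e \<le> 2 * real N * (R / real N)"
    by (rule order_trans[OF h1_inverse_inequality[OF N] mult_left_mono[OF e]]) simp
  then have he: "h1 ?A ?e \<le> 2 * R" using N by simp
  have "h1 ?A ?a = h1 ?A (\<lambda>k. ?c k - ?e k)" by simp
  also have "\<dots> \<le> h1 ?A ?c + h1 ?A ?e" by (rule h1_diff_triangle)
  finally show ha: "h1 ?A ?a \<le> 3 * R" using hc he by simp
  have gen: "\<bar>(\<Sum>k\<in>?A. w k * (norm (?a k))\<^sup>2) - (\<Sum>k\<in>?A. w k * (norm (?c k))\<^sup>2)\<bar> \<le> 4 * R\<^sup>2 / real N"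
    if w: "\<And>k. \<bar>w k\<bar> \<le> jb k" for w
  proof -
    have "\<bar>(\<Sum>k\<in>?A. w k * (norm (?a k))\<^sup>2) - (\<Sum>k\<in>?A. w k * (norm (?c k))\<^sup>2)\<bar> = \<bar>\<Sum>k\<in>?A. w k * ((norm (?a k))\<^sup>2 - (norm (?c k))\<^sup>2)\<bar>"
      by (simp only: sum_subtractf right_diff_distrib)
    also have "\<dots> \<le> (\<Sum>k\<in>?A. \<bar>norm (?e k)\<bar> * \<bar>jb k * (norm (?a k) + norm (?c k))\<bar>)"
    proof (rule order_trans[OF sum_abs sum_mono])
      fix k
      have "\<bar>norm (?a k) - norm (?c k)\<bar> \<le> norm (?e k)" using norm_triangle_ineq3[of "?a k" "?c k"] by (simp add: norm_minus_commute)
      then have "\<bar>w k\<bar> * (\<bar>norm (?a k) - norm (?c k)\<bar> * (norm (?a k) + norm (?c k))) \<le> jb k * (norm (?e k) * (norm (?a k) + norm (?c k)))"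
        by (intro mult_mono w mult_nonneg_nonneg) auto
      moreover have eq: "w k * ((norm (?a k))\<^sup>2 - (norm (?c k))\<^sup>2) = w k * ((norm (?a k) - norm (?c k)) * (norm (?a k) + norm (?c k)))"
        by (simp add: power2_eq_square algebra_simps)
      ultimately show "\<bar>w k * ((norm (?a k))\<^sup>2 - (norm (?c k))\<^sup>2)\<bar> \<le> \<bar>norm (?e k)\<bar> * \<bar>jb k * (norm (?a k) + norm (?c k))\<bar>"
        unfolding eq by (simp add: abs_mult mult_ac)
    qed
    also have "\<dots> \<le> L2_set (\<lambda>k. norm (?e k)) ?A * L2_set (\<lambda>k. jb k * (norm (?a k) + norm (?c k))) ?A" by (rule L2_set_mult_ineq)
    also have "\<dots> \<le> (R / real N) * (4 * R)"
    proof (rule mult_mono)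
      show "L2_set (\<lambda>k. norm (?e k)) ?A \<le> R / real N" using e unfolding l2_def .
      have "L2_set (\<lambda>k. jb k * (norm (?a k) + norm (?c k))) ?A \<le> h1 ?A ?a + h1 ?A ?c"
        unfolding h1_def ring_distribs by (rule L2_set_triangle_ineq)
      then show "L2_set (\<lambda>k. jb k * (norm (?a k) + norm (?c k))) ?A \<le> 4 * R" using ha hc by simp
    qed (use R0 in auto)
    finally show ?thesis by (simp add: power2_eq_square mult_ac)
  qed
  show "\<bar>(\<Sum>k\<in>?A. (norm (?a k))\<^sup>2) - (\<Sum>k\<in>?A. (norm (?c k))\<^sup>2)\<bar> \<le> 4 * R\<^sup>2 / real N"
    using gen[of "\<lambda>_. 1"] jb_ge_1 by simp
  show "\<bar>(\<Sum>k\<in>?A. of_int k * (norm (?a k))\<^sup>2) - (\<Sum>k\<in>?A. of_int k * (norm (?c k))\<^sup>2)\<bar> \<le> 4 * R\<^sup>2 / real N"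
    using gen[of of_int] abs_le_jb by simp
qed

section \<open>Convergence\<close>

lemma weighted_sum_le_h1_sq:
  assumes "\<And>k. \<bar>w k\<bar> \<le> jb k"
  shows "\<bar>\<Sum>k\<in>A. w k * (norm (a k))\<^sup>2\<bar> \<le> (h1 A a)\<^sup>2"
proof -
  have "\<bar>\<Sum>k\<in>A. w k * (norm (a k))\<^sup>2\<bar> \<le> (\<Sum>k\<in>A. (jb k * norm (a k))\<^sup>2)"
  proof (rule order_trans[OF sum_abs sum_mono])
    fix k
    have "\<bar>w k\<bar> \<le> jb k * 1" using assms[of k] by simp
    also have "\<dots> \<le> (jb k)\<^sup>2" unfolding power2_eq_square using jb_ge_1[of k] by (intro mult_left_mono) auto
    finally show "\<bar>w k * (norm (a k))\<^sup>2\<bar> \<le> (jb k * norm (a k))\<^sup>2"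
      by (simp add: abs_mult power_mult_distrib mult_right_mono)
  qed
  then show ?thesis unfolding h1_def L2_set_def by (simp add: sum_nonneg)
qed

lemma one_plus_power_le_exp:
  assumes "0 \<le> x" "real n * x \<le> y" shows "(1 + x)^n \<le> exp (y::real)"
proof -
  have "(1 + x)^n \<le> (exp x)^n" using assms exp_ge_add_one_self[of x] by (intro power_mono) auto
  also have "\<dots> = exp (real n * x)" by (simp add: exp_of_nat_mult)
  finally show ?thesis using assms(2) by (meson exp_le_cancel_iff order_trans)
qed

text \<open>The smallness of the \<open>L\<^sup>2\<close> error keeps the \<open>\<ell>\<^sup>1\<close> norm of the coefficients bounded; the latter
  is all that the growth of the \<open>H\<^sup>1\<close> norm depends on.\<close>

lemma bootstrap:
  fixes h E y :: "nat \<Rightarrow> real"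
  assumes \<tau>: "0 \<le> \<tau>" "real L * \<tau> \<le> T" and nonneg: "\<And>n. 0 \<le> h n" "\<And>n. 0 \<le> E n" "\<And>n. 0 \<le> y n"
    and hI: "h 0 \<le> hI" and hstep: "\<And>n. n < L \<Longrightarrow> h (Suc n) \<le> (1 + 36 * \<tau> * (y n)\<^sup>2) * h n"
    and H: "H = hI * exp (36 * T * Y\<^sup>2)"
    and yE: "\<And>n. n \<le> L \<Longrightarrow> h n \<le> H \<Longrightarrow> y n \<le> YI + s * E n"
    and Estep: "\<And>n. n < L \<Longrightarrow> h n \<le> H \<Longrightarrow> E (Suc n) \<le> \<tau> * d + (1 + \<kappa> * \<tau>) * E n"
    and E0: "E 0 \<le> eI" and nn: "0 \<le> d" "0 \<le> eI" "0 \<le> \<kappa>" "0 \<le> s" "0 \<le> hI" "0 \<le> T"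
    and small: "YI + s * (exp (\<kappa> * T) * (eI + T * d)) \<le> Y"
  shows "n \<le> L \<Longrightarrow> E n \<le> exp (\<kappa> * T) * (eI + T * d)"
proof -
  have nT: "real n * \<tau> \<le> T" if "n \<le> L" for n
    using that \<tau> mult_right_mono[of "real n" "real L" \<tau>] by linarith
  have k0: "0 \<le> \<kappa> * \<tau>" using \<tau> nn by simp
  have Ebd: "(1 + \<kappa> * \<tau>)^n * (eI + real n * \<tau> * d) \<le> exp (\<kappa> * T) * (eI + T * d)" if n: "n \<le> L" for n
  proof (rule mult_mono)
    have "real n * (\<kappa> * \<tau>) = \<kappa> * (real n * \<tau>)" by simp
    also have "\<dots> \<le> \<kappa> * T" using nT[OF n] nn by (intro mult_left_mono) auto
    finally show "(1 + \<kappa> * \<tau>)^n \<le> exp (\<kappa> * T)" by (rule one_plus_power_le_exp[OF k0])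
    show "eI + real n * \<tau> * d \<le> eI + T * d" using nT[OF n] nn by (intro add_left_mono mult_right_mono) auto
    show "0 \<le> eI + real n * \<tau> * d" using nn \<tau> by simp
  qed simp
  \<comment> \<open>The two bounds must be carried together. The one on \<open>h n\<close> gives
    \<open>h n \<le> H\<close>, which licenses the error step; the one on \<open>E n\<close> keeps
    \<open>y n\<close> below \<open>Y\<close>, so \<open>h\<close> grows for one more step at the
    rate 36 Y^2. \<open>H\<close> is exactly this growth accumulated up to time T.\<close>
  have main: "h n \<le> (1 + 36 * \<tau> * Y\<^sup>2)^n * hI \<and> E n \<le> (1 + \<kappa> * \<tau>)^n * (eI + real n * \<tau> * d)" if "n \<le> L" for n
    using that
  proof (induction n)
    case 0
    then show ?case using hI E0 by simp
  next
    case (Suc n)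
    then have n: "n < L" "n \<le> L" by auto
    have IH: "h n \<le> (1 + 36 * \<tau> * Y\<^sup>2)^n * hI" "E n \<le> (1 + \<kappa> * \<tau>)^n * (eI + real n * \<tau> * d)" using Suc by auto
    have "real n * (36 * \<tau> * Y\<^sup>2) = 36 * (real n * \<tau>) * Y\<^sup>2" by simp
    also have "\<dots> \<le> 36 * T * Y\<^sup>2" using nT[OF n(2)] by (intro mult_right_mono mult_left_mono) auto
    finally have "(1 + 36 * \<tau> * Y\<^sup>2)^n \<le> exp (36 * T * Y\<^sup>2)" using \<tau> by (intro one_plus_power_le_exp) auto
    then have "(1 + 36 * \<tau> * Y\<^sup>2)^n * hI \<le> exp (36 * T * Y\<^sup>2) * hI" using nn by (intro mult_right_mono) auto
    then have hH: "h n \<le> H" using IH(1) H by (simp add: mult.commute)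
    have "E n \<le> exp (\<kappa> * T) * (eI + T * d)" using IH(2) Ebd[OF n(2)] by linarith
    then have "y n \<le> YI + s * (exp (\<kappa> * T) * (eI + T * d))" using yE[OF n(2) hH] nn mult_left_mono by (smt (verit))
    then have yY: "y n \<le> Y" using small by linarith
    have "(y n)\<^sup>2 \<le> Y\<^sup>2" using yY nonneg(3)[of n] by (intro power_mono) auto
    then have "(1 + 36 * \<tau> * (y n)\<^sup>2) * h n \<le> (1 + 36 * \<tau> * Y\<^sup>2) * ((1 + 36 * \<tau> * Y\<^sup>2)^n * hI)"
      using IH(1) \<tau> nonneg(1)[of n] by (intro mult_mono add_left_mono mult_left_mono) auto
    then have 1: "h (Suc n) \<le> (1 + 36 * \<tau> * Y\<^sup>2)^(Suc n) * hI" using hstep[OF n(1)] by simp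
    define Q where "Q = (1 + \<kappa> * \<tau>)^n"
    have Q1: "1 \<le> (1 + \<kappa> * \<tau>) * Q" unfolding Q_def power_Suc[symmetric] using k0 by (intro one_le_power) simp
    have "E (Suc n) \<le> \<tau> * d + (1 + \<kappa> * \<tau>) * (Q * (eI + real n * \<tau> * d))"
      using Estep[OF n(1) hH] IH(2) k0 mult_left_mono[OF IH(2), of "1 + \<kappa> * \<tau>"] unfolding Q_def by linarith
    also have "\<dots> \<le> ((1 + \<kappa> * \<tau>) * Q) * (\<tau> * d) + (1 + \<kappa> * \<tau>) * (Q * (eI + real n * \<tau> * d))"
      using mult_right_mono[OF Q1, of "\<tau> * d"] \<tau> nn by simp
    also have "\<dots> = (1 + \<kappa> * \<tau>)^(Suc n) * (eI + real (Suc n) * \<tau> * d)" unfolding Q_def by (simp add: algebra_simps)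
    finally show ?case using 1 by simp
  qed
  show "n \<le> L \<Longrightarrow> E n \<le> exp (\<kappa> * T) * (eI + T * d)" using main Ebd by (meson order_trans)
qed

text \<open>The first bound absorbs plain powers of \<tau> into the logarithmic rate. The second,
  from ln x \<le> x, shows that the rate becomes small with \<tau>.\<close>

lemma tau_sqrt_ln:
  assumes t: "0 < \<tau>" "\<tau> \<le> 1 / 3"
  shows "\<tau> \<le> \<tau> * sqrt (ln (1 / \<tau>))" "\<tau> * sqrt (ln (1 / \<tau>)) \<le> sqrt \<tau>"
proof -
  have "1 \<le> sqrt (ln (1 / \<tau>))" using ln_inverse_ge_1[OF t] by simp
  then show "\<tau> \<le> \<tau> * sqrt (ln (1 / \<tau>))" using t by simp
  have "ln (1 / \<tau>) \<le> 1 / \<tau>" using ln_le_minus_one[of "1 / \<tau>"] t by simp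
  then have "\<tau> * sqrt (ln (1 / \<tau>)) \<le> \<tau> * sqrt (1 / \<tau>)" using t by (intro mult_left_mono real_sqrt_le_mono) auto
  also have "\<dots> = sqrt \<tau>" using t by (simp add: real_sqrt_divide real_div_sqrt)
  finally show "\<tau> * sqrt (ln (1 / \<tau>)) \<le> sqrt \<tau>" .
qed

context nls_sol begin

definition init_mass :: "nat \<Rightarrow> real" where "init_mass N = (\<Sum>k\<in>freqs N. (norm (init_hat N u0 k))\<^sup>2)"
definition init_momentum :: "nat \<Rightarrow> real" where "init_momentum N = (\<Sum>k\<in>freqs N. of_int k * (norm (init_hat N u0 k))\<^sup>2)"

definition step :: "real \<Rightarrow> nat \<Rightarrow> (int \<Rightarrow> complex) \<Rightarrow> int \<Rightarrow> complex" where
  "step \<tau> N = Psi_hat lam \<tau> N (- \<i> * of_real (init_momentum N)) (of_real (init_mass N))"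

definition num_hat :: "real \<Rightarrow> nat \<Rightarrow> nat \<Rightarrow> int \<Rightarrow> complex" where
  "num_hat \<tau> N n = (step \<tau> N ^^ n) (init_hat N u0)"

lemma has_coeffs_num_sol: "has_coeffs N (num_sol lam \<tau> N u0 n) (num_hat \<tau> N n)"
proof -
  have M: "Pi0 (absq (num_init N u0)) = of_real (init_mass N)" unfolding init_mass_def by (rule mass_has_coeffs[OF has_coeffs_num_init])
  have P: "Pi0 (\<lambda>x. num_init N u0 x * dx (conj_fun (num_init N u0)) x) = - \<i> * of_real (init_momentum N)"
    unfolding init_momentum_def by (rule momentum_has_coeffs[OF has_coeffs_num_init])
  have "has_coeffs N ((Psi lam \<tau> N (- \<i> * of_real (init_momentum N)) (of_real (init_mass N)) ^^ n) (num_init N u0)) (num_hat \<tau> N n)"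
  proof (induction n)
    case 0
    then show ?case unfolding num_hat_def by (simp add: has_coeffs_num_init)
  next
    case (Suc n)
    then show ?case using has_coeffs_Psi[OF Suc] unfolding num_hat_def step_def by simp
  qed
  then show ?thesis unfolding num_sol_def Let_def M P .
qed

text \<open>The sum of \<open>exact_step\<close> and \<open>Psi_hat_consistency\<close>. The
  summands of C come from freezing the profile (3645 = 135 * 27), truncation (2079 = 135 + 1944),
  the logarithmic defect (180), the Taylor remainder of the twist with invariants up to (3 R)^2, and
  finally from interpolating the invariants and their drift along the flow, both O(1 / N).\<close>

lemma local_error:
  assumes R: "Hs_norm 1 u0 \<le> R" "0 \<le> R" and B: "B = h1_bound_const R" and N: "N \<ge> 1" and t: "t \<in> {0..T}" "t + \<tau> \<in> {0..T}" and \<tau>: "0 < \<tau>" "\<tau> \<le> 1 / 3"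
    and C: "C = 3645 * B^5 + 2079 * B^3 + 180 * B^3 + 16 * 81 * R^4 * B + 4 * (4 * R\<^sup>2 + 270 * B^4 * T) * B"
  shows "l2 (freqs N) (\<lambda>k. c (t + \<tau>) k - step \<tau> N (c t) k) \<le> \<tau> * (C * (\<tau> * sqrt (ln (1 / \<tau>)) + 1 / real N))"
proof -
  let ?A = "freqs N" and ?X = "tri (freqs N) (sym_exact \<tau>) (c t) (conj_coeffs (c t)) (c t)"
  define \<theta> where "\<theta> = \<tau> * sqrt (ln (1 / \<tau>))"
  define \<nu> where "\<nu> = 1 / real N"
  have Bd: "h1 (freqs J) (c t) \<le> B" if "t \<in> {0..T}" for t J unfolding B by (rule c_h1_bound[OF R(1) that])
  have B0: "0 \<le> B" using order_trans[OF h1_nonneg Bd[of 0 0]] T by simp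
  have \<theta>: "\<tau> \<le> \<theta>" unfolding \<theta>_def by (rule tau_sqrt_ln[OF \<tau>])
  have \<nu>: "0 \<le> \<nu>" unfolding \<nu>_def by simp
  define \<delta> where "\<delta> = (4 * R\<^sup>2 + 270 * B^4 * T) * \<nu>"
  note init = init_hat_error[OF u0 R(1) N]
  have c0: "c 0 = fourier u0" unfolding c_fun u_0 ..
  have M: "\<bar>init_mass N - (\<Sum>k\<in>?A. (norm (c t k))\<^sup>2)\<bar> \<le> \<delta>"
    using init(3) mass_diff[OF Bd t(1) N] unfolding init_mass_def c0 \<delta>_def \<nu>_def by (simp add: add_divide_distrib)
  have Q: "\<bar>init_momentum N - (\<Sum>k\<in>?A. of_int k * (norm (c t k))\<^sup>2)\<bar> \<le> \<delta>"
    using init(4) momentum_diff[OF Bd t(1) N] unfolding init_momentum_def c0 \<delta>_def \<nu>_def by (simp add: add_divide_distrib)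
  have h2: "(h1 ?A (init_hat N u0))\<^sup>2 \<le> (3 * R)\<^sup>2" by (intro power_mono init(2)) simp
  have MD: "\<bar>init_mass N\<bar> \<le> (3 * R)\<^sup>2" using weighted_sum_le_h1_sq[where w="\<lambda>_. 1" and A="?A" and a="init_hat N u0"] jb_ge_1 h2 unfolding init_mass_def by simp
  have QD: "\<bar>init_momentum N\<bar> \<le> (3 * R)\<^sup>2" using weighted_sum_le_h1_sq[where w=of_int and A="?A" and a="init_hat N u0"] abs_le_jb h2 unfolding init_momentum_def by simp
  have 1: "l2 ?A (\<lambda>k. c (t + \<tau>) k - schr_symbol \<tau> k * (c t k - \<i> * of_real lam * ?X k)) \<le> \<tau> * (135 * B^3 / real N + 135 * B\<^sup>2 * (\<tau> * (27 * B^3)))"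
    by (rule exact_step[OF Bd t _ N]) (use \<tau> in auto)
  have 2: "l2 ?A (\<lambda>k. schr_symbol \<tau> k * (c t k - \<i> * of_real lam * ?X k) - step \<tau> N (c t) k)
     \<le> 180 * (\<tau>\<^sup>2 * sqrt (ln (1 / \<tau>))) * B^3 + 1944 * (\<tau> / real N) * B^3 + (16 * \<tau>\<^sup>2 * ((3 * R)\<^sup>2)\<^sup>2 + 4 * \<tau> * \<delta>) * B"
    unfolding step_def by (rule Psi_hat_consistency[OF lam \<tau> N Bd[OF t(1)] M MD Q QD])
  have "l2 ?A (\<lambda>k. c (t + \<tau>) k - step \<tau> N (c t) k) \<le>
     \<tau> * (135 * B^3 / real N + 135 * B\<^sup>2 * (\<tau> * (27 * B^3))) +
     (180 * (\<tau>\<^sup>2 * sqrt (ln (1 / \<tau>))) * B^3 + 1944 * (\<tau> / real N) * B^3 + (16 * \<tau>\<^sup>2 * ((3 * R)\<^sup>2)\<^sup>2 + 4 * \<tau> * \<delta>) * B)"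
    using l2_triangle[of ?A "\<lambda>k. c (t + \<tau>) k - schr_symbol \<tau> k * (c t k - \<i> * of_real lam * ?X k)" "\<lambda>k. schr_symbol \<tau> k * (c t k - \<i> * of_real lam * ?X k) - step \<tau> N (c t) k"] 1 2 by simp
  also have "\<dots> = \<tau> * (3645 * B^5 * \<tau> + 2079 * B^3 * \<nu> + 180 * B^3 * \<theta> + 16 * 81 * R^4 * B * \<tau> + 4 * (4 * R\<^sup>2 + 270 * B^4 * T) * B * \<nu>)"
    unfolding \<theta>_def \<nu>_def \<delta>_def by (simp add: power_mult_distrib eval_nat_numeral algebra_simps add_divide_distrib)
  also have "\<dots> \<le> \<tau> * (C * (\<theta> + \<nu>))"
  proof (rule mult_left_mono)
    have "3645 * B^5 * \<tau> \<le> 3645 * B^5 * (\<theta> + \<nu>)" "2079 * B^3 * \<nu> \<le> 2079 * B^3 * (\<theta> + \<nu>)" "180 * B^3 * \<theta> \<le> 180 * B^3 * (\<theta> + \<nu>)"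
      "16 * 81 * R^4 * B * \<tau> \<le> 16 * 81 * R^4 * B * (\<theta> + \<nu>)" "4 * (4 * R\<^sup>2 + 270 * B^4 * T) * B * \<nu> \<le> 4 * (4 * R\<^sup>2 + 270 * B^4 * T) * B * (\<theta> + \<nu>)"
      using B0 R \<theta> \<nu> \<tau> T by (intro mult_left_mono; simp)+
    then show "3645 * B^5 * \<tau> + 2079 * B^3 * \<nu> + 180 * B^3 * \<theta> + 16 * 81 * R^4 * B * \<tau> + 4 * (4 * R\<^sup>2 + 270 * B^4 * T) * B * \<nu> \<le> C * (\<theta> + \<nu>)"
      unfolding C distrib_right[where c="\<theta> + \<nu>"] by linarith
  qed (use \<tau> in simp)
  finally show ?thesis unfolding \<theta>_def \<nu>_def .
qed

text \<open>The bootstrap controls the coefficients up to N; the frequencies of the exact solution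
  above N contribute B / N. The condition on \<open>q\<close> involves only B and H, and the
  smallness condition restricts \<tau> and N separately once the rate is split into its two
  terms.\<close>

lemma global_error:
  assumes R: "Hs_norm 1 u0 \<le> R" "0 \<le> R" and B: "B = h1_bound_const R" and N: "N \<ge> 1" and L: "L > 0" "\<tau> = T / real L" and \<tau>3: "\<tau> \<le> 1 / 3"
    and C: "C = 3645 * B^5 + 2079 * B^3 + 180 * B^3 + 16 * 81 * R^4 * B + 4 * (4 * R\<^sup>2 + 270 * B^4 * T) * B"
    and H: "H = 3 * R * exp (36 * T * (3 * B + 2)\<^sup>2)" and q: "q \<ge> 1" "sqrt (2 / real q) * (B + H) \<le> 1"
    and \<kappa>: "\<kappa> = 1620 * (B + H)\<^sup>2" and C3: "C3 = exp (\<kappa> * T) * (R + T * C)"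
    and small: "sqrt (2 * real q + 1) * (C3 * (\<tau> * sqrt (ln (1 / \<tau>)) + 1 / real N)) \<le> 1"
    and n: "n \<le> L"
  shows "L2_norm (\<lambda>x. u (real n * \<tau>) x - num_sol lam \<tau> N u0 n x) \<le> 3 * (C3 + B) * (\<tau> * sqrt (ln (1 / \<tau>)) + 1 / real N)"
proof -
  let ?A = "freqs N"
  have \<tau>0: "0 < \<tau>" using L T by simp
  have LT: "real L * \<tau> = T" using L by simp
  define \<epsilon> where "\<epsilon> = \<tau> * sqrt (ln (1 / \<tau>)) + 1 / real N"
  have "0 \<le> \<tau> * sqrt (ln (1 / \<tau>))" using tau_sqrt_ln(1)[OF \<tau>0 \<tau>3] \<tau>0 by linarith
  then have \<epsilon>: "1 / real N \<le> \<epsilon>" "0 \<le> \<epsilon>" unfolding \<epsilon>_def by auto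
  have tn: "real n * \<tau> \<in> {0..T}" if "n \<le> L" for n
    using that \<tau>0 mult_right_mono[of "real n" "real L" \<tau>] unfolding LT by simp
  have Bd: "h1 (freqs J) (c t) \<le> B" if "t \<in> {0..T}" for t J unfolding B by (rule c_h1_bound[OF R(1) that])
  have B0: "0 \<le> B" using order_trans[OF h1_nonneg Bd[of 0 0]] T by simp
  have H0: "0 \<le> H" unfolding H using R by simp
  have C0: "0 \<le> C" unfolding C using B0 R T by (intro add_nonneg_nonneg mult_nonneg_nonneg) auto
  define E where "E n = l2 ?A (\<lambda>k. c (real n * \<tau>) k - num_hat \<tau> N n k)" for n
  note init = init_hat_error[OF u0 R(1) N]
  have bound: "E n \<le> exp (\<kappa> * T) * (R * \<epsilon> + T * (C * \<epsilon>))"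
  \<comment> \<open>In \<open>Y = 3 * B + 2\<close> the part \<open>3 * B\<close> bounds the l1 norm
    of the exact solution, one unit is spent on the high frequencies of the error through the choice
    of \<open>q\<close>, and one on its small L^2 norm.\<close>
  proof (rule bootstrap[where h="\<lambda>n. h1 ?A (num_hat \<tau> N n)" and y="\<lambda>n. l1 ?A (num_hat \<tau> N n)" and hI="3 * R" and Y="3 * B + 2" and YI="3 * B + 1"
        and s="sqrt (2 * real q + 1)" and L=L and \<tau>=\<tau> and H=H])
    show "h1 ?A (num_hat \<tau> N 0) \<le> 3 * R" unfolding num_hat_def using init(2) by simp
    show "h1 ?A (num_hat \<tau> N (Suc n)) \<le> (1 + 36 * \<tau> * (l1 ?A (num_hat \<tau> N n))\<^sup>2) * h1 ?A (num_hat \<tau> N n)" for n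
      unfolding num_hat_def funpow.simps comp_def step_def by (rule Psi_hat_h1_bound[OF lam]) (use \<tau>0 in simp)
    show "l1 ?A (num_hat \<tau> N n) \<le> 3 * B + 1 + sqrt (2 * real q + 1) * E n" if n: "n \<le> L" and h: "h1 ?A (num_hat \<tau> N n) \<le> H" for n
    proof -
      let ?e = "\<lambda>k. c (real n * \<tau>) k - num_hat \<tau> N n k"
      have "l1 ?A (num_hat \<tau> N n) = l1 ?A (\<lambda>k. c (real n * \<tau>) k + (- ?e k))" by simp
      also have "\<dots> \<le> l1 ?A (c (real n * \<tau>)) + l1 ?A (\<lambda>k. - ?e k)" by (rule l1_triangle)
      also have "l1 ?A (\<lambda>k. - ?e k) = l1 ?A ?e" by (rule l1_cong) (rule norm_minus_cancel)
      also have "l1 ?A ?e \<le> sqrt (2 * real q + 1) * E n + sqrt (2 / real q) * h1 ?A ?e" unfolding E_def by (rule l1_interp[OF q(1)])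
      also have "h1 ?A ?e \<le> B + H" using h1_diff_triangle[of ?A "c (real n * \<tau>)" "num_hat \<tau> N n"] Bd[OF tn[OF n], of N] h by linarith
      also have "l1 ?A (c (real n * \<tau>)) \<le> 3 * B" using l1_le_h1[of ?A "c (real n * \<tau>)"] Bd[OF tn[OF n], of N] by simp
      finally show ?thesis using q(2) by (simp add: mult_left_mono)
    qed
    show "E (Suc n) \<le> \<tau> * (C * \<epsilon>) + (1 + \<kappa> * \<tau>) * E n" if n: "n < L" and h: "h1 ?A (num_hat \<tau> N n) \<le> H" for n
    proof -
      let ?t = "real n * \<tau>"
      have t: "?t \<in> {0..T}" "?t + \<tau> \<in> {0..T}" using tn[of n] tn[of "Suc n"] n by (auto simp: algebra_simps)
      have su: "real (Suc n) * \<tau> = ?t + \<tau>" by (simp add: algebra_simps)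
      have "E (Suc n) = l2 ?A (\<lambda>k. (c (?t + \<tau>) k - step \<tau> N (c ?t) k) + (step \<tau> N (c ?t) k - step \<tau> N (num_hat \<tau> N n) k))"
        unfolding E_def su num_hat_def by simp
      also have "\<dots> \<le> l2 ?A (\<lambda>k. c (?t + \<tau>) k - step \<tau> N (c ?t) k) + l2 ?A (\<lambda>k. step \<tau> N (c ?t) k - step \<tau> N (num_hat \<tau> N n) k)"
        by (rule l2_triangle)
      also have "l2 ?A (\<lambda>k. c (?t + \<tau>) k - step \<tau> N (c ?t) k) \<le> \<tau> * (C * \<epsilon>)"
        unfolding \<epsilon>_def by (rule local_error[OF R B N t \<tau>0 \<tau>3 C])
      also have "l2 ?A (\<lambda>k. step \<tau> N (c ?t) k - step \<tau> N (num_hat \<tau> N n) k) \<le> (1 + 1620 * \<tau> * (B + H)\<^sup>2) * E n"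
        unfolding step_def E_def by (rule Psi_hat_l2_diff[OF lam]) (use \<tau>0 Bd[OF t(1), of N] h B0 H0 in auto)
      finally show ?thesis unfolding \<kappa> by (simp add: mult_ac)
    qed
    show "E 0 \<le> R * \<epsilon>"
    proof -
      have "E 0 \<le> R / real N" using init(1) unfolding E_def num_hat_def c_fun by (simp add: u_0)
      also have "\<dots> \<le> R * \<epsilon>" using mult_left_mono[OF \<epsilon>(1) R(2)] by simp
      finally show ?thesis .
    qed
    have "R * \<epsilon> + T * (C * \<epsilon>) = (R + T * C) * \<epsilon>" by (simp add: algebra_simps)
    then show "3 * B + 1 + sqrt (2 * real q + 1) * (exp (\<kappa> * T) * (R * \<epsilon> + T * (C * \<epsilon>))) \<le> 3 * B + 2"
      using small unfolding C3 \<epsilon>_def[symmetric] by (simp add: mult.assoc)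
    show "real L * \<tau> \<le> T" using LT by simp
  qed (use \<tau>0 R \<epsilon> C0 T H n in \<open>auto simp: \<kappa> E_def\<close>)
  also have "exp (\<kappa> * T) * (R * \<epsilon> + T * (C * \<epsilon>)) = C3 * \<epsilon>" unfolding C3 by (simp add: algebra_simps)
  finally have energy: "E n \<le> C3 * \<epsilon>" .
  let ?t = "real n * \<tau>"
  let ?e = "\<lambda>k. c ?t k - num_hat \<tau> N n k"
  note t = tn[OF n]
  have tp: "trig_poly N (num_sol lam \<tau> N u0 n)" "\<And>k. fourier (num_sol lam \<tau> N u0 n) k = num_hat \<tau> N n k"
    using has_coeffs_num_sol[of N \<tau> n] unfolding has_coeffs_def by auto
  have uh0: "num_hat \<tau> N n k = 0" if "k \<notin> ?A" for k using trig_poly_fourier_0[OF tp(1) that] tp(2) by simp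
  have uhs: "(\<lambda>k. norm (num_hat \<tau> N n k)) summable_on UNIV"
  proof -
    have "(\<lambda>k. norm (num_hat \<tau> N n k)) summable_on UNIV \<longleftrightarrow> (\<lambda>k. norm (num_hat \<tau> N n k)) summable_on ?A"
      by (rule summable_on_cong_neutral) (auto simp: uh0)
    then show ?thesis by simp
  qed
  have es: "(\<lambda>k. norm (?e k)) summable_on UNIV"
    by (rule summable_on_comparison_test[OF summable_on_add[OF c_summable[OF t] uhs]]) (auto intro: norm_triangle_ineq4)
  have "(\<lambda>x. u ?t x - num_sol lam \<tau> N u0 n x) = fourier_series ?e"
  proof
    fix x
    have "num_sol lam \<tau> N u0 n x = fourier_series (num_hat \<tau> N n) x"
    proof -
      have "fourier_series (num_hat \<tau> N n) x = (\<Sum>\<^sub>\<infinity>k\<in>?A. num_hat \<tau> N n k * ek k x)"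
        unfolding fourier_series_def by (rule infsum_cong_neutral) (auto simp: uh0)
      then show ?thesis using trig_poly_eq[OF tp(1), of x] tp(2) by simp
    qed
    moreover have "u ?t x = fourier_series (c ?t) x" using u_fourier_series[OF t] by simp
    ultimately have "(\<lambda>J. (\<Sum>k\<in>freqs J. c ?t k * ek k x) - (\<Sum>k\<in>freqs J. num_hat \<tau> N n k * ek k x)) \<longlonglongrightarrow> u ?t x - num_sol lam \<tau> N u0 n x"
      using tendsto_diff[OF fourier_series_limit[OF c_summable[OF t]] fourier_series_limit[OF uhs]] by simp
    then have "(\<lambda>J. \<Sum>k\<in>freqs J. ?e k * ek k x) \<longlonglongrightarrow> u ?t x - num_sol lam \<tau> N u0 n x"
      by (simp add: sum_subtractf ring_distribs)
    then show "u ?t x - num_sol lam \<tau> N u0 n x = fourier_series ?e x"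
      using fourier_series_limit[OF es, of x] LIMSEQ_unique by blast
  qed
  moreover have "L2_norm (fourier_series ?e) \<le> sqrt (2 * pi) * (C3 * \<epsilon> + B * \<epsilon>)"
  proof (rule L2_norm_fourier_series_le[OF es])
    fix J
    have "l2 (freqs J) ?e \<le> l2 (freqs J) (\<lambda>k. (trunc N (c ?t) k - num_hat \<tau> N n k) + (c ?t k - trunc N (c ?t) k))" by simp
    also have "\<dots> \<le> l2 (freqs J) (\<lambda>k. trunc N (c ?t) k - num_hat \<tau> N n k) + l2 (freqs J) (\<lambda>k. c ?t k - trunc N (c ?t) k)" by (rule l2_triangle)
    also have "l2 (freqs J) (\<lambda>k. trunc N (c ?t) k - num_hat \<tau> N n k) \<le> E n"
    proof -
      have "(\<Sum>k\<in>freqs J. (norm (trunc N (c ?t) k - num_hat \<tau> N n k))\<^sup>2) = (\<Sum>k\<in>freqs J \<inter> ?A. (norm (?e k))\<^sup>2)"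
        by (rule sum.mono_neutral_cong_right) (auto simp: trunc_def uh0)
      also have "\<dots> \<le> (\<Sum>k\<in>?A. (norm (?e k))\<^sup>2)" by (rule sum_mono2) auto
      finally show ?thesis unfolding E_def l2_def L2_set_def by simp
    qed
    also have "l2 (freqs J) (\<lambda>k. c ?t k - trunc N (c ?t) k) \<le> B / real N"
      by (rule order_trans[OF l2_trunc_diff[OF N] divide_right_mono[OF Bd[OF t]]]) simp
    also have "B / real N \<le> B * \<epsilon>" using mult_left_mono[OF \<epsilon>(1) B0] by simp
    finally show "l2 (freqs J) ?e \<le> C3 * \<epsilon> + B * \<epsilon>" using energy by simp
  qed
  moreover have "sqrt (2 * pi) * (C3 * \<epsilon> + B * \<epsilon>) \<le> 3 * (C3 * \<epsilon> + B * \<epsilon>)"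
  proof (rule mult_right_mono)
    have "2 * pi \<le> 9" using pi_less_4 by simp
    then have "sqrt (2 * pi) \<le> sqrt 9" by (rule real_sqrt_le_mono)
    then show "sqrt (2 * pi) \<le> 3" by simp
    have "0 \<le> C3" unfolding C3 using R T C0 by simp
    then show "0 \<le> C3 * \<epsilon> + B * \<epsilon>" using B0 \<epsilon> by simp
  qed
  ultimately show ?thesis unfolding \<epsilon>_def[symmetric] by (simp add: algebra_simps)
qed

end

theorem theorem2p1:
  fixes T R :: real
  assumes "T > 0"
  shows "\<exists>tau0 N0 C :: real. tau0 > 0 \<and> N0 > 0 \<and> C > 0 \<and>
    (\<forall>lam\<in>{-1, 1 :: real}. \<forall>u0 u. \<forall>L N :: nat. \<forall>tau.
       u0 \<in> H1 \<and> Hs_norm 1 u0 = R \<and> nls_solution lam T u0 u \<and>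
       L > 0 \<and> N > 0 \<and> tau = T / real L \<and> tau \<le> tau0 \<and> real N \<ge> N0 \<longrightarrow>
       (MAX n\<in>{1..L}. L2_norm (\<lambda>x. u (real n * tau) x - num_sol lam tau N u0 n x))
         \<le> C * (tau * sqrt (ln (1 / tau)) + 1 / real N))"
proof -
  \<comment> \<open>The constants are fixed in the order in which they depend on each other, before
    \<lambda>, the data, the solution, L and N are introduced.\<close>
  define B where "B = h1_bound_const R"
  define CL where "CL = 3645 * B^5 + 2079 * B^3 + 180 * B^3 + 16 * 81 * R^4 * B + 4 * (4 * R\<^sup>2 + 270 * B^4 * T) * B"
  define H where "H = 3 * R * exp (36 * T * (3 * B + 2)\<^sup>2)"
  define \<kappa> where "\<kappa> = 1620 * (B + H)\<^sup>2"
  define C3 where "C3 = exp (\<kappa> * T) * (R + T * CL)"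
  \<comment> \<open>This makes the H^1 coefficient sqrt(2 / q) in the interpolation inequality,
    times B + H, at most 1.\<close>
  obtain q :: nat where q0: "2 * (B + H)\<^sup>2 + 1 \<le> real q" using real_arch_simple by blast
  have q1: "q \<ge> 1" using q0 zero_le_power2[of "B + H"] by linarith
  have q2: "sqrt (2 / real q) * (B + H) \<le> 1"
  proof -
    have "2 / real q * (B + H)\<^sup>2 \<le> 1" using q0 q1 by (simp add: field_simps)
    then have "sqrt (2 / real q * (B + H)\<^sup>2) \<le> 1" by simp
    then have "sqrt (2 / real q) * \<bar>B + H\<bar> \<le> 1" by (simp only: real_sqrt_mult real_sqrt_abs)
    then show ?thesis by (smt (verit) mult_left_mono real_sqrt_ge_zero divide_nonneg_nonneg of_nat_0_le_iff)
  qed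
  define S where "S = sqrt (2 * real q + 1) * \<bar>C3\<bar> + 1"
  have S: "S \<ge> 1" unfolding S_def by simp
  \<comment> \<open>As the logarithmic rate is at most the square root of \<tau>, this threshold and
    \<open>N0\<close> each make their half of the error at most 1 / (2 S), so the sum is at most 1 /
    S.\<close>
  define tau0 where "tau0 = min (1 / 3) ((1 / (2 * S))\<^sup>2)"
  define N0 where "N0 = 2 * S"
  \<comment> \<open>R is not yet known to be the norm of a function, so the sign of
    \<open>C3\<close> is open here; absolute values and the added 1 make C positive in any
    case.\<close>
  define C where "C = 3 * (\<bar>C3\<bar> + \<bar>B\<bar>) + 1"
  show ?thesis
  proof (rule exI[of _ tau0], rule exI[of _ N0], rule exI[of _ C], intro conjI ballI allI impI)
    show "tau0 > 0" "N0 > 0" "C > 0" unfolding tau0_def N0_def C_def using S by auto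
    fix lam u0 u L N tau
    assume lam: "lam \<in> {-1, 1 :: real}"
    assume *: "u0 \<in> H1 \<and> Hs_norm 1 u0 = R \<and> nls_solution lam T u0 u \<and>
       L > 0 \<and> N > 0 \<and> tau = T / real L \<and> tau \<le> tau0 \<and> real N \<ge> N0"
    interpret nls_sol lam T u0 u
      by unfold_locales (use lam * assms in auto)
    have R: "Hs_norm 1 u0 \<le> R" "0 \<le> R"
      using * order_trans[OF h1_nonneg h1_le_Hs_norm[of u0 "{}"]] by auto
    have t0: "0 < tau" using * assms by simp
    have t3: "tau \<le> 1 / 3" "tau \<le> (1 / (2 * S))\<^sup>2" using * unfolding tau0_def by auto
    define \<epsilon> where "\<epsilon> = tau * sqrt (ln (1 / tau)) + 1 / real N"
    have "tau * sqrt (ln (1 / tau)) \<le> sqrt tau" by (rule tau_sqrt_ln[OF t0 t3(1)])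
    also have "\<dots> \<le> sqrt ((1 / (2 * S))\<^sup>2)" using t3(2) by (rule real_sqrt_le_mono)
    also have "\<dots> = 1 / (2 * S)" using S by simp
    finally have "tau * sqrt (ln (1 / tau)) \<le> 1 / (2 * S)" .
    moreover have "1 / real N \<le> 1 / (2 * S)" using * S unfolding N0_def by (intro divide_left_mono) auto
    moreover have "1 / (2 * S) + 1 / (2 * S) = 1 / S" by (simp add: field_simps)
    ultimately have \<epsilon>: "\<epsilon> \<le> 1 / S" unfolding \<epsilon>_def by linarith
    have "0 \<le> tau * sqrt (ln (1 / tau))" using tau_sqrt_ln(1)[OF t0 t3(1)] t0 by linarith
    then have \<epsilon>0: "0 \<le> \<epsilon>" unfolding \<epsilon>_def by simp
    have "sqrt (2 * real q + 1) * (C3 * \<epsilon>) = (sqrt (2 * real q + 1) * C3) * \<epsilon>" by simp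
    also have "\<dots> \<le> S * \<epsilon>"
    proof (rule mult_right_mono[OF _ \<epsilon>0])
      have "sqrt (2 * real q + 1) * C3 \<le> sqrt (2 * real q + 1) * \<bar>C3\<bar>" by (intro mult_left_mono) auto
      then show "sqrt (2 * real q + 1) * C3 \<le> S" unfolding S_def by linarith
    qed
    also have "\<dots> \<le> S * (1 / S)" using S \<epsilon> by (intro mult_left_mono) auto
    also have "\<dots> = 1" using S by simp
    finally have small: "sqrt (2 * real q + 1) * (C3 * \<epsilon>) \<le> 1" .
    have err: "L2_norm (\<lambda>x. u (real n * tau) x - num_sol lam tau N u0 n x) \<le> C * \<epsilon>" if n: "n \<in> {1..L}" for n
    proof -
      have "L2_norm (\<lambda>x. u (real n * tau) x - num_sol lam tau N u0 n x) \<le> 3 * (C3 + B) * \<epsilon>"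
        unfolding \<epsilon>_def
        by (rule global_error[where L=L, OF R B_def _ _ _ t3(1) CL_def H_def q1 q2 \<kappa>_def C3_def small[unfolded \<epsilon>_def]]) (use * n in auto)
      also have "\<dots> \<le> C * \<epsilon>" unfolding C_def by (intro mult_right_mono \<epsilon>0) auto
      finally show ?thesis .
    qed
    have "L > 0" using * by blast
    then show "(MAX n\<in>{1..L}. L2_norm (\<lambda>x. u (real n * tau) x - num_sol lam tau N u0 n x)) \<le> C * (tau * sqrt (ln (1 / tau)) + 1 / real N)"
      unfolding \<epsilon>_def[symmetric] by (subst Max_le_iff) (use err in auto)
  qed
qed

end
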